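(* Let $n\geqslant 1$, $\tau>0$, $\delta\geqslant 0$, $m>0$ with $m\tau<1$, and let $\ell>\frac n2$. Suppose that $(\psi_0,\psi_1,\psi_2)\in\mathcal{B}_{\delta,\ell}$. Let $\psi$ be the solution to the Cauchy problem $$\begin{cases}\tau\psi_{ttt}+\psi_{tt}-\Delta\psi-(\delta+\tau)\Delta\psi_t+\displaystyle\int_0^t m\,\mathrm{e}^{-\frac{t-\eta}{\tau}}\Delta\psi(\eta,x)\,\mathrm{d}\eta=0,& x\in\mathbb{R}^n,\ t>0,\\ (\psi,\psi_t,\psi_{tt})(0,x)=(\psi_0,\psi_1,\psi_2)(x),& x\in\mathbb{R}^n.\end{cases}$$ Then, provided that $Q_{\psi_0,\psi_1,\psi_2}\neq0$, the optimal error estimates $$t^{-\frac n4}\,|Q_{\psi_0,\psi_1,\psi_2}|\lesssim\|\psi(t,\cdot)-\psi^{(1,p)}(t,\cdot)\|_{L^2}\lesssim t^{-\frac n4}\,\|(\psi_0,\psi_1,\psi_2)\|_{\mathcal{B}_{\delta,\ell}}$$ hold for large time $t\gg1$. Furthermore, $$\|\psi(t,\cdot)-\psi^{(1,p)}(t,\cdot)-\psi^{(2,p)}(t,\cdot)\|_{L^2}=o(t^{-\frac n4})$$ for large time $t\gg 1$ (i.e. as $t\to+\infty$).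
   Context: The unknown $\psi=\psi(t,x)$ and the data are real-valued. The solution is understood through the partial Fourier transform in $x$: for each $\xi\in\mathbb{R}^n$, $\widehat\psi(\cdot,\xi)$ is the unique solution of the linear integro-differential ODE obtained by replacing $\Delta$ by $-|\xi|^2$, with initial data $(\widehat\psi_0,\widehat\psi_1,\widehat\psi_2)(\xi)$. The Fourier transform is normalized so that $\widehat f(\xi)=\int_{\mathbb{R}^n}\mathrm{e}^{-ix\cdot\xi}f(x)\,\mathrm{d}x$, and $\mathcal{F}^{-1}_{\xi\to x}$ is its inverse. Means: $P_f:=\int_{\mathbb{R}^n}f(x)\,\mathrm{d}x$ and $M_f:=\int_{\mathbb{R}^n}xf(x)\,\mathrm{d}x\in\mathbb{R}^n$. The symbol $\circ$ is the Euclidean inner product. Constant: $$\gamma_0:=\frac{(4\tau-\delta)\delta-4m\tau^2(2\delta+4m\tau^2-3\tau)}{8\sqrt{1-m\tau}}.$$ Diffusion-wave functions: $$J_0:=\mathcal{F}^{-1}_{\xi\to x}\left(\frac{\sin(\sqrt{1-m\tau}|\xi|t)}{\sqrt{1-m\tau}|\xi|}\mathrm{e}^{-\frac12(\delta+2m\tau^2)|\xi|^2t}\right),\quad J_1:=\mathcal{F}^{-1}_{\xi\to x}\left(\cos(\sqrt{1-m\tau}|\xi|t)\mathrm{e}^{-\frac12(\delta+2m\tau^2)|\xi|^2t}\right),$$ $$J_2:=\frac{\gamma_0t}{\sqrt{1-m\tau}}\mathcal{F}^{-1}_{\xi\to x}\left(|\xi|^2\cos(\sqrt{1-m\tau}|\xi|t)\mathrm{e}^{-\frac12(\delta+2m\tau^2)|\xi|^2t}\right).$$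 Profiles: $$\psi^{(1,p)}(t,x):=J_0(t,x)P_{\psi_1+\tau\psi_2},$$ $$\psi^{(2,p)}(t,x):=-\nabla J_0(t,x)\circ M_{\psi_1+\tau\psi_2}+J_1(t,x)P_{\psi_0-\tau^2\psi_2}+J_2(t,x)P_{\psi_1+\tau\psi_2}.$$ The quantity $|Q_{\psi_0,\psi_1,\psi_2}|\geqslant0$ is defined by $$|Q_{\psi_0,\psi_1,\psi_2}|^2:=|M_{\psi_1+\tau\psi_2}|^2+\left|(\delta+2m\tau^2)P_{\psi_0-\tau^2\psi_2}+\frac{n\gamma_0}{2\sqrt{1-m\tau}}P_{\psi_1+\tau\psi_2}\right|^2+|P_{\psi_1+\tau\psi_2}|^2.$$ Data spaces (with natural norms, all over $\mathbb{R}^n$): $\mathcal{B}_{\delta,\ell}:=\mathcal{A}_{\delta,\ell}\cap(L^1\times L^{1,1}\times L^{1,1})$, where $$\mathcal{A}_{\delta,\ell}:=\begin{cases}(L^2\cap L^1)\times(L^2\cap L^1)\times(L^2\cap L^1)&\text{when }\delta>0,\\ (H^{\ell}\cap L^1)\times(H^{\max\{\ell-1,0\}}\cap L^1)\times(H^{\max\{\ell-2,0\}}\cap L^1)&\text{when }\delta=0,\end{cases}$$ and $L^{1,1}:=\{f\in L^1:\ \|f\|_{L^{1,1}}:=\int_{\mathbb{R}^n}(1+|x|)|f(x)|\,\mathrm{d}x<+\infty\}$. Convention: $f\lesssim g$ means $f\leqslant Cg$ with a constant $C>0$ independent of $t$ and of the initial data (it may depend on $n,\tau,\delta,m,\ell$).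 "For large time $t\gg1$" means for all $t\geqslant T_0$ with some sufficiently large $T_0$, which for the lower bound may depend on the initial data.
   Formalization: The lower bound is proved only when γ₀≠0 or P_{ψ₁+τψ₂}=0; it fails as printed, e.g. for δ=0, mτ=3/4 (so γ₀=0), ψ₀=ψ₂=0, ψ₁ a centred Gaussian, where ψ^(2,p)=0 but Q≠0, contradicting the o(t^{-n/4}) claim. *)

theory Defs
  imports "HOL-Analysis.Analysis" "HOL-Library.Landau_Symbols"
begin

definition L1_space :: "(real^'n \<Rightarrow> 'b::{banach, second_countable_topology}) set" where
  "L1_space = {f. integrable lborel f}"

definition L1_norm :: "(real^'n \<Rightarrow> 'b::{banach, second_countable_topology}) \<Rightarrow> real" where
  "L1_norm f = (LINT x|lborel. norm (f x))"

definition L2_space :: "(real^'n \<Rightarrow> 'b::{banach, second_countable_topology}) set" where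
  "L2_space = {f \<in> borel_measurable lborel. integrable lborel (\<lambda>x. (norm (f x))\<^sup>2)}"

text \<open>The norm is meaningful only on the space above: the Bochner integral of a
  non-integrable function is 0, so membership has to be stated separately.\<close>

definition L2_norm :: "(real^'n \<Rightarrow> 'b::{banach, second_countable_topology}) \<Rightarrow> real" where
  "L2_norm f = sqrt (LINT x|lborel. (norm (f x))\<^sup>2)"

definition L11_space :: "(real^'n \<Rightarrow> real) set" where
  "L11_space = {f \<in> L1_space. integrable lborel (\<lambda>x. (1 + norm x) * \<bar>f x\<bar>)}"

definition L11_norm :: "(real^'n \<Rightarrow> real) \<Rightarrow> real" where
  "L11_norm f = (LINT x|lborel. (1 + norm x) * \<bar>f x\<bar>)"

definition fourier :: "(real^'n \<Rightarrow> complex) \<Rightarrow> real^'n \<Rightarrow> complex" where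
  "fourier f \<xi> = (LINT x|lborel. exp (- (\<i> * complex_of_real (x \<bullet> \<xi>))) * f x)"

definition inv_fourier :: "(real^'n \<Rightarrow> complex) \<Rightarrow> real^'n \<Rightarrow> complex" where
  "inv_fourier g x =
     complex_of_real (1 / (2 * pi) ^ CARD('n)) *
     (LINT \<xi>|lborel. exp (\<i> * complex_of_real (x \<bullet> \<xi>)) * g \<xi>)"

abbreviation fourier_real :: "(real^'n \<Rightarrow> real) \<Rightarrow> real^'n \<Rightarrow> complex" where
  "fourier_real f \<equiv> fourier (\<lambda>x. complex_of_real (f x))"

text \<open>The inverse Fourier-Plancherel transform: \<open>f\<close> is the limit in \<open>L\<^sup>2\<close>, as the cut-off
  radius \<open>R\<close> tends to infinity, of the inverse Fourier integrals of \<open>g\<close> over the ball of radius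
  \<open>R\<close>. For \<open>g\<close> in \<open>L\<^sup>2\<close> these integrals converge absolutely and define functions
  in \<open>L\<^sup>2\<close>.\<close>

definition is_L2_inv_fourier :: "(real^'n \<Rightarrow> complex) \<Rightarrow> (real^'n \<Rightarrow> complex) \<Rightarrow> bool" where
  "is_L2_inv_fourier g f \<longleftrightarrow>
     g \<in> L2_space \<and> f \<in> L2_space \<and>
     ((\<lambda>R. L2_norm (\<lambda>x. f x - inv_fourier (\<lambda>\<xi>. indicator (cball 0 R) \<xi> *\<^sub>R g \<xi>) x)) \<longlongrightarrow> 0) at_top"

text \<open>\<open>H\<^sup>s \<inter> L\<^sup>1\<close> for \<open>s \<ge> 0\<close>. Because of the intersection with \<open>L\<^sup>1\<close> the Fourier transform in
  the Sobolev norm is given by the Fourier integral.\<close>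

definition H_L1_space :: "real \<Rightarrow> (real^'n \<Rightarrow> real) set" where
  "H_L1_space s = {f \<in> L2_space \<inter> L1_space.
     integrable lborel (\<lambda>\<xi>. (1 + (norm \<xi>)\<^sup>2) powr s * (cmod (fourier_real f \<xi>))\<^sup>2)}"

definition H_norm :: "real \<Rightarrow> (real^'n \<Rightarrow> real) \<Rightarrow> real" where
  "H_norm s f = sqrt (LINT \<xi>|lborel. (1 + (norm \<xi>)\<^sup>2) powr s * (cmod (fourier_real f \<xi>))\<^sup>2)"

definition A_space ::
  "real \<Rightarrow> real \<Rightarrow> ((real^'n \<Rightarrow> real) \<times> (real^'n \<Rightarrow> real) \<times> (real^'n \<Rightarrow> real)) set" where
  "A_space \<delta> l =
     (if \<delta> > 0
      then (L2_space \<inter> L1_space) \<times> (L2_space \<inter> L1_space) \<times> (L2_space \<inter> L1_space)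
      else H_L1_space l \<times> H_L1_space (max (l - 1) 0) \<times> H_L1_space (max (l - 2) 0))"

definition A_norm ::
  "real \<Rightarrow> real \<Rightarrow> (real^'n \<Rightarrow> real) \<Rightarrow> (real^'n \<Rightarrow> real) \<Rightarrow> (real^'n \<Rightarrow> real) \<Rightarrow> real" where
  "A_norm \<delta> l \<psi>0 \<psi>1 \<psi>2 =
     (if \<delta> > 0
      then (L2_norm \<psi>0 + L1_norm \<psi>0) + (L2_norm \<psi>1 + L1_norm \<psi>1) + (L2_norm \<psi>2 + L1_norm \<psi>2)
      else (H_norm l \<psi>0 + L1_norm \<psi>0) + (H_norm (max (l - 1) 0) \<psi>1 + L1_norm \<psi>1)
         + (H_norm (max (l - 2) 0) \<psi>2 + L1_norm \<psi>2))"

definition B_space ::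
  "real \<Rightarrow> real \<Rightarrow> ((real^'n \<Rightarrow> real) \<times> (real^'n \<Rightarrow> real) \<times> (real^'n \<Rightarrow> real)) set" where
  "B_space \<delta> l = A_space \<delta> l \<inter> (L1_space \<times> L11_space \<times> L11_space)"

definition B_norm ::
  "real \<Rightarrow> real \<Rightarrow> (real^'n \<Rightarrow> real) \<Rightarrow> (real^'n \<Rightarrow> real) \<Rightarrow> (real^'n \<Rightarrow> real) \<Rightarrow> real" where
  "B_norm \<delta> l \<psi>0 \<psi>1 \<psi>2 = A_norm \<delta> l \<psi>0 \<psi>1 \<psi>2 + L1_norm \<psi>0 + L11_norm \<psi>1 + L11_norm \<psi>2"

text \<open>The Cauchy problem at a fixed frequency \<open>\<xi>\<close>, where \<open>s = \<bar>\<xi>\<bar>\<^sup>2\<close> and the Laplacian acts as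
  multiplication by \<open>- s\<close>; \<open>u\<close> is twice continuously differentiable on the closed half line
  (one-sided derivatives at 0) and satisfies the equation for positive times.\<close>

definition mgt_mode ::
  "real \<Rightarrow> real \<Rightarrow> real \<Rightarrow> real \<Rightarrow> complex \<Rightarrow> complex \<Rightarrow> complex \<Rightarrow> (real \<Rightarrow> complex) \<Rightarrow> bool" where
  "mgt_mode \<tau> \<delta> m s a0 a1 a2 u \<longleftrightarrow>
     (\<exists>u1 u2 u3.
        (\<forall>t\<ge>0. (u has_vector_derivative u1 t) (at t within {0..})) \<and>
        (\<forall>t\<ge>0. (u1 has_vector_derivative u2 t) (at t within {0..})) \<and>
        continuous_on {0..} u2 \<and>
        (\<forall>t>0. (u2 has_vector_derivative u3 t) (at t)) \<and>
        u 0 = a0 \<and> u1 0 = a1 \<and> u2 0 = a2 \<and>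
        (\<forall>t>0. \<tau> *\<^sub>R u3 t + u2 t - (- s) *\<^sub>R u t - ((\<delta> + \<tau>) * (- s)) *\<^sub>R u1 t
              + integral {0..t} (\<lambda>\<eta>. (m * exp (- (t - \<eta>) / \<tau>) * (- s)) *\<^sub>R u \<eta>) = 0))"

definition mgt_solution ::
  "real \<Rightarrow> real \<Rightarrow> real \<Rightarrow> (real^'n \<Rightarrow> real) \<Rightarrow> (real^'n \<Rightarrow> real) \<Rightarrow> (real^'n \<Rightarrow> real) \<Rightarrow>
   (real \<Rightarrow> real^'n \<Rightarrow> real) \<Rightarrow> bool" where
  "mgt_solution \<tau> \<delta> m \<psi>0 \<psi>1 \<psi>2 \<psi> \<longleftrightarrow>
     (\<exists>u. (\<forall>\<xi>. mgt_mode \<tau> \<delta> m ((norm \<xi>)\<^sup>2)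
                 (fourier_real \<psi>0 \<xi>) (fourier_real \<psi>1 \<xi>) (fourier_real \<psi>2 \<xi>) (\<lambda>t. u t \<xi>)) \<and>
          (\<forall>t\<ge>0. is_L2_inv_fourier (u t) (\<lambda>x. complex_of_real (\<psi> t x))))"

definition P_mean :: "(real^'n \<Rightarrow> real) \<Rightarrow> real" where
  "P_mean f = (LINT x|lborel. f x)"

definition M_mean :: "(real^'n \<Rightarrow> real) \<Rightarrow> real^'n" where
  "M_mean f = (LINT x|lborel. f x *\<^sub>R x)"

text \<open>This constant vanishes for some admissible parameters, for instance \<open>\<delta> = 0\<close>, \<open>m \<tau> = 3/4\<close>.\<close>

definition gamma0 :: "real \<Rightarrow> real \<Rightarrow> real \<Rightarrow> real" where
  "gamma0 \<tau> \<delta> m =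
     ((4 * \<tau> - \<delta>) * \<delta> - 4 * m * \<tau>\<^sup>2 * (2 * \<delta> + 4 * m * \<tau>\<^sup>2 - 3 * \<tau>)) / (8 * sqrt (1 - m * \<tau>))"

text \<open>The symbols below are even in \<open>\<xi>\<close>, so their inverse Fourier transforms are real; \<open>Re\<close> only
  changes the type. For \<open>t > 0\<close> the inverse Fourier integrals converge absolutely. The value of the
  first symbol at the null set \<open>\<xi> = 0\<close> is irrelevant.\<close>

definition J0 :: "real \<Rightarrow> real \<Rightarrow> real \<Rightarrow> real \<Rightarrow> real^'n \<Rightarrow> real" where
  "J0 \<tau> \<delta> m t x = Re (inv_fourier (\<lambda>\<xi>. complex_of_real
     (sin (sqrt (1 - m * \<tau>) * norm \<xi> * t) / (sqrt (1 - m * \<tau>) * norm \<xi>)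
      * exp (- (1 / 2) * (\<delta> + 2 * m * \<tau>\<^sup>2) * (norm \<xi>)\<^sup>2 * t))) x)"

definition J1 :: "real \<Rightarrow> real \<Rightarrow> real \<Rightarrow> real \<Rightarrow> real^'n \<Rightarrow> real" where
  "J1 \<tau> \<delta> m t x = Re (inv_fourier (\<lambda>\<xi>. complex_of_real
     (cos (sqrt (1 - m * \<tau>) * norm \<xi> * t)
      * exp (- (1 / 2) * (\<delta> + 2 * m * \<tau>\<^sup>2) * (norm \<xi>)\<^sup>2 * t))) x)"

definition J2 :: "real \<Rightarrow> real \<Rightarrow> real \<Rightarrow> real \<Rightarrow> real^'n \<Rightarrow> real" where
  "J2 \<tau> \<delta> m t x = gamma0 \<tau> \<delta> m * t / sqrt (1 - m * \<tau>) *
     Re (inv_fourier (\<lambda>\<xi>. complex_of_real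
       ((norm \<xi>)\<^sup>2 * cos (sqrt (1 - m * \<tau>) * norm \<xi> * t)
        * exp (- (1 / 2) * (\<delta> + 2 * m * \<tau>\<^sup>2) * (norm \<xi>)\<^sup>2 * t))) x)"

definition grad :: "(real^'n \<Rightarrow> real) \<Rightarrow> real^'n \<Rightarrow> real^'n" where
  "grad f x = (\<chi> i. frechet_derivative f (at x) (axis i 1))"

definition profile1 ::
  "real \<Rightarrow> real \<Rightarrow> real \<Rightarrow> (real^'n \<Rightarrow> real) \<Rightarrow> (real^'n \<Rightarrow> real) \<Rightarrow> (real^'n \<Rightarrow> real) \<Rightarrow>
   real \<Rightarrow> real^'n \<Rightarrow> real" where
  "profile1 \<tau> \<delta> m \<psi>0 \<psi>1 \<psi>2 t x = J0 \<tau> \<delta> m t x * P_mean (\<lambda>y. \<psi>1 y + \<tau> * \<psi>2 y)"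

definition profile2 ::
  "real \<Rightarrow> real \<Rightarrow> real \<Rightarrow> (real^'n \<Rightarrow> real) \<Rightarrow> (real^'n \<Rightarrow> real) \<Rightarrow> (real^'n \<Rightarrow> real) \<Rightarrow>
   real \<Rightarrow> real^'n \<Rightarrow> real" where
  "profile2 \<tau> \<delta> m \<psi>0 \<psi>1 \<psi>2 t x =
     - (grad (J0 \<tau> \<delta> m t) x \<bullet> M_mean (\<lambda>y. \<psi>1 y + \<tau> * \<psi>2 y))
     + J1 \<tau> \<delta> m t x * P_mean (\<lambda>y. \<psi>0 y - \<tau>\<^sup>2 * \<psi>2 y)
     + J2 \<tau> \<delta> m t x * P_mean (\<lambda>y. \<psi>1 y + \<tau> * \<psi>2 y)"

definition Q_abs ::
  "real \<Rightarrow> real \<Rightarrow> real \<Rightarrow> (real^'n \<Rightarrow> real) \<Rightarrow> (real^'n \<Rightarrow> real) \<Rightarrow> (real^'n \<Rightarrow> real) \<Rightarrow> real" where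
  "Q_abs \<tau> \<delta> m \<psi>0 \<psi>1 \<psi>2 = sqrt (
     (norm (M_mean (\<lambda>y. \<psi>1 y + \<tau> * \<psi>2 y)))\<^sup>2
     + \<bar>(\<delta> + 2 * m * \<tau>\<^sup>2) * P_mean (\<lambda>y. \<psi>0 y - \<tau>\<^sup>2 * \<psi>2 y)
        + real CARD('n) * gamma0 \<tau> \<delta> m / (2 * sqrt (1 - m * \<tau>)) * P_mean (\<lambda>y. \<psi>1 y + \<tau> * \<psi>2 y)\<bar>\<^sup>2
     + \<bar>P_mean (\<lambda>y. \<psi>1 y + \<tau> * \<psi>2 y)\<bar>\<^sup>2)"

end

theory Submission
  imports Defs "HOL-Probability.Probability" "HOL-Real_Asymp.Real_Asymp"
begin

text \<open>
  At a fixed frequency the memory integral is an additional unknown, so that \<open>u\<close> solves a linear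
  system of ordinary differential equations. A Lyapunov functional shows that the system decays like
  \<open>exp (- c \<rho>(s) t)\<close> with \<open>s = \<bar>\<xi>\<bar>\<^sup>2\<close>, where \<open>\<rho>(s) \<approx> s\<close> for small \<open>s\<close>,
  while for large \<open>s\<close> the rate is bounded below if \<open>\<delta> > 0\<close> and comparable to
  \<open>1 / s\<close> if \<open>\<delta> = 0\<close>; this loss of regularity is paid for by the Sobolev norms.

  For small \<open>r = \<bar>\<xi>\<bar>\<close> the characteristic equation has the approximate roots
  \<open>- \<beta> r\<^sup>2 \<plusminus> i (k r + \<gamma>\<^sub>0 r\<^sup>3)\<close> with a residual of order \<open>r\<^sup>5\<close>. The
  difference of \<open>u\<close> and the corresponding combination of exponentials solves the same system with
  a small source, and is controlled by the decay estimate; no explicit roots are needed. Expanding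
  the exponentials and the Fourier transforms of the data at \<open>\<xi> = 0\<close> produces the symbols of the
  two profiles up to errors of the form \<open>exp (- c r\<^sup>2 t) o(1)\<close>.

  Plancherel's inequality turns the pointwise estimates into \<open>L\<^sup>2\<close> estimates. For the lower
  bound it remains to bound the norm of the second profile from below; there the oscillating factors
  are removed by averaging over dilations of the frequency variable.
\<close>

section \<open>Decay of a single mode\<close>

text \<open>At \<xi> = 0 the equation reduces to \<tau> u''' + u'' = 0, with solution A + B t +
  \<tau>^2 exp (- t / \<tau>) a2, where A = a0 - \<tau>^2 a2 and B = a1 + \<tau> a2. These
  combinations of the data are the ones whose means and first moment enter the profiles; the last
  summand is the fast mode that has to be subtracted before any comparison. The energy method bounds
  u' and u + \<tau> u', but not u directly. At low frequency u is recovered as v - \<tau> a; at high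
  frequency the same estimate is run on a time antiderivative of u, since otherwise too much
  regularity of the data would be lost. The lower bound carries a condition. |Q| contains the mean P
  of \<psi>1 + \<tau> \<psi>2 on its own, whereas the second profile sees P only through
  \<open>gamma0\<close> P. If \<open>gamma0\<close> = 0, P \<noteq> 0, and both the first moment and
  the mean of \<psi>0 - \<tau>^2 \<psi>2 vanish, then the second profile is zero while |Q| > 0, and
  the o-estimate itself refutes the lower bound.\<close>

lemma sqrt_gronwall:
  fixes L Z h :: "real \<Rightarrow> real"
  assumes contL: "continuous_on {0..} L" and contZ: "continuous_on {0..} Z"
    and L0: "\<And>t. t \<ge> 0 \<Longrightarrow> L t \<ge> 0" and k: "k \<ge> 0" and h0: "\<And>t. t > 0 \<Longrightarrow> h t \<ge> 0"
    and dL: "\<And>t. t > 0 \<Longrightarrow> \<exists>D. (L has_real_derivative D) (at t) \<and> D \<le> - 2 * k * L t + 2 * sqrt (L t) * h t"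
    and dZ: "\<And>t. t > 0 \<Longrightarrow> \<exists>D. (Z has_real_derivative D) (at t) \<and> D \<ge> - k * Z t + h t"
    and init: "sqrt (L 0) \<le> Z 0" and t: "t \<ge> 0"
  shows "sqrt (L t) \<le> Z t"
proof (rule field_le_epsilon)
  fix e :: real assume e: "e > 0"
  \<comment> \<open>Formally S = sqrt L satisfies S' \<le> - k S + h, but the root is not
    differentiable where L vanishes. The regularisation sqrt (L + e^2) is, at the price of an extra
    k e^2 / S \<le> k e in its differential inequality. The summand - e in \<open>D\<close> pays
    exactly this price, so \<open>D\<close> is nonincreasing, and e is arbitrary.\<close>
  define D where "D = (\<lambda>t. exp (k * t) * (sqrt (L t + e\<^sup>2) - Z t - e))"
  have "D t \<le> D 0"
  proof (cases "t = 0")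
    case False
    with t have t: "0 < t" by simp
    show ?thesis
    proof (rule DERIV_nonpos_imp_decreasing_open[OF less_imp_le[OF t]])
      fix x assume x: "0 < x" "x < t"
      obtain L' where L': "(L has_real_derivative L') (at x)" "L' \<le> - 2 * k * L x + 2 * sqrt (L x) * h x"
        using dL x by blast
      obtain Z' where Z': "(Z has_real_derivative Z') (at x)" "Z' \<ge> - k * Z x + h x"
        using dZ x by blast
      define S where "S = sqrt (L x + e\<^sup>2)"
      have Lx: "L x \<ge> 0" using L0 x by simp
      have S: "S > 0" "S \<ge> e" "S\<^sup>2 = L x + e\<^sup>2" "S \<ge> sqrt (L x)"
        using e Lx by (auto simp: S_def intro: real_le_rsqrt add_nonneg_pos)
      have pos: "L x + e\<^sup>2 > 0" using e Lx by (simp add: add_nonneg_pos)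
      have "sqrt (L x) * h x \<le> S * h x" using S h0 x by (intro mult_right_mono) auto
      moreover have "k * e\<^sup>2 \<le> k * e * S" using mult_left_mono[OF S(2), of "k * e"] e k by (simp add: power2_eq_square mult.assoc)
      moreover have "k * (S * S) = k * L x + k * e\<^sup>2" using S(3) by (simp add: power2_eq_square distrib_left)
      ultimately have "L' \<le> 2 * S * (- k * S + k * e + h x)"
        using L'(2) by (simp add: algebra_simps)
      then have "L' / (2 * S) \<le> - k * S + k * e + h x"
        using S by (simp add: field_simps)
      then have neg: "k * (S - Z x - e) + (L' / (2 * S) - Z') \<le> 0"
        using Z'(2) by (simp add: algebra_simps)
      have "(D has_real_derivative exp (k * x) * (k * (S - Z x - e) + (L' / (2 * S) - Z'))) (at x)"
        unfolding D_def S_def using L'(1) Z'(1) pos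
        by (auto intro!: derivative_eq_intros simp: field_simps)
      then show "\<exists>y. (D has_real_derivative y) (at x) \<and> y \<le> 0"
        using neg by (meson exp_ge_zero mult_nonneg_nonpos)
    next
      show "continuous_on {0..t} D" unfolding D_def
        by (intro continuous_intros continuous_on_subset[OF contL] continuous_on_subset[OF contZ]) auto
    qed
  qed simp
  also have "D 0 \<le> 0"
    using init sqrt_add_le_add_sqrt[of "L 0" "e\<^sup>2"] L0[of 0] e by (simp add: D_def)
  finally have "sqrt (L t + e\<^sup>2) \<le> Z t + e" by (simp add: D_def mult_le_0_iff)
  moreover have "sqrt (L t) \<le> sqrt (L t + e\<^sup>2)" by simp
  ultimately show "sqrt (L t) \<le> Z t + e" by linarith
qed

lemma mult_le_squares: "x * y \<le> c * x\<^sup>2 + y\<^sup>2 / (4 * c)" if "c > 0" for x y c :: real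
proof -
  have "0 \<le> (2 * c * x - y)\<^sup>2 / (4 * c)" using that by simp
  also have "\<dots> = c * x\<^sup>2 + y\<^sup>2 / (4 * c) - x * y"
    using that by (simp add: power2_eq_square field_simps)
  finally show ?thesis by simp
qed

lemma abs_mult_le_squares: "\<bar>x * y\<bar> \<le> c * x\<^sup>2 + y\<^sup>2 / (4 * c)" if "c > 0" for x y c :: real
  using mult_le_squares[OF that, of x y] mult_le_squares[OF that, of x "- y"] by (simp add: abs_le_iff)

section \<open>Energy, correctors and the Lyapunov functional\<close>

locale mgt =
  fixes \<tau> \<delta> m :: real
  assumes tau: "\<tau> > 0" and delta: "\<delta> \<ge> 0" and m: "m > 0" and m_tau: "m * \<tau> < 1"
begin

text \<open>Coefficients that remain once the memory term w is replaced by \<tau> (m u - w') and u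
  by v - \<tau> u': the wave part becomes \<kappa> s v, with \<kappa> the square of the propagation
  speed at low frequency, and the damping part \<sigma> s u'.\<close>

definition \<kappa> where "\<kappa> = 1 - m * \<tau>"
definition \<sigma> where "\<sigma> = \<delta> + m * \<tau>\<^sup>2"

lemma kappa: "\<kappa> > 0" using m_tau by (simp add: \<kappa>_def)
lemma sigma: "\<sigma> > 0" using tau delta m by (simp add: \<sigma>_def add_nonneg_pos)

definition dens :: "real \<Rightarrow> real \<Rightarrow> real \<Rightarrow> real \<Rightarrow> real \<Rightarrow> real" where
  "dens s v z a b = z\<^sup>2 + s * v\<^sup>2 + s * a\<^sup>2 + s * b\<^sup>2"

text \<open>Without sources, the force - \<tau> s b in the equation of z produces - \<tau> s z b.
  The cross term \<tau>^2 s a b cancels it through a' = (z - a) / \<tau> and gives back m \<tau>^2 s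
  a^2; the total loss of energy is exactly \<delta> s a^2 + (2 / m) s b^2. Neither z nor v is
  damped, and a is damped only if \<delta> > 0.\<close>

definition energy :: "real \<Rightarrow> real \<Rightarrow> real \<Rightarrow> real \<Rightarrow> real \<Rightarrow> real" where
  "energy s v z a b = z\<^sup>2 / 2 + \<kappa> / 2 * (s * v\<^sup>2) + \<sigma> * \<tau> / 2 * (s * a\<^sup>2) + \<tau> / m * (s * b\<^sup>2) + \<tau>\<^sup>2 * (s * (a * b))"

text \<open>The correctors \<open>a b\<close> and \<open>v z - 2 \<tau> z a\<close> produce the missing dissipation of \<open>a\<close> and of
  \<open>z, v\<close>.\<close>

definition lyap :: "real \<Rightarrow> real \<Rightarrow> real \<Rightarrow> real \<Rightarrow> real \<Rightarrow> real \<Rightarrow> real \<Rightarrow> real" where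
  "lyap s p q v z a b = energy s v z a b - p * (a * b) + q * (v * z - 2 * \<tau> * (z * a))"

text \<open>Time derivative of \<open>lyap\<close> along the system without sources. In the bracket
  of q, the product v z contributes + z^2 and - 2 \<tau> z a contributes - 2 z^2; this is why the
  combination, and not v z alone, damps z.\<close>

definition lyap_deriv :: "real \<Rightarrow> real \<Rightarrow> real \<Rightarrow> real \<Rightarrow> real \<Rightarrow> real \<Rightarrow> real \<Rightarrow> real" where
  "lyap_deriv s p q v z a b = - \<delta> * (s * a\<^sup>2) - 2 / m * (s * b\<^sup>2)
     + p * (- m * a\<^sup>2 + 2 / \<tau> * (a * b) - z * b / \<tau>)
     + q * (- z\<^sup>2 - \<kappa> * (s * v\<^sup>2) + 2 * (z * a) + (2 * \<tau> * \<kappa> - \<sigma>) * (s * (v * a))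
            + 2 * \<tau> * \<sigma> * (s * a\<^sup>2) + 2 * \<tau>\<^sup>2 * (s * (a * b)) - \<tau> * (s * (v * b)))"

text \<open>Only the cross term threatens coercivity. Split with weight m \<tau> / 3, it costs m
  \<tau>^3 / 3 of s a^2 and 3 \<tau> / (4 m) of s b^2, strictly less than the available \<sigma>
  \<tau> / 2 \<ge> m \<tau>^3 / 2 and \<tau> / m, even when \<delta> = 0.\<close>

lemma energy_bounds:
  "\<exists>c>0. \<forall>s\<ge>0. \<forall>v z a b. c * dens s v z a b \<le> energy s v z a b \<and> c * energy s v z a b \<le> dens s v z a b"
proof -
  define c where "c = Min {1/2, \<kappa>/2, m * \<tau>^3/6, \<tau>/(4 * m)}"
  define C where "C = Max {1/2, \<kappa>/2, \<sigma> * \<tau> / 2 + m * \<tau>^3/3, \<tau>/m + 3 * \<tau>/(4 * m)}"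
  have c: "c > 0" "c \<le> 1/2" "c \<le> \<kappa>/2" "c \<le> m * \<tau>^3/6" "c \<le> \<tau>/(4 * m)"
    using tau m kappa unfolding c_def by auto
  have C: "C > 0" "C \<ge> 1/2" "C \<ge> \<kappa>/2" "C \<ge> \<sigma> * \<tau> / 2 + m * \<tau>^3/3" "C \<ge> \<tau>/m + 3 * \<tau>/(4 * m)"
    unfolding C_def by (rule less_le_trans[of _ "1/2"] Max_ge; simp)+
  have *: "c * dens s v z a b \<le> energy s v z a b \<and> energy s v z a b \<le> C * dens s v z a b"
    if s: "s \<ge> 0" for s v z a b
  proof -
    have ab: "\<tau>\<^sup>2 * \<bar>a * b\<bar> \<le> m * \<tau>^3/3 * a\<^sup>2 + 3 * \<tau>/(4 * m) * b\<^sup>2"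
    proof -
      have "\<bar>a * b\<bar> \<le> (m * \<tau> / 3) * a\<^sup>2 + b\<^sup>2 / (4 * (m * \<tau> / 3))"
        using tau m by (intro abs_mult_le_squares) simp
      then have "\<tau>\<^sup>2 * \<bar>a * b\<bar> \<le> \<tau>\<^sup>2 * ((m * \<tau> / 3) * a\<^sup>2 + b\<^sup>2 / (4 * (m * \<tau> / 3)))"
        by (intro mult_left_mono) auto
      also have "\<dots> = m * \<tau>^3/3 * a\<^sup>2 + 3 * \<tau>/(4 * m) * b\<^sup>2"
        using tau m by (simp add: field_simps power2_eq_square power3_eq_cube)
      finally show ?thesis .
    qed
    then have "s * (\<tau>\<^sup>2 * \<bar>a * b\<bar>) \<le> s * (m * \<tau>^3/3 * a\<^sup>2 + 3 * \<tau>/(4 * m) * b\<^sup>2)"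
      using s by (intro mult_left_mono)
    then have ab': "\<tau>\<^sup>2 * \<bar>s * (a * b)\<bar> \<le> m * \<tau>^3/3 * (s * a\<^sup>2) + 3 * \<tau>/(4 * m) * (s * b\<^sup>2)"
      using s by (simp add: abs_mult algebra_simps)
    have ab1: "- (m * \<tau>^3/3 * (s * a\<^sup>2) + 3 * \<tau>/(4 * m) * (s * b\<^sup>2)) \<le> \<tau>\<^sup>2 * (s * (a * b))"
      and ab2: "\<tau>\<^sup>2 * (s * (a * b)) \<le> m * \<tau>^3/3 * (s * a\<^sup>2) + 3 * \<tau>/(4 * m) * (s * b\<^sup>2)"
      using ab' abs_le_iff[of "\<tau>\<^sup>2 * (s * (a * b))"] by (auto simp: abs_mult)
    have nn: "0 \<le> s * v\<^sup>2" "0 \<le> s * a\<^sup>2" "0 \<le> s * b\<^sup>2" using s by auto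
    have sg: "m * \<tau>^3/2 \<le> \<sigma> * \<tau> / 2"
      using tau delta by (simp add: \<sigma>_def power2_eq_square power3_eq_cube algebra_simps)
    have "c * z\<^sup>2 \<le> 1/2 * z\<^sup>2" "c * (s * v\<^sup>2) \<le> \<kappa>/2 * (s * v\<^sup>2)"
      "c * (s * a\<^sup>2) \<le> m * \<tau>^3/6 * (s * a\<^sup>2)" "c * (s * b\<^sup>2) \<le> \<tau>/(4 * m) * (s * b\<^sup>2)"
      "m * \<tau>^3/2 * (s * a\<^sup>2) \<le> \<sigma> * \<tau> / 2 * (s * a\<^sup>2)"
      using c nn sg by (intro mult_right_mono; simp)+
    moreover have "m * \<tau>^3/2 * (s * a\<^sup>2) - m * \<tau>^3/3 * (s * a\<^sup>2) = m * \<tau>^3/6 * (s * a\<^sup>2)"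
      "\<tau> / m * (s * b\<^sup>2) - 3 * \<tau>/(4 * m) * (s * b\<^sup>2) = \<tau>/(4 * m) * (s * b\<^sup>2)"
      using m by (auto simp: field_simps)
    ultimately have 1: "c * dens s v z a b \<le> energy s v z a b"
      using ab1 unfolding dens_def energy_def distrib_left by linarith
    have "1/2 * z\<^sup>2 \<le> C * z\<^sup>2" "\<kappa>/2 * (s * v\<^sup>2) \<le> C * (s * v\<^sup>2)"
      "(\<sigma> * \<tau> / 2 + m * \<tau>^3/3) * (s * a\<^sup>2) \<le> C * (s * a\<^sup>2)" "(\<tau>/m + 3 * \<tau>/(4 * m)) * (s * b\<^sup>2) \<le> C * (s * b\<^sup>2)"
      using C nn by (intro mult_right_mono; simp)+
    then have 2: "energy s v z a b \<le> C * dens s v z a b"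
      using ab2 unfolding dens_def energy_def distrib_left distrib_right by linarith
    show ?thesis using 1 2 by blast
  qed
  have dens0: "dens s v z a b \<ge> 0" if "s \<ge> 0" for s v z a b using that by (simp add: dens_def)
  show ?thesis
  proof (intro exI[of _ "min c (1 / C)"] conjI allI impI)
    show "min c (1 / C) > 0" using c C by simp
    fix s v z a b :: real assume s: "s \<ge> 0"
    have "min c (1 / C) * dens s v z a b \<le> c * dens s v z a b"
      using dens0[OF s] by (intro mult_right_mono) auto
    then show "min c (1 / C) * dens s v z a b \<le> energy s v z a b" using *[OF s, of v z a b] by linarith
    have "energy s v z a b \<ge> 0" using *[OF s, of v z a b] c(1) dens0[OF s]
      by (meson less_imp_le mult_nonneg_nonneg order_trans)
    then have "min c (1 / C) * energy s v z a b \<le> (1/C) * energy s v z a b"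
      by (intro mult_right_mono) auto
    also have "\<dots> \<le> (1/C) * (C * dens s v z a b)" using *[OF s, of v z a b] C
      by (intro mult_left_mono) auto
    also have "\<dots> = dens s v z a b" using C by simp
    finally show "min c (1 / C) * energy s v z a b \<le> dens s v z a b" .
  qed
qed

text \<open>The correctors are small against \<open>dens\<close> because p is small against s and q
  against some \<nu> with \<nu>^2 \<le> s: then \<nu> |w z| is dominated by z^2 + s w^2.\<close>

lemma corrector_bound:
  assumes s: "s > 0" and p: "0 \<le> p" "p \<le> e * s" and q: "0 \<le> q" "q \<le> e * \<nu>" "\<nu> \<ge> 0" "\<nu>\<^sup>2 \<le> s"
    and e: "e \<ge> 0"
  shows "\<bar>lyap s p q v z a b - energy s v z a b\<bar> \<le> e * (1 + \<tau>) * dens s v z a b"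
proof -
  have nn: "0 \<le> s * v\<^sup>2" "0 \<le> s * a\<^sup>2" "0 \<le> s * b\<^sup>2" "0 \<le> z\<^sup>2" using s by auto
  have y: "\<bar>x * y\<bar> \<le> (x\<^sup>2 + y\<^sup>2) / 2" for x y :: real
    using abs_mult_le_squares[of "1/2" x y] by simp
  have "p * \<bar>a * b\<bar> \<le> (e * s) * ((a\<^sup>2 + b\<^sup>2) / 2)"
    using p y s by (intro mult_mono) auto
  then have 1: "p * \<bar>a * b\<bar> \<le> e * ((s * a\<^sup>2 + s * b\<^sup>2) / 2)" by (simp add: algebra_simps)
  have w: "\<nu> * \<bar>w * z\<bar> \<le> (z\<^sup>2 + s * w\<^sup>2) / 2" for w
  proof -
    have "\<nu> * \<bar>w * z\<bar> = \<bar>(\<nu> * w) * z\<bar>" using q by (simp add: abs_mult)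
    also have "\<dots> \<le> ((\<nu> * w)\<^sup>2 + z\<^sup>2) / 2" by (rule y)
    also have "\<dots> \<le> (s * w\<^sup>2 + z\<^sup>2) / 2"
      using mult_right_mono[OF q(4), of "w\<^sup>2"] by (simp add: power_mult_distrib)
    finally show ?thesis by (simp add: add.commute)
  qed
  have qw: "q * \<bar>w * z\<bar> \<le> e * ((z\<^sup>2 + s * w\<^sup>2) / 2)" for w
  proof -
    have "q * \<bar>w * z\<bar> \<le> e * \<nu> * \<bar>w * z\<bar>" using q by (intro mult_right_mono) auto
    also have "\<dots> \<le> e * ((z\<^sup>2 + s * w\<^sup>2) / 2)" using w[of w] e by (simp add: mult.assoc mult_left_mono)
    finally show ?thesis .
  qed
  have "\<bar>lyap s p q v z a b - energy s v z a b\<bar> \<le> p * \<bar>a * b\<bar> + q * \<bar>v * z\<bar> + 2 * \<tau> * (q * \<bar>a * z\<bar>)"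
  proof -
    have "lyap s p q v z a b - energy s v z a b = - (p * (a * b)) + q * (v * z) - 2 * \<tau> * (q * (a * z))"
      by (simp add: lyap_def algebra_simps)
    moreover have "\<bar>p * (a * b)\<bar> = p * \<bar>a * b\<bar>" "\<bar>q * (v * z)\<bar> = q * \<bar>v * z\<bar>"
       "\<bar>2 * \<tau> * (q * (a * z))\<bar> = 2 * \<tau> * (q * \<bar>a * z\<bar>)"
      using p q tau by (auto simp: abs_mult)
    ultimately show ?thesis by linarith
  qed
  also have "\<dots> \<le> e * ((s * a\<^sup>2 + s * b\<^sup>2) / 2) + e * ((z\<^sup>2 + s * v\<^sup>2) / 2) + 2 * \<tau> * (e * ((z\<^sup>2 + s * a\<^sup>2) / 2))"
    using 1 qw[of v] qw[of a] tau by (intro add_mono mult_left_mono) auto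
  also have "\<dots> = e * ((s * a\<^sup>2 + s * b\<^sup>2 + z\<^sup>2 + s * v\<^sup>2) / 2 + \<tau> * (z\<^sup>2 + s * a\<^sup>2))"
    by (simp add: algebra_simps add_divide_distrib)
  also have "\<dots> \<le> e * ((1 + \<tau>) * dens s v z a b)"
  proof (intro mult_left_mono e)
    have "\<tau> * (z\<^sup>2 + s * a\<^sup>2) \<le> \<tau> * dens s v z a b" using nn tau
      by (intro mult_left_mono) (auto simp: dens_def)
    moreover have "(s * a\<^sup>2 + s * b\<^sup>2 + z\<^sup>2 + s * v\<^sup>2) / 2 \<le> dens s v z a b"
      using nn by (simp add: dens_def)
    ultimately show "(s * a\<^sup>2 + s * b\<^sup>2 + z\<^sup>2 + s * v\<^sup>2) / 2 + \<tau> * (z\<^sup>2 + s * a\<^sup>2) \<le> (1 + \<tau>) * dens s v z a b"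
      unfolding distrib_right by linarith
  qed
  finally show ?thesis by (simp add: mult.assoc)
qed

definition M where "M = 2 + (2 * \<tau> * \<kappa> - \<sigma>)\<^sup>2 / \<kappa> + 2 * \<tau> * \<sigma> + \<tau>\<^sup>2 + \<tau>\<^sup>2 / \<kappa>"

lemma M_ge: "M \<ge> 2" using kappa tau sigma by (simp add: M_def)

text \<open>Half of the new dissipation of z and v pays for the mixed terms; what it cannot pay
  falls on a and b, with the constant \<open>M\<close>. The unweighted a^2 in (1 + s) a^2 stems from
  2 z a, the only mixed term without a factor s, and it limits the size of q.\<close>

lemma corrector_deriv:
  assumes s: "s > 0"
  shows "- z\<^sup>2 - \<kappa> * (s * v\<^sup>2) + 2 * (z * a) + (2 * \<tau> * \<kappa> - \<sigma>) * (s * (v * a))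
            + 2 * \<tau> * \<sigma> * (s * a\<^sup>2) + 2 * \<tau>\<^sup>2 * (s * (a * b)) - \<tau> * (s * (v * b))
    \<le> - z\<^sup>2 / 2 - \<kappa> / 2 * (s * v\<^sup>2) + M * ((1 + s) * a\<^sup>2 + s * b\<^sup>2)"
proof -
  have 1: "2 * (z * a) \<le> z\<^sup>2 / 2 + 2 * a\<^sup>2" using mult_le_squares[of "1/4" z a] by simp
  have 2: "(2 * \<tau> * \<kappa> - \<sigma>) * (s * (v * a)) \<le> \<kappa> / 4 * (s * v\<^sup>2) + (2 * \<tau> * \<kappa> - \<sigma>)\<^sup>2 / \<kappa> * (s * a\<^sup>2)"
  proof -
    define w where "w = 2 * \<tau> * \<kappa> - \<sigma>"
    show ?thesis
      using mult_left_mono[OF mult_le_squares[of "\<kappa>/4" v "w * a"], of s] kappa s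
      unfolding w_def[symmetric] by (simp add: power_mult_distrib algebra_simps)
  qed
  have 3: "2 * \<tau>\<^sup>2 * (s * (a * b)) \<le> \<tau>\<^sup>2 * (s * a\<^sup>2) + \<tau>\<^sup>2 * (s * b\<^sup>2)"
    using mult_left_mono[OF mult_le_squares[of "1/2" a b], of "2 * \<tau>\<^sup>2 * s"] s
    by (simp add: power_mult_distrib algebra_simps)
  have 4: "- \<tau> * (s * (v * b)) \<le> \<kappa> / 4 * (s * v\<^sup>2) + \<tau>\<^sup>2 / \<kappa> * (s * b\<^sup>2)"
    using mult_left_mono[OF mult_le_squares[of "\<kappa>/4" v "- \<tau> * b"], of s] kappa s
    by (simp add: power_mult_distrib algebra_simps)
  have nn: "0 \<le> s * a\<^sup>2" "0 \<le> s * b\<^sup>2" "0 \<le> a\<^sup>2" using s by auto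
  have pos: "0 \<le> (2 * \<tau> * \<kappa> - \<sigma>)\<^sup>2 / \<kappa>" "0 \<le> 2 * \<tau> * \<sigma>" "0 \<le> \<tau>\<^sup>2" "0 \<le> \<tau>\<^sup>2 / \<kappa>" using kappa tau sigma by auto
  have "2 * a\<^sup>2 \<le> M * a\<^sup>2" using M_ge by (intro mult_right_mono) auto
  moreover have "((2 * \<tau> * \<kappa> - \<sigma>)\<^sup>2 / \<kappa> + 2 * \<tau> * \<sigma> + \<tau>\<^sup>2) * (s * a\<^sup>2) \<le> M * (s * a\<^sup>2)"
    using pos nn by (intro mult_right_mono) (auto simp: M_def)
  moreover have "(\<tau>\<^sup>2 + \<tau>\<^sup>2 / \<kappa>) * (s * b\<^sup>2) \<le> M * (s * b\<^sup>2)"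
    using pos nn by (intro mult_right_mono) (auto simp: M_def)
  moreover have "M * ((1 + s) * a\<^sup>2 + s * b\<^sup>2) = M * a\<^sup>2 + M * (s * a\<^sup>2) + M * (s * b\<^sup>2)"
    by (simp add: algebra_simps)
  ultimately show ?thesis using 1 2 3 4 unfolding distrib_right by linarith
qed

definition rate :: "real \<Rightarrow> real" where
  "rate s = (if \<delta> > 0 then s / (1 + s) else s / (1 + s)\<^sup>2)"

lemma rate_pos: "s > 0 \<Longrightarrow> rate s > 0" by (simp add: rate_def)

lemma rate_le: "s > 0 \<Longrightarrow> rate s \<le> s" "s > 0 \<Longrightarrow> rate s \<le> 1" "s > 0 \<Longrightarrow> (rate s)\<^sup>2 \<le> s"
proof -
  show A: "rate s \<le> s" if "s > 0" for s
  proof -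
    have "1 + s * 2 \<le> (1 + s)\<^sup>2" by (simp add: power2_eq_square algebra_simps)
    then have "1 \<le> (1 + s)\<^sup>2" using that by linarith
    then show ?thesis using that by (simp add: rate_def field_simps)
  qed
  show B: "rate s \<le> 1" if "s > 0" for s
  proof -
    have "s \<le> (1 + s)\<^sup>2" using that by (simp add: power2_eq_square algebra_simps)
    then show ?thesis using that by (simp add: rate_def)
  qed
  show "(rate s)\<^sup>2 \<le> s" if "s > 0" for s
    using mult_mono[OF A[OF that] B[OF that]] that rate_pos[OF that] by (simp add: power2_eq_square)
qed


lemma dissipation:
  "\<exists>e0>0. \<forall>e>0. e \<le> e0 \<longrightarrow> (\<exists>d>0. \<forall>s>0. \<exists>p q. 0 \<le> p \<and> p \<le> e * s \<and> 0 \<le> q \<and> q \<le> e * rate s \<and>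
     (\<forall>v z a b. lyap_deriv s p q v z a b \<le> - d * (rate s * dens s v z a b)))"
proof (cases "\<delta> > 0")
  case True
  \<comment> \<open>Keeps half of \<delta> s a^2 and half of (2 / m) s b^2 after the
    correction.\<close>
  define e0 where "e0 = min (\<delta> / (2 * M)) (1 / (m * M))"
  show ?thesis
  proof (rule exI[of _ e0], intro conjI allI impI)
    show "e0 > 0" using True M_ge m by (simp add: e0_def)
    fix e assume e: "e > 0" "e \<le> e0"
    have e1: "e * M \<le> \<delta> / 2" "e * M \<le> 1 / m" using e M_ge m by (auto simp: e0_def field_simps)
    define d where "d = Min {\<delta> / 2, 1 / m, e / 2, e * \<kappa> / 2}"
    have d: "d > 0" "d \<le> \<delta> / 2" "d \<le> 1 / m" "d \<le> e / 2" "d \<le> e * \<kappa> / 2"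
      using True m e kappa by (auto simp: d_def)
    show "\<exists>d>0. \<forall>s>0. \<exists>p q. 0 \<le> p \<and> p \<le> e * s \<and> 0 \<le> q \<and> q \<le> e * rate s \<and>
      (\<forall>v z a b. lyap_deriv s p q v z a b \<le> - d * (rate s * dens s v z a b))"
    proof (rule exI[of _ d], intro conjI allI impI d(1))
      fix s :: real assume s: "s > 0"
      define \<nu> where "\<nu> = rate s"
      have \<nu>: "\<nu> > 0" "\<nu> \<le> 1" "\<nu> * (1 + s) = s"
        using rate_pos[OF s] rate_le[OF s] s True by (auto simp: \<nu>_def rate_def)
      show "\<exists>p q. 0 \<le> p \<and> p \<le> e * s \<and> 0 \<le> q \<and> q \<le> e * rate s \<and>
        (\<forall>v z a b. lyap_deriv s p q v z a b \<le> - d * (rate s * dens s v z a b))"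
      proof (rule exI[of _ 0], rule exI[of _ "e * \<nu>"], intro conjI allI)
        show "0 \<le> (0::real)" "0 \<le> e * s" "0 \<le> e * \<nu>" using e s \<nu> by auto
        show "e * \<nu> \<le> e * rate s" by (simp add: \<nu>_def)
        fix v z a b :: real
        have nn: "0 \<le> s * v\<^sup>2" "0 \<le> s * a\<^sup>2" "0 \<le> s * b\<^sup>2" using s by auto
        have "lyap_deriv s 0 (e * \<nu>) v z a b \<le> - \<delta> * (s * a\<^sup>2) - 2 / m * (s * b\<^sup>2)
            + (e * \<nu>) * (- z\<^sup>2 / 2 - \<kappa> / 2 * (s * v\<^sup>2) + M * ((1 + s) * a\<^sup>2 + s * b\<^sup>2))"
          unfolding lyap_deriv_def using e(1) \<nu>(1)
          by (intro add_mono mult_left_mono corrector_deriv s) auto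
        also have "(e * \<nu>) * (- z\<^sup>2 / 2 - \<kappa> / 2 * (s * v\<^sup>2) + M * ((1 + s) * a\<^sup>2 + s * b\<^sup>2)) =
           - (e/2) * (\<nu> * z\<^sup>2) - (e * \<kappa> / 2) * (\<nu> * (s * v\<^sup>2)) + e * M * ((\<nu> * (1 + s)) * a\<^sup>2) + e * M * (\<nu> * (s * b\<^sup>2))"
          by (simp add: algebra_simps)
        also have "\<dots> \<le> - d * (\<nu> * z\<^sup>2) - d * (\<nu> * (s * v\<^sup>2)) + \<delta> / 2 * (s * a\<^sup>2) + 1 / m * (s * b\<^sup>2)"
        proof -
          have "d * (\<nu> * z\<^sup>2) \<le> (e/2) * (\<nu> * z\<^sup>2)" "d * (\<nu> * (s * v\<^sup>2)) \<le> (e * \<kappa> / 2) * (\<nu> * (s * v\<^sup>2))"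
            "e * M * (s * a\<^sup>2) \<le> \<delta> / 2 * (s * a\<^sup>2)"
            using d e1 nn \<nu> by (intro mult_right_mono; simp)+
          moreover have "e * M * (\<nu> * (s * b\<^sup>2)) \<le> 1 / m * (1 * (s * b\<^sup>2))"
            using e1 nn \<nu> m s by (intro mult_mono) auto
          ultimately show ?thesis unfolding \<nu>(3) by (simp only: mult_minus_left mult_1; linarith)
        qed
        finally have "lyap_deriv s 0 (e * \<nu>) v z a b \<le>
           - d * (\<nu> * z\<^sup>2) - d * (\<nu> * (s * v\<^sup>2)) - \<delta> / 2 * (s * a\<^sup>2) - 1 / m * (s * b\<^sup>2)"
          by (simp add: algebra_simps)
        moreover have "d * (\<nu> * (s * a\<^sup>2)) \<le> \<delta> / 2 * (1 * (s * a\<^sup>2))" "d * (\<nu> * (s * b\<^sup>2)) \<le> 1 / m * (1 * (s * b\<^sup>2))"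
          using d nn \<nu> m s delta by (intro mult_mono; simp)+
        ultimately have "lyap_deriv s 0 (e * \<nu>) v z a b \<le> - d * (\<nu> * dens s v z a b)"
          by (simp add: dens_def algebra_simps)
        then show "lyap_deriv s 0 (e * \<nu>) v z a b \<le> - d * (rate s * dens s v z a b)" by (simp add: \<nu>_def)
      qed
    qed
  qed
next
  case False
  then have d0: "\<delta> = 0" using delta by simp
  \<comment> \<open>Keeps the a^2 left by the q-corrector, of size e \<mu> M \<theta> a^2, below
    half of the e (m / 2) \<theta> a^2 that remains of the p-corrector.\<close>
  define \<mu> where "\<mu> = min 1 (m / (4 * M))"
  have mu: "\<mu> > 0" "\<mu> \<le> 1" "\<mu> * M \<le> m / 4" using m M_ge by (auto simp: \<mu>_def field_simps min_def)
  define e0 where "e0 = Min {\<mu> * \<tau>\<^sup>2 / (2 * m), \<tau>\<^sup>2 / 4, 2 / m\<^sup>2}"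
  show ?thesis
  proof (rule exI[of _ e0], intro conjI allI impI)
    show "e0 > 0" using mu tau m by (simp add: e0_def)
    fix e assume e: "e > 0" "e \<le> e0"
    have "e \<le> \<mu> * \<tau>\<^sup>2 / (2 * m)" "e \<le> \<tau>\<^sup>2 / 4" "e \<le> 2 / m\<^sup>2" using e by (auto simp: e0_def)
    then have e1: "e * m / (2 * \<tau>\<^sup>2) \<le> \<mu> / 4" "2 * e / (m * \<tau>\<^sup>2) \<le> 1 / (2 * m)" "e * (m / 4) \<le> 1 / (2 * m)"
      using tau m by (auto simp: field_simps power2_eq_square)
    have e2: "e * \<mu> * M \<le> e * (m / 4)" using mu e by (simp add: mult.assoc)
    define d where "d = Min {1 / (2 * m), e * m / 4, e * \<mu> / 4, e * \<mu> * \<kappa> / 2}"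
    have d: "d > 0" "d \<le> 1 / (2 * m)" "d \<le> e * m / 4" "d \<le> e * \<mu> / 4" "d \<le> e * \<mu> * \<kappa> / 2"
      using m e kappa mu by (auto simp: d_def)
    show "\<exists>d>0. \<forall>s>0. \<exists>p q. 0 \<le> p \<and> p \<le> e * s \<and> 0 \<le> q \<and> q \<le> e * rate s \<and>
      (\<forall>v z a b. lyap_deriv s p q v z a b \<le> - d * (rate s * dens s v z a b))"
    proof (rule exI[of _ d], intro conjI allI impI d(1))
      fix s :: real assume s: "s > 0"
      define \<nu> where "\<nu> = rate s"
      define \<theta> where "\<theta> = s / (1 + s)"
      have \<nu>: "\<nu> > 0" "\<nu> \<le> 1" using rate_pos[OF s] rate_le[OF s] by (auto simp: \<nu>_def)
      have \<nu>': "\<nu> = \<theta> / (1 + s)" using False by (simp add: \<nu>_def rate_def \<theta>_def power2_eq_square)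
      have \<nu>: "\<nu> > 0" "\<nu> \<le> 1" "\<nu> * (1 + s) = \<theta>" "\<theta>\<^sup>2 = \<nu> * s"
        using \<nu> s by (auto simp: \<nu>' \<theta>_def power2_eq_square)
      have \<theta>: "0 < \<theta>" "\<theta> \<le> s" using s by (auto simp: \<theta>_def field_simps)
      show "\<exists>p q. 0 \<le> p \<and> p \<le> e * s \<and> 0 \<le> q \<and> q \<le> e * rate s \<and>
        (\<forall>v z a b. lyap_deriv s p q v z a b \<le> - d * (rate s * dens s v z a b))"
      proof (rule exI[of _ "e * \<theta>"], rule exI[of _ "e * \<mu> * \<nu>"], intro conjI allI)
        fix v z a b :: real
        have nn: "0 \<le> s * v\<^sup>2" "0 \<le> s * a\<^sup>2" "0 \<le> s * b\<^sup>2" "0 \<le> \<nu> * z\<^sup>2" "0 \<le> \<theta> * a\<^sup>2" "0 \<le> \<nu> * (s * v\<^sup>2)"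
          "0 \<le> \<theta> * b\<^sup>2"
          using s \<nu> \<theta> by auto
        have "2 / \<tau> * (a * b) \<le> m / 2 * a\<^sup>2 + 2 / (m * \<tau>\<^sup>2) * b\<^sup>2"
          using mult_le_squares[of "m/2" a "2 / \<tau> * b"] m tau
          by (simp add: power_mult_distrib power_divide field_simps)
        then have "(e * \<theta>) * (- m * a\<^sup>2 + 2 / \<tau> * (a * b)) \<le> (e * \<theta>) * (- m / 2 * a\<^sup>2 + 2 / (m * \<tau>\<^sup>2) * b\<^sup>2)"
          using e \<theta> by (intro mult_left_mono) (auto simp: field_simps)
        also have "\<dots> = - (e * m / 2) * (\<theta> * a\<^sup>2) + 2 * e / (m * \<tau>\<^sup>2) * (\<theta> * b\<^sup>2)"
          by (simp add: field_simps)
        also have "\<dots> \<le> - (e * m / 2) * (\<theta> * a\<^sup>2) + 1 / (2 * m) * (s * b\<^sup>2)"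
          using e1(2) \<theta> nn m by (intro add_mono order_refl mult_mono) auto
        finally have 1: "(e * \<theta>) * (- m * a\<^sup>2 + 2 / \<tau> * (a * b)) \<le> \<dots>" .
        have 2: "(e * \<theta>) * (- z * b / \<tau>) \<le> 1 / (2 * m) * (s * b\<^sup>2) + e * \<mu> / 4 * (\<nu> * z\<^sup>2)"
        proof -
          have "(e * \<theta>) * (- z * b / \<tau>) = b * (- (e * \<theta> / \<tau>) * z)" by simp
          \<comment> \<open>The weight s / (2 m) is the share of b. The rest is a multiple of
            (\<theta>^2 / s) z^2, and \<theta>^2 = \<nu> s makes it absorbable by the dissipation of
            z.\<close>
          also have "\<dots> \<le> s / (2 * m) * b\<^sup>2 + (- (e * \<theta> / \<tau>) * z)\<^sup>2 / (4 * (s / (2 * m)))"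
            using s m by (intro mult_le_squares) auto
          also have "(- (e * \<theta> / \<tau>) * z)\<^sup>2 / (4 * (s / (2 * m))) = e * (e * m / (2 * \<tau>\<^sup>2)) * (\<theta>\<^sup>2 / s * z\<^sup>2)"
            using s m tau by (simp add: power_mult_distrib power_divide power2_eq_square[of e] field_simps)
          also have "\<theta>\<^sup>2 / s = \<nu>" using \<nu>(4) s by simp
          also have "e * (e * m / (2 * \<tau>\<^sup>2)) * (\<nu> * z\<^sup>2) \<le> e * (\<mu> / 4) * (\<nu> * z\<^sup>2)"
            using e1(1) e nn by (intro mult_right_mono mult_left_mono) auto
          finally show ?thesis by simp
        qed
        have "(e * \<mu> * \<nu>) * (- z\<^sup>2 - \<kappa> * (s * v\<^sup>2) + 2 * (z * a) + (2 * \<tau> * \<kappa> - \<sigma>) * (s * (v * a))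
            + 2 * \<tau> * \<sigma> * (s * a\<^sup>2) + 2 * \<tau>\<^sup>2 * (s * (a * b)) - \<tau> * (s * (v * b)))
           \<le> (e * \<mu> * \<nu>) * (- z\<^sup>2 / 2 - \<kappa> / 2 * (s * v\<^sup>2) + M * ((1 + s) * a\<^sup>2 + s * b\<^sup>2))"
          using e(1) \<nu>(1) mu by (intro mult_left_mono corrector_deriv s) auto
        also have "\<dots> =
           - (e * \<mu>/2) * (\<nu> * z\<^sup>2) - (e * \<mu> * \<kappa> / 2) * (\<nu> * (s * v\<^sup>2)) + e * \<mu> * M * ((\<nu> * (1 + s)) * a\<^sup>2) + e * \<mu> * M * (\<nu> * (s * b\<^sup>2))"
          by (simp add: algebra_simps)
        also have "\<dots> \<le> - (e * \<mu>/2) * (\<nu> * z\<^sup>2) - d * (\<nu> * (s * v\<^sup>2)) + e * (m / 4) * (\<theta> * a\<^sup>2) + 1 / (2 * m) * (s * b\<^sup>2)"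
        proof -
          have "d * (\<nu> * (s * v\<^sup>2)) \<le> (e * \<mu> * \<kappa> / 2) * (\<nu> * (s * v\<^sup>2))"
            "e * \<mu> * M * (\<theta> * a\<^sup>2) \<le> e * (m / 4) * (\<theta> * a\<^sup>2)"
            using d e2 nn \<nu> by (intro mult_right_mono; simp)+
          moreover have "e * \<mu> * M * (\<nu> * (s * b\<^sup>2)) \<le> 1 / (2 * m) * (1 * (s * b\<^sup>2))"
            using e1 e2 nn \<nu> m s by (intro mult_mono) auto
          ultimately show ?thesis unfolding \<nu>(3) by (simp only: mult_minus_left mult_1; linarith)
        qed
        finally have 3: "(e * \<mu> * \<nu>) * (- z\<^sup>2 - \<kappa> * (s * v\<^sup>2) + 2 * (z * a) + (2 * \<tau> * \<kappa> - \<sigma>) * (s * (v * a))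
            + 2 * \<tau> * \<sigma> * (s * a\<^sup>2) + 2 * \<tau>\<^sup>2 * (s * (a * b)) - \<tau> * (s * (v * b))) \<le> \<dots>" .
        \<comment> \<open>The budget of b: of four equal parts of (2 / m) s b^2, one pays for p a b,
          one for p z b and one for the q-corrector; the last one survives as dissipation.\<close>
        have 4: "2 / m * (s * b\<^sup>2) = 1 / (2 * m) * (s * b\<^sup>2) + 1 / (2 * m) * (s * b\<^sup>2) + 1 / (2 * m) * (s * b\<^sup>2) + 1 / (2 * m) * (s * b\<^sup>2)"
          using m by (simp add: field_simps)
        have 5: "e * \<mu> / 2 * (\<nu> * z\<^sup>2) = e * \<mu> / 4 * (\<nu> * z\<^sup>2) + e * \<mu> / 4 * (\<nu> * z\<^sup>2)"
             "e * m / 2 * (\<theta> * a\<^sup>2) = e * (m / 4) * (\<theta> * a\<^sup>2) + e * (m / 4) * (\<theta> * a\<^sup>2)" by auto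
        have 6: "(e * \<theta>) * (- m * a\<^sup>2 + 2 / \<tau> * (a * b) - z * b / \<tau>) =
           (e * \<theta>) * (- m * a\<^sup>2 + 2 / \<tau> * (a * b)) + (e * \<theta>) * (- z * b / \<tau>)"
          by (simp add: algebra_simps)
        have 7: "\<delta> * (s * a\<^sup>2) = 0" using d0 by simp
        have A: "lyap_deriv s (e * \<theta>) (e * \<mu> * \<nu>) v z a b \<le>
           - (1 / (2 * m) * (s * b\<^sup>2)) - e * (m / 4) * (\<theta> * a\<^sup>2) - e * \<mu> / 4 * (\<nu> * z\<^sup>2) - d * (\<nu> * (s * v\<^sup>2))"
          unfolding lyap_deriv_def 6 using 1 2 3 4 5 7 by (simp only: mult_minus_left minus_zero mult_zero_left; linarith)
        have "d * (\<nu> * (s * b\<^sup>2)) \<le> 1 / (2 * m) * (1 * (s * b\<^sup>2))"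
          using d nn \<nu> m s by (intro mult_mono) auto
        moreover have "d * (\<nu> * (s * a\<^sup>2)) \<le> e * (m / 4) * (\<theta> * a\<^sup>2)"
        proof -
          have "\<nu> * s \<le> \<theta>" using \<nu>(1) unfolding \<nu>(3)[symmetric] by (simp add: algebra_simps)
          then have h: "\<nu> * (s * a\<^sup>2) \<le> \<theta> * a\<^sup>2" by (simp add: mult_right_mono flip: mult.assoc)
          show ?thesis by (rule mult_mono[OF _ h]) (use d(3) m e(1) \<nu>(1) s in auto)
        qed
        moreover have "d * (\<nu> * z\<^sup>2) \<le> e * \<mu> / 4 * (\<nu> * z\<^sup>2)" using d nn by (intro mult_right_mono) auto
        ultimately have "lyap_deriv s (e * \<theta>) (e * \<mu> * \<nu>) v z a b \<le> - d * (\<nu> * dens s v z a b)"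
          using A unfolding dens_def distrib_left by (simp only: mult_minus_left mult_1; linarith)
        then show "lyap_deriv s (e * \<theta>) (e * \<mu> * \<nu>) v z a b \<le> - d * (rate s * dens s v z a b)" by (simp add: \<nu>_def)
      next
        show "e * \<mu> * \<nu> \<le> e * rate s" using mu e \<nu> by (simp add: \<nu>_def)
      qed (use e s \<nu> \<theta> mu in \<open>auto simp: \<nu>_def\<close>)
    qed
  qed
qed

lemma lyapunov:
  "\<exists>c>0. \<exists>K>0. \<forall>s>0. \<exists>p q. 0 \<le> p \<and> p \<le> s \<and> 0 \<le> q \<and> q\<^sup>2 \<le> s \<and>
     (\<forall>v z a b. dens s v z a b \<le> K * lyap s p q v z a b \<and> lyap s p q v z a b \<le> K * dens s v z a b \<and>
        lyap_deriv s p q v z a b \<le> - (2 * c * rate s) * lyap s p q v z a b)"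
proof -
  obtain k where k: "k > 0"
    and E: "\<And>s v z a b. s \<ge> 0 \<Longrightarrow> k * dens s v z a b \<le> energy s v z a b"
      "\<And>s v z a b. s \<ge> 0 \<Longrightarrow> k * energy s v z a b \<le> dens s v z a b"
    using energy_bounds by blast
  obtain e0 where e0: "e0 > 0" and dis: "\<And>e. e > 0 \<Longrightarrow> e \<le> e0 \<Longrightarrow>
     (\<exists>d>0. \<forall>s>0. \<exists>p q. 0 \<le> p \<and> p \<le> e * s \<and> 0 \<le> q \<and> q \<le> e * rate s \<and>
     (\<forall>v z a b. lyap_deriv s p q v z a b \<le> - d * (rate s * dens s v z a b)))"
    using dissipation by blast
  \<comment> \<open>The third entry makes the correctors change \<open>energy\<close> by at most
    half of its lower bound k times \<open>dens\<close>, so that \<open>lyap\<close> inherits the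
    two-sided comparison.\<close>
  define e where "e = Min {e0, 1, k / (2 * (1 + \<tau>))}"
  have e: "e > 0" "e \<le> e0" "e \<le> 1" "e \<le> k / (2 * (1 + \<tau>))" using e0 k tau by (auto simp: e_def)
  have e': "e * (1 + \<tau>) \<le> k / 2" using e tau by (simp add: field_simps)
  obtain d where d: "d > 0" and D: "\<And>s. s > 0 \<Longrightarrow> \<exists>p q. 0 \<le> p \<and> p \<le> e * s \<and> 0 \<le> q \<and> q \<le> e * rate s \<and>
     (\<forall>v z a b. lyap_deriv s p q v z a b \<le> - d * (rate s * dens s v z a b))"
    using dis[OF e(1,2)] by blast
  define K where "K = max (2 / k) (1 / k + k / 2)"
  have K: "K > 0" "K \<ge> 2 / k" "K \<ge> 1 / k + k / 2" using k by (auto simp: K_def less_max_iff_disj)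
  have dK: "d / (2 * K) > 0" using d K by simp
  show ?thesis
  proof (rule exI[of _ "d / (2 * K)"], intro conjI dK, rule exI[of _ K], intro conjI K(1) allI impI)
    fix s :: real assume s: "s > 0"
    obtain p q where pq: "0 \<le> p" "p \<le> e * s" "0 \<le> q" "q \<le> e * rate s"
      and L: "\<And>v z a b. lyap_deriv s p q v z a b \<le> - d * (rate s * dens s v z a b)" using D[OF s] by blast
    show "\<exists>p q. 0 \<le> p \<and> p \<le> s \<and> 0 \<le> q \<and> q\<^sup>2 \<le> s \<and>
     (\<forall>v z a b. dens s v z a b \<le> K * lyap s p q v z a b \<and> lyap s p q v z a b \<le> K * dens s v z a b \<and>
        lyap_deriv s p q v z a b \<le> - (2 * (d / (2 * K)) * rate s) * lyap s p q v z a b)"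
    proof (rule exI[of _ p], rule exI[of _ q], intro conjI allI)
      show "0 \<le> p" "0 \<le> q" by fact+
      have "e * s \<le> 1 * s" using e s by (intro mult_right_mono) auto
      then show "p \<le> s" using pq by simp
      have "e * rate s \<le> 1 * rate s" using e rate_pos[OF s] by (intro mult_right_mono) auto
      then have "q \<le> rate s" using pq by simp
      then have "q\<^sup>2 \<le> (rate s)\<^sup>2" using pq by (intro power_mono)
      then show "q\<^sup>2 \<le> s" using rate_le(3)[OF s] by simp
      fix v z a b
      define N where "N = dens s v z a b"
      have N0: "N \<ge> 0" using s by (simp add: N_def dens_def)
      have cb: "\<bar>lyap s p q v z a b - energy s v z a b\<bar> \<le> k / 2 * N"
        using corrector_bound[OF s pq(1-4) _ rate_le(3)[OF s], of v z a b] e rate_pos[OF s]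
              mult_right_mono[OF e' N0] unfolding N_def by simp
      have "k * N \<le> energy s v z a b" using E(1)[of s v z a b] s by (simp add: N_def)
      then have l1: "k / 2 * N \<le> lyap s p q v z a b" using cb by linarith
      have "N \<le> 2 / k * lyap s p q v z a b" using l1 k by (simp add: field_simps)
      also have l0: "lyap s p q v z a b \<ge> 0" using l1 N0 k
        by (meson half_gt_zero less_imp_le mult_nonneg_nonneg order_trans)
      then have "2 / k * lyap s p q v z a b \<le> K * lyap s p q v z a b" using K by (intro mult_right_mono)
      finally show "dens s v z a b \<le> K * lyap s p q v z a b" by (simp add: N_def)
      have "energy s v z a b \<le> 1 / k * N" using E(2)[of s v z a b] s k by (simp add: N_def field_simps)
      then have "lyap s p q v z a b \<le> (1 / k + k / 2) * N" using cb unfolding distrib_right by linarith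
      also have "\<dots> \<le> K * N" using K N0 by (intro mult_right_mono)
      finally show l2: "lyap s p q v z a b \<le> K * dens s v z a b" by (simp add: N_def)
      have "(2 * (d / (2 * K)) * rate s) * lyap s p q v z a b \<le> (d * rate s) * N"
      proof -
        have "(2 * (d / (2 * K)) * rate s) * lyap s p q v z a b \<le> (2 * (d / (2 * K)) * rate s) * (K * N)"
          using l2 K d rate_pos[OF s] by (intro mult_left_mono) (auto simp: N_def)
        then show ?thesis using K by simp
      qed
      then show "lyap_deriv s p q v z a b \<le> - (2 * (d / (2 * K)) * rate s) * lyap s p q v z a b"
        using L[of v z a b] by (simp add: N_def mult.assoc)
    qed
  qed
qed

text \<open>The unknowns are \<open>v = u + \<tau> u'\<close>, \<open>z = v'\<close>, \<open>a = u'\<close> and the derivative \<open>b = w'\<close> of the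
  memory term \<open>w(t) = \<integral>m exp (- (t - \<eta>) / \<tau>) u(\<eta>) d\<eta>\<close>. The sources \<open>F\<close> and \<open>H\<close>
  accommodate approximate solutions.\<close>

definition flow :: "real \<Rightarrow> (real \<Rightarrow> real) \<Rightarrow> (real \<Rightarrow> real) \<Rightarrow> (real \<Rightarrow> real) \<Rightarrow> (real \<Rightarrow> real) \<Rightarrow>
    (real \<Rightarrow> real) \<Rightarrow> (real \<Rightarrow> real) \<Rightarrow> bool" where
  "flow s v z a b F H \<longleftrightarrow>
     continuous_on {0..} v \<and> continuous_on {0..} z \<and> continuous_on {0..} a \<and> continuous_on {0..} b \<and>
     (\<forall>t>0. (v has_real_derivative z t) (at t) \<and>
        (z has_real_derivative - \<kappa> * s * v t - \<sigma> * s * a t - \<tau> * s * b t + F t) (at t) \<and>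
        (a has_real_derivative (z t - a t) / \<tau>) (at t) \<and>
        (b has_real_derivative m * a t - b t / \<tau> + H t) (at t))"

text \<open>Any supersolution \<open>Z\<close> of the scalar comparison equation bounds the system.\<close>

definition real_decay :: "real \<Rightarrow> real \<Rightarrow> bool" where
  "real_decay K c \<longleftrightarrow> (\<forall>s v z a b F H g Z t.
     s > 0 \<longrightarrow> flow s v z a b F H \<longrightarrow> (\<forall>t>0. \<bar>F t\<bar> + sqrt s * \<bar>H t\<bar> \<le> g t) \<longrightarrow>
     continuous_on {0..} Z \<longrightarrow>
     (\<forall>t>0. \<exists>D. (Z has_real_derivative D) (at t) \<and> D \<ge> - (c * rate s) * Z t + K * g t) \<longrightarrow>
     K * (\<bar>z 0\<bar> + sqrt s * (\<bar>v 0\<bar> + \<bar>a 0\<bar> + \<bar>b 0\<bar>)) \<le> Z 0 \<longrightarrow> t \<ge> 0 \<longrightarrow>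
     sqrt s * \<bar>v t\<bar> \<le> K * Z t \<and> sqrt s * \<bar>a t\<bar> \<le> K * Z t)"

text \<open>Sources enter the derivative of \<open>lyap\<close> linearly: F with the z-gradient z +
  q (v - 2 \<tau> a), H with the b-gradient 2 (\<tau> / m) s b + \<tau>^2 s a - p a. Since q \<le>
  sqrt s and p \<le> s, the first is at most a multiple of sqrt L and the second of sqrt s sqrt L,
  which explains the weight sqrt s on H. The result is the differential inequality of
  \<open>sqrt_gronwall\<close>.\<close>

lemma flow_decay_real: "\<exists>K>0. \<exists>c>0. real_decay K c"
proof -
  obtain c K where c: "c > 0" and K: "K > 0" and lyap: "\<And>s. s > 0 \<Longrightarrow> \<exists>p q. 0 \<le> p \<and> p \<le> s \<and> 0 \<le> q \<and> q\<^sup>2 \<le> s \<and>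
     (\<forall>v z a b. dens s v z a b \<le> K * lyap s p q v z a b \<and> lyap s p q v z a b \<le> K * dens s v z a b \<and>
        lyap_deriv s p q v z a b \<le> - (2 * c * rate s) * lyap s p q v z a b)"
    using lyapunov by blast
  \<comment> \<open>Sum of the coefficients in the two gradient bounds; K' carries the further
    factor sqrt K from comparing \<open>dens\<close> with L.\<close>
  define B where "B = 1 + 2 * \<tau> + 1 + 2 * \<tau> / m + \<tau>\<^sup>2 + 1"
  define K' where "K' = sqrt K * B"
  have B: "B \<ge> 1" using tau m by (simp add: B_def)
  have K': "K' > 0" "K' \<ge> sqrt K" "K' \<ge> B * sqrt K"
  proof -
    show "K' > 0" using K B by (simp add: K'_def)
    show "K' \<ge> sqrt K" using mult_left_mono[OF B, of "sqrt K"] K by (simp add: K'_def)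
    show "K' \<ge> B * sqrt K" by (simp add: K'_def)
  qed
  show ?thesis
  proof (rule exI[of _ K'], intro conjI K'(1), rule exI[of _ c], rule conjI[OF c],
      unfold real_decay_def, intro conjI allI impI)
    fix s :: real and v z a b F H g Z :: "real \<Rightarrow> real" and t :: real
    assume s: "s > 0" and fl: "flow s v z a b F H" and g: "\<forall>t>0. \<bar>F t\<bar> + sqrt s * \<bar>H t\<bar> \<le> g t"
      and contZ: "continuous_on {0..} Z"
      and dZ: "\<forall>t>0. \<exists>D. (Z has_real_derivative D) (at t) \<and> D \<ge> - (c * rate s) * Z t + K' * g t"
      and init: "K' * (\<bar>z 0\<bar> + sqrt s * (\<bar>v 0\<bar> + \<bar>a 0\<bar> + \<bar>b 0\<bar>)) \<le> Z 0" and t: "t \<ge> 0"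
    obtain p q where pq: "0 \<le> p" "p \<le> s" "0 \<le> q" "q\<^sup>2 \<le> s" and
       L1: "\<And>v z a b. dens s v z a b \<le> K * lyap s p q v z a b" and
       L2: "\<And>v z a b. lyap s p q v z a b \<le> K * dens s v z a b" and
       L3: "\<And>v z a b. lyap_deriv s p q v z a b \<le> - (2 * c * rate s) * lyap s p q v z a b"
      using lyap[OF s] by blast
    define L where "L = (\<lambda>t. lyap s p q (v t) (z t) (a t) (b t))"
    have dens0: "dens s v z a b \<ge> 0" for v z a b using s by (simp add: dens_def)
    have Lnn: "L t \<ge> 0" for t
      using order_trans[OF dens0 L1[of "v t" "z t" "a t" "b t"]] K
      by (simp add: L_def zero_le_mult_iff)
    have comp: "sqrt s * \<bar>v\<bar> \<le> sqrt K * sqrt (lyap s p q v z a b)" "\<bar>z\<bar> \<le> sqrt K * sqrt (lyap s p q v z a b)"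
       "sqrt s * \<bar>a\<bar> \<le> sqrt K * sqrt (lyap s p q v z a b)" "sqrt s * \<bar>b\<bar> \<le> sqrt K * sqrt (lyap s p q v z a b)" for v z a b
    proof -
      have *: "sqrt (dens s v z a b) \<le> sqrt K * sqrt (lyap s p q v z a b)"
        using L1[of v z a b] by (simp flip: real_sqrt_mult)
      have n: "0 \<le> s * v\<^sup>2" "0 \<le> s * a\<^sup>2" "0 \<le> s * b\<^sup>2" using s by auto
      have "sqrt s * \<bar>v\<bar> = sqrt (s * v\<^sup>2)" "\<bar>z\<bar> = sqrt (z\<^sup>2)" "sqrt s * \<bar>a\<bar> = sqrt (s * a\<^sup>2)" "sqrt s * \<bar>b\<bar> = sqrt (s * b\<^sup>2)"
        by (auto simp: real_sqrt_mult)
      moreover have "sqrt (s * v\<^sup>2) \<le> sqrt (dens s v z a b)" "sqrt (z\<^sup>2) \<le> sqrt (dens s v z a b)"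
        "sqrt (s * a\<^sup>2) \<le> sqrt (dens s v z a b)" "sqrt (s * b\<^sup>2) \<le> sqrt (dens s v z a b)"
        using n by (auto intro!: real_sqrt_le_mono simp: dens_def simp del: real_sqrt_abs real_sqrt_le_iff)
      ultimately show "sqrt s * \<bar>v\<bar> \<le> sqrt K * sqrt (lyap s p q v z a b)" "\<bar>z\<bar> \<le> sqrt K * sqrt (lyap s p q v z a b)"
       "sqrt s * \<bar>a\<bar> \<le> sqrt K * sqrt (lyap s p q v z a b)" "sqrt s * \<bar>b\<bar> \<le> sqrt K * sqrt (lyap s p q v z a b)"
        using * by linarith+
    qed
    have qs: "q \<le> sqrt s" using pq by (simp add: real_le_rsqrt)
    have main: "sqrt (L t) \<le> Z t"
    proof (rule sqrt_gronwall[where L = L and Z = Z and t = t and k = "c * rate s" and h = "\<lambda>t. K' * g t"])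
      show "continuous_on {0..} L" unfolding L_def lyap_def energy_def
        using fl by (intro continuous_intros) (auto simp: flow_def)
      show "c * rate s \<ge> 0" using c rate_pos[OF s] by simp
      show "K' * g t \<ge> 0" if "t > 0" for t
      proof -
        have "0 \<le> \<bar>F t\<bar> + sqrt s * \<bar>H t\<bar>" using s by simp
        then have "0 \<le> g t" using g that by (meson order_trans)
        then show ?thesis using K' by simp
      qed
      show "\<exists>D. (Z has_real_derivative D) (at t) \<and> D \<ge> - (c * rate s) * Z t + K' * g t" if "t > 0" for t
        using dZ that by simp
      show "sqrt (L 0) \<le> Z 0"
      proof -
        have "(\<bar>z 0\<bar> + sqrt s * (\<bar>v 0\<bar> + \<bar>a 0\<bar> + \<bar>b 0\<bar>))\<^sup>2 \<ge> dens s (v 0) (z 0) (a 0) (b 0)"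
        proof -
          have "dens s (v 0) (z 0) (a 0) (b 0) = \<bar>z 0\<bar>\<^sup>2 + (sqrt s * \<bar>v 0\<bar>)\<^sup>2 + (sqrt s * \<bar>a 0\<bar>)\<^sup>2 + (sqrt s * \<bar>b 0\<bar>)\<^sup>2"
            using s by (simp add: dens_def power_mult_distrib)
          also have "\<dots> \<le> (\<bar>z 0\<bar> + sqrt s * \<bar>v 0\<bar> + sqrt s * \<bar>a 0\<bar> + sqrt s * \<bar>b 0\<bar>)\<^sup>2"
          proof -
            have "x\<^sup>2 + y\<^sup>2 + u\<^sup>2 + w\<^sup>2 \<le> (x + y + u + w)\<^sup>2" if "x \<ge> 0" "y \<ge> 0" "u \<ge> 0" "w \<ge> 0" for x y u w :: real
            proof -
              have "(x + y + u + w)\<^sup>2 - (x\<^sup>2 + y\<^sup>2 + u\<^sup>2 + w\<^sup>2) = 2 * (x * y + x * u + x * w + y * u + y * w + u * w)"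
                by (simp add: power2_eq_square algebra_simps)
              also have "\<dots> \<ge> 0" using that by simp
              finally show ?thesis by linarith
            qed
            from this[of "\<bar>z 0\<bar>" "sqrt s * \<bar>v 0\<bar>" "sqrt s * \<bar>a 0\<bar>" "sqrt s * \<bar>b 0\<bar>"]
            show ?thesis using s by simp
          qed
          finally show ?thesis by (simp add: algebra_simps)
        qed
        then have "sqrt (dens s (v 0) (z 0) (a 0) (b 0)) \<le> \<bar>z 0\<bar> + sqrt s * (\<bar>v 0\<bar> + \<bar>a 0\<bar> + \<bar>b 0\<bar>)"
          using s by (intro real_le_lsqrt) auto
        moreover have "sqrt (L 0) \<le> sqrt K * sqrt (dens s (v 0) (z 0) (a 0) (b 0))"
          using L2[of "v 0" "z 0" "a 0" "b 0"] by (simp add: L_def flip: real_sqrt_mult)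
        ultimately have "sqrt (L 0) \<le> K' * (\<bar>z 0\<bar> + sqrt s * (\<bar>v 0\<bar> + \<bar>a 0\<bar> + \<bar>b 0\<bar>))"
          using K' K s by (smt (verit, best) dens0 mult_mono real_sqrt_ge_zero)
        then show ?thesis using init by simp
      qed
      fix t :: real assume t: "t > 0"
      define D where "D = lyap_deriv s p q (v t) (z t) (a t) (b t) + (z t + q * (v t - 2 * \<tau> * a t)) * F t
          + (2 * \<tau> / m * s * b t + \<tau>\<^sup>2 * s * a t - p * a t) * H t"
      have d: "(v has_real_derivative z t) (at t)"
        "(z has_real_derivative - \<kappa> * s * v t - \<sigma> * s * a t - \<tau> * s * b t + F t) (at t)"
        "(a has_real_derivative (z t - a t) / \<tau>) (at t)"
        "(b has_real_derivative m * a t - b t / \<tau> + H t) (at t)"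
        using fl t by (auto simp: flow_def)
      have "(L has_real_derivative D) (at t)"
        unfolding L_def lyap_def energy_def
        using tau m
        by (auto intro!: derivative_eq_intros d simp: D_def lyap_deriv_def \<sigma>_def field_simps power2_eq_square)
      moreover have "D \<le> - 2 * (c * rate s) * L t + 2 * sqrt (L t) * (K' * g t)"
      proof -
        define S where "S = sqrt K * sqrt (L t)"
        have S: "sqrt s * \<bar>v t\<bar> \<le> S" "\<bar>z t\<bar> \<le> S" "sqrt s * \<bar>a t\<bar> \<le> S" "sqrt s * \<bar>b t\<bar> \<le> S"
          using comp unfolding S_def L_def by blast+
        have S0: "S \<ge> 0" using S(2) by linarith
        have q1: "q * \<bar>x\<bar> \<le> sqrt s * \<bar>x\<bar>" for x using qs by (intro mult_right_mono) auto
        have "\<bar>z t + q * (v t - 2 * \<tau> * a t)\<bar> \<le> \<bar>z t\<bar> + q * \<bar>v t\<bar> + 2 * \<tau> * (q * \<bar>a t\<bar>)"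
        proof -
          have "\<bar>z t + (q * v t - 2 * \<tau> * (q * a t))\<bar> \<le> \<bar>z t\<bar> + \<bar>q * v t\<bar> + \<bar>2 * \<tau> * (q * a t)\<bar>" by linarith
          then show ?thesis using pq tau by (simp add: abs_mult algebra_simps)
        qed
        also have "\<dots> \<le> S + S + 2 * \<tau> * S" using S q1[of "v t"] q1[of "a t"] tau
          by (intro add_mono mult_left_mono) (auto intro: order_trans)
        also have "\<dots> \<le> B * S" using S0 tau m by (simp add: B_def distrib_right)
        finally have A1: "\<bar>z t + q * (v t - 2 * \<tau> * a t)\<bar> \<le> B * S" .
        have "\<bar>2 * \<tau> / m * s * b t + \<tau>\<^sup>2 * s * a t - p * a t\<bar> \<le> 2 * \<tau> / m * (s * \<bar>b t\<bar>) + \<tau>\<^sup>2 * (s * \<bar>a t\<bar>) + p * \<bar>a t\<bar>"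
        proof -
          have "\<bar>2 * \<tau> / m * s * b t + \<tau>\<^sup>2 * s * a t - p * a t\<bar> \<le> \<bar>2 * \<tau> / m * s * b t\<bar> + \<bar>\<tau>\<^sup>2 * s * a t\<bar> + \<bar>p * a t\<bar>"
            by (rule order_trans[OF abs_triangle_ineq4 add_right_mono[OF abs_triangle_ineq]])
          then show ?thesis using pq tau s m by (simp add: abs_mult mult.assoc)
        qed
        also have "\<dots> \<le> 2 * \<tau> / m * (s * \<bar>b t\<bar>) + \<tau>\<^sup>2 * (s * \<bar>a t\<bar>) + s * \<bar>a t\<bar>"
          using pq by (intro add_mono mult_right_mono) auto
        also have "\<dots> = sqrt s * (2 * \<tau> / m * (sqrt s * \<bar>b t\<bar>) + \<tau>\<^sup>2 * (sqrt s * \<bar>a t\<bar>) + sqrt s * \<bar>a t\<bar>)"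
        proof -
          have ss: "sqrt s * (c * (sqrt s * x)) = c * (s * x)" "sqrt s * (sqrt s * x) = s * x" for c x
          proof -
            show "sqrt s * (sqrt s * x) = s * x" for x using s by (simp flip: mult.assoc)
            then show "sqrt s * (c * (sqrt s * x)) = c * (s * x)" by (simp add: mult.left_commute[of c])
          qed
          show ?thesis unfolding distrib_left ss ..
        qed
        also have "\<dots> \<le> sqrt s * (2 * \<tau> / m * S + \<tau>\<^sup>2 * S + S)"
          using S tau m s by (intro mult_left_mono add_mono) auto
        also have "\<dots> \<le> sqrt s * (B * S)" using S0 tau m s by (intro mult_left_mono) (auto simp: B_def distrib_right)
        finally have A2: "\<bar>2 * \<tau> / m * s * b t + \<tau>\<^sup>2 * s * a t - p * a t\<bar> \<le> sqrt s * (B * S)" .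
        have "(z t + q * (v t - 2 * \<tau> * a t)) * F t + (2 * \<tau> / m * s * b t + \<tau>\<^sup>2 * s * a t - p * a t) * H t
           \<le> (B * S) * \<bar>F t\<bar> + (sqrt s * (B * S)) * \<bar>H t\<bar>"
        proof -
          have "x * y \<le> X * \<bar>y\<bar>" if "\<bar>x\<bar> \<le> X" for x y X :: real
            using mult_right_mono[OF that, of "\<bar>y\<bar>"] abs_ge_self[of "x * y"] by (simp add: abs_mult)
          then show ?thesis using A1 A2 by (intro add_mono) auto
        qed
        also have "\<dots> = B * S * (\<bar>F t\<bar> + sqrt s * \<bar>H t\<bar>)" by (simp add: algebra_simps)
        also have "\<dots> \<le> B * S * g t" using g t B S0 by (intro mult_left_mono) auto
        also have "\<dots> = K' * g t * sqrt (L t)" by (simp add: S_def K'_def)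
        also have "\<dots> \<le> 2 * (K' * g t * sqrt (L t))"
        proof -
          have "0 \<le> \<bar>F t\<bar> + sqrt s * \<bar>H t\<bar>" using s by simp
          then have "0 \<le> g t" using g t by (meson order_trans)
          then have "0 \<le> K' * g t * sqrt (L t)" using K' Lnn[of t] by simp
          then show ?thesis by simp
        qed
        finally show ?thesis using L3[of "v t" "z t" "a t" "b t"] by (simp add: D_def L_def algebra_simps)
      qed
      ultimately show "\<exists>D. (L has_real_derivative D) (at t) \<and> D \<le> - 2 * (c * rate s) * L t + 2 * sqrt (L t) * (K' * g t)"
        by blast
    qed (use Lnn contZ t in auto)
    have "sqrt K * sqrt (L t) \<le> K' * Z t"
      using K' K main Lnn by (intro mult_mono) (auto intro: order_trans[OF real_sqrt_ge_zero])
    then show "sqrt s * \<bar>v t\<bar> \<le> K' * Z t" "sqrt s * \<bar>a t\<bar> \<le> K' * Z t"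
      using comp(1,3) unfolding L_def by (meson order_trans)+
  qed
qed

definition cflow :: "real \<Rightarrow> (real \<Rightarrow> complex) \<Rightarrow> (real \<Rightarrow> complex) \<Rightarrow> (real \<Rightarrow> complex) \<Rightarrow> (real \<Rightarrow> complex) \<Rightarrow>
    (real \<Rightarrow> complex) \<Rightarrow> (real \<Rightarrow> complex) \<Rightarrow> bool" where
  "cflow s v z a b F H \<longleftrightarrow>
     continuous_on {0..} v \<and> continuous_on {0..} z \<and> continuous_on {0..} a \<and> continuous_on {0..} b \<and>
     (\<forall>t>0. (v has_vector_derivative z t) (at t) \<and>
        (z has_vector_derivative - (\<kappa> * s) *\<^sub>R v t - (\<sigma> * s) *\<^sub>R a t - (\<tau> * s) *\<^sub>R b t + F t) (at t) \<and>
        (a has_vector_derivative (1 / \<tau>) *\<^sub>R (z t - a t)) (at t) \<and>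
        (b has_vector_derivative m *\<^sub>R a t - (1 / \<tau>) *\<^sub>R b t + H t) (at t))"

lemma flow_Re:
  assumes "cflow s v z a b F H"
  shows "flow s (\<lambda>t. Re (v t)) (\<lambda>t. Re (z t)) (\<lambda>t. Re (a t)) (\<lambda>t. Re (b t)) (\<lambda>t. Re (F t)) (\<lambda>t. Re (H t))"
  using assms unfolding cflow_def flow_def has_vector_derivative_complex_iff
  by (auto intro!: continuous_intros simp: mult.assoc)

lemma flow_Im:
  assumes "cflow s v z a b F H"
  shows "flow s (\<lambda>t. Im (v t)) (\<lambda>t. Im (z t)) (\<lambda>t. Im (a t)) (\<lambda>t. Im (b t)) (\<lambda>t. Im (F t)) (\<lambda>t. Im (H t))"
  using assms unfolding cflow_def flow_def has_vector_derivative_complex_iff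
  by (auto intro!: continuous_intros simp: mult.assoc)

text \<open>Complex form of \<open>real_decay\<close>, obtained from real and imaginary parts
  separately; the factor 2 is the cost of |x| \<le> |Re x| + |Im x|.\<close>

definition decay :: "real \<Rightarrow> real \<Rightarrow> bool" where
  "decay K c \<longleftrightarrow> (\<forall>s v z a b F H g Z t.
     s > 0 \<longrightarrow> cflow s v z a b F H \<longrightarrow> (\<forall>t>0. cmod (F t) + sqrt s * cmod (H t) \<le> g t) \<longrightarrow>
     continuous_on {0..} Z \<longrightarrow>
     (\<forall>t>0. \<exists>D. (Z has_real_derivative D) (at t) \<and> D \<ge> - (c * rate s) * Z t + K * g t) \<longrightarrow>
     K * (cmod (z 0) + sqrt s * (cmod (v 0) + cmod (a 0) + cmod (b 0))) \<le> Z 0 \<longrightarrow> t \<ge> 0 \<longrightarrow>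
     sqrt s * cmod (v t) \<le> 2 * (K * Z t) \<and> sqrt s * cmod (a t) \<le> 2 * (K * Z t))"

lemma flow_decay: "\<exists>K>0. \<exists>c>0. decay K c"
proof -
  obtain K c where K: "K > 0" and c: "c > 0" and R: "real_decay K c"
    using flow_decay_real by blast
  note R = R[unfolded real_decay_def, rule_format]
  show ?thesis
  proof (rule exI[of _ K], intro conjI K, rule exI[of _ c], rule conjI[OF c], unfold decay_def, intro allI impI)
    fix s :: real and v z a b F H :: "real \<Rightarrow> complex" and g Z :: "real \<Rightarrow> real" and t :: real
    assume s: "s > 0" and fl: "cflow s v z a b F H" and g: "\<forall>t>0. cmod (F t) + sqrt s * cmod (H t) \<le> g t"
      and Z: "continuous_on {0..} Z"
        "\<forall>t>0. \<exists>D. (Z has_real_derivative D) (at t) \<and> D \<ge> - (c * rate s) * Z t + K * g t"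
      and init: "K * (cmod (z 0) + sqrt s * (cmod (v 0) + cmod (a 0) + cmod (b 0))) \<le> Z 0" and t: "t \<ge> 0"
    have g1: "\<forall>t>0. \<bar>Re (F t)\<bar> + sqrt s * \<bar>Re (H t)\<bar> \<le> g t" "\<forall>t>0. \<bar>Im (F t)\<bar> + sqrt s * \<bar>Im (H t)\<bar> \<le> g t"
      using g s by (auto intro!: order_trans[OF add_mono[OF abs_Re_le_cmod mult_left_mono[OF abs_Re_le_cmod]]]
          order_trans[OF add_mono[OF abs_Im_le_cmod mult_left_mono[OF abs_Im_le_cmod]]])
    have i1: "K * (\<bar>Re (z 0)\<bar> + sqrt s * (\<bar>Re (v 0)\<bar> + \<bar>Re (a 0)\<bar> + \<bar>Re (b 0)\<bar>)) \<le> Z 0"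
      "K * (\<bar>Im (z 0)\<bar> + sqrt s * (\<bar>Im (v 0)\<bar> + \<bar>Im (a 0)\<bar> + \<bar>Im (b 0)\<bar>)) \<le> Z 0"
      using K s by (intro order_trans[OF _ init] mult_left_mono add_mono abs_Re_le_cmod abs_Im_le_cmod; simp)+
    have 1: "sqrt s * \<bar>Re (v t)\<bar> \<le> K * Z t \<and> sqrt s * \<bar>Re (a t)\<bar> \<le> K * Z t"
      by (rule R[where g = g, OF s flow_Re[OF fl] _ Z(1) _ i1(1) t]) (use g1 Z(2) in simp_all)
    have 2: "sqrt s * \<bar>Im (v t)\<bar> \<le> K * Z t \<and> sqrt s * \<bar>Im (a t)\<bar> \<le> K * Z t"
      by (rule R[where g = g, OF s flow_Im[OF fl] _ Z(1) _ i1(2) t]) (use g1 Z(2) in simp_all)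
    have "sqrt s * cmod x \<le> sqrt s * \<bar>Re x\<bar> + sqrt s * \<bar>Im x\<bar>" for x
      using mult_left_mono[OF cmod_le[of x], of "sqrt s"] s by (simp add: distrib_left)
    from this[of "v t"] this[of "a t"] 1 2
    show "sqrt s * cmod (v t) \<le> 2 * (K * Z t) \<and> sqrt s * cmod (a t) \<le> 2 * (K * Z t)" by linarith
  qed
qed

section \<open>From the integro-differential equation to the first-order system\<close>

lemma memory_term:
  fixes u :: "real \<Rightarrow> complex"
  assumes u: "continuous_on {0..} u"
  defines "w \<equiv> \<lambda>t. integral {0..t} (\<lambda>\<eta>. (m * exp (- (t - \<eta>) / \<tau>)) *\<^sub>R u \<eta>)"
  shows "continuous_on {0..} w" "w 0 = 0"
    "\<And>t. t > 0 \<Longrightarrow> (w has_vector_derivative m *\<^sub>R u t - (1 / \<tau>) *\<^sub>R w t) (at t)"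
proof -
  define I where "I = (\<lambda>t. integral {0..t} (\<lambda>\<eta>. (m * exp (\<eta> / \<tau>)) *\<^sub>R u \<eta>))"
  have contf: "continuous_on {0..t} (\<lambda>\<eta>. (m * exp (\<eta> / \<tau>)) *\<^sub>R u \<eta>)" for t
    using tau by (intro continuous_intros continuous_on_subset[OF u]) auto
  \<comment> \<open>Taking exp (- t / \<tau>) out leaves an integrand that no longer depends on t.
    The fundamental theorem of calculus then applies, and the product rule gives w' = m u - w /
    \<tau>.\<close>
  have wI: "w = (\<lambda>t. exp (- t / \<tau>) *\<^sub>R I t)"
  proof
    fix t
    have "(m * exp (- (t - \<eta>) / \<tau>)) *\<^sub>R u \<eta> = exp (- t / \<tau>) *\<^sub>R ((m * exp (\<eta> / \<tau>)) *\<^sub>R u \<eta>)" for \<eta>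
    proof -
      have "exp (- (t - \<eta>) / \<tau>) = exp (- t / \<tau>) * exp (\<eta> / \<tau>)"
        unfolding exp_add[symmetric] by (simp add: diff_divide_distrib)
      then show ?thesis by simp
    qed
    then show "w t = exp (- t / \<tau>) *\<^sub>R I t" unfolding w_def I_def by (simp only: integral_cmul)
  qed
  have dI: "(I has_vector_derivative (m * exp (t / \<tau>)) *\<^sub>R u t) (at t within {0..T})" if "0 \<le> t" "t \<le> T" for t T
    unfolding I_def using integral_has_vector_derivative[OF contf[of T], of t] that by simp
  have dI': "(I has_vector_derivative (m * exp (t / \<tau>)) *\<^sub>R u t) (at t)" if "t > 0" for t
    using dI[of t "t + 1"] that by (simp add: at_within_interior[of t "{0..t+1}"])
  have "continuous_on {0..} I"
  proof (rule continuous_on_eq_continuous_within[THEN iffD2], rule ballI)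
    fix t :: real assume "t \<in> {0..}"
    then have t: "0 \<le> t" by simp
    have "continuous (at t within {0..t+1}) I"
      using dI[of t "t+1"] t by (auto intro: has_vector_derivative_continuous)
    moreover have "at t within {0..t+1} = at t within {0..}"
      by (rule at_within_nhd[of t "{..<t+1}"]) auto
    ultimately show "continuous (at t within {0..}) I" by simp
  qed
  then show "continuous_on {0..} w" unfolding wI using tau by (intro continuous_intros) auto
  show "w 0 = 0" by (simp add: w_def)
  show "(w has_vector_derivative m *\<^sub>R u t - (1 / \<tau>) *\<^sub>R w t) (at t)" if "t > 0" for t
  proof -
    have d: "((\<lambda>t. exp (- t / \<tau>)) has_real_derivative - exp (- t / \<tau>) / \<tau>) (at t)"
      using tau by (auto intro!: derivative_eq_intros)
    have "(w has_vector_derivative exp (- t / \<tau>) *\<^sub>R ((m * exp (t / \<tau>)) *\<^sub>R u t) + (- exp (- t / \<tau>) / \<tau>) *\<^sub>R I t) (at t)"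
      unfolding wI by (rule has_vector_derivative_scaleR[OF d dI'[OF that]])
    moreover have "exp (- t / \<tau>) *\<^sub>R ((m * exp (t / \<tau>)) *\<^sub>R u t) = m *\<^sub>R u t"
    proof -
      have "exp (- (t / \<tau>)) * exp (t / \<tau>) = 1" by (simp flip: exp_add)
      then show ?thesis by simp
    qed
    moreover have "(- exp (- t / \<tau>) / \<tau>) *\<^sub>R I t = - ((1 / \<tau>) *\<^sub>R w t)"
      by (simp add: wI)
    ultimately show ?thesis by (simp only: scaleR_minus_left diff_conv_add_uminus[symmetric])
  qed
qed

lemma mode_system:
  assumes "mgt_mode \<tau> \<delta> m s a0 a1 a2 u"
  obtains u1 u2 w where "continuous_on {0..} u" "continuous_on {0..} u1" "continuous_on {0..} u2" "continuous_on {0..} w"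
    "u 0 = a0" "u1 0 = a1" "u2 0 = a2" "w 0 = 0"
    "\<And>t. t > 0 \<Longrightarrow> (u has_vector_derivative u1 t) (at t)"
    "\<And>t. t > 0 \<Longrightarrow> (u1 has_vector_derivative u2 t) (at t)"
    "\<And>t. t > 0 \<Longrightarrow> (w has_vector_derivative m *\<^sub>R u t - (1 / \<tau>) *\<^sub>R w t) (at t)"
    "\<And>t. t > 0 \<Longrightarrow> (u2 has_vector_derivative
        (1 / \<tau>) *\<^sub>R (s *\<^sub>R w t - s *\<^sub>R u t - ((\<delta> + \<tau>) * s) *\<^sub>R u1 t - u2 t)) (at t)"
proof -
  obtain u1 u2 u3 where H:
    "\<forall>t\<ge>0. (u has_vector_derivative u1 t) (at t within {0..})"
    "\<forall>t\<ge>0. (u1 has_vector_derivative u2 t) (at t within {0..})"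
    "continuous_on {0..} u2"
    "\<forall>t>0. (u2 has_vector_derivative u3 t) (at t)"
    "u 0 = a0" "u1 0 = a1" "u2 0 = a2"
    "\<forall>t>0. \<tau> *\<^sub>R u3 t + u2 t - (- s) *\<^sub>R u t - ((\<delta> + \<tau>) * (- s)) *\<^sub>R u1 t
              + integral {0..t} (\<lambda>\<eta>. (m * exp (- (t - \<eta>) / \<tau>) * (- s)) *\<^sub>R u \<eta>) = 0"
    using assms unfolding mgt_mode_def by (elim exE conjE) (rule that)
  note U1 = H(1)[rule_format] and U2 = H(2)[rule_format] and c2 = H(3) and U3 = H(4)[rule_format]
    and init = H(5-7) and eq = H(8)[rule_format]
  have cu: "continuous_on {0..} u" "continuous_on {0..} u1"
    unfolding continuous_on_eq_continuous_within
    using has_vector_derivative_continuous[OF U1] has_vector_derivative_continuous[OF U2] by simp_all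
  define w where "w = (\<lambda>t. integral {0..t} (\<lambda>\<eta>. (m * exp (- (t - \<eta>) / \<tau>)) *\<^sub>R u \<eta>))"
  have int: "integral {0..t} (\<lambda>\<eta>. (m * exp (- (t - \<eta>) / \<tau>) * (- s)) *\<^sub>R u \<eta>) = - (s *\<^sub>R w t)" for t
  proof -
    have "integral {0..t} (\<lambda>\<eta>. (m * exp (- (t - \<eta>) / \<tau>) * (- s)) *\<^sub>R u \<eta>)
      = integral {0..t} (\<lambda>\<eta>. (- s) *\<^sub>R ((m * exp (- (t - \<eta>) / \<tau>)) *\<^sub>R u \<eta>))"
      by (rule integral_cong) (simp add: mult.commute)
    also have "\<dots> = (- s) *\<^sub>R w t" unfolding w_def by (rule integral_cmul)
    finally show ?thesis by simp
  qed
  have u3: "u3 t = (1 / \<tau>) *\<^sub>R (s *\<^sub>R w t - s *\<^sub>R u t - ((\<delta> + \<tau>) * s) *\<^sub>R u1 t - u2 t)" if "t > 0" for t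
  proof -
    have "\<tau> *\<^sub>R u3 t + (u2 t - (- s) *\<^sub>R u t - ((\<delta> + \<tau>) * (- s)) *\<^sub>R u1 t - s *\<^sub>R w t) = 0"
      using eq[OF that] unfolding int by (simp only: diff_conv_add_uminus add.assoc)
    from eq_neg_iff_add_eq_0[THEN iffD2, OF this]
    have "\<tau> *\<^sub>R u3 t = s *\<^sub>R w t - s *\<^sub>R u t - ((\<delta> + \<tau>) * s) *\<^sub>R u1 t - u2 t"
      by simp
    then have "(1 / \<tau>) *\<^sub>R (\<tau> *\<^sub>R u3 t) = (1 / \<tau>) *\<^sub>R (s *\<^sub>R w t - s *\<^sub>R u t - ((\<delta> + \<tau>) * s) *\<^sub>R u1 t - u2 t)" by simp
    then show ?thesis using tau by simp
  qed
  have at: "at t within {0..} = at t" if "t > 0" for t :: real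
    by (rule at_within_nhd[of t "{0<..}"]) (use that in auto)
  have w0: "w 0 = 0" by (simp add: w_def)
  note mem = memory_term[OF cu(1), folded w_def]
  show ?thesis
  proof (rule that[OF cu c2 mem(1) init w0])
    fix t :: real assume t: "t > 0"
    show "(u has_vector_derivative u1 t) (at t)" using U1[OF less_imp_le[OF t]] unfolding at[OF t] .
    show "(u1 has_vector_derivative u2 t) (at t)" using U2[OF less_imp_le[OF t]] unfolding at[OF t] .
    show "(w has_vector_derivative m *\<^sub>R u t - (1 / \<tau>) *\<^sub>R w t) (at t)" using memory_term(3)[OF cu(1) t] unfolding w_def .
    show "(u2 has_vector_derivative (1 / \<tau>) *\<^sub>R (s *\<^sub>R w t - s *\<^sub>R u t - ((\<delta> + \<tau>) * s) *\<^sub>R u1 t - u2 t)) (at t)"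
      using U3[OF t] unfolding u3[OF t] .
  qed
qed

text \<open>The component b is written as m u - w / \<tau>, which is w' by the memory equation;
  differentiating once more closes the system.\<close>

lemma flow_of_mode:
  assumes "continuous_on {0..} u" "continuous_on {0..} u1" "continuous_on {0..} u2" "continuous_on {0..} w"
    and d: "\<And>t. t > 0 \<Longrightarrow> (u has_vector_derivative u1 t) (at t)"
    "\<And>t. t > 0 \<Longrightarrow> (u1 has_vector_derivative u2 t) (at t)"
    "\<And>t. t > 0 \<Longrightarrow> (w has_vector_derivative m *\<^sub>R u t - (1 / \<tau>) *\<^sub>R w t) (at t)"
    "\<And>t. t > 0 \<Longrightarrow> (u2 has_vector_derivative
        (1 / \<tau>) *\<^sub>R (s *\<^sub>R w t - s *\<^sub>R u t - ((\<delta> + \<tau>) * s) *\<^sub>R u1 t - u2 t)) (at t)"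
  shows "cflow s (\<lambda>t. u t + \<tau> *\<^sub>R u1 t) (\<lambda>t. u1 t + \<tau> *\<^sub>R u2 t) u1 (\<lambda>t. m *\<^sub>R u t - (1 / \<tau>) *\<^sub>R w t)
     (\<lambda>t. 0) (\<lambda>t. 0)"
  unfolding cflow_def
proof (intro conjI allI impI)
  fix t :: real assume t: "t > 0"
  show "((\<lambda>t. u t + \<tau> *\<^sub>R u1 t) has_vector_derivative u1 t + \<tau> *\<^sub>R u2 t) (at t)"
    by (rule has_vector_derivative_eq_rhs, (rule derivative_intros d[OF t])+) simp
  show "((\<lambda>t. m *\<^sub>R u t - (1 / \<tau>) *\<^sub>R w t) has_vector_derivative m *\<^sub>R u1 t - (1 / \<tau>) *\<^sub>R (m *\<^sub>R u t - (1 / \<tau>) *\<^sub>R w t) + 0) (at t)"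
    by (rule has_vector_derivative_eq_rhs, (rule derivative_intros d[OF t])+) simp
  show "(u1 has_vector_derivative (1 / \<tau>) *\<^sub>R (u1 t + \<tau> *\<^sub>R u2 t - u1 t)) (at t)"
    using d(2)[OF t] tau by simp
  have "((\<lambda>t. u1 t + \<tau> *\<^sub>R u2 t) has_vector_derivative u2 t + \<tau> *\<^sub>R ((1 / \<tau>) *\<^sub>R (s *\<^sub>R w t - s *\<^sub>R u t - ((\<delta> + \<tau>) * s) *\<^sub>R u1 t - u2 t))) (at t)"
    by (rule has_vector_derivative_eq_rhs, (rule derivative_intros d[OF t])+) simp
  also have "u2 t + \<tau> *\<^sub>R ((1 / \<tau>) *\<^sub>R (s *\<^sub>R w t - s *\<^sub>R u t - ((\<delta> + \<tau>) * s) *\<^sub>R u1 t - u2 t)) =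
    - (\<kappa> * s) *\<^sub>R (u t + \<tau> *\<^sub>R u1 t) - (\<sigma> * s) *\<^sub>R u1 t - (\<tau> * s) *\<^sub>R (m *\<^sub>R u t - (1 / \<tau>) *\<^sub>R w t) + 0"
    using tau by (simp add: \<kappa>_def \<sigma>_def complex_eq_iff algebra_simps power2_eq_square)
  finally show "((\<lambda>t. u1 t + \<tau> *\<^sub>R u2 t) has_vector_derivative
    - (\<kappa> * s) *\<^sub>R (u t + \<tau> *\<^sub>R u1 t) - (\<sigma> * s) *\<^sub>R u1 t - (\<tau> * s) *\<^sub>R (m *\<^sub>R u t - (1 / \<tau>) *\<^sub>R w t) + 0) (at t)" .
qed (intro continuous_intros assms)+

text \<open>The estimate \<open>decay\<close> controls sqrt s |a|. To make a equal to u rather than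
  u', the system is run on a time antiderivative of u: then z = u + \<tau> u' and b = w, while v is
  not integrated but read off from the z-equation, which can be solved for v since s > 0. After
  division by sqrt s the three data carry the weights 1, 1 / sqrt s and 1 / s; for the last two this
  is one factor 1 / sqrt s better than what \<open>flow_of_mode\<close> would give.\<close>

lemma antiderivative_flow:
  assumes "continuous_on {0..} u" "continuous_on {0..} u1" "continuous_on {0..} u2" "continuous_on {0..} w"
    and d: "\<And>t. t > 0 \<Longrightarrow> (u has_vector_derivative u1 t) (at t)"
    "\<And>t. t > 0 \<Longrightarrow> (u1 has_vector_derivative u2 t) (at t)"
    "\<And>t. t > 0 \<Longrightarrow> (w has_vector_derivative m *\<^sub>R u t - (1 / \<tau>) *\<^sub>R w t) (at t)"
    "\<And>t. t > 0 \<Longrightarrow> (u2 has_vector_derivative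
        (1 / \<tau>) *\<^sub>R (s *\<^sub>R w t - s *\<^sub>R u t - ((\<delta> + \<tau>) * s) *\<^sub>R u1 t - u2 t)) (at t)"
    and s: "s > 0"
  shows "cflow s (\<lambda>t. (- 1 / (\<kappa> * s)) *\<^sub>R ((u1 t + \<tau> *\<^sub>R u2 t) + (\<sigma> * s) *\<^sub>R u t + (\<tau> * s) *\<^sub>R w t))
     (\<lambda>t. u t + \<tau> *\<^sub>R u1 t) u w (\<lambda>t. 0) (\<lambda>t. 0)"
  unfolding cflow_def
proof (intro conjI allI impI)
  fix t :: real assume t: "t > 0"
  have ks: "\<kappa> * s \<noteq> 0" using kappa s by simp
  have "((\<lambda>t. (- 1 / (\<kappa> * s)) *\<^sub>R ((u1 t + \<tau> *\<^sub>R u2 t) + (\<sigma> * s) *\<^sub>R u t + (\<tau> * s) *\<^sub>R w t)) has_vector_derivative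
     (- 1 / (\<kappa> * s)) *\<^sub>R ((u2 t + \<tau> *\<^sub>R ((1 / \<tau>) *\<^sub>R (s *\<^sub>R w t - s *\<^sub>R u t - ((\<delta> + \<tau>) * s) *\<^sub>R u1 t - u2 t)))
       + (\<sigma> * s) *\<^sub>R u1 t + (\<tau> * s) *\<^sub>R (m *\<^sub>R u t - (1 / \<tau>) *\<^sub>R w t))) (at t)"
    by (rule has_vector_derivative_eq_rhs, (rule derivative_intros d[OF t])+) simp
  also have "(u2 t + \<tau> *\<^sub>R ((1 / \<tau>) *\<^sub>R (s *\<^sub>R w t - s *\<^sub>R u t - ((\<delta> + \<tau>) * s) *\<^sub>R u1 t - u2 t)))
       + (\<sigma> * s) *\<^sub>R u1 t + (\<tau> * s) *\<^sub>R (m *\<^sub>R u t - (1 / \<tau>) *\<^sub>R w t) = - (\<kappa> * s) *\<^sub>R (u t + \<tau> *\<^sub>R u1 t)"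
    using tau by (simp add: \<kappa>_def \<sigma>_def complex_eq_iff algebra_simps power2_eq_square)
  also have "(- 1 / (\<kappa> * s)) *\<^sub>R (- (\<kappa> * s) *\<^sub>R (u t + \<tau> *\<^sub>R u1 t)) = u t + \<tau> *\<^sub>R u1 t" using ks by simp
  finally show "((\<lambda>t. (- 1 / (\<kappa> * s)) *\<^sub>R ((u1 t + \<tau> *\<^sub>R u2 t) + (\<sigma> * s) *\<^sub>R u t + (\<tau> * s) *\<^sub>R w t)) has_vector_derivative
     u t + \<tau> *\<^sub>R u1 t) (at t)" .
  show "(u has_vector_derivative (1 / \<tau>) *\<^sub>R (u t + \<tau> *\<^sub>R u1 t - u t)) (at t)"
    using d(1)[OF t] tau by simp
  show "(w has_vector_derivative m *\<^sub>R u t - (1 / \<tau>) *\<^sub>R w t + 0) (at t)" using d(3)[OF t] by simp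
  have "- (\<kappa> * s) *\<^sub>R ((- 1 / (\<kappa> * s)) *\<^sub>R ((u1 t + \<tau> *\<^sub>R u2 t) + (\<sigma> * s) *\<^sub>R u t + (\<tau> * s) *\<^sub>R w t)) =
     (u1 t + \<tau> *\<^sub>R u2 t) + (\<sigma> * s) *\<^sub>R u t + (\<tau> * s) *\<^sub>R w t"
    using ks by simp
  then have "- (\<kappa> * s) *\<^sub>R ((- 1 / (\<kappa> * s)) *\<^sub>R ((u1 t + \<tau> *\<^sub>R u2 t) + (\<sigma> * s) *\<^sub>R u t + (\<tau> * s) *\<^sub>R w t))
     - (\<sigma> * s) *\<^sub>R u t - (\<tau> * s) *\<^sub>R w t + 0 = u1 t + \<tau> *\<^sub>R u2 t" by simp
  moreover have "((\<lambda>t. u t + \<tau> *\<^sub>R u1 t) has_vector_derivative u1 t + \<tau> *\<^sub>R u2 t) (at t)"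
    by (rule has_vector_derivative_eq_rhs, (rule derivative_intros d[OF t])+) simp
  ultimately show "((\<lambda>t. u t + \<tau> *\<^sub>R u1 t) has_vector_derivative
     - (\<kappa> * s) *\<^sub>R ((- 1 / (\<kappa> * s)) *\<^sub>R ((u1 t + \<tau> *\<^sub>R u2 t) + (\<sigma> * s) *\<^sub>R u t + (\<tau> * s) *\<^sub>R w t))
     - (\<sigma> * s) *\<^sub>R u t - (\<tau> * s) *\<^sub>R w t + 0) (at t)" by simp
qed (intro continuous_intros assms)+

lemma mode_high:
  assumes s0: "s0 > 0"
  shows "\<exists>C>0. \<exists>c>0. \<forall>s\<ge>s0. \<forall>a0 a1 a2 u. mgt_mode \<tau> \<delta> m s a0 a1 a2 u \<longrightarrow>
     (\<forall>t\<ge>0. cmod (u t) \<le> C * exp (- c * rate s * t) * (cmod a0 + cmod a1 / sqrt s + cmod a2 / s))"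
proof -
  obtain K c where K: "K > 0" and c: "c > 0" and R: "decay K c"
    using flow_decay by blast
  note R = R[unfolded decay_def, rule_format]
  \<comment> \<open>The first entry is the coefficient of a0, the second the sum of those of a1 /
    sqrt s and a2 / s in the initial size computed below, with 1 / sqrt s replaced by its largest
    value, at s0.\<close>
  define C1 where "C1 = max (1 / sqrt s0 + 1 + \<sigma> / \<kappa>) (\<tau> + (1 / sqrt s0) / \<kappa> + \<tau> / \<kappa>)"
  have C1: "C1 > 0" "1 / sqrt s0 + 1 + \<sigma> / \<kappa> \<le> C1" "\<tau> + (1 / sqrt s0) / \<kappa> + \<tau> / \<kappa> \<le> C1"
    using s0 sigma kappa by (auto simp: C1_def less_max_iff_disj add_pos_pos)
  have C2: "2 * K * (K * C1) > 0" using K C1 by simp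
  show ?thesis
  proof (rule exI[of _ "2 * K * (K * C1)"], intro conjI C2, rule exI[of _ c], rule conjI[OF c], intro allI impI)
    fix s a0 a1 a2 u and t :: real assume s': "s0 \<le> s" and mode: "mgt_mode \<tau> \<delta> m s a0 a1 a2 u" and t: "t \<ge> 0"
    have s: "s > 0" using s0 s' by simp
    define r where "r = sqrt s"
    have r: "r > 0" "s = r * r" "1 / r \<le> 1 / sqrt s0" using s s0 s' by (auto simp: r_def field_simps)
    from mode obtain u1 u2 w where
      U: "continuous_on {0..} u" "continuous_on {0..} u1" "continuous_on {0..} u2" "continuous_on {0..} w"
      and i: "u 0 = a0" "u1 0 = a1" "u2 0 = a2" "w 0 = 0" and
      D: "\<And>t. t > 0 \<Longrightarrow> (u has_vector_derivative u1 t) (at t)"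
      "\<And>t. t > 0 \<Longrightarrow> (u1 has_vector_derivative u2 t) (at t)"
      "\<And>t. t > 0 \<Longrightarrow> (w has_vector_derivative m *\<^sub>R u t - (1 / \<tau>) *\<^sub>R w t) (at t)"
      "\<And>t. t > 0 \<Longrightarrow> (u2 has_vector_derivative
        (1 / \<tau>) *\<^sub>R (s *\<^sub>R w t - s *\<^sub>R u t - ((\<delta> + \<tau>) * s) *\<^sub>R u1 t - u2 t)) (at t)"
      by (rule mode_system) blast
    define N where "N = cmod a0 + cmod a1 / r + cmod a2 / s"
    define Z0 where "Z0 = K * (C1 * (r * N))"
    have "r * cmod (u t) \<le> 2 * (K * (Z0 * exp (- (c * rate s) * t)))"
      unfolding r_def
    proof (rule R[where g = "\<lambda>_. 0" and Z = "\<lambda>t. Z0 * exp (- (c * rate s) * t)",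
          OF s antiderivative_flow[OF U D s], THEN conjunct2])
      show "cmod 0 + sqrt s * cmod 0 \<le> 0" by simp
      show "continuous_on {0..} (\<lambda>t. Z0 * exp (- (c * rate s) * t))" by (intro continuous_intros)
      show "\<exists>D. ((\<lambda>t. Z0 * exp (- (c * rate s) * t)) has_real_derivative D) (at t) \<and>
         - (c * rate s) * (Z0 * exp (- (c * rate s) * t)) + K * 0 \<le> D" for t
      proof -
        have "((\<lambda>t. Z0 * exp (- (c * rate s) * t)) has_real_derivative - (c * rate s) * (Z0 * exp (- (c * rate s) * t)) + K * 0) (at t)"
          by (auto intro!: derivative_eq_intros)
        then show "\<exists>D. ((\<lambda>t. Z0 * exp (- (c * rate s) * t)) has_real_derivative D) (at t) \<and>
           - (c * rate s) * (Z0 * exp (- (c * rate s) * t)) + K * 0 \<le> D" by blast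
      qed
      have "cmod ((- 1 / (\<kappa> * s)) *\<^sub>R ((u1 0 + \<tau> *\<^sub>R u2 0) + (\<sigma> * s) *\<^sub>R u 0 + (\<tau> * s) *\<^sub>R w 0)) \<le>
         1 / (\<kappa> * s) * ((cmod a1 + \<tau> * cmod a2) + \<sigma> * s * cmod a0)"
      proof -
        have "cmod ((u1 0 + \<tau> *\<^sub>R u2 0) + (\<sigma> * s) *\<^sub>R u 0 + (\<tau> * s) *\<^sub>R w 0) \<le> (cmod a1 + \<tau> * cmod a2) + \<sigma> * s * cmod a0"
        proof -
          have "cmod ((u1 0 + \<tau> *\<^sub>R u2 0) + (\<sigma> * s) *\<^sub>R u 0 + (\<tau> * s) *\<^sub>R w 0) = cmod (a1 + \<tau> *\<^sub>R a2 + (\<sigma> * s) *\<^sub>R a0)"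
            by (simp add: i)
          also have "\<dots> \<le> cmod a1 + cmod (\<tau> *\<^sub>R a2) + cmod ((\<sigma> * s) *\<^sub>R a0)"
            by (rule order_trans[OF norm_triangle_ineq add_right_mono[OF norm_triangle_ineq]])
          finally show ?thesis using tau sigma s by simp
        qed
        then show ?thesis using kappa s by (simp add: divide_right_mono)
      qed
      then have "cmod (u 0 + \<tau> *\<^sub>R u1 0) +
         sqrt s * (cmod ((- 1 / (\<kappa> * s)) *\<^sub>R ((u1 0 + \<tau> *\<^sub>R u2 0) + (\<sigma> * s) *\<^sub>R u 0 + (\<tau> * s) *\<^sub>R w 0)) + cmod (u 0) + cmod (w 0))
         \<le> (cmod a0 + \<tau> * cmod a1) + sqrt s * (1 / (\<kappa> * s) * ((cmod a1 + \<tau> * cmod a2) + \<sigma> * s * cmod a0) + cmod a0 + 0)"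
        using tau s unfolding i
        by (intro add_mono mult_left_mono order_trans[OF norm_triangle_ineq]) auto
      also have "\<dots> = r * ((1 / r + 1 + \<sigma> / \<kappa>) * cmod a0 + (\<tau> + (1 / r) / \<kappa>) * (cmod a1 / r) + \<tau> / \<kappa> * (cmod a2 / s))"
        using r(1) kappa unfolding r_def[symmetric] r(2) by (simp add: field_simps)
      also have "\<dots> \<le> r * (C1 * cmod a0 + C1 * (cmod a1 / r) + C1 * (cmod a2 / s))"
      proof -
        have k: "(1 / r) / \<kappa> \<le> (1 / sqrt s0) / \<kappa>" using r(3) kappa by (intro divide_right_mono) auto
        have "1 / r + 1 + \<sigma> / \<kappa> \<le> C1" using r C1 by linarith
        moreover have p: "0 \<le> \<tau> / \<kappa>" "0 \<le> (1 / sqrt s0) / \<kappa>" using kappa tau s0 by auto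
        then have "\<tau> + (1 / r) / \<kappa> \<le> C1" using k C1 by linarith
        moreover have "\<tau> / \<kappa> \<le> C1" using C1(3) tau p by linarith
        ultimately show ?thesis using r s by (intro mult_left_mono add_mono mult_right_mono) auto
      qed
      also have "\<dots> = C1 * (r * N)" by (simp add: N_def algebra_simps)
      finally show "K * (cmod (u 0 + \<tau> *\<^sub>R u1 0) +
         sqrt s * (cmod ((- 1 / (\<kappa> * s)) *\<^sub>R ((u1 0 + \<tau> *\<^sub>R u2 0) + (\<sigma> * s) *\<^sub>R u 0 + (\<tau> * s) *\<^sub>R w 0)) + cmod (u 0) + cmod (w 0)))
        \<le> Z0 * exp (- (c * rate s) * 0)"
        using K by (simp add: Z0_def)
    qed (use t in simp_all)
    also have "\<dots> = r * (2 * K * (K * C1) * exp (- c * rate s * t) * N)" by (simp add: Z0_def algebra_simps)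
    finally have "cmod (u t) \<le> 2 * K * (K * C1) * exp (- c * rate s * t) * N" using r(1) by simp
    then show "cmod (u t) \<le> 2 * K * (K * C1) * exp (- c * rate s * t) * (cmod a0 + cmod a1 / sqrt s + cmod a2 / s)"
      by (simp add: N_def r_def)
  qed
qed

section \<open>Low frequencies\<close>

definition \<beta> where "\<beta> = (\<delta> + 2 * m * \<tau>\<^sup>2) / 2"
definition k where "k = sqrt \<kappa>"
abbreviation \<gamma> where "\<gamma> \<equiv> gamma0 \<tau> \<delta> m"
definition \<omega> where "\<omega> r = k * r + \<gamma> * r ^ 3"

lemma beta: "\<beta> > 0" using tau delta m by (simp add: \<beta>_def add_nonneg_pos)
lemma k: "k > 0" "k * k = \<kappa>" "k = sqrt (1 - m * \<tau>)" using kappa by (auto simp: k_def \<kappa>_def)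

text \<open>The form in which \<open>gamma0\<close> is used: it makes the coefficient of r^4 in the
  characteristic function vanish at the approximate roots, as hypothesis \<open>g\<close> of
  \<open>residual_identity\<close>.\<close>

lemma gamma0_eq: "2 * (k * \<gamma>) = - \<beta>\<^sup>2 + 2 * \<tau> * \<kappa> * \<beta> + m * \<tau> ^ 3 * \<kappa>"
proof -
  have "8 * (k * \<gamma>) = (4 * \<tau> - \<delta>) * \<delta> - 4 * m * \<tau>\<^sup>2 * (2 * \<delta> + 4 * m * \<tau>\<^sup>2 - 3 * \<tau>)"
    using k(1) unfolding gamma0_def k(3)[symmetric] by simp
  then show ?thesis unfolding \<beta>_def \<kappa>_def
    by (simp add: power2_eq_square power3_eq_cube field_simps)
qed

text \<open>The characteristic function, with the memory kernel \<open>1 / (1 + \<tau> l)\<close> expanded to the order that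
  contributes to residuals below \<open>r\<^sup>5\<close>.\<close>

definition symb :: "real \<Rightarrow> complex \<Rightarrow> complex" where
  "symb s l = l\<^sup>2 * (1 + of_real \<tau> * l) + of_real (\<kappa> * s) * (1 + of_real \<tau> * l) + of_real (\<sigma> * s) * l
     + of_real (\<tau> * s) * (of_real (m * \<tau>) * (l - of_real \<tau> * l\<^sup>2 + of_real (\<tau>\<^sup>2) * l ^ 3))"

definition root :: "real \<Rightarrow> complex" where
  "root r = Complex (- \<beta> * r\<^sup>2) (\<omega> r)"

text \<open>With l = r u and u = J + O(r) the powers r^2, r^3 and r^4 vanish one after the other:
  J^2 = - K removes r^2, the real part - B together with S = 2 B - M T^2 removes r^3, and the
  condition on J g removes r^4. The facts \<open>h1\<close> to \<open>h4\<close> isolate the leading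
  part of each bracket, so that the quotient by r^5 becomes explicit.\<close>

lemma residual_identity:
  fixes J g B T M K S r :: complex
  assumes J: "J * J = - K" and g: "2 * (J * g) = B\<^sup>2 - 2 * T * K * B - M * T ^ 3 * K" and S: "S = 2 * B - M * T\<^sup>2"
  defines "n \<equiv> - B + g * r" and "u \<equiv> J + r * (- B + g * r)"
  defines "l \<equiv> r * u"
  shows "l\<^sup>2 * (1 + T * l) + K * r\<^sup>2 * (1 + T * l) + S * r\<^sup>2 * l + T * r\<^sup>2 * (M * T * (l - T * l\<^sup>2 + T\<^sup>2 * l ^ 3)) =
    r ^ 5 * (g\<^sup>2 * r + 2 * T * J * (J * g + n\<^sup>2) - M * T ^ 3 * (2 * J * n + r * n\<^sup>2) + T * u * n\<^sup>2 + M * T ^ 4 * u ^ 3)"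
proof -
  have u: "u = J + r * n" by (simp add: u_def n_def)
  have h1: "u\<^sup>2 + K = r * (2 * J * n + r * n\<^sup>2)" using J unfolding u by algebra
  have h2: "2 * J * n + 2 * B * u = r * (2 * (J * g) + 2 * B * n)" unfolding u n_def by algebra
  have h3: "2 * B * n + n\<^sup>2 = g\<^sup>2 * r\<^sup>2 - B\<^sup>2" unfolding n_def by algebra
  have h4: "J * u * n = K * B + J * r * (J * g + n\<^sup>2)" using J unfolding u n_def by algebra
  have "l\<^sup>2 * (1 + T * l) + K * r\<^sup>2 * (1 + T * l) + S * r\<^sup>2 * l + T * r\<^sup>2 * (M * T * (l - T * l\<^sup>2 + T\<^sup>2 * l ^ 3))
    = r\<^sup>2 * (u\<^sup>2 + K) + r ^ 3 * u * (T * (u\<^sup>2 + K) + 2 * B) - r ^ 4 * (M * T ^ 3 * u\<^sup>2) + r ^ 5 * (M * T ^ 4 * u ^ 3)"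
    unfolding l_def S by algebra
  also have "\<dots> = r ^ 3 * (2 * J * n + 2 * B * u) + r ^ 4 * (n\<^sup>2 + T * u * (2 * J * n + r * n\<^sup>2) - M * T ^ 3 * u\<^sup>2) + r ^ 5 * (M * T ^ 4 * u ^ 3)"
    unfolding h1 by algebra
  also have "\<dots> = r ^ 4 * (2 * (J * g) + (2 * B * n + n\<^sup>2) + 2 * T * (J * u * n) - M * T ^ 3 * ((u\<^sup>2 + K) - K)) + r ^ 5 * (T * u * n\<^sup>2 + M * T ^ 4 * u ^ 3)"
    unfolding h2 by algebra
  also have "\<dots> = r ^ 5 * (g\<^sup>2 * r + 2 * T * J * (J * g + n\<^sup>2) - M * T ^ 3 * (2 * J * n + r * n\<^sup>2) + T * u * n\<^sup>2 + M * T ^ 4 * u ^ 3)"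
    unfolding h1 h3 h4 g by algebra
  finally show ?thesis .
qed

lemma root_bounds:
  "\<exists>C>0. \<forall>r. 0 < r \<and> r \<le> 1 \<longrightarrow> cmod (symb (r\<^sup>2) (root r)) \<le> C * r ^ 5 \<and> cmod (symb (r\<^sup>2) (cnj (root r))) \<le> C * r ^ 5
     \<and> cmod (root r) \<le> C * r"
proof -
  \<comment> \<open>The sign e = 1 or e = - 1 selects the root or its conjugate, so one computation
    serves both. It enters J and g alike, and neither J^2 nor J g sees it.\<close>
  have *: "\<exists>C. \<forall>r. 0 < r \<and> r \<le> 1 \<longrightarrow> cmod (symb (r\<^sup>2) (Complex (- \<beta> * r\<^sup>2) (e * \<omega> r))) \<le> C * r ^ 5 \<and>
       cmod (Complex (- \<beta> * r\<^sup>2) (e * \<omega> r)) \<le> C * r"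
    if e: "e * e = 1" for e :: real
  proof -
    define J :: complex where "J = \<i> * complex_of_real (e * k)"
    define g :: complex where "g = \<i> * complex_of_real (e * \<gamma>)"
    have J: "J * J = - complex_of_real \<kappa>"
    proof -
      have "J * J = - complex_of_real ((e * e) * (k * k))"
        by (simp add: J_def complex_eq_iff)
      then show ?thesis using e k(2) by simp
    qed
    have g: "2 * (J * g) = (complex_of_real \<beta>)\<^sup>2 - 2 * complex_of_real \<tau> * complex_of_real \<kappa> * complex_of_real \<beta>
        - complex_of_real m * complex_of_real \<tau> ^ 3 * complex_of_real \<kappa>"
    proof -
      have "2 * (J * g) = - complex_of_real ((e * e) * (2 * (k * \<gamma>)))"
        by (simp add: J_def g_def complex_eq_iff)
      also have "\<dots> = (complex_of_real \<beta>)\<^sup>2 - 2 * complex_of_real \<tau> * complex_of_real \<kappa> * complex_of_real \<beta>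
        - complex_of_real m * complex_of_real \<tau> ^ 3 * complex_of_real \<kappa>"
        unfolding gamma0_eq e by simp
      finally show ?thesis .
    qed
    have S: "complex_of_real \<sigma> = 2 * complex_of_real \<beta> - complex_of_real m * (complex_of_real \<tau>)\<^sup>2"
      by (simp add: \<sigma>_def \<beta>_def algebra_simps)
    define u where "u = (\<lambda>r::real. J + r * (- complex_of_real \<beta> + g * r))"
    define n where "n = (\<lambda>r::real. - complex_of_real \<beta> + g * r)"
    define R where "R = (\<lambda>r::real. g\<^sup>2 * r + 2 * \<tau> * J * (J * g + (n r)\<^sup>2) - m * complex_of_real \<tau> ^ 3 * (2 * J * n r + r * (n r)\<^sup>2)
         + \<tau> * u r * (n r)\<^sup>2 + m * complex_of_real \<tau> ^ 4 * u r ^ 3)"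
    have l: "Complex (- \<beta> * r\<^sup>2) (e * \<omega> r) = r * u r" for r
      by (simp add: complex_eq_iff u_def J_def g_def \<omega>_def power2_eq_square power3_eq_cube algebra_simps)
    have sy: "symb (r\<^sup>2) (r * u r) = complex_of_real r ^ 5 * R r" for r
      using residual_identity[OF J g S, of r]
      by (simp add: symb_def R_def u_def n_def)
    \<comment> \<open>Once r^5 is factored out, what remains is a polynomial in r and hence bounded
      on the unit interval.\<close>
    have "continuous_on {0..1} R" "continuous_on {0..1} u" unfolding R_def u_def n_def by (intro continuous_intros)+
    then have "bounded (R ` {0..1})" "bounded (u ` {0..1})"
      by (auto intro: compact_imp_bounded compact_continuous_image)
    then obtain C1 C2 where C: "\<And>r. r \<in> {0..1} \<Longrightarrow> cmod (R r) \<le> C1" "\<And>r. r \<in> {0..1} \<Longrightarrow> cmod (u r) \<le> C2"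
      unfolding bounded_iff by (metis imageI)
    show ?thesis unfolding l sy
    proof (intro exI[of _ "max C1 C2"] allI impI)
      fix r :: real assume r: "0 < r \<and> r \<le> 1"
      have "cmod (R r) \<le> max C1 C2" "cmod (u r) \<le> max C1 C2" using C[of r] r by auto
      then show "cmod (complex_of_real r ^ 5 * R r) \<le> max C1 C2 * r ^ 5 \<and> cmod (r * u r) \<le> max C1 C2 * r"
        using r by (auto simp: norm_mult norm_power mult.commute intro!: mult_left_mono)
    qed
  qed
  obtain C1 where C1: "\<And>r. 0 < r \<and> r \<le> 1 \<Longrightarrow> cmod (symb (r\<^sup>2) (Complex (- \<beta> * r\<^sup>2) (1 * \<omega> r))) \<le> C1 * r ^ 5 \<and>
       cmod (Complex (- \<beta> * r\<^sup>2) (1 * \<omega> r)) \<le> C1 * r" using *[of 1] by auto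
  obtain C2 where C2: "\<And>r. 0 < r \<and> r \<le> 1 \<Longrightarrow> cmod (symb (r\<^sup>2) (Complex (- \<beta> * r\<^sup>2) (- 1 * \<omega> r))) \<le> C2 * r ^ 5 \<and>
       cmod (Complex (- \<beta> * r\<^sup>2) (- 1 * \<omega> r)) \<le> C2 * r" using *[of "- 1"] by auto
  define C where "C = max 1 (max C1 C2)"
  have C: "C > 0" "C1 \<le> C" "C2 \<le> C" by (auto simp: C_def)
  have cnj: "cnj (root r) = Complex (- \<beta> * r\<^sup>2) (- 1 * \<omega> r)" for r by (simp add: root_def complex_eq_iff)
  show ?thesis
  proof (rule exI[of _ C], intro conjI C(1) allI impI)
    fix r :: real assume r: "0 < r \<and> r \<le> 1"
    have m: "C1 * r ^ 5 \<le> C * r ^ 5" "C2 * r ^ 5 \<le> C * r ^ 5" "C1 * r \<le> C * r"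
      using C r by (auto intro!: mult_right_mono)
    show "cmod (symb (r\<^sup>2) (root r)) \<le> C * r ^ 5" using C1[OF r] m by (simp add: root_def)
    show "cmod (symb (r\<^sup>2) (cnj (root r))) \<le> C * r ^ 5" using C2[OF r] m unfolding cnj by linarith
    show "cmod (root r) \<le> C * r" using C1[OF r] m by (simp add: root_def)
  qed
qed

section \<open>Approximate solutions of the system\<close>

lemma cflow_add:
  assumes "cflow s v z a b F H" "cflow s v' z' a' b' F' H'"
  shows "cflow s (\<lambda>t. v t + c * v' t) (\<lambda>t. z t + c * z' t) (\<lambda>t. a t + c * a' t) (\<lambda>t. b t + c * b' t)
     (\<lambda>t. F t + c * F' t) (\<lambda>t. H t + c * H' t)"
  unfolding cflow_def
proof (intro conjI allI impI)
  fix t :: real assume t: "t > 0"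
  have D: "(v has_vector_derivative z t) (at t)"
    "(z has_vector_derivative - (\<kappa> * s) *\<^sub>R v t - (\<sigma> * s) *\<^sub>R a t - (\<tau> * s) *\<^sub>R b t + F t) (at t)"
    "(a has_vector_derivative (1 / \<tau>) *\<^sub>R (z t - a t)) (at t)"
    "(b has_vector_derivative m *\<^sub>R a t - (1 / \<tau>) *\<^sub>R b t + H t) (at t)"
    "(v' has_vector_derivative z' t) (at t)"
    "(z' has_vector_derivative - (\<kappa> * s) *\<^sub>R v' t - (\<sigma> * s) *\<^sub>R a' t - (\<tau> * s) *\<^sub>R b' t + F' t) (at t)"
    "(a' has_vector_derivative (1 / \<tau>) *\<^sub>R (z' t - a' t)) (at t)"
    "(b' has_vector_derivative m *\<^sub>R a' t - (1 / \<tau>) *\<^sub>R b' t + H' t) (at t)"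
    using assms t by (auto simp: cflow_def)
  note A = has_vector_derivative_eq_rhs[OF has_vector_derivative_add[OF _ has_vector_derivative_mult_right]]
  show "((\<lambda>t. v t + c * v' t) has_vector_derivative z t + c * z' t) (at t)"
    by (rule A[OF D(1) D(5)]) simp
  show "((\<lambda>t. z t + c * z' t) has_vector_derivative - (\<kappa> * s) *\<^sub>R (v t + c * v' t) - (\<sigma> * s) *\<^sub>R (a t + c * a' t) - (\<tau> * s) *\<^sub>R (b t + c * b' t) + (F t + c * F' t)) (at t)"
    by (rule A[OF D(2) D(6)]) (simp add: scaleR_conv_of_real algebra_simps)
  show "((\<lambda>t. a t + c * a' t) has_vector_derivative (1 / \<tau>) *\<^sub>R (z t + c * z' t - (a t + c * a' t))) (at t)"
    by (rule A[OF D(3) D(7)]) (simp add: scaleR_conv_of_real algebra_simps)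
  show "((\<lambda>t. b t + c * b' t) has_vector_derivative m *\<^sub>R (a t + c * a' t) - (1 / \<tau>) *\<^sub>R (b t + c * b' t) + (H t + c * H' t)) (at t)"
    by (rule A[OF D(4) D(8)]) (simp add: scaleR_conv_of_real algebra_simps)
qed (use assms in \<open>auto simp: cflow_def intro!: continuous_intros\<close>)

text \<open>For a = l exp (l t) the exact b would be m \<tau> l / (1 + \<tau> l) exp (l t). Keeping
  three terms of the geometric series leaves the source m \<tau>^3 l^4 in the b-equation and
  \<open>symb\<close> s l in the z-equation. At the approximate roots, where l is of order r, the
  latter and sqrt s times the former are both of order r^5.\<close>

lemma exp_flow:
  fixes l :: complex
  shows "cflow s (\<lambda>t. (1 + \<tau> * l) * exp (l * t)) (\<lambda>t. l * (1 + \<tau> * l) * exp (l * t)) (\<lambda>t. l * exp (l * t))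
     (\<lambda>t. m * \<tau> * (l - \<tau> * l\<^sup>2 + \<tau>\<^sup>2 * l ^ 3) * exp (l * t))
     (\<lambda>t. symb s l * exp (l * t)) (\<lambda>t. m * \<tau> ^ 3 * l ^ 4 * exp (l * t))"
  unfolding cflow_def
proof (intro conjI allI impI)
  fix t :: real assume t: "t > 0"
  have D: "((\<lambda>t. c * exp (l * of_real t)) has_vector_derivative c * (l * exp (l * t))) (at t)" for c
  proof -
    have "((\<lambda>z. c * exp (l * z)) has_field_derivative c * (l * exp (l * complex_of_real t))) (at (of_real t))"
      by (auto intro!: derivative_eq_intros)
    from has_vector_derivative_real_field[OF this] show ?thesis by simp
  qed
  show "((\<lambda>t. (1 + \<tau> * l) * exp (l * t)) has_vector_derivative l * (1 + \<tau> * l) * exp (l * t)) (at t)"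
    by (rule has_vector_derivative_eq_rhs[OF D]) simp
  show "((\<lambda>t. l * (1 + \<tau> * l) * exp (l * t)) has_vector_derivative
      - (\<kappa> * s) *\<^sub>R ((1 + \<tau> * l) * exp (l * t)) - (\<sigma> * s) *\<^sub>R (l * exp (l * t))
      - (\<tau> * s) *\<^sub>R (m * \<tau> * (l - \<tau> * l\<^sup>2 + \<tau>\<^sup>2 * l ^ 3) * exp (l * t)) + symb s l * exp (l * t)) (at t)"
    by (rule has_vector_derivative_eq_rhs[OF D])
       (simp add: symb_def scaleR_conv_of_real algebra_simps power2_eq_square)
  show "((\<lambda>t. l * exp (l * t)) has_vector_derivative (1 / \<tau>) *\<^sub>R (l * (1 + \<tau> * l) * exp (l * t) - l * exp (l * t))) (at t)"
    using tau by (intro has_vector_derivative_eq_rhs[OF D]) (simp add: scaleR_conv_of_real field_simps)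
  show "((\<lambda>t. m * \<tau> * (l - \<tau> * l\<^sup>2 + \<tau>\<^sup>2 * l ^ 3) * exp (l * t)) has_vector_derivative
     m *\<^sub>R (l * exp (l * t)) - (1 / \<tau>) *\<^sub>R (m * \<tau> * (l - \<tau> * l\<^sup>2 + \<tau>\<^sup>2 * l ^ 3) * exp (l * t)) + m * \<tau> ^ 3 * l ^ 4 * exp (l * t)) (at t)"
    using tau by (intro has_vector_derivative_eq_rhs[OF D])
      (simp add: scaleR_conv_of_real field_simps power2_eq_square power3_eq_cube power4_eq_xxxx)
qed (intro continuous_intros)+

text \<open>The contribution of \<open>\<tau>\<^sup>2 exp (- t / \<tau>) a\<^sub>2\<close> to the initial data has to be removed separately: it
  is of order one, but decays exponentially.\<close>

lemma fast_flow:
  fixes a2 c1 :: complex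
  shows "cflow s (\<lambda>t. 0) (\<lambda>t. 0) (\<lambda>t. (- \<tau> * exp (- t / \<tau>)) *\<^sub>R a2) (\<lambda>t. exp (- t / \<tau>) *\<^sub>R (c1 - (m * \<tau> * t) *\<^sub>R a2))
     (\<lambda>t. (s * exp (- t / \<tau>)) *\<^sub>R (\<tau> *\<^sub>R c1 - (\<sigma> * \<tau> + m * \<tau>\<^sup>2 * t) *\<^sub>R a2)) (\<lambda>t. 0)"
  unfolding cflow_def
proof (intro conjI allI impI)
  fix t :: real assume t: "t > 0"
  have e: "((\<lambda>t. exp (- t / \<tau>)) has_real_derivative - exp (- t / \<tau>) / \<tau>) (at t)"
    using tau by (auto intro!: derivative_eq_intros)
  show "((\<lambda>t. 0) has_vector_derivative 0) (at t)" by simp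
  show "((\<lambda>t. 0) has_vector_derivative
      - (\<kappa> * s) *\<^sub>R 0 - (\<sigma> * s) *\<^sub>R (- \<tau> * exp (- t / \<tau>)) *\<^sub>R a2 - (\<tau> * s) *\<^sub>R exp (- t / \<tau>) *\<^sub>R (c1 - (m * \<tau> * t) *\<^sub>R a2)
     + (s * exp (- t / \<tau>)) *\<^sub>R (\<tau> *\<^sub>R c1 - (\<sigma> * \<tau> + m * \<tau>\<^sup>2 * t) *\<^sub>R a2)) (at t)"
    by (rule has_vector_derivative_eq_rhs[OF has_vector_derivative_const])
       (simp add: scaleR_conv_of_real algebra_simps power2_eq_square)
  have "((\<lambda>t. (- \<tau> * exp (- t / \<tau>)) *\<^sub>R a2) has_vector_derivative (- \<tau> * (- exp (- t / \<tau>) / \<tau>)) *\<^sub>R a2) (at t)"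
    using has_vector_derivative_scaleR[OF DERIV_cmult[OF e, of "- \<tau>"] has_vector_derivative_const[of a2]] by simp
  then show "((\<lambda>t. (- \<tau> * exp (- t / \<tau>)) *\<^sub>R a2) has_vector_derivative (1 / \<tau>) *\<^sub>R (0 - (- \<tau> * exp (- t / \<tau>)) *\<^sub>R a2)) (at t)"
    by (rule has_vector_derivative_eq_rhs) (use tau in simp)
  have "((\<lambda>t. c1 - (m * \<tau> * t) *\<^sub>R a2) has_vector_derivative - ((m * \<tau>) *\<^sub>R a2)) (at t)"
    by (rule has_vector_derivative_eq_rhs, (rule derivative_intros DERIV_cmult_Id)+) simp
  from has_vector_derivative_scaleR[OF e this]
  show "((\<lambda>t. exp (- t / \<tau>) *\<^sub>R (c1 - (m * \<tau> * t) *\<^sub>R a2)) has_vector_derivative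
     m *\<^sub>R (- \<tau> * exp (- t / \<tau>)) *\<^sub>R a2 - (1 / \<tau>) *\<^sub>R exp (- t / \<tau>) *\<^sub>R (c1 - (m * \<tau> * t) *\<^sub>R a2) + 0) (at t)"
    by (rule has_vector_derivative_eq_rhs) (use tau in \<open>simp add: scaleR_conv_of_real field_simps\<close>)
qed (use tau in \<open>auto intro!: continuous_intros\<close>)

text \<open>Combination of the two approximate exponentials that equals A at t = 0 and tends to A +
  B t as r \<rightarrow> 0. Its derivative at t = 0 is B - \<beta> r^2 A rather than B; the
  discrepancy is of the order r^2 that the initial errors have anyway.\<close>

definition slow :: "real \<Rightarrow> real \<Rightarrow> complex \<Rightarrow> complex \<Rightarrow> complex" where
  "slow r t A B = exp (- \<beta> * r\<^sup>2 * t) *\<^sub>R (cos (\<omega> r * t) *\<^sub>R A + (sin (\<omega> r * t) / \<omega> r) *\<^sub>R B)"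

lemma slow_eq_exp:
  fixes A B :: complex
  assumes w: "\<omega> r \<noteq> 0"
  defines "P \<equiv> A / 2 + B / (2 * \<i> * \<omega> r)" and "Q \<equiv> A / 2 - B / (2 * \<i> * \<omega> r)"
  shows "slow r t A B = P * exp (root r * t) + Q * exp (cnj (root r) * t)"
    and "P + Q = A" and "P * root r + Q * cnj (root r) = B - (\<beta> * r\<^sup>2) * A"
proof -
  have e: "exp (root r * t) = exp (- \<beta> * r\<^sup>2 * t) * (cos (\<omega> r * t) + \<i> * sin (\<omega> r * t))"
    "exp (cnj (root r) * t) = exp (- \<beta> * r\<^sup>2 * t) * (cos (\<omega> r * t) - \<i> * sin (\<omega> r * t))"
    by (auto simp: complex_eq_iff Re_exp Im_exp root_def)
  have pq: "P + Q = A" "P - Q = B / (\<i> * \<omega> r)" using w by (auto simp: P_def Q_def field_simps)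
  show "P + Q = A" by fact
  have "P * exp (root r * t) + Q * exp (cnj (root r) * t) =
     exp (- \<beta> * r\<^sup>2 * t) * ((P + Q) * cos (\<omega> r * t) + (P - Q) * (\<i> * sin (\<omega> r * t)))"
    unfolding e by (simp add: algebra_simps)
  then show "slow r t A B = P * exp (root r * t) + Q * exp (cnj (root r) * t)"
    unfolding pq slow_def using w by (simp add: scaleR_conv_of_real field_simps)
  have rt: "root r = - (\<beta> * r\<^sup>2) + \<i> * \<omega> r" by (simp add: root_def complex_eq_iff)
  have crt: "cnj (root r) = - (\<beta> * r\<^sup>2) - \<i> * \<omega> r" by (simp add: root_def complex_eq_iff)
  have "P * root r + Q * cnj (root r) = (P - Q) * (\<i> * \<omega> r) - (\<beta> * r\<^sup>2) * (P + Q)"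
    unfolding rt crt by (simp add: algebra_simps)
  then show "P * root r + Q * cnj (root r) = B - (\<beta> * r\<^sup>2) * A"
    unfolding pq using w by simp
qed

text \<open>The numbers l and cnj l are the roots of X^2 - 2 (Re l) X + |l|^2. In the application P
  and Q are only of order 1 / r, while their power sums with exponents 0 and 1 are bounded. The
  recursion has coefficients of order r^2 and so gives order r^2 for the exponents 2 and 3, which a
  bound summand by summand would miss.\<close>

lemma power_sum_recursion:
  fixes P Q l :: complex
  defines "U \<equiv> \<lambda>j. P * l ^ j + Q * cnj l ^ j"
  shows "U (j + 2) = of_real (2 * Re l) * U (j + 1) - of_real ((cmod l)\<^sup>2) * U j"
proof -
  have l: "l\<^sup>2 = of_real (2 * Re l) * l - of_real ((cmod l)\<^sup>2)" for l
    unfolding cmod_power2 by (simp add: complex_eq_iff power2_eq_square algebra_simps)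
  have "U (j + 2) = P * l ^ j * l\<^sup>2 + Q * cnj l ^ j * (cnj l)\<^sup>2" by (simp add: U_def power2_eq_square mult_ac)
  also have "\<dots> = of_real (2 * Re l) * U (j + 1) - of_real ((cmod l)\<^sup>2) * U j"
    unfolding l[of l] l[of "cnj l"] by (simp add: U_def algebra_simps)
  finally show ?thesis .
qed

lemma omega_lower:
  assumes "0 < r" "r \<le> 1" "r\<^sup>2 * (2 * (\<bar>\<gamma>\<bar> + 1)) \<le> k"
  shows "k * r / 2 \<le> \<omega> r"
proof -
  have "\<bar>\<gamma>\<bar> * r\<^sup>2 \<le> (\<bar>\<gamma>\<bar> + 1) * r\<^sup>2" using assms by (intro mult_right_mono) auto
  also have "\<dots> \<le> k / 2" using assms(3) by (simp add: algebra_simps)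
  finally have "\<bar>\<gamma>\<bar> * r\<^sup>2 * r \<le> k / 2 * r" using assms by (intro mult_right_mono) auto
  then have "\<bar>\<gamma> * r ^ 3\<bar> \<le> k / 2 * r" using assms by (simp add: abs_mult power2_eq_square power3_eq_cube mult.assoc)
  then show ?thesis unfolding \<omega>_def abs_le_iff by (simp add: algebra_simps)
qed

text \<open>These are the initial errors of the four components. For z, v and a they reduce to
  multiples of \<beta> r^2 A and to the small power sums. For b, since w vanishes at t = 0, the slow
  part leaves m (a0 - \<tau> a1 - \<tau>^2 a2) at leading order; this is the value that
  \<open>mode_low\<close> gives to the constant \<open>c1\<close> of the fast mode.\<close>

lemma init_bounds:
  "\<exists>C>0. \<forall>r a0 a1 a2 P Q. 0 < r \<and> r \<le> 1 \<longrightarrow>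
     P + Q = a0 - \<tau>\<^sup>2 *\<^sub>R a2 \<longrightarrow>
     P * root r + Q * cnj (root r) = a1 + \<tau> *\<^sub>R a2 - (\<beta> * r\<^sup>2) *\<^sub>R (a0 - \<tau>\<^sup>2 *\<^sub>R a2) \<longrightarrow>
     (let U = \<lambda>j. P * root r ^ j + Q * cnj (root r) ^ j in
       cmod (a1 + \<tau> *\<^sub>R a2 - (U 1 + \<tau> *\<^sub>R U 2)) \<le> C * r\<^sup>2 * (cmod a0 + cmod a1 + cmod a2) \<and>
       cmod (a0 + \<tau> *\<^sub>R a1 - (U 0 + \<tau> *\<^sub>R U 1)) \<le> C * r\<^sup>2 * (cmod a0 + cmod a1 + cmod a2) \<and>
       cmod (a1 - U 1 + \<tau> *\<^sub>R a2) \<le> C * r\<^sup>2 * (cmod a0 + cmod a1 + cmod a2) \<and>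
       cmod (m *\<^sub>R a0 - (m * \<tau>) *\<^sub>R (U 1 - \<tau> *\<^sub>R U 2 + \<tau>\<^sup>2 *\<^sub>R U 3) - m *\<^sub>R (a0 - \<tau> *\<^sub>R a1 - \<tau>\<^sup>2 *\<^sub>R a2))
          \<le> C * r\<^sup>2 * (cmod a0 + cmod a1 + cmod a2))"
proof -
  obtain C where C: "C > 0" "\<And>r. 0 < r \<Longrightarrow> r \<le> 1 \<Longrightarrow> cmod (root r) \<le> C * r" using root_bounds by blast
  \<comment> \<open>Relative to the size of the data, \<open>D1\<close> bounds \<open>U\<close> 1,
    r^2 \<open>D2\<close> and r^2 \<open>D3\<close> bound \<open>U\<close> 2 and \<open>U\<close> 3,
    and \<open>E\<close> bounds \<beta> A.\<close>
  define D1 where "D1 = 1 + \<tau> + \<beta> * (1 + \<tau>\<^sup>2)"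
  define D2 where "D2 = 2 * \<beta> * D1 + C\<^sup>2 * (1 + \<tau>\<^sup>2)"
  define D3 where "D3 = 2 * \<beta> * D2 + C\<^sup>2 * D1"
  define E where "E = \<beta> * (1 + \<tau>\<^sup>2)"
  have nn: "D1 \<ge> 0" "D2 \<ge> 0" "D3 \<ge> 0" "E > 0" using beta tau by (auto simp: D1_def D2_def D3_def E_def add_pos_pos)
  define D where "D = E + \<tau> * E + \<tau> * D2 + m * \<tau> * (E + \<tau> * D2 + \<tau>\<^sup>2 * D3)"
  have D: "D > 0" "E + \<tau> * D2 \<le> D" "\<tau> * E \<le> D" "E \<le> D" "m * \<tau> * (E + \<tau> * D2 + \<tau>\<^sup>2 * D3) \<le> D"
    using nn tau m by (auto simp: D_def add_pos_nonneg)
  show ?thesis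
  proof (rule exI[of _ D], intro conjI D(1) allI impI)
    fix r :: real and a0 a1 a2 P Q :: complex
    assume r: "0 < r \<and> r \<le> 1" and h0: "P + Q = a0 - \<tau>\<^sup>2 *\<^sub>R a2"
      and h1: "P * root r + Q * cnj (root r) = a1 + \<tau> *\<^sub>R a2 - (\<beta> * r\<^sup>2) *\<^sub>R (a0 - \<tau>\<^sup>2 *\<^sub>R a2)"
    define U where "U = (\<lambda>j. P * root r ^ j + Q * cnj (root r) ^ j)"
    define N where "N = cmod a0 + cmod a1 + cmod a2"
    define A where "A = a0 - \<tau>\<^sup>2 *\<^sub>R a2"
    define s where "s = r\<^sup>2"
    have s: "0 \<le> s" "s \<le> 1" using r by (auto simp: s_def power_le_one)
    have N0: "N \<ge> 0" by (simp add: N_def)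
    have U0: "U 0 = A" using h0 by (simp add: U_def A_def)
    have U1: "U 1 = a1 + \<tau> *\<^sub>R a2 - (\<beta> * s) *\<^sub>R A" using h1 by (simp add: U_def A_def s_def)
    note U1 = U1 U1[unfolded One_nat_def]
    have re: "2 * Re (root r) = - 2 * \<beta> * s" by (simp add: root_def s_def)
    have rec: "U (j + 2) = (- 2 * \<beta> * s) *\<^sub>R U (j + 1) - ((cmod (root r))\<^sup>2) *\<^sub>R U j" for j
      using power_sum_recursion[of P "root r" j Q] unfolding U_def re by (simp add: scaleR_conv_of_real)
    have U2: "U 2 = (- 2 * \<beta> * s) *\<^sub>R U 1 - ((cmod (root r))\<^sup>2) *\<^sub>R A" using rec[of 0] by (simp add: U0 numeral_2_eq_2)
    have U3: "U 3 = (- 2 * \<beta> * s) *\<^sub>R U 2 - ((cmod (root r))\<^sup>2) *\<^sub>R U 1" using rec[of 1] by (simp add: numeral_3_eq_3 numeral_2_eq_2)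
    have O: "(cmod (root r))\<^sup>2 \<le> C\<^sup>2 * s"
      using power_mono[OF C(2), of r 2] r by (simp add: power_mult_distrib s_def)
    have nd: "norm (x - y) \<le> norm x + norm y" for x y :: complex by (rule norm_triangle_ineq4)
    have nA: "cmod A \<le> (1 + \<tau>\<^sup>2) * N"
    proof -
      have "cmod A \<le> cmod a0 + \<tau>\<^sup>2 * cmod a2" using nd[of a0 "\<tau>\<^sup>2 *\<^sub>R a2"] by (simp add: A_def)
      also have "\<dots> \<le> 1 * N + \<tau>\<^sup>2 * N" unfolding N_def by (intro add_mono mult_mono) auto
      finally show ?thesis by (simp add: distrib_right)
    qed
    have bsA: "cmod ((\<beta> * s) *\<^sub>R A) \<le> s * E * N"
      using mult_left_mono[OF nA, of "\<beta> * s"] beta s by (simp add: E_def mult_ac)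
    have nU1: "cmod (U 1) \<le> D1 * N"
    proof -
      have "cmod (U 1) \<le> cmod a1 + \<tau> * cmod a2 + s * E * N"
        unfolding U1 using tau by (intro order_trans[OF nd] add_mono bsA order_trans[OF norm_triangle_ineq]) auto
      also have "\<dots> \<le> 1 * N + \<tau> * N + 1 * E * N"
        using tau s nn N0 unfolding N_def by (intro add_mono mult_mono mult_right_mono) auto
      finally show ?thesis by (simp add: D1_def E_def distrib_right)
    qed
    have nU2: "cmod (U 2) \<le> s * D2 * N"
    proof -
      have "cmod (U 2) \<le> 2 * \<beta> * s * cmod (U 1) + (cmod (root r))\<^sup>2 * cmod A"
        unfolding U2 using beta s by (intro order_trans[OF nd]) (simp add: abs_mult)
      also have "\<dots> \<le> 2 * \<beta> * s * (D1 * N) + (C\<^sup>2 * s) * ((1 + \<tau>\<^sup>2) * N)"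
        using nU1 nA O beta s by (intro add_mono mult_mono) auto
      finally show ?thesis by (simp add: D2_def algebra_simps)
    qed
    have nU3: "cmod (U 3) \<le> s * D3 * N"
    proof -
      have "cmod (U 3) \<le> 2 * \<beta> * s * cmod (U 2) + (cmod (root r))\<^sup>2 * cmod (U 1)"
        unfolding U3 using beta s by (intro order_trans[OF nd]) (simp add: abs_mult)
      also have "\<dots> \<le> 2 * \<beta> * s * (1 * D2 * N) + (C\<^sup>2 * s) * (D1 * N)"
      proof (intro add_mono mult_mono)
        have "s * D2 * N \<le> 1 * D2 * N" using s nn N0 by (intro mult_right_mono) auto
        then show "cmod (U 2) \<le> 1 * D2 * N" using nU2 by linarith
      qed (use nU1 O beta s nn N0 in auto)
      finally show ?thesis by (simp add: D3_def algebra_simps)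
    qed
    have fin: "cmod x \<le> D * s * N" if "cmod x \<le> c * (s * N)" "c \<le> D" for x c
      using that mult_right_mono[OF that(2), of "s * N"] s N0 by (simp add: mult.assoc)
    have tU2: "cmod (\<tau> *\<^sub>R U 2) \<le> \<tau> * (s * D2 * N)" using nU2 tau by (simp add: mult_left_mono)
    have tU3: "cmod (\<tau>\<^sup>2 *\<^sub>R U 3) \<le> \<tau>\<^sup>2 * (s * D3 * N)" using nU3 tau by (simp add: mult_left_mono)
    have 1: "cmod (a1 + \<tau> *\<^sub>R a2 - (U 1 + \<tau> *\<^sub>R U 2)) \<le> D * s * N"
    proof (rule fin[OF _ D(2)])
      have "a1 + \<tau> *\<^sub>R a2 - (U 1 + \<tau> *\<^sub>R U 2) = (\<beta> * s) *\<^sub>R A - \<tau> *\<^sub>R U 2" by (simp add: U1)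
      then have "cmod (a1 + \<tau> *\<^sub>R a2 - (U 1 + \<tau> *\<^sub>R U 2)) \<le> s * E * N + \<tau> * (s * D2 * N)"
        using order_trans[OF nd add_mono[OF bsA tU2]] by (simp only:)
      then show "cmod (a1 + \<tau> *\<^sub>R a2 - (U 1 + \<tau> *\<^sub>R U 2)) \<le> (E + \<tau> * D2) * (s * N)" by (simp add: algebra_simps)
    qed
    have 2: "cmod (a0 + \<tau> *\<^sub>R a1 - (U 0 + \<tau> *\<^sub>R U 1)) \<le> D * s * N"
    proof (rule fin[OF _ D(3)])
      have "a0 + \<tau> *\<^sub>R a1 - (U 0 + \<tau> *\<^sub>R U 1) = \<tau> *\<^sub>R ((\<beta> * s) *\<^sub>R A)"
        by (simp add: U1 U0 A_def complex_eq_iff algebra_simps power2_eq_square)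
      moreover have "cmod (\<tau> *\<^sub>R ((\<beta> * s) *\<^sub>R A)) \<le> \<tau> * (s * E * N)"
        unfolding norm_scaleR[of \<tau>] using bsA tau by (intro mult_mono) auto
      ultimately show "cmod (a0 + \<tau> *\<^sub>R a1 - (U 0 + \<tau> *\<^sub>R U 1)) \<le> (\<tau> * E) * (s * N)"
        by (simp only: mult_ac)
    qed
    have 3: "cmod (a1 - U 1 + \<tau> *\<^sub>R a2) \<le> D * s * N"
    proof (rule fin[OF _ D(4)])
      have "a1 - U 1 + \<tau> *\<^sub>R a2 = (\<beta> * s) *\<^sub>R A" by (simp add: U1)
      then show "cmod (a1 - U 1 + \<tau> *\<^sub>R a2) \<le> E * (s * N)" using bsA by (simp add: mult_ac)
    qed
    have 4: "cmod (m *\<^sub>R a0 - (m * \<tau>) *\<^sub>R (U 1 - \<tau> *\<^sub>R U 2 + \<tau>\<^sup>2 *\<^sub>R U 3) - m *\<^sub>R (a0 - \<tau> *\<^sub>R a1 - \<tau>\<^sup>2 *\<^sub>R a2)) \<le> D * s * N"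
    proof (rule fin[OF _ D(5)])
      have "m *\<^sub>R a0 - (m * \<tau>) *\<^sub>R (U 1 - \<tau> *\<^sub>R U 2 + \<tau>\<^sup>2 *\<^sub>R U 3) - m *\<^sub>R (a0 - \<tau> *\<^sub>R a1 - \<tau>\<^sup>2 *\<^sub>R a2) =
         (m * \<tau>) *\<^sub>R ((\<beta> * s) *\<^sub>R A + \<tau> *\<^sub>R U 2 - \<tau>\<^sup>2 *\<^sub>R U 3)"
        by (simp add: U1 complex_eq_iff algebra_simps power2_eq_square)
      moreover have "cmod ((\<beta> * s) *\<^sub>R A + \<tau> *\<^sub>R U 2 - \<tau>\<^sup>2 *\<^sub>R U 3) \<le> s * E * N + \<tau> * (s * D2 * N) + \<tau>\<^sup>2 * (s * D3 * N)"
        by (intro order_trans[OF nd] add_mono tU3 order_trans[OF norm_triangle_ineq] bsA tU2)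
      ultimately have "cmod (m *\<^sub>R a0 - (m * \<tau>) *\<^sub>R (U 1 - \<tau> *\<^sub>R U 2 + \<tau>\<^sup>2 *\<^sub>R U 3) - m *\<^sub>R (a0 - \<tau> *\<^sub>R a1 - \<tau>\<^sup>2 *\<^sub>R a2))
         \<le> (m * \<tau>) * (s * E * N + \<tau> * (s * D2 * N) + \<tau>\<^sup>2 * (s * D3 * N))"
        using m tau by (simp add: mult_left_mono)
      then show "cmod (m *\<^sub>R a0 - (m * \<tau>) *\<^sub>R (U 1 - \<tau> *\<^sub>R U 2 + \<tau>\<^sup>2 *\<^sub>R U 3) - m *\<^sub>R (a0 - \<tau> *\<^sub>R a1 - \<tau>\<^sup>2 *\<^sub>R a2))
         \<le> (m * \<tau> * (E + \<tau> * D2 + \<tau>\<^sup>2 * D3)) * (s * N)"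
        by (simp add: algebra_simps)
    qed
    show "let U = \<lambda>j. P * root r ^ j + Q * cnj (root r) ^ j in
       cmod (a1 + \<tau> *\<^sub>R a2 - (U 1 + \<tau> *\<^sub>R U 2)) \<le> D * r\<^sup>2 * (cmod a0 + cmod a1 + cmod a2) \<and>
       cmod (a0 + \<tau> *\<^sub>R a1 - (U 0 + \<tau> *\<^sub>R U 1)) \<le> D * r\<^sup>2 * (cmod a0 + cmod a1 + cmod a2) \<and>
       cmod (a1 - U 1 + \<tau> *\<^sub>R a2) \<le> D * r\<^sup>2 * (cmod a0 + cmod a1 + cmod a2) \<and>
       cmod (m *\<^sub>R a0 - (m * \<tau>) *\<^sub>R (U 1 - \<tau> *\<^sub>R U 2 + \<tau>\<^sup>2 *\<^sub>R U 3) - m *\<^sub>R (a0 - \<tau> *\<^sub>R a1 - \<tau>\<^sup>2 *\<^sub>R a2))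
          \<le> D * r\<^sup>2 * (cmod a0 + cmod a1 + cmod a2)"
      using 1 2 3 4 unfolding U_def N_def s_def Let_def by blast
  qed
qed

text \<open>The difference of u and its slow and fast parts solves the system with sources of size
  s^2 exp (- \<beta> s t) and s exp (- t / (2 \<tau>)) and initial values of size s. By
  \<open>decay\<close>, sqrt s = r times its components is at most of size s (1 + s t) exp (- c s
  t); dividing by r leaves the factor r of the estimate.\<close>

lemma mode_low:
  "\<exists>r0>0. \<exists>C>0. \<exists>c>0. r0 \<le> 1 \<and> (\<forall>r. 0 < r \<and> r \<le> r0 \<longrightarrow> k * r / 2 \<le> \<omega> r) \<and>
     (\<forall>r a0 a1 a2 u t. 0 < r \<and> r \<le> r0 \<and> mgt_mode \<tau> \<delta> m (r\<^sup>2) a0 a1 a2 u \<and> t \<ge> 0 \<longrightarrow>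
       cmod (u t - slow r t (a0 - \<tau>\<^sup>2 *\<^sub>R a2) (a1 + \<tau> *\<^sub>R a2) - (\<tau>\<^sup>2 * exp (- t / \<tau>)) *\<^sub>R a2)
         \<le> C * r * (1 + r\<^sup>2 * t) * exp (- c * r\<^sup>2 * t) * (cmod a0 + cmod a1 + cmod a2))"
proof -
  obtain K cc where K: "K > 0" and cc: "cc > 0" and R: "decay K cc"
    using flow_decay by blast
  note R = R[unfolded decay_def, rule_format]
  obtain CR where CR: "CR > 0" and rb: "\<forall>r. 0 < r \<and> r \<le> 1 \<longrightarrow> cmod (symb (r\<^sup>2) (root r)) \<le> CR * r ^ 5 \<and>
     cmod (symb (r\<^sup>2) (cnj (root r))) \<le> CR * r ^ 5 \<and> cmod (root r) \<le> CR * r"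
    using root_bounds by blast
  obtain CI where CI: "CI > 0" and ib: "\<forall>r a0 a1 a2 P Q. 0 < r \<and> r \<le> 1 \<longrightarrow>
     P + Q = a0 - \<tau>\<^sup>2 *\<^sub>R a2 \<longrightarrow>
     P * root r + Q * cnj (root r) = a1 + \<tau> *\<^sub>R a2 - (\<beta> * r\<^sup>2) *\<^sub>R (a0 - \<tau>\<^sup>2 *\<^sub>R a2) \<longrightarrow>
     (let U = \<lambda>j. P * root r ^ j + Q * cnj (root r) ^ j in
       cmod (a1 + \<tau> *\<^sub>R a2 - (U 1 + \<tau> *\<^sub>R U 2)) \<le> CI * r\<^sup>2 * (cmod a0 + cmod a1 + cmod a2) \<and>
       cmod (a0 + \<tau> *\<^sub>R a1 - (U 0 + \<tau> *\<^sub>R U 1)) \<le> CI * r\<^sup>2 * (cmod a0 + cmod a1 + cmod a2) \<and>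
       cmod (a1 - U 1 + \<tau> *\<^sub>R a2) \<le> CI * r\<^sup>2 * (cmod a0 + cmod a1 + cmod a2) \<and>
       cmod (m *\<^sub>R a0 - (m * \<tau>) *\<^sub>R (U 1 - \<tau> *\<^sub>R U 2 + \<tau>\<^sup>2 *\<^sub>R U 3) - m *\<^sub>R (a0 - \<tau> *\<^sub>R a1 - \<tau>\<^sup>2 *\<^sub>R a2))
          \<le> CI * r\<^sup>2 * (cmod a0 + cmod a1 + cmod a2))"
    using init_bounds by blast
  \<comment> \<open>The entry cc / 4 comes from \<open>rate\<close> s \<ge> s / 4 for s \<le> 1; the
    entry \<beta> makes the residuals of the exponentials decay at least as fast as exp (- c s
    t).\<close>
  define c where "c = min (cc / 4) \<beta>"
  have c: "c > 0" "c \<le> cc / 4" "c \<le> \<beta>" using cc beta by (auto simp: c_def)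
  \<comment> \<open>The second entry ensures \<omega> r \<ge> k r / 2. The third ensures c s \<le> 1
    / (4 \<tau>), so that exp (- t / (2 \<tau>)) is at most exp (- c s t) exp (- t / (4
    \<tau>)).\<close>
  define r0 where "r0 = min 1 (min (k / (2 * (\<bar>\<gamma>\<bar> + 1))) (1 / (4 * \<tau> * c)))"
  have r0: "r0 > 0" "r0 \<le> 1" "r0 \<le> k / (2 * (\<bar>\<gamma>\<bar> + 1))" "r0 \<le> 1 / (4 * \<tau> * c)"
    using k tau c by (auto simp: r0_def add_nonneg_pos)
  have r0s: "r\<^sup>2 \<le> r0" if "0 < r" "r \<le> r0" for r
    using mult_mono[of r 1 r r0] that r0 by (simp add: power2_eq_square)
  have w: "k * r / 2 \<le> \<omega> r" if r: "0 < r" "r \<le> r0" for r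
  proof (rule omega_lower)
    have "r\<^sup>2 \<le> k / (2 * (\<bar>\<gamma>\<bar> + 1))" using r0s[OF r] r0 by linarith
    then show "r\<^sup>2 * (2 * (\<bar>\<gamma>\<bar> + 1)) \<le> k" by (simp add: field_simps)
  qed (use r r0 in auto)
  \<comment> \<open>Bound for r |P| and r |Q| relative to the data: A / 2 contributes (1 + \<tau>^2)
    / 2, and the denominator 2 \<omega> of B is at least k r.\<close>
  define CP where "CP = (1 + \<tau>\<^sup>2) / 2 + (1 + \<tau>) / k"
  have CP: "CP > 0" using tau k by (auto simp: CP_def add_pos_pos)
  define C1 where "C1 = 2 * CP * CR + 2 * CP * (m * \<tau> ^ 3 * CR ^ 4)"
  define C2 where "C2 = (\<tau> * (m * (1 + \<tau> + \<tau>\<^sup>2)) + \<sigma> * \<tau> + m * \<tau>\<^sup>2) * (1 + 2 * \<tau>)"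
  have C12: "C1 > 0" "C2 > 0" using CP CR m tau sigma by (auto simp: C1_def C2_def add_pos_pos)
  define D where "D = K * (4 * CI) + K * C1 + K * C2"
  have D: "D > 0" "K * (4 * CI) \<le> D" "K * C1 \<le> D" "K * C2 \<le> D"
    using K CI C12 by (auto simp: D_def add_pos_pos)
  define C where "C = (1 + \<tau>) * (2 * K * D * (1 + 4 * \<tau>))"
  have C: "C > 0" using tau K D by (auto simp: C_def add_pos_pos)
  show ?thesis
  proof (rule exI[of _ r0], rule conjI[OF r0(1)], rule exI[of _ C], rule conjI[OF C], rule exI[of _ c],
      rule conjI[OF c(1)], intro conjI allI impI)
    show "r0 \<le> 1" by (rule r0)
    show "k * r / 2 \<le> \<omega> r" if "0 < r \<and> r \<le> r0" for r using w that by blast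
    fix r a0 a1 a2 u and t :: real
    assume "0 < r \<and> r \<le> r0 \<and> mgt_mode \<tau> \<delta> m (r\<^sup>2) a0 a1 a2 u \<and> t \<ge> 0"
    then have r: "0 < r" "r \<le> r0" and mode: "mgt_mode \<tau> \<delta> m (r\<^sup>2) a0 a1 a2 u" and t: "t \<ge> 0" by auto
    have r1: "r \<le> 1" using r r0 by linarith
    define s where "s = r\<^sup>2"
    have s: "s > 0" "s \<le> r0" "s \<le> 1" "sqrt s = r" "r * r = s" using r r0s[OF r] r0 by (auto simp: s_def power2_eq_square)
    define N where "N = cmod a0 + cmod a1 + cmod a2"
    have N: "N \<ge> 0" "cmod a0 \<le> N" "cmod a1 \<le> N" "cmod a2 \<le> N" by (auto simp: N_def)
    from mode obtain u1 u2 w' where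
      U: "continuous_on {0..} u" "continuous_on {0..} u1" "continuous_on {0..} u2" "continuous_on {0..} w'"
      and i: "u 0 = a0" "u1 0 = a1" "u2 0 = a2" "w' 0 = 0" and
      Dv: "\<And>t. t > 0 \<Longrightarrow> (u has_vector_derivative u1 t) (at t)"
      "\<And>t. t > 0 \<Longrightarrow> (u1 has_vector_derivative u2 t) (at t)"
      "\<And>t. t > 0 \<Longrightarrow> (w' has_vector_derivative m *\<^sub>R u t - (1 / \<tau>) *\<^sub>R w' t) (at t)"
      "\<And>t. t > 0 \<Longrightarrow> (u2 has_vector_derivative
        (1 / \<tau>) *\<^sub>R (s *\<^sub>R w' t - s *\<^sub>R u t - ((\<delta> + \<tau>) * s) *\<^sub>R u1 t - u2 t)) (at t)"
      unfolding s_def by (rule mode_system) blast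
    define A where "A = a0 - \<tau>\<^sup>2 *\<^sub>R a2"
    define B where "B = a1 + \<tau> *\<^sub>R a2"
    define P where "P = A / 2 + B / (2 * \<i> * complex_of_real (\<omega> r))"
    define Q where "Q = A / 2 - B / (2 * \<i> * complex_of_real (\<omega> r))"
    define l where "l = root r"
    define c1 where "c1 = m *\<^sub>R (a0 - \<tau> *\<^sub>R a1 - \<tau>\<^sup>2 *\<^sub>R a2)"
    have kr: "k * r / 2 > 0" using k r by simp
    have wr: "\<omega> r > 0" "\<omega> r \<noteq> 0" using w[OF r] kr by auto
    have nd: "norm (x - y) \<le> norm x + norm y" for x y :: complex by (rule norm_triangle_ineq4)
    have nA: "cmod A \<le> (1 + \<tau>\<^sup>2) * N"
    proof -
      have "cmod A \<le> cmod a0 + \<tau>\<^sup>2 * cmod a2" using nd[of a0 "\<tau>\<^sup>2 *\<^sub>R a2"] by (simp add: A_def)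
      also have "\<dots> \<le> 1 * N + \<tau>\<^sup>2 * N" using N by (intro add_mono mult_mono) auto
      finally show ?thesis by (simp add: distrib_right)
    qed
    have nB: "cmod B \<le> (1 + \<tau>) * N"
    proof -
      have "cmod B \<le> cmod a1 + \<tau> * cmod a2" using norm_triangle_ineq[of a1 "\<tau> *\<^sub>R a2"] tau by (simp add: B_def)
      also have "\<dots> \<le> 1 * N + \<tau> * N" using N tau by (intro add_mono mult_mono) auto
      finally show ?thesis by (simp add: distrib_right)
    qed
    have PQ: "cmod P \<le> CP * N / r" "cmod Q \<le> CP * N / r"
    proof -
      have "cmod (A / 2) \<le> (1 + \<tau>\<^sup>2) * N / 2" using nA by (simp add: norm_divide)
      also have "\<dots> \<le> (1 + \<tau>\<^sup>2) * N / 2 / r"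
        using r1 r N mult_left_mono[OF r1, of "(1 + \<tau>\<^sup>2) * N / 2"] by (simp add: field_simps)
      finally have 1: "cmod (A / 2) \<le> (1 + \<tau>\<^sup>2) / 2 * N / r" by simp
      have "cmod (B / (2 * \<i> * complex_of_real (\<omega> r))) = cmod B / (2 * \<omega> r)"
        using wr by (simp add: norm_divide norm_mult)
      also have "\<dots> \<le> ((1 + \<tau>) * N) / (2 * (k * r / 2))"
        using nB w[OF r] kr N tau by (intro frac_le) auto
      finally have 2: "cmod (B / (2 * \<i> * complex_of_real (\<omega> r))) \<le> (1 + \<tau>) / k * N / r" by simp
      have 3: "(1 + \<tau>\<^sup>2) / 2 * N / r + (1 + \<tau>) / k * N / r = CP * N / r"
        by (simp add: CP_def distrib_right add_divide_distrib)
      show "cmod P \<le> CP * N / r" unfolding P_def using norm_triangle_ineq 1 2 3 by (smt (verit))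
      show "cmod Q \<le> CP * N / r" unfolding Q_def using nd 1 2 3 by (smt (verit))
    qed
    have f0: "cflow s (\<lambda>t. u t + \<tau> *\<^sub>R u1 t) (\<lambda>t. u1 t + \<tau> *\<^sub>R u2 t) u1
        (\<lambda>t. m *\<^sub>R u t - (1 / \<tau>) *\<^sub>R w' t) (\<lambda>t. 0) (\<lambda>t. 0)"
      by (rule flow_of_mode[OF U Dv])
    \<comment> \<open>The mode minus the two approximate exponentials minus the fast mode, as a
      solution of the system with sources.\<close>
    note fl = cflow_add[OF cflow_add[OF cflow_add[OF f0 exp_flow[of s l], of "- P"]
        exp_flow[of s "cnj l"], of "- Q"] fast_flow[of s a2 c1], of "- 1"]
    \<comment> \<open>P and Q are of order 1 / r and the residuals of order r^5, which gives s^2. In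
      the fast source the factor 1 + t has been absorbed by halving the exponent.\<close>
    define g where "g = (\<lambda>t. N * (C1 * (s\<^sup>2 * exp (- \<beta> * s * t)) + C2 * (s * exp (- t / (2 * \<tau>)))))"
    \<comment> \<open>Explicit solution of Z' = - c s Z + D N exp (- c s t) (s^2 + s exp (- t / (4
      \<tau>))) with initial value D N s: the two sources integrate to s^2 t and 4 \<tau> s (1 - exp
      (- t / (4 \<tau>))).\<close>
    define Z where "Z = (\<lambda>t. D * N * (exp (- c * s * t) * (s + s\<^sup>2 * t + s * (4 * \<tau>) * (1 - exp (- t / (4 * \<tau>))))))"
    have el: "cmod (exp (l * complex_of_real t)) = exp (- \<beta> * s * t)" "cmod (exp (cnj l * complex_of_real t)) = exp (- \<beta> * s * t)" for t
      by (simp_all add: l_def root_def s_def)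
    have src: "cmod (((0 + - P * (symb s l * exp (l * complex_of_real t))) + - Q * (symb s (cnj l) * exp (cnj l * complex_of_real t)))
         + - 1 * ((s * exp (- t / \<tau>)) *\<^sub>R (\<tau> *\<^sub>R c1 - (\<sigma> * \<tau> + m * \<tau>\<^sup>2 * t) *\<^sub>R a2)))
       + sqrt s * cmod (((0 + - P * (complex_of_real (m * \<tau> ^ 3) * l ^ 4 * exp (l * complex_of_real t)))
          + - Q * (complex_of_real (m * \<tau> ^ 3) * cnj l ^ 4 * exp (cnj l * complex_of_real t))) + - 1 * 0) \<le> g t"
      if t: "t > 0" for t
    proof -
      define e where "e = exp (- \<beta> * s * t)"
      have e0: "e > 0" by (simp add: e_def)
      have sl: "cmod (symb s l) \<le> CR * r ^ 5" "cmod (symb s (cnj l)) \<le> CR * r ^ 5" "cmod l \<le> CR * r"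
        using rb r r1 by (auto simp: s_def l_def)
      have l4: "cmod l ^ 4 \<le> CR ^ 4 * r ^ 4" using power_mono[OF sl(3), of 4] by (simp add: power_mult_distrib)
      have a: "cmod (- X * (symb s L * exp (L * complex_of_real t))) \<le> CP * N * CR * s\<^sup>2 * e"
        if "cmod X \<le> CP * N / r" "cmod (symb s L) \<le> CR * r ^ 5" "cmod (exp (L * complex_of_real t)) = e" for X L
      proof -
        have "cmod (- X * (symb s L * exp (L * complex_of_real t))) = cmod X * (cmod (symb s L) * e)"
          using that(3) by (simp add: norm_mult)
        also have "\<dots> \<le> (CP * N / r) * (CR * r ^ 5 * e)"
          using that(1,2) e0 CR r CP N by (intro mult_mono) auto
        also have "\<dots> = CP * N * CR * s\<^sup>2 * e" using r by (simp add: s_def field_simps eval_nat_numeral)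
        finally show ?thesis .
      qed
      have b: "cmod (- X * (complex_of_real (m * \<tau> ^ 3) * L ^ 4 * exp (L * complex_of_real t))) \<le> CP * N / r * (m * \<tau> ^ 3 * (CR ^ 4 * r ^ 4) * e)"
        if "cmod X \<le> CP * N / r" "cmod L = cmod l" "cmod (exp (L * complex_of_real t)) = e" for X L
      proof -
        have "cmod (- X * (complex_of_real (m * \<tau> ^ 3) * L ^ 4 * exp (L * complex_of_real t))) = cmod X * (m * \<tau> ^ 3 * cmod l ^ 4 * e)"
          using that(2,3) m tau by (simp add: norm_mult norm_power)
        also have "\<dots> \<le> CP * N / r * (m * \<tau> ^ 3 * (CR ^ 4 * r ^ 4) * e)"
          using that(1) l4 e0 CR r CP N m tau by (intro mult_mono mult_left_mono mult_right_mono) auto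
        finally show ?thesis .
      qed
      have f: "cmod (- 1 * ((s * exp (- t / \<tau>)) *\<^sub>R (\<tau> *\<^sub>R c1 - (\<sigma> * \<tau> + m * \<tau>\<^sup>2 * t) *\<^sub>R a2))) \<le> N * (C2 * (s * exp (- t / (2 * \<tau>))))"
      proof -
        have c1: "cmod c1 \<le> m * (1 + \<tau> + \<tau>\<^sup>2) * N"
        proof -
          have "cmod (a0 - \<tau> *\<^sub>R a1 - \<tau>\<^sup>2 *\<^sub>R a2) \<le> cmod a0 + \<tau> * cmod a1 + \<tau>\<^sup>2 * cmod a2"
            using order_trans[OF nd[of "a0 - \<tau> *\<^sub>R a1" "\<tau>\<^sup>2 *\<^sub>R a2"] add_right_mono[OF nd[of a0 "\<tau> *\<^sub>R a1"]]] tau by simp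
          also have "\<dots> \<le> 1 * N + \<tau> * N + \<tau>\<^sup>2 * N" using N tau by (intro add_mono mult_mono) auto
          finally have "cmod (a0 - \<tau> *\<^sub>R a1 - \<tau>\<^sup>2 *\<^sub>R a2) \<le> (1 + \<tau> + \<tau>\<^sup>2) * N" by (simp add: algebra_simps)
          then show ?thesis using m by (simp add: c1_def mult.assoc mult_left_mono)
        qed
        have "cmod (\<tau> *\<^sub>R c1 - (\<sigma> * \<tau> + m * \<tau>\<^sup>2 * t) *\<^sub>R a2) \<le> \<tau> * cmod c1 + (\<sigma> * \<tau> + m * \<tau>\<^sup>2 * t) * cmod a2"
          using nd[of "\<tau> *\<^sub>R c1" "(\<sigma> * \<tau> + m * \<tau>\<^sup>2 * t) *\<^sub>R a2"] tau sigma m t by simp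
        also have "\<dots> \<le> \<tau> * (m * (1 + \<tau> + \<tau>\<^sup>2) * N) + (\<sigma> * \<tau> + m * \<tau>\<^sup>2 * t) * N"
          using c1 N tau sigma m t by (intro add_mono mult_left_mono) auto
        also have "\<dots> \<le> (\<tau> * (m * (1 + \<tau> + \<tau>\<^sup>2)) + \<sigma> * \<tau> + m * \<tau>\<^sup>2) * (1 + t) * N"
        proof -
          have "0 \<le> (\<tau> * (m * (1 + \<tau> + \<tau>\<^sup>2)) + \<sigma> * \<tau>) * t + m * \<tau>\<^sup>2" using tau sigma m t by auto
          then have "\<tau> * (m * (1 + \<tau> + \<tau>\<^sup>2)) + (\<sigma> * \<tau> + m * \<tau>\<^sup>2 * t) \<le> (\<tau> * (m * (1 + \<tau> + \<tau>\<^sup>2)) + \<sigma> * \<tau> + m * \<tau>\<^sup>2) * (1 + t)"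
            by (simp add: algebra_simps)
          from mult_right_mono[OF this N(1)] show ?thesis by (simp add: algebra_simps)
        qed
        finally have n1: "cmod (\<tau> *\<^sub>R c1 - (\<sigma> * \<tau> + m * \<tau>\<^sup>2 * t) *\<^sub>R a2) \<le> (\<tau> * (m * (1 + \<tau> + \<tau>\<^sup>2)) + \<sigma> * \<tau> + m * \<tau>\<^sup>2) * (1 + t) * N" .
        have n2: "(1 + t) * exp (- t / \<tau>) \<le> (1 + 2 * \<tau>) * exp (- t / (2 * \<tau>))"
        proof -
          have "t / (2 * \<tau>) \<le> exp (t / (2 * \<tau>))" using exp_ge_add_one_self[of "t / (2 * \<tau>)"] by linarith
          then have "t \<le> 2 * \<tau> * exp (t / (2 * \<tau>))" using tau by (simp add: field_simps)
          moreover have "1 \<le> exp (t / (2 * \<tau>))" using t tau by simp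
          ultimately have "1 + t \<le> (1 + 2 * \<tau>) * exp (t / (2 * \<tau>))" unfolding distrib_right mult_1 by (intro add_mono)
          then have "(1 + t) * exp (- t / \<tau>) \<le> (1 + 2 * \<tau>) * exp (t / (2 * \<tau>)) * exp (- t / \<tau>)" by (intro mult_right_mono) auto
          also have "\<dots> = (1 + 2 * \<tau>) * exp (t / (2 * \<tau>) + - t / \<tau>)" by (simp only: exp_add mult.assoc)
          also have "t / (2 * \<tau>) + - t / \<tau> = - t / (2 * \<tau>)" using tau by (simp add: field_simps)
          finally show ?thesis .
        qed
        have "cmod (- 1 * ((s * exp (- t / \<tau>)) *\<^sub>R (\<tau> *\<^sub>R c1 - (\<sigma> * \<tau> + m * \<tau>\<^sup>2 * t) *\<^sub>R a2))) \<le>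
           (s * exp (- t / \<tau>)) * ((\<tau> * (m * (1 + \<tau> + \<tau>\<^sup>2)) + \<sigma> * \<tau> + m * \<tau>\<^sup>2) * (1 + t) * N)"
          unfolding mult_minus1 norm_minus_cancel norm_scaleR using mult_left_mono[OF n1, of "s * exp (- t / \<tau>)"] s by simp
        also have "\<dots> = (s * (\<tau> * (m * (1 + \<tau> + \<tau>\<^sup>2)) + \<sigma> * \<tau> + m * \<tau>\<^sup>2) * N) * ((1 + t) * exp (- t / \<tau>))"
          by simp
        also have "\<dots> \<le> (s * (\<tau> * (m * (1 + \<tau> + \<tau>\<^sup>2)) + \<sigma> * \<tau> + m * \<tau>\<^sup>2) * N) * ((1 + 2 * \<tau>) * exp (- t / (2 * \<tau>)))"
          using n2 s N tau sigma m by (intro mult_left_mono) auto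
        also have "\<dots> = N * (C2 * (s * exp (- t / (2 * \<tau>))))" by (simp add: C2_def)
        finally show ?thesis .
      qed
      have n3: "cmod (x + y + z) \<le> X + Y + W" if "cmod x \<le> X" "cmod y \<le> Y" "cmod z \<le> W" for x y z X Y W
        using norm_triangle_ineq[of "x + y" z] norm_triangle_ineq[of x y] that by linarith
      have S1: "cmod (((0 + - P * (symb s l * exp (l * complex_of_real t))) + - Q * (symb s (cnj l) * exp (cnj l * complex_of_real t)))
         + - 1 * ((s * exp (- t / \<tau>)) *\<^sub>R (\<tau> *\<^sub>R c1 - (\<sigma> * \<tau> + m * \<tau>\<^sup>2 * t) *\<^sub>R a2)))
         \<le> CP * N * CR * s\<^sup>2 * e + CP * N * CR * s\<^sup>2 * e + N * (C2 * (s * exp (- t / (2 * \<tau>))))"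
        unfolding add_0_left by (intro n3 a f PQ sl) (use el in \<open>auto simp: e_def\<close>)
      have "cmod (((0 + - P * (complex_of_real (m * \<tau> ^ 3) * l ^ 4 * exp (l * complex_of_real t)))
          + - Q * (complex_of_real (m * \<tau> ^ 3) * cnj l ^ 4 * exp (cnj l * complex_of_real t))) + - 1 * 0)
          \<le> CP * N / r * (m * \<tau> ^ 3 * (CR ^ 4 * r ^ 4) * e) + CP * N / r * (m * \<tau> ^ 3 * (CR ^ 4 * r ^ 4) * e) + 0"
        unfolding add_0_left by (intro n3 b PQ) (use el in \<open>auto simp: e_def\<close>)
      then have "sqrt s * cmod (((0 + - P * (complex_of_real (m * \<tau> ^ 3) * l ^ 4 * exp (l * complex_of_real t)))
          + - Q * (complex_of_real (m * \<tau> ^ 3) * cnj l ^ 4 * exp (cnj l * complex_of_real t))) + - 1 * 0)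
          \<le> r * (CP * N / r * (m * \<tau> ^ 3 * (CR ^ 4 * r ^ 4) * e) + CP * N / r * (m * \<tau> ^ 3 * (CR ^ 4 * r ^ 4) * e) + 0)"
        unfolding s(4) using r by (intro mult_left_mono) auto
      also have "\<dots> = 2 * CP * (m * \<tau> ^ 3 * CR ^ 4) * (N * s\<^sup>2 * e)"
        using r by (simp add: s_def field_simps eval_nat_numeral)
      finally show ?thesis using S1 by (simp add: g_def C1_def e_def algebra_simps)
    qed
    define U' where "U' = (\<lambda>j. P * l ^ j + Q * cnj l ^ j)"
    have I: "cmod (a1 + \<tau> *\<^sub>R a2 - (U' 1 + \<tau> *\<^sub>R U' 2)) \<le> CI * s * N"
       "cmod (a0 + \<tau> *\<^sub>R a1 - (U' 0 + \<tau> *\<^sub>R U' 1)) \<le> CI * s * N"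
       "cmod (a1 - U' 1 + \<tau> *\<^sub>R a2) \<le> CI * s * N"
       "cmod (m *\<^sub>R a0 - (m * \<tau>) *\<^sub>R (U' 1 - \<tau> *\<^sub>R U' 2 + \<tau>\<^sup>2 *\<^sub>R U' 3) - c1) \<le> CI * s * N"
    proof -
      have 1: "P + Q = a0 - \<tau>\<^sup>2 *\<^sub>R a2"
        using slow_eq_exp(2)[OF wr(2), of A B] by (simp add: P_def Q_def A_def)
      have 2: "P * root r + Q * cnj (root r) = a1 + \<tau> *\<^sub>R a2 - (\<beta> * r\<^sup>2) *\<^sub>R (a0 - \<tau>\<^sup>2 *\<^sub>R a2)"
        using slow_eq_exp(3)[OF wr(2), of A B] by (simp add: P_def Q_def A_def B_def scaleR_conv_of_real)
      show "cmod (a1 + \<tau> *\<^sub>R a2 - (U' 1 + \<tau> *\<^sub>R U' 2)) \<le> CI * s * N"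
       "cmod (a0 + \<tau> *\<^sub>R a1 - (U' 0 + \<tau> *\<^sub>R U' 1)) \<le> CI * s * N"
       "cmod (a1 - U' 1 + \<tau> *\<^sub>R a2) \<le> CI * s * N"
       "cmod (m *\<^sub>R a0 - (m * \<tau>) *\<^sub>R (U' 1 - \<tau> *\<^sub>R U' 2 + \<tau>\<^sup>2 *\<^sub>R U' 3) - c1) \<le> CI * s * N"
        using ib[rule_format, OF conjI[OF r(1) r1] 1 2] unfolding Let_def U'_def l_def s_def N_def c1_def by blast+
    qed
    note R1 = R[where g = g and Z = Z, OF s(1) fl, OF src]
    have dec: "sqrt s * cmod (((u t + \<tau> *\<^sub>R u1 t + - P * ((1 + of_real \<tau> * l) * exp (l * complex_of_real t)))
          + - Q * ((1 + of_real \<tau> * cnj l) * exp (cnj l * complex_of_real t))) + - 1 * 0) \<le> 2 * (K * Z t) \<and>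
       sqrt s * cmod (((u1 t + - P * (l * exp (l * complex_of_real t))) + - Q * (cnj l * exp (cnj l * complex_of_real t)))
          + - 1 * ((- \<tau> * exp (- t / \<tau>)) *\<^sub>R a2)) \<le> 2 * (K * Z t)"
    proof (rule R1)
      show "continuous_on {0..} Z" unfolding Z_def using tau by (intro continuous_intros) auto
      show "\<exists>D. (Z has_real_derivative D) (at t) \<and> - (cc * rate s) * Z t + K * g t \<le> D" if t: "t > 0" for t
      proof (intro exI conjI)
        define E where "E = exp (- t / (4 * \<tau>))"
        define G where "G = exp (- c * s * t)"
        have EG: "E > 0" "G > 0" "E \<le> 1" using t tau by (auto simp: E_def G_def)
        have Z0: "Z t \<ge> 0" unfolding Z_def E_def[symmetric] G_def[symmetric] using D N EG s t tau by auto
        show "(Z has_real_derivative - (c * s) * Z t + D * N * (G * (s\<^sup>2 + s * E))) (at t)"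
          unfolding Z_def E_def G_def using tau
          by (auto intro!: derivative_eq_intros simp: field_simps)
        have "c * s \<le> cc * rate s"
        proof -
          have "(1 + s)\<^sup>2 \<le> 2\<^sup>2" using s by (intro power_mono) auto
          then have "s / 4 \<le> s / (1 + s)\<^sup>2" using s by (intro divide_left_mono) auto
          moreover have "s / 4 \<le> s / (1 + s)" using s by (intro divide_left_mono) auto
          ultimately have "s / 4 \<le> rate s" by (simp add: rate_def)
          then have "cc * (s / 4) \<le> cc * rate s" using cc by (intro mult_left_mono) auto
          moreover have "c * s \<le> cc / 4 * s" using c s by (intro mult_right_mono) auto
          ultimately show ?thesis by simp
        qed
        then have 1: "- (cc * rate s) * Z t \<le> - (c * s) * Z t" using Z0 by (intro mult_right_mono) auto
        have "K * g t = N * ((K * C1) * (s\<^sup>2 * exp (- \<beta> * s * t)) + (K * C2) * (s * exp (- t / (2 * \<tau>))))"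
          by (simp add: g_def algebra_simps)
        also have "\<dots> \<le> N * (D * (s\<^sup>2 * G) + D * (s * (G * E)))"
        proof (intro mult_left_mono add_mono mult_mono N D)
          show "exp (- \<beta> * s * t) \<le> G" using c s t by (simp add: G_def)
          have "c * s \<le> c * (1 / (4 * \<tau> * c))" using s r0 c by (intro mult_left_mono) auto
          also have "\<dots> = 1 / (4 * \<tau>)" using c by simp
          finally have "c * s * t \<le> 1 / (4 * \<tau>) * t" using t by (intro mult_right_mono) auto
          then have "- t / (2 * \<tau>) \<le> - c * s * t + - t / (4 * \<tau>)" using tau by (simp add: field_simps)
          then show "exp (- t / (2 * \<tau>)) \<le> G * E" unfolding G_def E_def exp_add[symmetric] by simp
        qed (use s D K C12 in auto)
        also have "\<dots> = D * N * (G * (s\<^sup>2 + s * E))" by (simp add: algebra_simps)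
        finally show "- (cc * rate s) * Z t + K * g t \<le> - (c * s) * Z t + D * N * (G * (s\<^sup>2 + s * E))"
          using 1 by linarith
      qed
      have z: "(u1 0 + \<tau> *\<^sub>R u2 0 + - P * (l * (1 + of_real \<tau> * l) * exp (l * complex_of_real 0)))
          + - Q * (cnj l * (1 + of_real \<tau> * cnj l) * exp (cnj l * complex_of_real 0)) + - 1 * 0 =
          a1 + \<tau> *\<^sub>R a2 - (U' 1 + \<tau> *\<^sub>R U' 2)"
        by (simp add: i U'_def scaleR_conv_of_real algebra_simps power2_eq_square)
      have v: "(u 0 + \<tau> *\<^sub>R u1 0 + - P * ((1 + of_real \<tau> * l) * exp (l * complex_of_real 0)))
          + - Q * ((1 + of_real \<tau> * cnj l) * exp (cnj l * complex_of_real 0)) + - 1 * 0 = a0 + \<tau> *\<^sub>R a1 - (U' 0 + \<tau> *\<^sub>R U' 1)"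
        by (simp add: i U'_def scaleR_conv_of_real algebra_simps)
      have a: "((u1 0 + - P * (l * exp (l * complex_of_real 0))) + - Q * (cnj l * exp (cnj l * complex_of_real 0)))
          + - 1 * ((- \<tau> * exp (- 0 / \<tau>)) *\<^sub>R a2) = a1 - U' 1 + \<tau> *\<^sub>R a2"
        by (simp add: i U'_def scaleR_conv_of_real algebra_simps)
      have b: "((m *\<^sub>R u 0 - (1 / \<tau>) *\<^sub>R w' 0 + - P * (of_real (m * \<tau>) * (l - of_real \<tau> * l\<^sup>2 + of_real (\<tau>\<^sup>2) * l ^ 3) * exp (l * complex_of_real 0)))
          + - Q * (of_real (m * \<tau>) * (cnj l - of_real \<tau> * (cnj l)\<^sup>2 + of_real (\<tau>\<^sup>2) * cnj l ^ 3) * exp (cnj l * complex_of_real 0)))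
          + - 1 * (exp (- 0 / \<tau>) *\<^sub>R (c1 - (m * \<tau> * 0) *\<^sub>R a2))
          = m *\<^sub>R a0 - (m * \<tau>) *\<^sub>R (U' 1 - \<tau> *\<^sub>R U' 2 + \<tau>\<^sup>2 *\<^sub>R U' 3) - c1"
        by (simp add: i U'_def scaleR_conv_of_real algebra_simps)
      have "K * (cmod (a1 + \<tau> *\<^sub>R a2 - (U' 1 + \<tau> *\<^sub>R U' 2)) + sqrt s * (cmod (a0 + \<tau> *\<^sub>R a1 - (U' 0 + \<tau> *\<^sub>R U' 1)) + cmod (a1 - U' 1 + \<tau> *\<^sub>R a2)
          + cmod (m *\<^sub>R a0 - (m * \<tau>) *\<^sub>R (U' 1 - \<tau> *\<^sub>R U' 2 + \<tau>\<^sup>2 *\<^sub>R U' 3) - c1)))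
         \<le> K * (CI * s * N + 1 * (CI * s * N + CI * s * N + CI * s * N))"
        using I r1 r K s CI N by (intro mult_left_mono add_mono mult_mono) auto
      also have "\<dots> = K * (4 * CI) * (s * N)" by (simp add: algebra_simps)
      also have "\<dots> \<le> D * (s * N)" using D s N by (intro mult_right_mono) auto
      also have "\<dots> = Z 0" by (simp add: Z_def)
      finally show "K * (cmod ((u1 0 + \<tau> *\<^sub>R u2 0 + - P * (l * (1 + of_real \<tau> * l) * exp (l * complex_of_real 0)))
          + - Q * (cnj l * (1 + of_real \<tau> * cnj l) * exp (cnj l * complex_of_real 0)) + - 1 * 0)
        + sqrt s * (cmod ((u 0 + \<tau> *\<^sub>R u1 0 + - P * ((1 + of_real \<tau> * l) * exp (l * complex_of_real 0)))
          + - Q * ((1 + of_real \<tau> * cnj l) * exp (cnj l * complex_of_real 0)) + - 1 * 0)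
        + cmod (((u1 0 + - P * (l * exp (l * complex_of_real 0))) + - Q * (cnj l * exp (cnj l * complex_of_real 0)))
          + - 1 * ((- \<tau> * exp (- 0 / \<tau>)) *\<^sub>R a2))
        + cmod (((m *\<^sub>R u 0 - (1 / \<tau>) *\<^sub>R w' 0 + - P * (of_real (m * \<tau>) * (l - of_real \<tau> * l\<^sup>2 + of_real (\<tau>\<^sup>2) * l ^ 3) * exp (l * complex_of_real 0)))
          + - Q * (of_real (m * \<tau>) * (cnj l - of_real \<tau> * (cnj l)\<^sup>2 + of_real (\<tau>\<^sup>2) * cnj l ^ 3) * exp (cnj l * complex_of_real 0)))
          + - 1 * (exp (- 0 / \<tau>) *\<^sub>R (c1 - (m * \<tau> * 0) *\<^sub>R a2))))) \<le> Z 0"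
        unfolding z v a b .
      show "0 \<le> t" by (rule t)
    qed
    define X where "X = ((u t + \<tau> *\<^sub>R u1 t + - P * ((1 + of_real \<tau> * l) * exp (l * complex_of_real t)))
          + - Q * ((1 + of_real \<tau> * cnj l) * exp (cnj l * complex_of_real t))) + - 1 * 0"
    define Y where "Y = ((u1 t + - P * (l * exp (l * complex_of_real t))) + - Q * (cnj l * exp (cnj l * complex_of_real t)))
          + - 1 * ((- \<tau> * exp (- t / \<tau>)) *\<^sub>R a2)"
    have XY: "r * cmod X \<le> 2 * (K * Z t)" "r * cmod Y \<le> 2 * (K * Z t)"
      using dec unfolding X_def[symmetric] Y_def[symmetric] s(4) by auto
    \<comment> \<open>The relation u = v - \<tau> a for the errors \<open>X\<close> in v and
      \<open>Y\<close> in a. The fast mode has v = 0 and enters through a = - \<tau> exp (- t /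
      \<tau>) a2 only.\<close>
    have "u t - slow r t A B - (\<tau>\<^sup>2 * exp (- t / \<tau>)) *\<^sub>R a2 = X - \<tau> *\<^sub>R Y"
      unfolding slow_eq_exp(1)[OF wr(2)] X_def Y_def P_def[symmetric] Q_def[symmetric] l_def[symmetric]
      by (simp add: scaleR_conv_of_real algebra_simps power2_eq_square)
    then have "r * cmod (u t - slow r t A B - (\<tau>\<^sup>2 * exp (- t / \<tau>)) *\<^sub>R a2) \<le> r * (cmod X + \<tau> * cmod Y)"
      using nd[of X "\<tau> *\<^sub>R Y"] r tau by (intro mult_left_mono) auto
    also have "\<dots> = r * cmod X + \<tau> * (r * cmod Y)" by (simp add: algebra_simps)
    also have "\<dots> \<le> 2 * (K * Z t) + \<tau> * (2 * (K * Z t))"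
      using XY tau by (intro add_mono mult_left_mono) auto
    also have "\<dots> = (1 + \<tau>) * (2 * K) * Z t" by (simp add: algebra_simps)
    also have "\<dots> \<le> (1 + \<tau>) * (2 * K) * (D * N * (exp (- c * s * t) * (s * (1 + 4 * \<tau>) * (1 + s * t))))"
    proof -
      have "4 * \<tau> * (1 - exp (- t / (4 * \<tau>))) \<le> 4 * \<tau> * 1" using tau by (intro mult_left_mono) auto
      then have "1 + s * t + (4 * \<tau>) * (1 - exp (- t / (4 * \<tau>))) \<le> (1 + 4 * \<tau>) * (1 + s * t)"
      proof -
        have "0 \<le> 4 * \<tau> * (s * t)" using tau s t by auto
        then show ?thesis using \<open>4 * \<tau> * (1 - exp (- t / (4 * \<tau>))) \<le> 4 * \<tau> * 1\<close> by (simp add: algebra_simps)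
      qed
      then have "s * (1 + s * t + (4 * \<tau>) * (1 - exp (- t / (4 * \<tau>)))) \<le> s * ((1 + 4 * \<tau>) * (1 + s * t))"
        using s by (intro mult_left_mono) auto
      then have "s + s\<^sup>2 * t + s * (4 * \<tau>) * (1 - exp (- t / (4 * \<tau>))) \<le> s * (1 + 4 * \<tau>) * (1 + s * t)"
        by (simp add: algebra_simps power2_eq_square)
      then show ?thesis unfolding Z_def using tau K D N by (intro mult_left_mono) auto
    qed
    also have "\<dots> = r * (C * r * (1 + s * t) * exp (- c * s * t) * N)"
      unfolding C_def s(5)[symmetric] by simp
    finally have "cmod (u t - slow r t A B - (\<tau>\<^sup>2 * exp (- t / \<tau>)) *\<^sub>R a2) \<le> C * r * (1 + s * t) * exp (- c * s * t) * N"
      using r by simp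
    then show "cmod (u t - slow r t (a0 - \<tau>\<^sup>2 *\<^sub>R a2) (a1 + \<tau> *\<^sub>R a2) - (\<tau>\<^sup>2 * exp (- t / \<tau>)) *\<^sub>R a2)
         \<le> C * r * (1 + r\<^sup>2 * t) * exp (- c * r\<^sup>2 * t) * (cmod a0 + cmod a1 + cmod a2)"
      by (simp add: s_def N_def A_def B_def)
  qed
qed

end

section \<open>Plancherel inequality\<close>

lemma nn_integral_lborel_affine:
  fixes f :: "'a::euclidean_space \<Rightarrow> ennreal"
  assumes [measurable]: "f \<in> borel_measurable borel" and c: "c \<noteq> 0"
  shows "(\<integral>\<^sup>+x. f x \<partial>lborel) = ennreal (\<bar>c\<bar> ^ DIM('a)) * (\<integral>\<^sup>+x. f (t + c *\<^sub>R x) \<partial>lborel)"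
  by (subst lborel_affine[OF c, of t]) (simp add: nn_integral_density nn_integral_distr nn_integral_cmult ennreal_power)

lemma integral_lborel_affine:
  fixes f :: "'a::euclidean_space \<Rightarrow> 'b::{banach, second_countable_topology}"
  assumes [measurable]: "f \<in> borel_measurable borel" and c: "c \<noteq> 0"
  shows "(LINT x|lborel. f x) = \<bar>c\<bar> ^ DIM('a) *\<^sub>R (LINT x|lborel. f (t + c *\<^sub>R x))"
  using integral_density[of f "distr lborel borel (\<lambda>x. t + c *\<^sub>R x)" "\<lambda>_. \<bar>c\<bar> ^ DIM('a)"]
  unfolding lborel_affine[OF c, of t, symmetric]
  by (simp add: integral_distr ennreal_power flip: lborel_affine[OF c, of t])

lemma integrable_lborel_affine:
  fixes f :: "'a::euclidean_space \<Rightarrow> 'b::{banach, second_countable_topology}"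
  assumes f: "integrable lborel f" and c: "c \<noteq> 0"
  shows "integrable lborel (\<lambda>x. f (t + c *\<^sub>R x))"
proof -
  have [measurable]: "f \<in> borel_measurable borel" using f by auto
  have "(\<integral>\<^sup>+x. ennreal (norm (f x)) \<partial>lborel) = ennreal (\<bar>c\<bar> ^ DIM('a)) * (\<integral>\<^sup>+x. ennreal (norm (f (t + c *\<^sub>R x))) \<partial>lborel)"
    using c by (intro nn_integral_lborel_affine) auto
  moreover have "(\<integral>\<^sup>+x. ennreal (norm (f x)) \<partial>lborel) < \<infinity>" using f by (simp add: integrable_iff_bounded)
  ultimately have "(\<integral>\<^sup>+x. ennreal (norm (f (t + c *\<^sub>R x))) \<partial>lborel) < \<infinity>"
    using c by (auto simp: ennreal_mult_less_top)
  then show ?thesis by (simp add: integrable_iff_bounded)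
qed

lemma integral_lborel_prod:
  fixes f :: "'a::euclidean_space \<Rightarrow> real \<Rightarrow> complex"
  assumes f: "\<And>b. b \<in> Basis \<Longrightarrow> integrable lborel (f b)"
  shows "integrable lborel (\<lambda>x. \<Prod>b\<in>Basis. f b (x \<bullet> b))"
    and "(LINT x|lborel. (\<Prod>b\<in>Basis. f b (x \<bullet> b))) = (\<Prod>b\<in>Basis. (LINT x|lborel. f b x))"
proof -
  interpret product_sigma_finite "\<lambda>b::'a. lborel :: real measure" ..
  have [measurable]: "f b \<in> borel_measurable borel" if "b \<in> Basis" for b using f[OF that] by auto
  have m: "(\<lambda>x. \<Prod>b\<in>Basis. f b (x \<bullet> b)) \<in> borel_measurable borel" by measurable
  have m2: "(\<lambda>f. \<Sum>b\<in>(Basis::'a set). f b *\<^sub>R b) \<in> measurable (\<Pi>\<^sub>M b\<in>Basis. (lborel :: real measure)) borel" by measurable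
  show "integrable lborel (\<lambda>x. \<Prod>b\<in>Basis. f b (x \<bullet> b))"
    unfolding lborel_eq[where 'a='a] integrable_distr_eq[OF m2 m]
    using product_integrable_prod[of Basis f] f by simp
  show "(LINT x|lborel. (\<Prod>b\<in>Basis. f b (x \<bullet> b))) = (\<Prod>b\<in>Basis. (LINT x|lborel. f b x))"
    using product_integral_prod[of Basis f] f
    unfolding lborel_eq[where 'a='a] integral_distr[OF m2 m] by simp
qed

text \<open>Up to the factor sqrt (2 pi) the integral is the characteristic function of the standard
  normal distribution.\<close>

lemma gaussian_fourier_1d:
  fixes y :: real
  defines "h \<equiv> \<lambda>x. exp (- (\<i> * complex_of_real (y * x))) * complex_of_real (exp (- x\<^sup>2 / 2))"
  shows "integrable lborel h" "(LINT x|lborel. h x) = complex_of_real (sqrt (2 * pi) * exp (- y\<^sup>2 / 2))"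
proof -
  have h: "h x = sqrt (2 * pi) *\<^sub>R (std_normal_density x *\<^sub>R exp (\<i> * complex_of_real (- y * x)))" for x
    by (simp add: h_def std_normal_density_def scaleR_conv_of_real)
  have i: "integrable lborel (\<lambda>x. std_normal_density x *\<^sub>R exp (\<i> * complex_of_real (- y * x)))"
    by (rule Bochner_Integration.integrable_bound[OF integrable_normal_density[of 1 0]])
       (auto simp: norm_mult)
  show "integrable lborel h" unfolding h using i by (intro integrable_scaleR_right) auto
  have "(LINT x|lborel. std_normal_density x *\<^sub>R exp (\<i> * complex_of_real (- y * x))) = char std_normal_distribution (- y)"
    unfolding char_def by (subst integral_density) auto
  also have "\<dots> = complex_of_real (exp (- y\<^sup>2 / 2))" by (simp add: char_std_normal_distribution)
  finally show "(LINT x|lborel. h x) = complex_of_real (sqrt (2 * pi) * exp (- y\<^sup>2 / 2))"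
    unfolding h by (subst integral_scaleR_right) (use i in \<open>auto simp: scaleR_conv_of_real\<close>)
qed

lemma borel_measurable_cnj [measurable (raw)]:
  assumes [measurable]: "f \<in> borel_measurable M"
  shows "(\<lambda>x. cnj (f x)) \<in> borel_measurable M"
  by (rule measurable_compose[OF assms borel_measurable_continuous_onI]) (intro continuous_intros)

definition gauss :: "real^'n \<Rightarrow> complex" where
  "gauss x = complex_of_real (exp (- (norm x)\<^sup>2 / 2))"

lemma gauss_measurable [measurable]: "gauss \<in> borel_measurable borel" unfolding gauss_def[abs_def] by measurable

lemma fourier_gauss:
  fixes y :: "real^'n"
  shows "integrable lborel (gauss :: real^'n \<Rightarrow> complex)"
    and "fourier gauss y = complex_of_real (sqrt (2 * pi) ^ CARD('n) * exp (- (norm y)\<^sup>2 / 2))"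
proof -
  define h where "h = (\<lambda>y x. exp (- (\<i> * complex_of_real (y * x))) * complex_of_real (exp (- x\<^sup>2 / 2)))"
  have ns: "(norm x)\<^sup>2 = (\<Sum>b\<in>Basis. (x \<bullet> b)\<^sup>2)" for x :: "real^'n"
    unfolding power2_norm_eq_inner by (subst euclidean_inner) (simp add: power2_eq_square)
  have eq: "exp (- (\<i> * complex_of_real (x \<bullet> y))) * gauss x = (\<Prod>b\<in>Basis. h (y \<bullet> b) (x \<bullet> b))" for x y :: "real^'n"
  proof -
    have "(\<Prod>b\<in>Basis. h (y \<bullet> b) (x \<bullet> b)) = exp (\<Sum>b\<in>Basis. - (\<i> * complex_of_real ((y \<bullet> b) * (x \<bullet> b)))) * complex_of_real (exp (\<Sum>b\<in>Basis. - (x \<bullet> b)\<^sup>2 / 2))"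
      unfolding h_def prod.distrib by (simp only: exp_sum[symmetric] of_real_prod[symmetric] finite_Basis)
    also have "(\<Sum>b\<in>Basis. - (x \<bullet> b)\<^sup>2 / 2) = - (norm x)\<^sup>2 / 2" by (simp add: ns sum_negf flip: sum_divide_distrib)
    also have "(\<Sum>b\<in>Basis. - (\<i> * complex_of_real ((y \<bullet> b) * (x \<bullet> b)))) = - (\<i> * complex_of_real (x \<bullet> y))"
      unfolding euclidean_inner[of x y] by (simp add: sum_negf sum_distrib_left mult.commute)
    finally show ?thesis by (simp add: gauss_def)
  qed
  have i: "integrable lborel (h y)" for y using gaussian_fourier_1d(1) by (simp add: h_def)
  have "integrable lborel (\<lambda>x::real^'n. \<Prod>b\<in>Basis. h (0 \<bullet> b) (x \<bullet> b))"
    by (rule integral_lborel_prod(1)) (rule i)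
  then show "integrable lborel (gauss :: real^'n \<Rightarrow> complex)" unfolding eq[symmetric] by simp
  have "fourier gauss y = (\<Prod>b\<in>(Basis :: (real^'n) set). LINT x|lborel. h (y \<bullet> b) x)"
    unfolding fourier_def eq by (rule integral_lborel_prod(2)) (rule i)
  also have "\<dots> = complex_of_real (\<Prod>b\<in>(Basis :: (real^'n) set). sqrt (2 * pi) * exp (- (y \<bullet> b)\<^sup>2 / 2))"
    unfolding h_def gaussian_fourier_1d(2) by simp
  also have "(\<Prod>b\<in>(Basis :: (real^'n) set). sqrt (2 * pi) * exp (- (y \<bullet> b)\<^sup>2 / 2)) = sqrt (2 * pi) ^ CARD('n) * exp (- (norm y)\<^sup>2 / 2)"
    by (simp add: prod.distrib exp_sum[symmetric] ns sum_negf flip: sum_divide_distrib)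
  finally show "fourier gauss y = complex_of_real (sqrt (2 * pi) ^ CARD('n) * exp (- (norm y)\<^sup>2 / 2))" .
qed

section \<open>Rules for the Fourier integral\<close>

lemma integrable_kernel:
  fixes f :: "real^'n \<Rightarrow> complex"
  assumes f: "integrable lborel f"
  shows "integrable lborel (\<lambda>x. exp (- (\<i> * complex_of_real (x \<bullet> \<xi>))) * f x)"
proof (rule Bochner_Integration.integrable_bound[OF f])
  have [measurable]: "f \<in> borel_measurable borel" using f by auto
  show "(\<lambda>x. exp (- (\<i> * complex_of_real (x \<bullet> \<xi>))) * f x) \<in> borel_measurable lborel" by measurable
qed (simp add: norm_mult)

lemma fourier_norm_le: "integrable lborel f \<Longrightarrow> cmod (fourier f \<xi>) \<le> (LINT x|lborel. cmod (f x))"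
  unfolding fourier_def
  by (rule order_trans[OF integral_norm_bound]) (simp add: norm_mult)

lemma fourier_measurable [measurable]:
  assumes [measurable]: "f \<in> borel_measurable borel"
  shows "fourier f \<in> borel_measurable borel"
  unfolding fourier_def[abs_def] by measurable

lemma fourier_add:
  assumes "integrable lborel f" "integrable lborel g"
  shows "fourier (\<lambda>x. f x + g x) \<xi> = fourier f \<xi> + fourier g \<xi>"
  unfolding fourier_def using assms by (simp add: distrib_left integrable_kernel)

lemma fourier_diff:
  assumes "integrable lborel f" "integrable lborel g"
  shows "fourier (\<lambda>x. f x - g x) \<xi> = fourier f \<xi> - fourier g \<xi>"
  unfolding fourier_def using assms by (simp add: right_diff_distrib integrable_kernel)

lemma fourier_mult:
  shows "fourier (\<lambda>x. c * f x) \<xi> = c * fourier f \<xi>"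
  unfolding fourier_def by (simp add: mult.left_commute)

text \<open>Fubini's theorem: the integrand exp (- i x \<bullet> \<xi>) f(x) g(\<xi>) has modulus
  |f(x)| |g(\<xi>)|, and its exponential factor is symmetric in x and \<xi>.\<close>

lemma fourier_multiplication_formula:
  fixes f g :: "real^'n \<Rightarrow> complex"
  assumes f: "integrable lborel f" and g: "integrable lborel g"
  shows "(LINT \<xi>|lborel. fourier f \<xi> * g \<xi>) = (LINT x|lborel. f x * fourier g x)"
proof -
  have [measurable]: "f \<in> borel_measurable borel" "g \<in> borel_measurable borel" using f g by auto
  have "integrable (lborel \<Otimes>\<^sub>M lborel) (\<lambda>(x, \<xi>). exp (- (\<i> * complex_of_real (x \<bullet> \<xi>))) * f x * g \<xi>)"
  proof (rule lborel_pair.Fubini_integrable)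
    show "(\<lambda>(x, \<xi>). exp (- (\<i> * complex_of_real (x \<bullet> \<xi>))) * f x * g \<xi>) \<in> borel_measurable (lborel \<Otimes>\<^sub>M lborel)"
      by measurable
    have "integrable lborel (\<lambda>x. cmod (f x) * (LINT \<xi>|lborel. cmod (g \<xi>)))" using f by simp
    then show "integrable lborel (\<lambda>x. LINT y|lborel. norm (case (x, y) of (x, \<xi>) \<Rightarrow> exp (- (\<i> * complex_of_real (x \<bullet> \<xi>))) * f x * g \<xi>))"
      by (simp add: norm_mult)
    have "integrable lborel (\<lambda>y. exp (- (\<i> * complex_of_real (x \<bullet> y))) * f x * g y)" for x
      using integrable_mult_right[of "f x", OF integrable_kernel[OF g, of x]] by (simp add: mult_ac inner_commute)
    then show "AE x in lborel. integrable lborel (\<lambda>y. case (x, y) of (x, \<xi>) \<Rightarrow> exp (- (\<i> * complex_of_real (x \<bullet> \<xi>))) * f x * g \<xi>)"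
      by simp
  qed
  from lborel_pair.Fubini_integral[OF this]
  have "(LINT \<xi>|lborel. LINT x|lborel. exp (- (\<i> * complex_of_real (x \<bullet> \<xi>))) * f x * g \<xi>) =
     (LINT x|lborel. LINT \<xi>|lborel. exp (- (\<i> * complex_of_real (x \<bullet> \<xi>))) * f x * g \<xi>)" .
  moreover have "(LINT x|lborel. exp (- (\<i> * complex_of_real (x \<bullet> \<xi>))) * f x * g \<xi>) = fourier f \<xi> * g \<xi>" for \<xi>
    unfolding fourier_def by simp
  moreover have "(LINT \<xi>|lborel. exp (- (\<i> * complex_of_real (x \<bullet> \<xi>))) * f x * g \<xi>) = f x * fourier g x" for x
  proof -
    have eq: "exp (- (\<i> * complex_of_real (x \<bullet> \<xi>))) * f x * g \<xi> = f x * (exp (- (\<i> * complex_of_real (\<xi> \<bullet> x))) * g \<xi>)" for \<xi>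
      by (simp add: inner_commute mult_ac)
    show ?thesis unfolding eq fourier_def by simp
  qed
  ultimately show ?thesis by (simp only:)
qed

lemma fourier_gauss_scaled:
  fixes y :: "real^'n" and a :: real
  assumes a: "a > 0"
  shows "integrable lborel (\<lambda>x::real^'n. gauss (a *\<^sub>R x))"
    and "fourier (\<lambda>x. gauss (a *\<^sub>R x)) (a *\<^sub>R y) = complex_of_real ((sqrt (2 * pi) / a) ^ CARD('n) * exp (- (norm y)\<^sup>2 / 2))"
proof -
  show "integrable lborel (\<lambda>x::real^'n. gauss (a *\<^sub>R x))"
    using integrable_lborel_affine[OF fourier_gauss(1), of a 0] a by simp
  have m: "(\<lambda>x. exp (- (\<i> * complex_of_real (x \<bullet> y))) * gauss x) \<in> borel_measurable borel" by measurable
  have "fourier gauss y = \<bar>a\<bar> ^ CARD('n) *\<^sub>R (LINT x|lborel. exp (- (\<i> * complex_of_real ((0 + a *\<^sub>R x) \<bullet> y))) * gauss (0 + a *\<^sub>R x))"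
    unfolding fourier_def using integral_lborel_affine[OF m, of a 0] a by simp
  then have "fourier gauss y = complex_of_real (a ^ CARD('n)) * fourier (\<lambda>x. gauss (a *\<^sub>R x)) (a *\<^sub>R y)"
    unfolding fourier_def using a by (simp add: scaleR_conv_of_real[where 'a = complex])
  then show "fourier (\<lambda>x. gauss (a *\<^sub>R x)) (a *\<^sub>R y) = complex_of_real ((sqrt (2 * pi) / a) ^ CARD('n) * exp (- (norm y)\<^sup>2 / 2))"
    unfolding fourier_gauss(2) using a by (simp add: field_simps power_divide)
qed

lemma fourier_cnj_reflect:
  fixes f :: "real^'n \<Rightarrow> complex"
  assumes [measurable]: "f \<in> borel_measurable borel"
  shows "cnj (fourier f \<xi>) = fourier (\<lambda>y. cnj (f (- y))) \<xi>"
proof -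
  have m: "(\<lambda>x. exp (\<i> * complex_of_real (x \<bullet> \<xi>)) * cnj (f x)) \<in> borel_measurable borel" by measurable
  have "cnj (fourier f \<xi>) = (LINT x|lborel. exp (\<i> * complex_of_real (x \<bullet> \<xi>)) * cnj (f x))"
    unfolding fourier_def by (subst Bochner_Integration.integral_cnj[symmetric]) (simp add: exp_cnj)
  also have "\<dots> = fourier (\<lambda>y. cnj (f (- y))) \<xi>"
    unfolding fourier_def by (subst integral_lborel_affine[OF m, of "-1" 0]) simp_all
  finally show ?thesis .
qed

text \<open>Kernel of the approximate identity that Gaussian damping produces. Its total mass (2
  pi)^n is the constant in Plancherel's formula.\<close>

definition gmass :: "real^'n \<Rightarrow> complex" where
  "gmass w = complex_of_real (sqrt (2 * pi) ^ CARD('n)) * gauss w"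

text \<open>The conjugate of the transform of f is the transform of the reflected conjugate of f.
  Two applications of the multiplication formula therefore move both transforms onto the Gaussian
  factor, and f becomes paired with a Gaussian mean of its conjugate at scale a.\<close>

lemma regularised_plancherel:
  fixes f :: "real^'n \<Rightarrow> complex" and a :: real
  assumes f: "integrable lborel f" and a: "a > 0"
  shows "complex_of_real (LINT \<xi>|lborel. (cmod (fourier f \<xi>))\<^sup>2 * exp (- (norm (a *\<^sub>R \<xi>))\<^sup>2 / 2)) =
    (LINT x|lborel. f x * (LINT w|lborel. cnj (f (x - a *\<^sub>R w)) * gmass w))"
proof -
  have [measurable]: "f \<in> borel_measurable borel" using f by auto
  define f' where "f' = (\<lambda>y. cnj (f (- y)))"
  have f': "integrable lborel f'" unfolding f'_def
    using integrable_lborel_affine[OF f, of "-1" 0] by (intro integrable_cnj) simp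
  have [measurable]: "f' \<in> borel_measurable borel" using f' by auto
  define h :: "real^'n \<Rightarrow> complex" where "h = (\<lambda>\<xi>. gauss (a *\<^sub>R \<xi>))"
  have h: "integrable lborel h" using fourier_gauss_scaled(1)[OF a] by (simp add: h_def)
  define g where "g = (\<lambda>\<xi>. fourier f' \<xi> * h \<xi>)"
  have g: "integrable lborel g" unfolding g_def
  proof (rule Bochner_Integration.integrable_bound)
    show "integrable lborel (\<lambda>x. (LINT x|lborel. cmod (f' x)) * cmod (h x))" using h by simp
    show "(\<lambda>\<xi>. fourier f' \<xi> * h \<xi>) \<in> borel_measurable lborel" unfolding h_def by measurable
    show "AE x in lborel. norm (fourier f' x * h x) \<le> norm ((LINT x|lborel. cmod (f' x)) * cmod (h x))"
      using fourier_norm_le[OF f'] by (auto simp: norm_mult intro!: mult_right_mono order_trans[OF _ abs_ge_self])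
  qed
  have "complex_of_real ((cmod (fourier f \<xi>))\<^sup>2 * exp (- (norm (a *\<^sub>R \<xi>))\<^sup>2 / 2)) = fourier f \<xi> * g \<xi>" for \<xi>
    unfolding g_def h_def f'_def gauss_def fourier_cnj_reflect[symmetric, OF \<open>f \<in> borel_measurable borel\<close>]
    by (simp only: of_real_mult complex_norm_square mult.assoc)
  then have "complex_of_real (LINT \<xi>|lborel. (cmod (fourier f \<xi>))\<^sup>2 * exp (- (norm (a *\<^sub>R \<xi>))\<^sup>2 / 2)) = (LINT \<xi>|lborel. fourier f \<xi> * g \<xi>)"
    by (simp only: integral_complex_of_real[symmetric])
  also have "\<dots> = (LINT x|lborel. f x * fourier g x)" by (rule fourier_multiplication_formula[OF f g])
  finally have E: "complex_of_real (LINT \<xi>|lborel. (cmod (fourier f \<xi>))\<^sup>2 * exp (- (norm (a *\<^sub>R \<xi>))\<^sup>2 / 2)) =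
    (LINT x|lborel. f x * fourier g x)" .
  have G: "fourier g x = (LINT w|lborel. cnj (f (x - a *\<^sub>R w)) * gmass w)" for x
  proof -
    have hx: "integrable lborel (\<lambda>\<xi>. exp (- (\<i> * complex_of_real (\<xi> \<bullet> x))) * h \<xi>)" by (rule integrable_kernel[OF h])
    have sh: "fourier (\<lambda>\<xi>. exp (- (\<i> * complex_of_real (\<xi> \<bullet> x))) * h \<xi>) y = fourier h (x + y)" for y
    proof -
      have eq: "exp (- (\<i> * complex_of_real (\<xi> \<bullet> y))) * (exp (- (\<i> * complex_of_real (\<xi> \<bullet> x))) * h \<xi>)
          = exp (- (\<i> * complex_of_real (\<xi> \<bullet> (x + y)))) * h \<xi>" for \<xi>
      proof -
        have "- (\<i> * complex_of_real (\<xi> \<bullet> (x + y))) = - (\<i> * complex_of_real (\<xi> \<bullet> y)) + - (\<i> * complex_of_real (\<xi> \<bullet> x))"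
          by (simp add: inner_add_right distrib_left)
        then show ?thesis by (simp only: exp_add mult.assoc)
      qed
      show ?thesis unfolding fourier_def eq ..
    qed
    have "fourier g x = (LINT \<xi>|lborel. fourier f' \<xi> * (exp (- (\<i> * complex_of_real (\<xi> \<bullet> x))) * h \<xi>))"
      unfolding g_def fourier_def[of "\<lambda>\<xi>. fourier f' \<xi> * h \<xi>"] by (simp add: mult_ac)
    also have "\<dots> = (LINT y|lborel. f' y * fourier h (x + y))"
      unfolding fourier_multiplication_formula[OF f' hx] sh ..
    \<comment> \<open>Substitution y = - x + a w: the transform of the Gaussian is then taken at x +
      y = a w, where it is \<open>gmass\<close> w divided by the Jacobian.\<close>
    also have "\<dots> = \<bar>a\<bar> ^ CARD('n) *\<^sub>R (LINT w|lborel. f' (- x + a *\<^sub>R w) * fourier h (x + (- x + a *\<^sub>R w)))"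
    proof -
      have m: "(\<lambda>y. f' y * fourier h (x + y)) \<in> borel_measurable borel" unfolding h_def by measurable
      show ?thesis using integral_lborel_affine[OF m, of a "- x"] a by simp
    qed
    also have "\<dots> = (LINT w|lborel. cnj (f (x - a *\<^sub>R w)) * gmass w)"
    proof -
      have "fourier h (a *\<^sub>R w) = gmass w / complex_of_real (a ^ CARD('n))" for w
        unfolding h_def fourier_gauss_scaled(2)[OF a] by (simp add: gmass_def gauss_def power_divide)
      then show ?thesis using a by (simp add: f'_def scaleR_conv_of_real[where 'a = complex])
    qed
    finally show ?thesis .
  qed
  show ?thesis unfolding E G ..
qed

text \<open>Holds for every f because the Bochner integral of a non-integrable function is 0.
  Estimates can thus be carried out with nonnegative integrals from the start.\<close>

lemma norm_integral_le_nn_integral: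
  fixes f :: "'a \<Rightarrow> 'b::{banach, second_countable_topology}"
  shows "ennreal (norm (integral\<^sup>L M f)) \<le> (\<integral>\<^sup>+x. ennreal (norm (f x)) \<partial>M)"
  by (cases "integrable M f") (auto simp: integral_norm_bound_ennreal not_integrable_integral_eq)

lemma gmass_props:
  shows "integrable lborel (\<lambda>w::real^'n. cmod (gmass w))"
    and "(LINT w|lborel. cmod (gmass (w::real^'n))) = (2 * pi) ^ CARD('n)"
    and "(LINT w|lborel. gmass (w::real^'n)) = complex_of_real ((2 * pi) ^ CARD('n))"
    and "integrable lborel (gmass :: real^'n \<Rightarrow> complex)"
    and "gmass \<in> borel_measurable borel"
proof -
  have i: "integrable lborel (gmass :: real^'n \<Rightarrow> complex)"
    unfolding gmass_def[abs_def] using fourier_gauss(1) by (intro integrable_mult_right)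
  show "integrable lborel (gmass :: real^'n \<Rightarrow> complex)" by fact
  then show "integrable lborel (\<lambda>w::real^'n. cmod (gmass w))" by (rule integrable_norm)
  have "(LINT w|lborel. gauss (w::real^'n)) = complex_of_real (sqrt (2 * pi) ^ CARD('n))"
    using fourier_gauss(2)[of "0::real^'n"] by (simp add: fourier_def)
  then have *: "(LINT w|lborel. gmass (w::real^'n)) = complex_of_real (sqrt (2 * pi) ^ CARD('n) * sqrt (2 * pi) ^ CARD('n))"
    unfolding gmass_def by simp
  have sq: "sqrt (2 * pi) ^ CARD('n) * sqrt (2 * pi) ^ CARD('n) = (2 * pi) ^ CARD('n)"
    unfolding power_mult_distrib[symmetric] by simp
  show **: "(LINT w|lborel. gmass (w::real^'n)) = complex_of_real ((2 * pi) ^ CARD('n))" using * unfolding sq .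
  have re: "complex_of_real (cmod (gmass w)) = gmass w" for w :: "real^'n"
    by (simp add: gmass_def gauss_def norm_mult norm_power)
  have "complex_of_real (LINT w|lborel. cmod (gmass (w::real^'n))) = complex_of_real ((2 * pi) ^ CARD('n))"
    unfolding integral_complex_of_real[symmetric] re by (rule **)
  then show "(LINT w|lborel. cmod (gmass (w::real^'n))) = (2 * pi) ^ CARD('n)" by (simp only: of_real_eq_iff)
  show "gmass \<in> borel_measurable borel" unfolding gmass_def[abs_def] by measurable
qed

lemma gmass_measurable [measurable]: "gmass \<in> borel_measurable borel" by (rule gmass_props)

lemma integrable_damped:
  fixes f :: "real^'n \<Rightarrow> complex"
  assumes f: "integrable lborel f" and a: "a > 0"
  shows "integrable lborel (\<lambda>\<xi>. (cmod (fourier f \<xi>))\<^sup>2 * exp (- (norm (a *\<^sub>R \<xi>))\<^sup>2 / 2))"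
proof (rule Bochner_Integration.integrable_bound)
  have [measurable]: "f \<in> borel_measurable borel" using f by auto
  define B where "B = (LINT x|lborel. cmod (f x))"
  show "integrable lborel (\<lambda>\<xi>::real^'n. B\<^sup>2 * cmod (gauss (a *\<^sub>R \<xi>)))"
    by (intro integrable_mult_right integrable_norm fourier_gauss_scaled(1)[OF a])
  have "(cmod (fourier f \<xi>))\<^sup>2 \<le> B\<^sup>2" for \<xi> using fourier_norm_le[OF f] by (intro power_mono) (auto simp: B_def)
  then show "AE \<xi> in lborel. norm ((cmod (fourier f \<xi>))\<^sup>2 * exp (- (norm (a *\<^sub>R \<xi>))\<^sup>2 / 2)) \<le> norm (B\<^sup>2 * cmod (gauss (a *\<^sub>R \<xi>)))"
    by (auto simp: gauss_def norm_mult intro!: mult_right_mono)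
  show "(\<lambda>\<xi>. (cmod (fourier f \<xi>))\<^sup>2 * exp (- (norm (a *\<^sub>R \<xi>))\<^sup>2 / 2)) \<in> borel_measurable lborel" by measurable
qed

text \<open>By |f(x)| |f(x - a w)| \<le> (|f(x)|^2 + |f(x - a w)|^2) / 2 and translation invariance,
  the integral over x no longer depends on a w; only the mass of \<open>gmass\<close> is
  left.\<close>

lemma damped_bound:
  fixes f :: "real^'n \<Rightarrow> complex"
  assumes f: "integrable lborel f" and f2: "integrable lborel (\<lambda>x. (cmod (f x))\<^sup>2)" and a: "a > 0"
  shows "(LINT \<xi>|lborel. (cmod (fourier f \<xi>))\<^sup>2 * exp (- (norm (a *\<^sub>R \<xi>))\<^sup>2 / 2)) \<le> (2 * pi) ^ CARD('n) * (LINT x|lborel. (cmod (f x))\<^sup>2)"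
proof -
  have [measurable]: "f \<in> borel_measurable borel" using f by auto
  define F where "F = (LINT x|lborel. (cmod (f x))\<^sup>2)"
  have F0: "F \<ge> 0" by (simp add: F_def)
  have nnF: "(\<integral>\<^sup>+x. ennreal ((cmod (f x))\<^sup>2) \<partial>lborel) = ennreal F"
    unfolding F_def by (rule nn_integral_eq_integral[OF f2]) simp
  have nnG: "(\<integral>\<^sup>+w. ennreal (cmod (gmass (w::real^'n))) \<partial>lborel) = ennreal ((2 * pi) ^ CARD('n))"
    unfolding gmass_props(2)[where 'n='n, symmetric]
    by (rule nn_integral_eq_integral[OF gmass_props(1)]) simp
  define L where "L = (LINT \<xi>|lborel. (cmod (fourier f \<xi>))\<^sup>2 * exp (- (norm (a *\<^sub>R \<xi>))\<^sup>2 / 2))"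
  have "ennreal L \<le> ennreal (cmod (complex_of_real L))" by (intro ennreal_leI) simp
  also have "\<dots> \<le> (\<integral>\<^sup>+x. ennreal (cmod (f x * (LINT w|lborel. cnj (f (x - a *\<^sub>R w)) * gmass w))) \<partial>lborel)"
    unfolding L_def regularised_plancherel[OF f a] by (rule norm_integral_le_nn_integral)
  also have "\<dots> \<le> (\<integral>\<^sup>+x. (\<integral>\<^sup>+w. ennreal (((cmod (f x))\<^sup>2 + (cmod (f (x - a *\<^sub>R w)))\<^sup>2) / 2) * ennreal (cmod (gmass w)) \<partial>lborel) \<partial>lborel)"
  proof (rule nn_integral_mono)
    fix x
    have "ennreal (cmod (f x * (LINT w|lborel. cnj (f (x - a *\<^sub>R w)) * gmass w))) = ennreal (cmod (f x)) * ennreal (cmod (LINT w|lborel. cnj (f (x - a *\<^sub>R w)) * gmass w))"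
      by (simp add: norm_mult ennreal_mult)
    also have "\<dots> \<le> ennreal (cmod (f x)) * (\<integral>\<^sup>+w. ennreal (cmod (cnj (f (x - a *\<^sub>R w)) * gmass w)) \<partial>lborel)"
      by (intro mult_left_mono norm_integral_le_nn_integral) auto
    also have "\<dots> = (\<integral>\<^sup>+w. ennreal (cmod (f x)) * ennreal (cmod (cnj (f (x - a *\<^sub>R w)) * gmass w)) \<partial>lborel)"
      by (rule nn_integral_cmult[symmetric]) measurable
    also have "\<dots> \<le> (\<integral>\<^sup>+w. ennreal (((cmod (f x))\<^sup>2 + (cmod (f (x - a *\<^sub>R w)))\<^sup>2) / 2) * ennreal (cmod (gmass w)) \<partial>lborel)"
    proof (rule nn_integral_mono)
      fix w
      have "cmod (f x) * cmod (f (x - a *\<^sub>R w)) \<le> ((cmod (f x))\<^sup>2 + (cmod (f (x - a *\<^sub>R w)))\<^sup>2) / 2"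
        using sum_squares_bound[of "cmod (f x)" "cmod (f (x - a *\<^sub>R w))"] by simp
      then have "cmod (f x) * cmod (f (x - a *\<^sub>R w)) * cmod (gmass w) \<le> ((cmod (f x))\<^sup>2 + (cmod (f (x - a *\<^sub>R w)))\<^sup>2) / 2 * cmod (gmass w)"
        by (intro mult_right_mono) auto
      then show "ennreal (cmod (f x)) * ennreal (cmod (cnj (f (x - a *\<^sub>R w)) * gmass w)) \<le> ennreal (((cmod (f x))\<^sup>2 + (cmod (f (x - a *\<^sub>R w)))\<^sup>2) / 2) * ennreal (cmod (gmass w))"
        by (simp add: norm_mult mult.assoc ennreal_leI flip: ennreal_mult)
    qed
    finally show "ennreal (cmod (f x * (LINT w|lborel. cnj (f (x - a *\<^sub>R w)) * gmass w))) \<le> \<dots>" .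
  qed
  also have "\<dots> = (\<integral>\<^sup>+w. (\<integral>\<^sup>+x. ennreal (((cmod (f x))\<^sup>2 + (cmod (f (x - a *\<^sub>R w)))\<^sup>2) / 2) * ennreal (cmod (gmass w)) \<partial>lborel) \<partial>lborel)"
    by (rule lborel_pair.Fubini') measurable
  also have "\<dots> = (\<integral>\<^sup>+w. ennreal F * ennreal (cmod (gmass (w::real^'n))) \<partial>lborel)"
  proof (rule nn_integral_cong)
    fix w :: "real^'n"
    have t: "(\<integral>\<^sup>+x. ennreal ((cmod (f (x - a *\<^sub>R w)))\<^sup>2) \<partial>lborel) = ennreal F"
      using nn_integral_lborel_affine[of "\<lambda>x. ennreal ((cmod (f x))\<^sup>2)" 1 "- (a *\<^sub>R w)"] nnF by simp
    have "(\<integral>\<^sup>+x. ennreal (((cmod (f x))\<^sup>2 + (cmod (f (x - a *\<^sub>R w)))\<^sup>2) / 2) \<partial>lborel) =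
      (\<integral>\<^sup>+x. ennreal (1/2) * (ennreal ((cmod (f x))\<^sup>2) + ennreal ((cmod (f (x - a *\<^sub>R w)))\<^sup>2)) \<partial>lborel)"
    proof (rule nn_integral_cong)
      fix x
      have "ennreal (((cmod (f x))\<^sup>2 + (cmod (f (x - a *\<^sub>R w)))\<^sup>2) / 2) = ennreal (1/2 * ((cmod (f x))\<^sup>2 + (cmod (f (x - a *\<^sub>R w)))\<^sup>2))"
        by simp
      also have "\<dots> = ennreal (1/2) * ennreal ((cmod (f x))\<^sup>2 + (cmod (f (x - a *\<^sub>R w)))\<^sup>2)"
        by (rule ennreal_mult) auto
      also have "ennreal ((cmod (f x))\<^sup>2 + (cmod (f (x - a *\<^sub>R w)))\<^sup>2) = ennreal ((cmod (f x))\<^sup>2) + ennreal ((cmod (f (x - a *\<^sub>R w)))\<^sup>2)"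
        by (rule ennreal_plus) auto
      finally show "ennreal (((cmod (f x))\<^sup>2 + (cmod (f (x - a *\<^sub>R w)))\<^sup>2) / 2) =
        ennreal (1/2) * (ennreal ((cmod (f x))\<^sup>2) + ennreal ((cmod (f (x - a *\<^sub>R w)))\<^sup>2))" .
    qed
    also have "\<dots> = ennreal (1/2) * (ennreal F + ennreal F)"
      by (subst nn_integral_cmult) (auto simp: nn_integral_add t nnF)
    also have "ennreal F + ennreal F = ennreal (F + F)" using F0 by (intro ennreal_plus[symmetric])
    also have "ennreal (1/2) * ennreal (F + F) = ennreal (1/2 * (F + F))" using F0 by (intro ennreal_mult[symmetric]) auto
    also have "1/2 * (F + F) = F" by simp
    finally have h: "(\<integral>\<^sup>+x. ennreal (((cmod (f x))\<^sup>2 + (cmod (f (x - a *\<^sub>R w)))\<^sup>2) / 2) \<partial>lborel) = ennreal F" .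
    show "(\<integral>\<^sup>+x. ennreal (((cmod (f x))\<^sup>2 + (cmod (f (x - a *\<^sub>R w)))\<^sup>2) / 2) * ennreal (cmod (gmass w)) \<partial>lborel) = ennreal F * ennreal (cmod (gmass w))"
      by (subst nn_integral_multc) (auto simp: h)
  qed
  also have "\<dots> = ennreal F * ennreal ((2 * pi) ^ CARD('n))"
    by (subst nn_integral_cmult) (auto simp: nnG)
  also have "\<dots> = ennreal ((2 * pi) ^ CARD('n) * F)" using F0 by (simp add: mult.commute flip: ennreal_mult)
  finally have "ennreal L \<le> ennreal ((2 * pi) ^ CARD('n) * F)" .
  then show ?thesis using F0 by (simp add: L_def F_def)
qed

text \<open>Fatou's lemma along a sequence of scales a tending to 0: the damping factors tend to 1,
  and \<open>damped_bound\<close> is uniform in a.\<close>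

lemma plancherel_le:
  fixes f :: "real^'n \<Rightarrow> complex"
  assumes f: "integrable lborel f" and f2: "integrable lborel (\<lambda>x. (cmod (f x))\<^sup>2)"
  shows "integrable lborel (\<lambda>\<xi>. (cmod (fourier f \<xi>))\<^sup>2)"
    and "(LINT \<xi>|lborel. (cmod (fourier f \<xi>))\<^sup>2) \<le> (2 * pi) ^ CARD('n) * (LINT x|lborel. (cmod (f x))\<^sup>2)"
proof -
  have [measurable]: "f \<in> borel_measurable borel" using f by auto
  define F where "F = (2 * pi) ^ CARD('n) * (LINT x|lborel. (cmod (f x))\<^sup>2)"
  have F0: "F \<ge> 0" by (simp add: F_def)
  define a where "a = (\<lambda>k. inverse (real (Suc k)))"
  have a: "a k > 0" for k by (simp add: a_def)
  have alim: "a \<longlonglongrightarrow> 0" unfolding a_def by (rule LIMSEQ_inverse_real_of_nat)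
  define u where "u = (\<lambda>k \<xi>. (cmod (fourier f \<xi>))\<^sup>2 * exp (- (norm (a k *\<^sub>R \<xi>))\<^sup>2 / 2))"
  have "(\<lambda>k. ennreal (u k \<xi>)) \<longlonglongrightarrow> ennreal ((cmod (fourier f \<xi>))\<^sup>2 * exp (- (norm (0 *\<^sub>R \<xi>))\<^sup>2 / 2))" for \<xi>
    unfolding u_def by (intro tendsto_intros alim) auto
  then have lim: "liminf (\<lambda>k. ennreal (u k \<xi>)) = ennreal ((cmod (fourier f \<xi>))\<^sup>2)" for \<xi>
    using lim_imp_Liminf[OF sequentially_bot] by fastforce
  have "(\<integral>\<^sup>+\<xi>. ennreal ((cmod (fourier f \<xi>))\<^sup>2) \<partial>lborel) \<le> liminf (\<lambda>k. \<integral>\<^sup>+\<xi>. ennreal (u k \<xi>) \<partial>lborel)"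
    unfolding lim[symmetric] by (rule nn_integral_liminf) (simp add: u_def)
  also have "(\<integral>\<^sup>+\<xi>. ennreal (u k \<xi>) \<partial>lborel) \<le> ennreal F" for k
    using nn_integral_eq_integral[OF integrable_damped[OF f a[of k]]] damped_bound[OF f f2 a[of k]]
    by (simp add: u_def F_def ennreal_leI)
  then have "liminf (\<lambda>k. \<integral>\<^sup>+\<xi>. ennreal (u k \<xi>) \<partial>lborel) \<le> ennreal F" by (intro Liminf_le) auto
  finally have *: "(\<integral>\<^sup>+\<xi>. ennreal ((cmod (fourier f \<xi>))\<^sup>2) \<partial>lborel) \<le> ennreal F" .
  have "(\<integral>\<^sup>+\<xi>. ennreal (norm ((cmod (fourier f \<xi>))\<^sup>2)) \<partial>lborel) < \<infinity>"
    using le_less_trans[OF * ennreal_less_top] by simp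
  then show i: "integrable lborel (\<lambda>\<xi>. (cmod (fourier f \<xi>))\<^sup>2)"
    by (subst integrable_iff_bounded) auto
  show "(LINT \<xi>|lborel. (cmod (fourier f \<xi>))\<^sup>2) \<le> (2 * pi) ^ CARD('n) * (LINT x|lborel. (cmod (f x))\<^sup>2)"
    using * F0 unfolding F_def[symmetric] by (subst (asm) nn_integral_eq_integral[OF i]) auto
qed

text \<open>For bounded continuous f the Gaussian means converge pointwise and stay bounded, so
  dominated convergence identifies the limit of the damped integrals and yields the reverse
  inequality. Equality serves the lower bound; the symbol of the second profile is of this
  kind.\<close>

lemma plancherel_continuous:
  fixes f :: "real^'n \<Rightarrow> complex"
  assumes f: "integrable lborel f" and cont: "continuous_on UNIV f" and B: "\<And>x. cmod (f x) \<le> B"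
  shows "integrable lborel (\<lambda>x. (cmod (f x))\<^sup>2)"
    and "(LINT \<xi>|lborel. (cmod (fourier f \<xi>))\<^sup>2) = (2 * pi) ^ CARD('n) * (LINT x|lborel. (cmod (f x))\<^sup>2)"
proof -
  have [measurable]: "f \<in> borel_measurable borel" using f by auto
  have B0: "B \<ge> 0" using B[of 0] norm_ge_zero order_trans by blast
  show f2: "integrable lborel (\<lambda>x. (cmod (f x))\<^sup>2)"
  proof (rule Bochner_Integration.integrable_bound)
    show "integrable lborel (\<lambda>x. B * cmod (f x))" using f by simp
    show "AE x in lborel. norm ((cmod (f x))\<^sup>2) \<le> norm (B * cmod (f x))"
      using B B0 by (auto simp: power2_eq_square abs_mult intro!: mult_right_mono)
  qed measurable
  note P = plancherel_le[OF f f2]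
  define a where "a = (\<lambda>k. inverse (real (Suc k)))"
  have a: "a k > 0" for k by (simp add: a_def)
  have alim: "a \<longlonglongrightarrow> 0" unfolding a_def by (rule LIMSEQ_inverse_real_of_nat)
  define R where "R = (\<lambda>k. (LINT \<xi>|lborel. (cmod (fourier f \<xi>))\<^sup>2 * exp (- (norm (a k *\<^sub>R \<xi>))\<^sup>2 / 2)))"
  define I where "I = (\<lambda>k x. (LINT w|lborel. cnj (f (x - a k *\<^sub>R w)) * gmass (w::real^'n)))"
  define c where "c = (2 * pi) ^ CARD('n)"
  have gb: "integrable lborel (\<lambda>w::real^'n. B * cmod (gmass w))" by (intro integrable_mult_right gmass_props(1))
  have bound: "norm (cnj (f (x - a k *\<^sub>R w)) * gmass w) \<le> B * cmod (gmass w)" for x w k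
    using B by (auto simp: norm_mult intro!: mult_right_mono)
  have I: "(\<lambda>k. I k x) \<longlonglongrightarrow> cnj (f x) * complex_of_real c" for x
  proof -
    have "(\<lambda>k. I k x) \<longlonglongrightarrow> (LINT w|lborel. cnj (f x) * gmass (w::real^'n))"
      unfolding I_def
    proof (rule integral_dominated_convergence[OF _ _ gb])
      show "AE w in lborel. (\<lambda>k. cnj (f (x - a k *\<^sub>R w)) * gmass w) \<longlonglongrightarrow> cnj (f x) * gmass w"
      proof (rule AE_I2)
        fix w
        have "(\<lambda>k. x - a k *\<^sub>R w) \<longlonglongrightarrow> x - 0 *\<^sub>R w" by (intro tendsto_intros alim)
        then have "(\<lambda>k. f (x - a k *\<^sub>R w)) \<longlonglongrightarrow> f x"
          using continuous_on_tendsto_compose[OF cont] by simp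
        then show "(\<lambda>k. cnj (f (x - a k *\<^sub>R w)) * gmass w) \<longlonglongrightarrow> cnj (f x) * gmass w"
          by (intro tendsto_intros)
      qed
      show "AE w in lborel. norm (cnj (f (x - a k *\<^sub>R w)) * gmass w) \<le> B * cmod (gmass w)" for k
        using bound by simp
    qed measurable
    then show ?thesis using gmass_props(3)[where 'n='n] gmass_props(4)[where 'n='n] by (simp add: c_def)
  qed
  have IB: "cmod (I k x) \<le> B * c" for k x
  proof -
    have "cmod (I k x) \<le> (LINT w|lborel. B * cmod (gmass (w::real^'n)))"
      unfolding I_def
      by (rule order_trans[OF integral_norm_bound integral_mono'[OF gb]]) (use bound B0 in auto)
    then show ?thesis using gmass_props(1,2)[where 'n='n] by (simp add: c_def)
  qed
  have "(\<lambda>k. LINT x|lborel. f x * I k x) \<longlonglongrightarrow> (LINT x|lborel. f x * (cnj (f x) * complex_of_real c))"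
  proof (rule integral_dominated_convergence)
    show "integrable lborel (\<lambda>x. cmod (f x) * (B * c))" using f by simp
    show "AE x in lborel. (\<lambda>k. f x * I k x) \<longlonglongrightarrow> f x * (cnj (f x) * complex_of_real c)"
      by (intro AE_I2 tendsto_intros I)
    show "AE x in lborel. norm (f x * I k x) \<le> cmod (f x) * (B * c)" for k
      using IB by (auto simp: norm_mult intro!: mult_left_mono)
  qed (simp_all add: I_def)
  moreover have "(LINT x|lborel. f x * I k x) = complex_of_real (R k)" for k
    unfolding R_def I_def regularised_plancherel[OF f a] ..
  moreover have "(LINT x|lborel. f x * (cnj (f x) * complex_of_real c)) = complex_of_real (c * (LINT x|lborel. (cmod (f x))\<^sup>2))"
  proof -
    have "f x * (cnj (f x) * complex_of_real c) = complex_of_real (c * (cmod (f x))\<^sup>2)" for x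
      by (simp add: complex_norm_square[symmetric] mult_ac flip: of_real_power)
    then show ?thesis by (simp only: integral_complex_of_real integral_mult_right_zero)
  qed
  ultimately have "(\<lambda>k. complex_of_real (R k)) \<longlonglongrightarrow> complex_of_real (c * (LINT x|lborel. (cmod (f x))\<^sup>2))" by simp
  then have "R \<longlonglongrightarrow> c * (LINT x|lborel. (cmod (f x))\<^sup>2)" by (simp only: tendsto_of_real_iff)
  moreover have "R k \<le> (LINT \<xi>|lborel. (cmod (fourier f \<xi>))\<^sup>2)" for k
    unfolding R_def by (rule integral_mono[OF integrable_damped[OF f a] P(1)]) (simp add: mult_left_le)
  ultimately have "c * (LINT x|lborel. (cmod (f x))\<^sup>2) \<le> (LINT \<xi>|lborel. (cmod (fourier f \<xi>))\<^sup>2)"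
    by (intro LIMSEQ_le_const2) auto
  then show "(LINT \<xi>|lborel. (cmod (fourier f \<xi>))\<^sup>2) = (2 * pi) ^ CARD('n) * (LINT x|lborel. (cmod (f x))\<^sup>2)"
    using P(2) by (simp add: c_def)
qed

section \<open>The inverse transform on square-integrable functions\<close>

lemma L2_norm_nonneg: "0 \<le> L2_norm f" by (simp add: L2_norm_def)

lemma L2_norm_square: "(L2_norm f)\<^sup>2 = (LINT x|lborel. (norm (f x))\<^sup>2)" by (simp add: L2_norm_def)

lemma L2_spaceD:
  assumes "f \<in> L2_space"
  shows "f \<in> borel_measurable borel" "integrable lborel (\<lambda>x. (norm (f x))\<^sup>2)"
  using assms by (auto simp: L2_space_def)

lemma L2_spaceI:
  assumes "f \<in> borel_measurable borel" "integrable lborel (\<lambda>x. (norm (f x))\<^sup>2)"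
  shows "f \<in> L2_space"
  using assms by (auto simp: L2_space_def)

lemma L2_bound:
  fixes f :: "real^'n \<Rightarrow> 'b::{banach, second_countable_topology}"
  assumes m: "f \<in> borel_measurable borel" and h: "integrable lborel h"
    and le: "AE x in lborel. (norm (f x))\<^sup>2 \<le> h x"
  shows "f \<in> L2_space" "(L2_norm f)\<^sup>2 \<le> (LINT x|lborel. h x)"
proof -
  note [measurable] = m
  have i: "integrable lborel (\<lambda>x. (norm (f x))\<^sup>2)"
    by (rule Bochner_Integration.integrable_bound[OF h]) (use le in \<open>auto\<close>)
  then show "f \<in> L2_space" by (intro L2_spaceI m)
  show "(L2_norm f)\<^sup>2 \<le> (LINT x|lborel. h x)"
    unfolding L2_norm_square by (rule integral_mono_AE[OF i h le])
qed

lemma norm_add_square_le: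
  fixes x y :: "'a::real_normed_vector"
  assumes e: "e > 0"
  shows "(norm (x + y))\<^sup>2 \<le> (1 + e) * (norm x)\<^sup>2 + (1 + 1 / e) * (norm y)\<^sup>2"
proof -
  have "(norm (x + y))\<^sup>2 \<le> (norm x + norm y)\<^sup>2" by (intro power_mono norm_triangle_ineq) auto
  also have "\<dots> = (norm x)\<^sup>2 + (norm y)\<^sup>2 + 2 * norm x * norm y" by (simp add: power2_sum)
  also have "2 * norm x * norm y \<le> e * (norm x)\<^sup>2 + (norm y)\<^sup>2 / e"
  proof -
    have "0 \<le> (e * norm x - norm y)\<^sup>2 / e" using e by simp
    also have "\<dots> = e * (norm x)\<^sup>2 + (norm y)\<^sup>2 / e - 2 * norm x * norm y"
      using e by (simp add: power2_eq_square field_simps)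
    finally show ?thesis by simp
  qed
  finally show ?thesis using e by (simp add: algebra_simps)
qed

lemma L2_add:
  fixes f g :: "real^'n \<Rightarrow> 'b::{banach, second_countable_topology}"
  assumes f: "f \<in> L2_space" and g: "g \<in> L2_space"
  shows "(\<lambda>x. f x + g x) \<in> L2_space" "L2_norm (\<lambda>x. f x + g x) \<le> L2_norm f + L2_norm g"
proof -
  note [measurable] = L2_spaceD(1)[OF f] L2_spaceD(1)[OF g]
  have *: "(\<lambda>x. f x + g x) \<in> L2_space \<and> (L2_norm (\<lambda>x. f x + g x))\<^sup>2 \<le> (1 + e) * (L2_norm f)\<^sup>2 + (1 + 1 / e) * (L2_norm g)\<^sup>2"
    if e: "e > 0" for e
  proof -
    have h: "integrable lborel (\<lambda>x. (1 + e) * (norm (f x))\<^sup>2 + (1 + 1 / e) * (norm (g x))\<^sup>2)"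
      by (rule Bochner_Integration.integrable_add[OF integrable_mult_right[OF L2_spaceD(2)[OF f]] integrable_mult_right[OF L2_spaceD(2)[OF g]]])
    have "(LINT x|lborel. (1 + e) * (norm (f x))\<^sup>2 + (1 + 1 / e) * (norm (g x))\<^sup>2) = (1 + e) * (L2_norm f)\<^sup>2 + (1 + 1 / e) * (L2_norm g)\<^sup>2"
      unfolding L2_norm_square
      by (subst Bochner_Integration.integral_add[OF integrable_mult_right[OF L2_spaceD(2)[OF f]] integrable_mult_right[OF L2_spaceD(2)[OF g]]])
        (simp only: Bochner_Integration.integral_mult_right_zero)
    moreover have "(\<lambda>x. f x + g x) \<in> borel_measurable borel" by measurable
    ultimately show ?thesis using L2_bound[OF _ h AE_I2[OF norm_add_square_le[OF e]]] by simp
  qed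
  show "(\<lambda>x. f x + g x) \<in> L2_space" using *[of 1] by simp
  show "L2_norm (\<lambda>x. f x + g x) \<le> L2_norm f + L2_norm g"
  proof (rule field_le_epsilon)
    fix d :: real assume d: "d > 0"
    \<comment> \<open>Minkowski's inequality: the weighted bound \<open>*\<close> is best when e is
      the quotient of the two norms. Adding d / 2 keeps both away from 0.\<close>
    define a where "a = L2_norm f + d / 2"
    define b where "b = L2_norm g + d / 2"
    have ab: "a > 0" "b > 0" "L2_norm f \<le> a" "L2_norm g \<le> b"
      using d L2_norm_nonneg[of f] L2_norm_nonneg[of g] by (auto simp: a_def b_def)
    have "(L2_norm (\<lambda>x. f x + g x))\<^sup>2 \<le> (1 + b / a) * (L2_norm f)\<^sup>2 + (1 + 1 / (b / a)) * (L2_norm g)\<^sup>2"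
      using *[of "b / a"] ab by simp
    also have "\<dots> \<le> (1 + b / a) * a\<^sup>2 + (1 + 1 / (b / a)) * b\<^sup>2"
      using ab L2_norm_nonneg by (intro add_mono mult_left_mono power_mono) auto
    also have "\<dots> = (a + b)\<^sup>2" using ab by (simp add: power2_eq_square field_simps)
    finally have "L2_norm (\<lambda>x. f x + g x) \<le> a + b" using ab by - (rule power2_le_imp_le, auto)
    then show "L2_norm (\<lambda>x. f x + g x) \<le> L2_norm f + L2_norm g + d" by (simp add: a_def b_def)
  qed
qed

lemma L2_minus:
  fixes f :: "real^'n \<Rightarrow> 'b::{banach, second_countable_topology}"
  shows "f \<in> L2_space \<Longrightarrow> (\<lambda>x. - f x) \<in> L2_space" "L2_norm (\<lambda>x. - f x) = L2_norm f"
  by (auto simp: L2_space_def L2_norm_def)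

lemma L2_diff:
  fixes f g :: "real^'n \<Rightarrow> 'b::{banach, second_countable_topology}"
  assumes f: "f \<in> L2_space" and g: "g \<in> L2_space"
  shows "(\<lambda>x. f x - g x) \<in> L2_space" "L2_norm (\<lambda>x. f x - g x) \<le> L2_norm f + L2_norm g"
  using L2_add[OF f L2_minus(1)[OF g]] by (simp_all add: L2_minus(2))

lemma L2_of_real:
  "(\<lambda>x. complex_of_real (f x)) \<in> L2_space \<longleftrightarrow> f \<in> L2_space"
  "L2_norm (\<lambda>x. complex_of_real (f x)) = L2_norm f"
proof -
  have "f \<in> borel_measurable borel" if "(\<lambda>x. complex_of_real (f x)) \<in> borel_measurable borel"
    using measurable_compose[OF that borel_measurable_Re] by simp
  then have "(\<lambda>x. complex_of_real (f x)) \<in> borel_measurable borel \<longleftrightarrow> f \<in> borel_measurable borel"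
    using measurable_compose[OF _ borel_measurable_of_real, of f borel] by blast
  then show "(\<lambda>x. complex_of_real (f x)) \<in> L2_space \<longleftrightarrow> f \<in> L2_space"
    unfolding L2_space_def by (simp only: mem_Collect_eq norm_of_real real_norm_def measurable_lborel2)
qed (simp add: L2_norm_def)

section \<open>The inverse integral and its extension to square-integrable symbols\<close>

lemma inv_fourier_eq: "inv_fourier (g :: real^'n \<Rightarrow> complex) x = complex_of_real (1 / (2 * pi) ^ CARD('n)) * fourier g (- x)"
  by (simp add: inv_fourier_def fourier_def inner_commute)

lemma inv_fourier_L2:
  fixes g :: "real^'n \<Rightarrow> complex"
  assumes g: "integrable lborel g" and g2: "g \<in> L2_space"
  shows "inv_fourier g \<in> L2_space" "L2_norm (inv_fourier g) \<le> L2_norm g / sqrt ((2 * pi) ^ CARD('n))"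
    "continuous_on UNIV g \<Longrightarrow> (\<And>x. cmod (g x) \<le> B) \<Longrightarrow> L2_norm (inv_fourier g) = L2_norm g / sqrt ((2 * pi) ^ CARD('n))"
proof -
  define c where "c = (2 * pi) ^ CARD('n)"
  have c: "c > 0" by (simp add: c_def)
  note [measurable] = L2_spaceD(1)[OF g2]
  note P = plancherel_le[OF g L2_spaceD(2)[OF g2]]
  have sq: "(cmod (inv_fourier g x))\<^sup>2 = (1 / c\<^sup>2) * (cmod (fourier g (- x)))\<^sup>2" for x
    using c unfolding inv_fourier_eq c_def[symmetric] by (simp add: norm_mult power_mult_distrib norm_divide power_divide)
  have i: "integrable lborel (\<lambda>x. (cmod (fourier g (- x)))\<^sup>2)"
    using integrable_lborel_affine[OF P(1), of "-1" 0] by simp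
  show m: "inv_fourier g \<in> L2_space"
  proof (rule L2_spaceI)
    show "inv_fourier g \<in> borel_measurable borel" unfolding inv_fourier_eq[abs_def] by measurable
    show "integrable lborel (\<lambda>x. (norm (inv_fourier g x))\<^sup>2)" unfolding sq by (intro integrable_mult_right i)
  qed
  have "(LINT x|lborel. (cmod (fourier g (- x)))\<^sup>2) = (LINT x|lborel. (cmod (fourier g x))\<^sup>2)"
    by (subst integral_lborel_affine[of "\<lambda>x. (cmod (fourier g x))\<^sup>2" "-1" 0]) simp_all
  then have s: "(L2_norm (inv_fourier g))\<^sup>2 = (1 / c\<^sup>2) * (LINT x|lborel. (cmod (fourier g x))\<^sup>2)"
    unfolding L2_norm_square sq using i by simp
  have nn: "0 \<le> L2_norm g / sqrt c" "0 \<le> L2_norm (inv_fourier g)"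
    using c L2_norm_nonneg by (auto intro!: divide_nonneg_nonneg)
  have cc: "(1 / c\<^sup>2) * (c * (L2_norm g)\<^sup>2) = (L2_norm g / sqrt c)\<^sup>2"
    using c by (simp add: power_divide power2_eq_square)
  have "(L2_norm (inv_fourier g))\<^sup>2 \<le> (1 / c\<^sup>2) * (c * (L2_norm g)\<^sup>2)"
    unfolding s using P(2) c unfolding L2_norm_square c_def by (intro mult_left_mono) auto
  then show "L2_norm (inv_fourier g) \<le> L2_norm g / sqrt ((2 * pi) ^ CARD('n))"
    unfolding cc c_def[symmetric] using nn by - (rule power2_le_imp_le, auto)
  assume "continuous_on UNIV g" "\<And>x. cmod (g x) \<le> B"
  from plancherel_continuous(2)[OF g this]
  have P': "(LINT x|lborel. (cmod (fourier g x))\<^sup>2) = c * (L2_norm g)\<^sup>2"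
    unfolding L2_norm_square c_def .
  have "(L2_norm (inv_fourier g))\<^sup>2 = (1 / c\<^sup>2) * (c * (L2_norm g)\<^sup>2)" unfolding s P' ..
  then show "L2_norm (inv_fourier g) = L2_norm g / sqrt ((2 * pi) ^ CARD('n))"
    unfolding cc c_def[symmetric] using nn by - (rule power2_eq_imp_eq, auto)
qed

lemma inv_fourier_diff:
  assumes "integrable lborel f" "integrable lborel g"
  shows "inv_fourier (\<lambda>\<xi>. f \<xi> - g \<xi>) x = inv_fourier f x - inv_fourier g x"
  unfolding inv_fourier_eq fourier_diff[OF assms] by (simp add: right_diff_distrib)

text \<open>On a ball |g| \<le> 1 + |g|^2, so the truncated symbols are integrable and the inverse
  integrals in \<open>is_L2_inv_fourier\<close> converge absolutely.\<close>

lemma cutoff: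
  fixes g :: "real^'n \<Rightarrow> complex"
  assumes g: "g \<in> L2_space"
  defines "h \<equiv> \<lambda>R \<xi>. indicator (cball 0 R) \<xi> *\<^sub>R g \<xi>"
  shows "integrable lborel (h R)" "h R \<in> L2_space" "L2_norm (h R) \<le> L2_norm g"
proof -
  note [measurable] = L2_spaceD(1)[OF g]
  have [measurable]: "(\<lambda>\<xi>. indicat_real (cball 0 R) \<xi>) \<in> borel_measurable (borel :: (real^'n) measure)"
    by (intro borel_measurable_indicator) simp
  have m: "h R \<in> borel_measurable borel" unfolding h_def by measurable
  note [measurable] = m
  have "(norm (h R x))\<^sup>2 \<le> (norm (g x))\<^sup>2" for x by (simp add: h_def indicator_def)
  note B = L2_bound[OF m L2_spaceD(2)[OF g] AE_I2[OF this]]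
  show "h R \<in> L2_space" by (rule B(1))
  show "L2_norm (h R) \<le> L2_norm g"
    by (rule power2_le_imp_le[OF _ L2_norm_nonneg]) (use B(2) in \<open>simp add: L2_norm_square[of g]\<close>)
  show "integrable lborel (h R)"
  proof (rule Bochner_Integration.integrable_bound)
    show "integrable lborel (\<lambda>\<xi>. indicator (cball 0 R) \<xi> + (norm (g \<xi>))\<^sup>2)"
      using L2_spaceD(2)[OF g]
      by (intro Bochner_Integration.integrable_add integrable_real_indicator emeasure_bounded_finite bounded_cball) simp
    have "x \<le> 1 + x\<^sup>2" for x :: real using sum_squares_bound[of x 1] by (simp add: power2_eq_square) (smt (verit) zero_le_square)
    then show "AE \<xi> in lborel. norm (h R \<xi>) \<le> norm (indicator (cball 0 R) \<xi> + (norm (g \<xi>))\<^sup>2)"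
      by (auto simp: h_def indicator_def)
  qed measurable
qed

lemma squeeze:
  fixes f :: "real \<Rightarrow> real^'n \<Rightarrow> 'b::{banach, second_countable_topology}"
  assumes "\<And>R. L2_norm (f R) \<le> g R" "(g \<longlongrightarrow> 0) at_top"
  shows "((\<lambda>R. L2_norm (f R)) \<longlongrightarrow> 0) at_top"
  by (rule tendsto_sandwich[OF always_eventually always_eventually tendsto_const assms(2)])
     (use assms(1) L2_norm_nonneg in blast)+

lemma is_L2_inv_fourier_diff:
  fixes f g :: "real^'n \<Rightarrow> complex"
  assumes 1: "is_L2_inv_fourier g f" and 2: "is_L2_inv_fourier g' f'"
  shows "is_L2_inv_fourier (\<lambda>\<xi>. g \<xi> - g' \<xi>) (\<lambda>x. f x - f' x)"
proof -
  have g: "g \<in> L2_space" "f \<in> L2_space" "g' \<in> L2_space" "f' \<in> L2_space"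
    using 1 2 by (auto simp: is_L2_inv_fourier_def)
  define h where "h = (\<lambda>R \<xi>. indicator (cball 0 R) \<xi> *\<^sub>R g \<xi>)"
  define h' where "h' = (\<lambda>R \<xi>. indicator (cball 0 R) \<xi> *\<^sub>R g' \<xi>)"
  have l1: "((\<lambda>R. L2_norm (\<lambda>x. f x - inv_fourier (h R) x)) \<longlongrightarrow> 0) at_top"
    and l2: "((\<lambda>R. L2_norm (\<lambda>x. f' x - inv_fourier (h' R) x)) \<longlongrightarrow> 0) at_top"
    using 1 2 by (auto simp: is_L2_inv_fourier_def h_def h'_def)
  have ih: "integrable lborel (h R)" "h R \<in> L2_space" "integrable lborel (h' R)" "h' R \<in> L2_space" for R
    using cutoff[OF g(1)] cutoff[OF g(3)] by (auto simp: h_def h'_def)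
  have le: "L2_norm (\<lambda>x. f x - f' x - inv_fourier (\<lambda>\<xi>. indicator (cball 0 R) \<xi> *\<^sub>R (g \<xi> - g' \<xi>)) x)
     \<le> L2_norm (\<lambda>x. f x - inv_fourier (h R) x) + L2_norm (\<lambda>x. f' x - inv_fourier (h' R) x)" for R
  proof -
    have eq: "inv_fourier (\<lambda>\<xi>. indicator (cball 0 R) \<xi> *\<^sub>R (g \<xi> - g' \<xi>)) x = inv_fourier (h R) x - inv_fourier (h' R) x" for x
      using inv_fourier_diff[OF ih(1,3)] by (simp add: h_def h'_def scaleR_diff_right)
    have eq2: "f x - f' x - inv_fourier (\<lambda>\<xi>. indicator (cball 0 R) \<xi> *\<^sub>R (g \<xi> - g' \<xi>)) x =
        (f x - inv_fourier (h R) x) - (f' x - inv_fourier (h' R) x)" for x unfolding eq by simp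
    show ?thesis
      unfolding eq2 using L2_diff(2)[OF L2_diff(1)[OF g(2) inv_fourier_L2(1)[OF ih(1,2)]] L2_diff(1)[OF g(4) inv_fourier_L2(1)[OF ih(3,4)]], of R R] .
  qed
  have "((\<lambda>R. L2_norm (\<lambda>x. f x - f' x - inv_fourier (\<lambda>\<xi>. indicator (cball 0 R) \<xi> *\<^sub>R (g \<xi> - g' \<xi>)) x)) \<longlongrightarrow> 0) at_top"
    by (rule squeeze[OF le]) (use tendsto_add[OF l1 l2] in simp)
  then show ?thesis unfolding is_L2_inv_fourier_def using L2_diff(1)[OF g(1,3)] L2_diff(1)[OF g(2,4)] by blast
qed

text \<open>The bound holds for truncated symbols, whose norms do not exceed that of g, and is
  preserved as the radius R tends to infinity.\<close>

lemma is_L2_inv_fourier_norm: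
  fixes f g :: "real^'n \<Rightarrow> complex"
  assumes "is_L2_inv_fourier g f"
  shows "L2_norm f \<le> L2_norm g / sqrt ((2 * pi) ^ CARD('n))"
proof -
  have g: "g \<in> L2_space" "f \<in> L2_space" using assms by (auto simp: is_L2_inv_fourier_def)
  define h where "h = (\<lambda>R \<xi>. indicator (cball 0 R) \<xi> *\<^sub>R g \<xi>)"
  have l: "((\<lambda>R. L2_norm (\<lambda>x. f x - inv_fourier (h R) x)) \<longlongrightarrow> 0) at_top"
    using assms by (auto simp: is_L2_inv_fourier_def h_def)
  have h: "integrable lborel (h R)" "h R \<in> L2_space" "L2_norm (h R) \<le> L2_norm g" for R
    using cutoff[OF g(1)] by (auto simp: h_def)
  have "L2_norm f \<le> L2_norm (\<lambda>x. f x - inv_fourier (h R) x) + L2_norm g / sqrt ((2 * pi) ^ CARD('n))" for R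
  proof -
    have "L2_norm f = L2_norm (\<lambda>x. (f x - inv_fourier (h R) x) + inv_fourier (h R) x)" by simp
    also have "\<dots> \<le> L2_norm (\<lambda>x. f x - inv_fourier (h R) x) + L2_norm (inv_fourier (h R))"
      using L2_add(2)[OF L2_diff(1)[OF g(2) inv_fourier_L2(1)[OF h(1,2)]] inv_fourier_L2(1)[OF h(1,2)], of R R] .
    also have "L2_norm (inv_fourier (h R)) \<le> L2_norm (h R) / sqrt ((2 * pi) ^ CARD('n))" by (rule inv_fourier_L2(2)[OF h(1,2)])
    also have "\<dots> \<le> L2_norm g / sqrt ((2 * pi) ^ CARD('n))" using h(3) by (intro divide_right_mono) auto
    finally show ?thesis by simp
  qed
  then have "L2_norm f \<le> 0 + L2_norm g / sqrt ((2 * pi) ^ CARD('n))"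
    by (intro tendsto_lowerbound[OF tendsto_add[OF l tendsto_const]]) auto
  then show ?thesis by simp
qed

text \<open>The part of g outside a ball of radius R tends to 0 in L2 by dominated convergence. Thus
  the profiles, defined by integrals, are also transforms in the limit sense that defines the
  solution, and can be subtracted from it.\<close>

lemma is_L2_inv_fourier_integrable:
  fixes g :: "real^'n \<Rightarrow> complex"
  assumes g: "integrable lborel g" and g2: "g \<in> L2_space"
  shows "is_L2_inv_fourier g (inv_fourier g)"
proof -
  note [measurable] = L2_spaceD(1)[OF g2]
  define h where "h = (\<lambda>R \<xi>. indicator (cball 0 R) \<xi> *\<^sub>R g \<xi>)"
  define r where "r = (\<lambda>R \<xi>. g \<xi> - h R \<xi>)"
  have h: "integrable lborel (h R)" "h R \<in> L2_space" for R using cutoff[OF g2] by (auto simp: h_def)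
  have r: "integrable lborel (r R)" "r R \<in> L2_space" for R
    unfolding r_def using h g g2 L2_diff(1) by auto
  have rsq: "(norm (r R \<xi>))\<^sup>2 = indicator (- cball 0 R) \<xi> * (norm (g \<xi>))\<^sup>2" for R \<xi>
    by (simp add: r_def h_def indicator_def)
  have "((\<lambda>R. LINT \<xi>|lborel. (norm (r R \<xi>))\<^sup>2) \<longlongrightarrow> (LINT \<xi>|(lborel :: (real^'n) measure). 0)) at_top"
    unfolding rsq
  proof (rule integral_dominated_convergence_at_top[where w = "\<lambda>\<xi>. (norm (g \<xi>))\<^sup>2"])
    show "integrable lborel (\<lambda>\<xi>. (norm (g \<xi>))\<^sup>2)" by (rule L2_spaceD(2)[OF g2])
    show "AE x in lborel. ((\<lambda>R. indicator (- cball 0 R) x * (norm (g x))\<^sup>2) \<longlongrightarrow> 0) at_top"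
    proof (rule AE_I2)
      fix x
      have "\<forall>\<^sub>F R in at_top. indicator (- cball 0 R) x * (norm (g x))\<^sup>2 = 0"
        using eventually_ge_at_top[of "norm x"] by eventually_elim (simp add: indicator_def)
      then show "((\<lambda>R. indicator (- cball 0 R) x * (norm (g x))\<^sup>2) \<longlongrightarrow> 0) at_top" by (rule tendsto_eventually)
    qed
  qed (auto simp: indicator_def intro!: always_eventually)
  then have "((\<lambda>R. L2_norm (r R)) \<longlongrightarrow> sqrt 0) at_top"
    unfolding L2_norm_def by (intro tendsto_real_sqrt) simp
  then have "((\<lambda>R. L2_norm (r R) / sqrt ((2 * pi) ^ CARD('n))) \<longlongrightarrow> 0 / sqrt ((2 * pi) ^ CARD('n))) at_top"
    by (intro tendsto_divide tendsto_const) auto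
  moreover have "L2_norm (\<lambda>x. inv_fourier g x - inv_fourier (h R) x) \<le> L2_norm (r R) / sqrt ((2 * pi) ^ CARD('n))" for R
  proof -
    have "(\<lambda>x. inv_fourier g x - inv_fourier (h R) x) = inv_fourier (r R)"
      unfolding r_def using inv_fourier_diff[OF g h(1)] by (intro ext) simp
    then show ?thesis using inv_fourier_L2(2)[OF r] by simp
  qed
  ultimately have "((\<lambda>R. L2_norm (\<lambda>x. inv_fourier g x - inv_fourier (h R) x)) \<longlongrightarrow> 0) at_top"
    by (intro squeeze) auto
  then show ?thesis unfolding is_L2_inv_fourier_def h_def using g2 inv_fourier_L2(1)[OF g g2] by blast
qed

text \<open>Conjugation and reflection cancel, so the inverse transform is real; in this way the
  \<open>Re\<close> in the diffusion-wave functions is removed.\<close>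

lemma inv_fourier_hermitian:
  fixes g :: "real^'n \<Rightarrow> complex"
  assumes [measurable]: "g \<in> borel_measurable borel" and h: "\<And>\<xi>. g (- \<xi>) = cnj (g \<xi>)"
  shows "complex_of_real (Re (inv_fourier g x)) = inv_fourier g x"
proof -
  have "cnj (fourier g (- x)) = fourier g (- x)"
    unfolding fourier_cnj_reflect[OF assms(1)] using h by simp
  then have "cnj (inv_fourier g x) = inv_fourier g x" unfolding inv_fourier_eq by simp
  then show ?thesis by (simp add: complex_eq_iff)
qed

text \<open>The first-order expansion of exp (i h \<bullet> \<xi>) has an error of at most |h|^2
  |\<xi>|^2, so a second moment of g directly yields a remainder of order |h|^2. The lemma gives
  access to \<open>grad\<close> of \<open>J0\<close>.\<close>

lemma inv_fourier_has_derivative: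
  fixes g :: "real^'n \<Rightarrow> complex"
  assumes g: "integrable lborel g" and g2: "integrable lborel (\<lambda>\<xi>. (norm \<xi>)\<^sup>2 * cmod (g \<xi>))"
  shows "(inv_fourier g has_derivative (\<lambda>h. inv_fourier (\<lambda>\<xi>. \<i> * complex_of_real (h \<bullet> \<xi>) * g \<xi>) x)) (at x)"
proof -
  note [measurable] = borel_measurable_integrable[OF g, simplified]
  define c where "c = complex_of_real (1 / (2 * pi) ^ CARD('n))"
  define D where "D = (\<lambda>h. inv_fourier (\<lambda>\<xi>. \<i> * complex_of_real (h \<bullet> \<xi>) * g \<xi>) x)"
  define E where "E = (\<lambda>(y :: real^'n) (\<xi> :: real^'n). exp (\<i> * complex_of_real (y \<bullet> \<xi>)))"
  have Em [measurable]: "E y \<in> borel_measurable borel" for y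
    unfolding E_def by (intro borel_measurable_continuous_onI continuous_intros)
  have hm [measurable]: "(\<lambda>\<xi>. complex_of_real (y \<bullet> \<xi>)) \<in> borel_measurable borel" for y :: "real^'n"
    by (intro borel_measurable_continuous_onI continuous_intros)
  have nE: "cmod (E y \<xi>) = 1" for y \<xi> by (simp add: E_def)
  have i1: "integrable lborel (\<lambda>\<xi>. E y \<xi> * g \<xi>)" for y
    by (rule Bochner_Integration.integrable_bound[OF g]) (auto simp: norm_mult nE)
  have ih: "integrable lborel (\<lambda>\<xi>. E x \<xi> * (\<i> * complex_of_real (h \<bullet> \<xi>) * g \<xi>))" for h
  proof (rule Bochner_Integration.integrable_bound)
    show "integrable lborel (\<lambda>\<xi>. norm h * (cmod (g \<xi>) + (norm \<xi>)\<^sup>2 * cmod (g \<xi>)))"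
      using g g2 by (intro integrable_mult_right Bochner_Integration.integrable_add integrable_norm)
    have "\<bar>h \<bullet> \<xi>\<bar> * cmod (g \<xi>) \<le> norm h * (cmod (g \<xi>) + (norm \<xi>)\<^sup>2 * cmod (g \<xi>))" for \<xi>
    proof -
      have "norm \<xi> \<le> 1 + (norm \<xi>)\<^sup>2" using sum_squares_bound[of "norm \<xi>" 1] by (simp add: power2_eq_square) (smt (verit) norm_ge_zero)
      then have "norm h * norm \<xi> \<le> norm h * (1 + (norm \<xi>)\<^sup>2)" by (intro mult_left_mono) auto
      then have "\<bar>h \<bullet> \<xi>\<bar> \<le> norm h * (1 + (norm \<xi>)\<^sup>2)" using Cauchy_Schwarz_ineq2[of h \<xi>] by linarith
      then have "\<bar>h \<bullet> \<xi>\<bar> * cmod (g \<xi>) \<le> norm h * (1 + (norm \<xi>)\<^sup>2) * cmod (g \<xi>)" by (intro mult_right_mono) auto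
      then show ?thesis by (simp add: algebra_simps)
    qed
    then show "AE \<xi> in lborel. norm (E x \<xi> * (\<i> * complex_of_real (h \<bullet> \<xi>) * g \<xi>)) \<le> norm (norm h * (cmod (g \<xi>) + (norm \<xi>)\<^sup>2 * cmod (g \<xi>)))"
      by (auto simp: norm_mult nE intro!: order_trans[OF _ abs_ge_self])
  qed measurable
  have Deq: "D h = c * (LINT \<xi>|lborel. E x \<xi> * (\<i> * complex_of_real (h \<bullet> \<xi>) * g \<xi>))" for h
    by (simp add: D_def inv_fourier_def c_def E_def)
  have Ieq: "inv_fourier g y = c * (LINT \<xi>|lborel. E y \<xi> * g \<xi>)" for y
    by (simp add: inv_fourier_def c_def E_def)
  define K where "K = (LINT \<xi>|lborel. (norm \<xi>)\<^sup>2 * cmod (g \<xi>))"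
  have rem: "cmod (inv_fourier g (x + h) - inv_fourier g x - D h) \<le> cmod c * ((norm h)\<^sup>2 * K)" for h
  proof -
    have "inv_fourier g (x + h) - inv_fourier g x - D h = c * (LINT \<xi>|lborel. E (x + h) \<xi> * g \<xi> - E x \<xi> * g \<xi> - E x \<xi> * (\<i> * complex_of_real (h \<bullet> \<xi>) * g \<xi>))"
      unfolding Deq Ieq using i1 ih by (simp add: right_diff_distrib)
    note A = this
    have B: "cmod (LINT \<xi>|lborel. E (x + h) \<xi> * g \<xi> - E x \<xi> * g \<xi> - E x \<xi> * (\<i> * complex_of_real (h \<bullet> \<xi>) * g \<xi>)) \<le> (LINT \<xi>|lborel. (norm h)\<^sup>2 * ((norm \<xi>)\<^sup>2 * cmod (g \<xi>)))"
    proof (rule order_trans[OF integral_norm_bound integral_mono'])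
      show "integrable lborel (\<lambda>\<xi>. (norm h)\<^sup>2 * ((norm \<xi>)\<^sup>2 * cmod (g \<xi>)))" using g2 by (intro integrable_mult_right)
      fix \<xi>
      have "E (x + h) \<xi> * g \<xi> - E x \<xi> * g \<xi> - E x \<xi> * (\<i> * complex_of_real (h \<bullet> \<xi>) * g \<xi>) = E x \<xi> * g \<xi> * (E h \<xi> - (1 + \<i> * complex_of_real (h \<bullet> \<xi>)))"
        by (simp add: E_def inner_add_left distrib_left exp_add algebra_simps)
      moreover have "cmod (E h \<xi> - (1 + \<i> * complex_of_real (h \<bullet> \<xi>))) \<le> \<bar>h \<bullet> \<xi>\<bar>\<^sup>2 / 2"
        using iexp_approx1[of "h \<bullet> \<xi>" 1] by (simp add: E_def power2_eq_square)
      moreover have "\<bar>h \<bullet> \<xi>\<bar>\<^sup>2 / 2 \<le> (norm h)\<^sup>2 * (norm \<xi>)\<^sup>2"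
        using power_mono[OF Cauchy_Schwarz_ineq2[of h \<xi>], of 2] by (simp add: power_mult_distrib) (smt (verit) zero_le_power2)
      ultimately have "cmod (E (x + h) \<xi> * g \<xi> - E x \<xi> * g \<xi> - E x \<xi> * (\<i> * complex_of_real (h \<bullet> \<xi>) * g \<xi>)) \<le> cmod (g \<xi>) * ((norm h)\<^sup>2 * (norm \<xi>)\<^sup>2)"
        by (simp add: norm_mult nE mult_left_mono)
      then show "cmod (E (x + h) \<xi> * g \<xi> - E x \<xi> * g \<xi> - E x \<xi> * (\<i> * complex_of_real (h \<bullet> \<xi>) * g \<xi>)) \<le> (norm h)\<^sup>2 * ((norm \<xi>)\<^sup>2 * cmod (g \<xi>))"
        by (simp add: mult_ac)
    qed simp
    have C: "(LINT \<xi>|lborel. (norm h)\<^sup>2 * ((norm \<xi>)\<^sup>2 * cmod (g \<xi>))) = (norm h)\<^sup>2 * K"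
      unfolding K_def by (rule Bochner_Integration.integral_mult_right_zero)
    show ?thesis unfolding A norm_mult using B unfolding C by (intro mult_left_mono) auto
  qed
  have lin: "linear D"
  proof
    fix h h' :: "real^'n" and r :: real
    have "E x \<xi> * (\<i> * complex_of_real ((h + h') \<bullet> \<xi>) * g \<xi>) = E x \<xi> * (\<i> * complex_of_real (h \<bullet> \<xi>) * g \<xi>) + E x \<xi> * (\<i> * complex_of_real (h' \<bullet> \<xi>) * g \<xi>)" for \<xi>
      by (simp add: inner_add_left algebra_simps)
    then show "D (h + h') = D h + D h'" unfolding Deq using ih by (simp add: distrib_left)
    have eq: "E x \<xi> * (\<i> * complex_of_real ((r *\<^sub>R h) \<bullet> \<xi>) * g \<xi>) = complex_of_real r * (E x \<xi> * (\<i> * complex_of_real (h \<bullet> \<xi>) * g \<xi>))" for \<xi>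
      by (simp add: algebra_simps)
    show "D (r *\<^sub>R h) = r *\<^sub>R D h" unfolding Deq eq scaleR_conv_of_real[where 'a = complex] by simp
  qed
  then have bl: "bounded_linear D" by (rule linear_conv_bounded_linear[THEN iffD1])
  have "(inv_fourier g has_derivative D) (at x)"
    unfolding has_derivative_at
  proof (intro conjI bl)
    show "(\<lambda>h. norm (inv_fourier g (x + h) - inv_fourier g x - D h) / norm h) \<midarrow>0\<rightarrow> 0"
    proof (rule tendsto_sandwich[OF _ _ tendsto_const])
      show "\<forall>\<^sub>F h in at 0. norm (inv_fourier g (x + h) - inv_fourier g x - D h) / norm h \<le> cmod c * K * norm h"
      proof (rule always_eventually, rule allI)
        fix h
        show "norm (inv_fourier g (x + h) - inv_fourier g x - D h) / norm h \<le> cmod c * K * norm h"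
        proof (cases "h = 0")
          case False
          then show ?thesis using rem[of h] by (simp add: divide_simps power2_eq_square mult_ac)
        qed simp
      qed
      have "((\<lambda>h::real^'n. cmod c * K * norm h) \<longlongrightarrow> cmod c * K * norm (0::real^'n)) (at 0)" by (intro tendsto_intros)
      then show "((\<lambda>h::real^'n. cmod c * K * norm h) \<longlongrightarrow> 0) (at 0)" by simp
    qed simp
  qed
  then show ?thesis by (simp only: D_def)
qed

section \<open>Behaviour of the data at low frequencies\<close>

lemma L1_space_iff: "f \<in> L1_space \<longleftrightarrow> integrable lborel f" by (simp add: L1_space_def)

lemma L11_spaceD:
  assumes "f \<in> L11_space"
  shows "integrable lborel f" "integrable lborel (\<lambda>x. norm x * \<bar>f x\<bar>)"
    "L1_norm f \<le> L11_norm f" "(LINT x|lborel. norm x * \<bar>f x\<bar>) \<le> L11_norm f"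
proof -
  have f: "integrable lborel f" and w: "integrable lborel (\<lambda>x. (1 + norm x) * \<bar>f x\<bar>)"
    using assms by (auto simp: L11_space_def L1_space_def)
  note [measurable] = borel_measurable_integrable[OF f]
  show "integrable lborel f" by fact
  show i: "integrable lborel (\<lambda>x. norm x * \<bar>f x\<bar>)"
  proof (rule Bochner_Integration.integrable_bound[OF w])
    show "AE x in lborel. norm (norm x * \<bar>f x\<bar>) \<le> norm ((1 + norm x) * \<bar>f x\<bar>)"
      by (intro AE_I2) (simp add: abs_mult mult_right_mono)
  qed measurable
  show "L1_norm f \<le> L11_norm f" unfolding L1_norm_def L11_norm_def
    using f by (intro integral_mono w integrable_norm) (auto simp: algebra_simps)
  show "(LINT x|lborel. norm x * \<bar>f x\<bar>) \<le> L11_norm f" unfolding L11_norm_def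
    using i by (intro integral_mono w) (auto simp: algebra_simps)
qed

lemma fourier_real_bound:
  assumes "integrable lborel f"
  shows "cmod (fourier_real f \<xi>) \<le> L1_norm f"
  using fourier_norm_le[of "\<lambda>x. complex_of_real (f x)"] assms by (simp add: L1_norm_def)

lemma P_mean_bound: "\<bar>P_mean f\<bar> \<le> L1_norm f"
  unfolding P_mean_def L1_norm_def using integral_norm_bound[of lborel f] by simp

lemma M_mean_bound:
  assumes "f \<in> L11_space"
  shows "norm (M_mean f) \<le> L11_norm f"
proof -
  have "norm (M_mean f) \<le> (LINT x|lborel. norm (f x *\<^sub>R x))" unfolding M_mean_def by (rule integral_norm_bound)
  also have "\<dots> = (LINT x|lborel. norm x * \<bar>f x\<bar>)" by (simp add: mult.commute)
  finally show ?thesis using L11_spaceD(4)[OF assms] by simp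
qed

definition kern :: "real^'n \<Rightarrow> real^'n \<Rightarrow> complex" where
  "kern \<xi> x = exp (- (\<i> * complex_of_real (x \<bullet> \<xi>)))"

text \<open>The quadratic and the linear bound on the same remainder have different uses: the first
  gives the pointwise limit after division by |\<xi>|, the second a dominating function that costs a
  first moment only.\<close>

lemma kern_props:
  "cmod (kern \<xi> x) = 1" "cmod (kern \<xi> x - 1) \<le> norm x * norm \<xi>"
  "cmod (kern \<xi> x - 1 + \<i> * complex_of_real (x \<bullet> \<xi>)) \<le> (norm x * norm \<xi>)\<^sup>2 / 2"
  "cmod (kern \<xi> x - 1 + \<i> * complex_of_real (x \<bullet> \<xi>)) \<le> 2 * (norm x * norm \<xi>)"
proof -
  have k: "kern \<xi> x = exp (\<i> * complex_of_real (- (x \<bullet> \<xi>)))" by (simp add: kern_def)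
  show "cmod (kern \<xi> x) = 1" by (simp add: kern_def)
  have cs: "\<bar>x \<bullet> \<xi>\<bar> \<le> norm x * norm \<xi>" by (rule Cauchy_Schwarz_ineq2)
  have "cmod (kern \<xi> x - 1) \<le> \<bar>x \<bullet> \<xi>\<bar>" using iexp_approx1[of "- (x \<bullet> \<xi>)" 0] by (simp add: k)
  then show 1: "cmod (kern \<xi> x - 1) \<le> norm x * norm \<xi>" using cs by linarith
  have "cmod (kern \<xi> x - 1 + \<i> * complex_of_real (x \<bullet> \<xi>)) \<le> \<bar>x \<bullet> \<xi>\<bar>\<^sup>2 / 2"
    using iexp_approx1[of "- (x \<bullet> \<xi>)" 1] by (simp add: k power2_eq_square algebra_simps)
  also have "\<dots> \<le> (norm x * norm \<xi>)\<^sup>2 / 2" using cs by (intro divide_right_mono power_mono) auto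
  finally show "cmod (kern \<xi> x - 1 + \<i> * complex_of_real (x \<bullet> \<xi>)) \<le> (norm x * norm \<xi>)\<^sup>2 / 2" .
  have "cmod (kern \<xi> x - 1 + \<i> * complex_of_real (x \<bullet> \<xi>)) \<le> cmod (kern \<xi> x - 1) + \<bar>x \<bullet> \<xi>\<bar>"
    by (rule order_trans[OF norm_triangle_ineq]) (simp add: norm_mult)
  then show "cmod (kern \<xi> x - 1 + \<i> * complex_of_real (x \<bullet> \<xi>)) \<le> 2 * (norm x * norm \<xi>)" using 1 cs by linarith
qed

lemma kern_measurable [measurable]: "(\<lambda>x. kern \<xi> x) \<in> borel_measurable borel"
  unfolding kern_def by (intro borel_measurable_continuous_onI continuous_intros)

lemma fourier_minus_mean:
  assumes f: "integrable lborel f"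
  shows "fourier_real f \<xi> - complex_of_real (P_mean f) = (LINT x|lborel. (kern \<xi> x - 1) * complex_of_real (f x))"
proof -
  have i: "integrable lborel (\<lambda>x. kern \<xi> x * complex_of_real (f x))"
    using integrable_kernel[of "\<lambda>x. complex_of_real (f x)"] f by (simp add: kern_def)
  have "(LINT x|lborel. (kern \<xi> x - 1) * complex_of_real (f x)) = (LINT x|lborel. kern \<xi> x * complex_of_real (f x)) - (LINT x|lborel. complex_of_real (f x))"
    using i f by (simp add: left_diff_distrib)
  then show ?thesis by (simp add: fourier_def kern_def P_mean_def)
qed

text \<open>Dominated convergence with the bound 2 |f|. Without a first moment, as for \<psi>0,
  there is no rate; this is one source of the o in the final estimate.\<close>

lemma fourier_tendsto_mean:
  fixes f :: "real^'n \<Rightarrow> real"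
  assumes f: "integrable lborel f"
  shows "((\<lambda>\<xi>. cmod (fourier_real f \<xi> - complex_of_real (P_mean f))) \<longlongrightarrow> 0) (at 0)"
proof -
  note [measurable] = borel_measurable_integrable[OF f, simplified]
  have "((\<lambda>\<xi>. fourier_real f \<xi> - complex_of_real (P_mean f)) \<longlongrightarrow> (LINT x|(lborel :: (real^'n) measure). 0)) (at 0)"
    unfolding fourier_minus_mean[OF f] tendsto_at_iff_sequentially
  proof (intro allI impI, unfold comp_def, rule integral_dominated_convergence)
    fix X :: "nat \<Rightarrow> real^'n" assume X: "X \<longlonglongrightarrow> 0"
    show "integrable lborel (\<lambda>x. 2 * \<bar>f x\<bar>)" using f by simp
    show "AE x in lborel. (\<lambda>n. (kern (X n) x - 1) * complex_of_real (f x)) \<longlonglongrightarrow> 0"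
    proof (rule AE_I2)
      fix x
      have "(\<lambda>n. cmod ((kern (X n) x - 1) * complex_of_real (f x))) \<longlonglongrightarrow> 0"
      proof (rule tendsto_sandwich[OF _ _ tendsto_const])
        have "(\<lambda>n. norm x * norm (X n) * \<bar>f x\<bar>) \<longlonglongrightarrow> norm x * norm (0 :: real^'n) * \<bar>f x\<bar>" by (intro tendsto_intros X)
        then show "(\<lambda>n. norm x * norm (X n) * \<bar>f x\<bar>) \<longlonglongrightarrow> 0" by simp
        show "\<forall>\<^sub>F n in sequentially. cmod ((kern (X n) x - 1) * complex_of_real (f x)) \<le> norm x * norm (X n) * \<bar>f x\<bar>"
        proof (intro always_eventually allI)
          fix n
          show "cmod ((kern (X n) x - 1) * complex_of_real (f x)) \<le> norm x * norm (X n) * \<bar>f x\<bar>"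
            using mult_right_mono[OF kern_props(2)[of "X n" x], of "\<bar>f x\<bar>"] by (simp add: norm_mult)
        qed
      qed simp
      then show "(\<lambda>n. (kern (X n) x - 1) * complex_of_real (f x)) \<longlonglongrightarrow> 0" by (rule tendsto_norm_zero_cancel)
    qed
    show "AE x in lborel. norm ((kern (X n) x - 1) * complex_of_real (f x)) \<le> 2 * \<bar>f x\<bar>" for n
    proof (rule AE_I2)
      fix x
      have "cmod (kern (X n) x - 1) \<le> 2" using norm_triangle_ineq4[of "kern (X n) x" 1] kern_props(1)[of "X n" x] by simp
      then show "norm ((kern (X n) x - 1) * complex_of_real (f x)) \<le> 2 * \<bar>f x\<bar>" by (simp add: norm_mult mult_right_mono)
    qed
  qed measurable
  then show ?thesis using tendsto_norm_zero by fastforce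
qed

lemma fourier_minus_mean_bound:
  assumes f: "f \<in> L11_space"
  shows "cmod (fourier_real f \<xi> - complex_of_real (P_mean f)) \<le> norm \<xi> * L11_norm f"
proof -
  have "cmod (fourier_real f \<xi> - complex_of_real (P_mean f)) \<le> (LINT x|lborel. norm \<xi> * (norm x * \<bar>f x\<bar>))"
    unfolding fourier_minus_mean[OF L11_spaceD(1)[OF f]]
  proof (rule order_trans[OF integral_norm_bound integral_mono'])
    show "integrable lborel (\<lambda>x. norm \<xi> * (norm x * \<bar>f x\<bar>))" using L11_spaceD(2)[OF f] by (intro integrable_mult_right)
    show "norm ((kern \<xi> x - 1) * complex_of_real (f x)) \<le> norm \<xi> * (norm x * \<bar>f x\<bar>)" for x
      using mult_right_mono[OF kern_props(2)[of \<xi> x], of "\<bar>f x\<bar>"] by (simp add: norm_mult mult_ac)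
  qed simp
  also have "\<dots> = norm \<xi> * (LINT x|lborel. norm x * \<bar>f x\<bar>)" by (rule Bochner_Integration.integral_mult_right_zero)
  also have "\<dots> \<le> norm \<xi> * L11_norm f" using L11_spaceD(4)[OF f] by (intro mult_left_mono) auto
  finally show ?thesis .
qed

text \<open>After division by |\<xi>| the integrand tends to 0 pointwise and is dominated by 2 |x|
  |f(x)|.\<close>

lemma fourier_first_order:
  fixes f :: "real^'n \<Rightarrow> real"
  assumes f: "f \<in> L11_space"
  shows "((\<lambda>\<xi>. cmod (fourier_real f \<xi> - complex_of_real (P_mean f) + \<i> * complex_of_real (M_mean f \<bullet> \<xi>)) / norm \<xi>) \<longlongrightarrow> 0) (at 0)"
proof -
  note fi = L11_spaceD(1)[OF f] and fx = L11_spaceD(2)[OF f]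
  note [measurable] = borel_measurable_integrable[OF fi, simplified]
  have Mi: "integrable lborel (\<lambda>x. f x *\<^sub>R x)"
    by (rule Bochner_Integration.integrable_bound[OF fx]) (auto simp: mult.commute)
  have eq: "fourier_real f \<xi> - complex_of_real (P_mean f) + \<i> * complex_of_real (M_mean f \<bullet> \<xi>) =
     (LINT x|lborel. (kern \<xi> x - 1 + \<i> * complex_of_real (x \<bullet> \<xi>)) * complex_of_real (f x))" for \<xi>
  proof -
    have i1: "integrable lborel (\<lambda>x. (kern \<xi> x - 1) * complex_of_real (f x))"
      using integrable_kernel[of "\<lambda>x. complex_of_real (f x)" \<xi>] fi by (simp add: kern_def left_diff_distrib)
    have i2: "integrable lborel (\<lambda>x. f x * (x \<bullet> \<xi>))" using integrable_inner_left[OF Mi, of \<xi>] by simp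
    have "M_mean f \<bullet> \<xi> = (LINT x|lborel. f x * (x \<bullet> \<xi>))"
      unfolding M_mean_def using integral_inner_left[of \<xi> lborel "\<lambda>x. f x *\<^sub>R x"] Mi by simp
    then have Meq: "\<i> * complex_of_real (M_mean f \<bullet> \<xi>) = (LINT x|lborel. \<i> * complex_of_real (f x * (x \<bullet> \<xi>)))"
      by (simp only: integral_complex_of_real Bochner_Integration.integral_mult_right_zero)
    have i3: "integrable lborel (\<lambda>x. \<i> * complex_of_real (f x * (x \<bullet> \<xi>)))"
      by (intro integrable_mult_right integrable_of_real i2)
    have pt: "(kern \<xi> x - 1 + \<i> * complex_of_real (x \<bullet> \<xi>)) * complex_of_real (f x) =
      (kern \<xi> x - 1) * complex_of_real (f x) + \<i> * complex_of_real (f x * (x \<bullet> \<xi>))" for x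
      by (simp add: distrib_right)
    show ?thesis unfolding fourier_minus_mean[OF fi] Meq pt
      by (rule Bochner_Integration.integral_add[OF i1 i3, symmetric])
  qed
  have "((\<lambda>\<xi>. LINT x|lborel. cmod ((kern \<xi> x - 1 + \<i> * complex_of_real (x \<bullet> \<xi>)) * complex_of_real (f x)) / norm \<xi>) \<longlongrightarrow> (LINT x|(lborel :: (real^'n) measure). 0)) (at 0)"
    unfolding tendsto_at_iff_sequentially
  proof (intro allI impI, unfold comp_def, rule integral_dominated_convergence)
    fix X :: "nat \<Rightarrow> real^'n" assume X: "X \<longlonglongrightarrow> 0" and X0: "\<forall>i. X i \<in> UNIV - {0}"
    show "integrable lborel (\<lambda>x. 2 * (norm x * \<bar>f x\<bar>))" using fx by simp
    have Xp: "norm (X n) > 0" for n using X0 by auto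
    show "AE x in lborel. (\<lambda>n. cmod ((kern (X n) x - 1 + \<i> * complex_of_real (x \<bullet> X n)) * complex_of_real (f x)) / norm (X n)) \<longlonglongrightarrow> 0"
    proof (rule AE_I2)
      fix x
      show "(\<lambda>n. cmod ((kern (X n) x - 1 + \<i> * complex_of_real (x \<bullet> X n)) * complex_of_real (f x)) / norm (X n)) \<longlonglongrightarrow> 0"
      proof (rule tendsto_sandwich[OF _ _ tendsto_const])
        have "(\<lambda>n. (norm x)\<^sup>2 * norm (X n) * \<bar>f x\<bar>) \<longlonglongrightarrow> (norm x)\<^sup>2 * norm (0 :: real^'n) * \<bar>f x\<bar>" by (intro tendsto_intros X)
        then show "(\<lambda>n. (norm x)\<^sup>2 * norm (X n) * \<bar>f x\<bar>) \<longlonglongrightarrow> 0" by simp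
        show "\<forall>\<^sub>F n in sequentially. cmod ((kern (X n) x - 1 + \<i> * complex_of_real (x \<bullet> X n)) * complex_of_real (f x)) / norm (X n) \<le> (norm x)\<^sup>2 * norm (X n) * \<bar>f x\<bar>"
        proof (intro always_eventually allI)
          fix n
          have "cmod (kern (X n) x - 1 + \<i> * complex_of_real (x \<bullet> X n)) * \<bar>f x\<bar> \<le> (norm x * norm (X n))\<^sup>2 * \<bar>f x\<bar>"
            by (intro mult_right_mono order_trans[OF kern_props(3)]) auto
          then have "cmod (kern (X n) x - 1 + \<i> * complex_of_real (x \<bullet> X n)) * \<bar>f x\<bar> / norm (X n) \<le> (norm x * norm (X n))\<^sup>2 * \<bar>f x\<bar> / norm (X n)"
            by (intro divide_right_mono) auto
          also have "\<dots> = (norm x)\<^sup>2 * norm (X n) * \<bar>f x\<bar>" using Xp[of n] by (simp add: power2_eq_square field_simps)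
          finally show "cmod ((kern (X n) x - 1 + \<i> * complex_of_real (x \<bullet> X n)) * complex_of_real (f x)) / norm (X n) \<le> (norm x)\<^sup>2 * norm (X n) * \<bar>f x\<bar>"
            by (simp add: norm_mult)
        qed
      qed simp
    qed
    show "AE x in lborel. norm (cmod ((kern (X n) x - 1 + \<i> * complex_of_real (x \<bullet> X n)) * complex_of_real (f x)) / norm (X n)) \<le> 2 * (norm x * \<bar>f x\<bar>)" for n
    proof (rule AE_I2)
      fix x
      have "cmod (kern (X n) x - 1 + \<i> * complex_of_real (x \<bullet> X n)) * \<bar>f x\<bar> / norm (X n) \<le> 2 * (norm x * norm (X n)) * \<bar>f x\<bar> / norm (X n)"
        using kern_props(4)[of "X n" x] by (intro divide_right_mono mult_right_mono) auto
      also have "\<dots> = 2 * (norm x * \<bar>f x\<bar>)" using Xp[of n] by simp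
      finally show "norm (cmod ((kern (X n) x - 1 + \<i> * complex_of_real (x \<bullet> X n)) * complex_of_real (f x)) / norm (X n)) \<le> 2 * (norm x * \<bar>f x\<bar>)"
        by (simp add: norm_mult)
    qed
  qed measurable
  then have l: "((\<lambda>\<xi>. LINT x|lborel. cmod ((kern \<xi> x - 1 + \<i> * complex_of_real (x \<bullet> \<xi>)) * complex_of_real (f x)) / norm \<xi>) \<longlongrightarrow> 0) (at 0)"
    by simp
  have le: "cmod (fourier_real f \<xi> - complex_of_real (P_mean f) + \<i> * complex_of_real (M_mean f \<bullet> \<xi>)) / norm \<xi> \<le>
     (LINT x|lborel. cmod ((kern \<xi> x - 1 + \<i> * complex_of_real (x \<bullet> \<xi>)) * complex_of_real (f x)) / norm \<xi>)" for \<xi>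
    unfolding eq Bochner_Integration.integral_divide_zero by (intro divide_right_mono integral_norm_bound) simp
  show ?thesis
    by (rule tendsto_sandwich[OF always_eventually always_eventually tendsto_const l]) (use le in auto)
qed

section \<open>Parabolic rescaling of Gaussian integrals\<close>

lemma scale_sqrt_integral:
  fixes f :: "real^'n \<Rightarrow> 'b::{banach, second_countable_topology}"
  assumes f: "f \<in> borel_measurable borel" and t: "t > 0"
  shows "(LINT \<xi>|lborel. f \<xi>) = t powr (- (real CARD('n) / 2)) *\<^sub>R (LINT y|lborel. f ((1 / sqrt t) *\<^sub>R y))"
proof -
  have "\<bar>1 / sqrt t\<bar> ^ CARD('n) = t powr (- (real CARD('n) / 2))"
    using t by (simp add: powr_minus powr_half_sqrt[symmetric] powr_powr power_divide field_simps flip: powr_realpow)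
  then show ?thesis using integral_lborel_affine[OF f, of "1 / sqrt t" 0] t by simp
qed

lemma gaussian_integrable:
  assumes c: "c > 0"
  shows "integrable lborel (\<lambda>\<xi>::real^'n. exp (- c * (norm \<xi>)\<^sup>2))"
proof -
  have "integrable lborel (\<lambda>x::real^'n. cmod (gauss (sqrt (2 * c) *\<^sub>R x)))"
    using c by (intro integrable_norm fourier_gauss_scaled(1)) simp
  moreover have "cmod (gauss (sqrt (2 * c) *\<^sub>R x)) = exp (- c * (norm x)\<^sup>2)" for x :: "real^'n"
    using c by (simp add: gauss_def power_mult_distrib)
  ultimately show ?thesis by simp
qed

lemma gaussian_integral_scaled:
  assumes c: "c > 0" and t: "t > 0"
  shows "integrable lborel (\<lambda>\<xi>::real^'n. exp (- c * (norm \<xi>)\<^sup>2 * t))"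
    "(LINT \<xi>|lborel. exp (- c * (norm (\<xi>::real^'n))\<^sup>2 * t)) = t powr (- (real CARD('n) / 2)) * (LINT \<xi>|lborel. exp (- c * (norm (\<xi>::real^'n))\<^sup>2))"
proof -
  show "integrable lborel (\<lambda>\<xi>::real^'n. exp (- c * (norm \<xi>)\<^sup>2 * t))"
    using gaussian_integrable[of "c * t", where 'n='n] c t by (simp add: mult_ac)
  have "(\<lambda>\<xi>::real^'n. exp (- c * (norm \<xi>)\<^sup>2 * t)) \<in> borel_measurable borel" by measurable
  from scale_sqrt_integral[OF this t]
  show "(LINT \<xi>|lborel. exp (- c * (norm (\<xi>::real^'n))\<^sup>2 * t)) = t powr (- (real CARD('n) / 2)) * (LINT \<xi>|lborel. exp (- c * (norm (\<xi>::real^'n))\<^sup>2))"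
    using t by (simp add: power_mult_distrib power_divide)
qed

text \<open>After the parabolic rescaling only the behaviour of \<open>\<eta>\<close> at the origin survives.\<close>

lemma gaussian_concentration:
  fixes \<eta> :: "real^'n \<Rightarrow> real"
  assumes [measurable]: "\<eta> \<in> borel_measurable borel" and b: "\<And>\<xi>. \<bar>\<eta> \<xi>\<bar> \<le> B"
    and lim: "(\<eta> \<longlongrightarrow> 0) (at 0)" and c: "c > 0"
  shows "((\<lambda>t. t powr (real CARD('n) / 2) * (LINT \<xi>|lborel. exp (- c * (norm \<xi>)\<^sup>2 * t) * \<eta> \<xi>)) \<longlongrightarrow> 0) at_top"
proof -
  have "((\<lambda>t. LINT y|lborel. exp (- c * (norm y)\<^sup>2) * \<eta> ((1 / sqrt t) *\<^sub>R y)) \<longlongrightarrow> (LINT y|(lborel :: (real^'n) measure). 0)) at_top"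
  proof (rule integral_dominated_convergence_at_top)
    show "integrable lborel (\<lambda>y::real^'n. exp (- c * (norm y)\<^sup>2) * B)"
      using gaussian_integrable[OF c] by (intro integrable_mult_left)
    show "\<forall>\<^sub>F t in at_top. AE y in lborel. norm (exp (- c * (norm y)\<^sup>2) * \<eta> ((1 / sqrt t) *\<^sub>R y)) \<le> exp (- c * (norm y)\<^sup>2) * B"
      using b by (intro always_eventually allI AE_I2) (simp add: abs_mult)
    show "AE y in lborel. ((\<lambda>t. exp (- c * (norm y)\<^sup>2) * \<eta> ((1 / sqrt t) *\<^sub>R y)) \<longlongrightarrow> 0) at_top"
    proof (rule AE_I[of _ _ "{0}"])
      have "((\<lambda>t. exp (- c * (norm y)\<^sup>2) * \<eta> ((1 / sqrt t) *\<^sub>R y)) \<longlongrightarrow> 0) at_top" if y: "y \<noteq> 0" for y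
      proof -
        have "((\<lambda>t. 1 / sqrt t) \<longlongrightarrow> 0) at_top" by real_asymp
        then have "((\<lambda>t. (1 / sqrt t) *\<^sub>R y) \<longlongrightarrow> 0 *\<^sub>R y) at_top" by (intro tendsto_scaleR tendsto_const)
        moreover have "\<forall>\<^sub>F t in at_top. (1 / sqrt t) *\<^sub>R y \<noteq> 0"
          using eventually_gt_at_top[of 0] by eventually_elim (use y in simp)
        ultimately have "filterlim (\<lambda>t. (1 / sqrt t) *\<^sub>R y) (at 0) at_top" by (simp add: filterlim_at)
        from tendsto_mult_right_zero[OF filterlim_compose[OF lim this]] show ?thesis .
      qed
      then show "{y \<in> space lborel. \<not> ((\<lambda>t. exp (- c * (norm y)\<^sup>2) * \<eta> ((1 / sqrt t) *\<^sub>R y)) \<longlongrightarrow> 0) at_top} \<subseteq> {0}" by auto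
    qed simp_all
  qed measurable
  then have l: "((\<lambda>t. LINT y|lborel. exp (- c * (norm y)\<^sup>2) * \<eta> ((1 / sqrt t) *\<^sub>R y)) \<longlongrightarrow> 0) at_top" by simp
  have "\<forall>\<^sub>F t in at_top. (LINT y|lborel. exp (- c * (norm y)\<^sup>2) * \<eta> ((1 / sqrt t) *\<^sub>R y)) =
      t powr (real CARD('n) / 2) * (LINT \<xi>|lborel. exp (- c * (norm \<xi>)\<^sup>2 * t) * \<eta> \<xi>)"
    using eventually_gt_at_top[of 0]
  proof eventually_elim
    case (elim t)
    have "(\<lambda>\<xi>. exp (- c * (norm \<xi>)\<^sup>2 * t) * \<eta> \<xi>) \<in> borel_measurable borel" by measurable
    from scale_sqrt_integral[OF this elim]
    have "(LINT \<xi>|lborel. exp (- c * (norm \<xi>)\<^sup>2 * t) * \<eta> \<xi>) = t powr (- (real CARD('n) / 2)) * (LINT y|lborel. exp (- c * (norm y)\<^sup>2) * \<eta> ((1 / sqrt t) *\<^sub>R y))"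
      using elim by (simp add: power_mult_distrib power_divide)
    then show ?case using elim by (simp add: powr_minus)
  qed
  from tendsto_cong[OF this] l show ?thesis by simp
qed

section \<open>Lower bound for the second profile\<close>

text \<open>By explicit primitives the mean over [1, 2] is 1 / 2 up to two boundary terms, each at
  most 1 / (4 b) \<le> 1 / 8.\<close>

lemma mean_square_oscillation:
  fixes b :: real
  assumes b: "b \<ge> 2"
  shows "(\<integral>\<^sup>+l. ennreal ((sin (b * l))\<^sup>2) * indicator {1..2} l \<partial>lborel) \<ge> ennreal (1/4)"
    and "(\<integral>\<^sup>+l. ennreal ((cos (b * l))\<^sup>2) * indicator {1..2} l \<partial>lborel) \<ge> ennreal (1/4)"
proof -
  have db: "sin (4 * b) / (4 * b) \<le> 1/8" "- (1/8) \<le> sin (4 * b) / (4 * b)" "sin (2 * b) / (4 * b) \<le> 1/8" "- (1/8) \<le> sin (2 * b) / (4 * b)"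
  proof -
    have "sin x / (4 * b) \<le> 1/8 \<and> - (1/8) \<le> sin x / (4 * b)" for x
    proof -
      have "2 * sin x \<le> b" "- b \<le> 2 * sin x" using b sin_le_one[of x] sin_ge_minus_one[of x] by linarith+
      then show ?thesis using b by (simp add: field_simps)
    qed
    then show "sin (4 * b) / (4 * b) \<le> 1/8" "- (1/8) \<le> sin (4 * b) / (4 * b)" "sin (2 * b) / (4 * b) \<le> 1/8" "- (1/8) \<le> sin (2 * b) / (4 * b)"
      by blast+
  qed
  have "(\<integral>\<^sup>+l. ennreal ((sin (b * l))\<^sup>2) * indicator {1..2} l \<partial>lborel) = ennreal ((2 / 2 - sin (2 * b * 2) / (4 * b)) - (1 / 2 - sin (2 * b * 1) / (4 * b)))"
  proof (rule nn_integral_FTC_Icc)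
    fix l :: real
    have eq: "(sin (b * l))\<^sup>2 = 1 / 2 - cos (2 * (b * l)) / 2" using cos_double_sin[of "b * l"] by (simp add: field_simps)
    show "((\<lambda>l. l / 2 - sin (2 * b * l) / (4 * b)) has_real_derivative (sin (b * l))\<^sup>2) (at l)"
      unfolding eq using b by (auto intro!: derivative_eq_intros simp: mult_ac)
  qed auto
  also have "\<dots> \<ge> ennreal (1/4)" using db by (intro ennreal_leI) (simp add: mult.commute)
  finally show "(\<integral>\<^sup>+l. ennreal ((sin (b * l))\<^sup>2) * indicator {1..2} l \<partial>lborel) \<ge> ennreal (1/4)" .
  have "(\<integral>\<^sup>+l. ennreal ((cos (b * l))\<^sup>2) * indicator {1..2} l \<partial>lborel) = ennreal ((2 / 2 + sin (2 * b * 2) / (4 * b)) - (1 / 2 + sin (2 * b * 1) / (4 * b)))"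
  proof (rule nn_integral_FTC_Icc)
    fix l :: real
    have eq: "(cos (b * l))\<^sup>2 = 1 / 2 + cos (2 * (b * l)) / 2" using cos_double_cos[of "b * l"] by (simp add: field_simps)
    show "((\<lambda>l. l / 2 + sin (2 * b * l) / (4 * b)) has_real_derivative (cos (b * l))\<^sup>2) (at l)"
      unfolding eq using b by (auto intro!: derivative_eq_intros simp: mult_ac)
  qed auto
  also have "\<dots> \<ge> ennreal (1/4)" using db by (intro ennreal_leI) (simp add: mult.commute)
  finally show "(\<integral>\<^sup>+l. ennreal ((cos (b * l))\<^sup>2) * indicator {1..2} l \<partial>lborel) \<ge> ennreal (1/4)" .
qed

text \<open>Averaging over the dilations \<open>\<xi> \<mapsto> \<lambda> \<xi>\<close> with \<open>1 \<le> \<lambda> \<le> 2\<close> replaces the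
  Riemann--Lebesgue lemma and gives a bound that is uniform in \<open>G\<close>.\<close>

lemma oscillation_lower_bound:
  fixes G :: "real^'n \<Rightarrow> real" and w :: "real \<Rightarrow> real"
  assumes G [measurable]: "G \<in> borel_measurable borel" and w [measurable]: "w \<in> borel_measurable borel"
    and w0: "\<And>x. 0 \<le> w x"
    and avg: "\<And>b. b \<ge> 2 \<Longrightarrow> ennreal (1/4) \<le> (\<integral>\<^sup>+l. ennreal (w (b * l)) * indicator {1..2} l \<partial>lborel)"
    and t: "t > 0" and k: "k > 0" and g0: "g0 \<ge> 0"
    and S [measurable]: "S \<in> sets borel" and vol: "emeasure lborel S \<ge> 1"
    and low: "\<And>y l. y \<in> S \<Longrightarrow> 1 \<le> l \<Longrightarrow> l \<le> 2 \<Longrightarrow> g0 \<le> G ((l / sqrt t) *\<^sub>R y)"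
    and freq: "\<And>y. y \<in> S \<Longrightarrow> 2 \<le> k * sqrt t * norm y"
  shows "ennreal (t powr (- (real CARD('n) / 2)) * g0 / 4) \<le> (\<integral>\<^sup>+\<xi>. ennreal (G \<xi> * w (k * norm \<xi> * t)) \<partial>lborel)"
proof -
  define I where "I = (\<integral>\<^sup>+\<xi>. ennreal (G \<xi> * w (k * norm \<xi> * t)) \<partial>lborel)"
  define T where "T = t powr (- (real CARD('n) / 2))"
  have T0: "T \<ge> 0" by (simp add: T_def)
  \<comment> \<open>For each dilation l the substitution \<xi> = (l / sqrt t) y shows that
    \<open>I\<close> dominates the integral over \<open>S\<close> with the phase multiplied by l.
    Since \<open>I\<close> does not depend on l, the left-hand side can afterwards be averaged over
    l.\<close>
  have step: "ennreal (T * g0) * (\<integral>\<^sup>+y. ennreal (w (k * sqrt t * norm y * l)) * indicator S y \<partial>lborel) \<le> I"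
    if l: "1 \<le> l" "l \<le> 2" for l
  proof -
    have c: "l / sqrt t \<noteq> 0" "l / sqrt t > 0" using t l by auto
    have arg: "k * norm ((l / sqrt t) *\<^sub>R y) * t = k * sqrt t * norm y * l" for y :: "real^'n"
      using t l by (simp add: field_simps)
    have "T \<le> (l / sqrt t) ^ CARD('n)"
    proof -
      have "T = (1 / sqrt t) ^ CARD('n)"
        unfolding T_def using t by (simp add: powr_minus powr_half_sqrt[symmetric] powr_powr power_divide field_simps flip: powr_realpow)
      also have "\<dots> \<le> (l / sqrt t) ^ CARD('n)" using l t by (intro power_mono divide_right_mono) auto
      finally show ?thesis .
    qed
    then have T1: "ennreal T \<le> ennreal (\<bar>l / sqrt t\<bar> ^ CARD('n))" unfolding abs_of_pos[OF c(2)] by (rule ennreal_leI)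
    have "ennreal (T * g0) * (\<integral>\<^sup>+y. ennreal (w (k * sqrt t * norm y * l)) * indicator S y \<partial>lborel)
      = ennreal T * (\<integral>\<^sup>+y. ennreal g0 * (ennreal (w (k * sqrt t * norm y * l)) * indicator S y) \<partial>lborel)"
      using T0 g0 by (subst nn_integral_cmult) (auto simp: ennreal_mult mult.assoc)
    also have "\<dots> \<le> ennreal (\<bar>l / sqrt t\<bar> ^ CARD('n)) * (\<integral>\<^sup>+y. ennreal (G (0 + (l / sqrt t) *\<^sub>R y) * w (k * norm (0 + (l / sqrt t) *\<^sub>R y) * t)) \<partial>lborel)"
    proof (intro mult_mono T1 nn_integral_mono)
      fix y
      show "ennreal g0 * (ennreal (w (k * sqrt t * norm y * l)) * indicator S y) \<le> ennreal (G (0 + (l / sqrt t) *\<^sub>R y) * w (k * norm (0 + (l / sqrt t) *\<^sub>R y) * t))"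
      proof (cases "y \<in> S")
        case True
        have "g0 * w (k * sqrt t * norm y * l) \<le> G ((l / sqrt t) *\<^sub>R y) * w (k * sqrt t * norm y * l)"
          using low[OF True l] w0 by (intro mult_right_mono)
        then show ?thesis using True g0 w0 unfolding add_0_left arg by (simp add: ennreal_leI flip: ennreal_mult)
      qed simp
    qed auto
    also have "\<dots> = I"
      unfolding I_def using nn_integral_lborel_affine[of "\<lambda>\<xi>. ennreal (G \<xi> * w (k * norm \<xi> * t))" "l / sqrt t" 0] c by simp
    finally show ?thesis .
  qed
  have "ennreal (1/4) * 1 \<le> ennreal (1/4) * emeasure lborel S"
    using vol by (intro mult_left_mono) auto
  also have "ennreal (1/4) * emeasure lborel S = (\<integral>\<^sup>+y. ennreal (1/4) * indicator S y \<partial>lborel)"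
    by (simp add: nn_integral_cmult_indicator)
  also have "\<dots> \<le> (\<integral>\<^sup>+y. (\<integral>\<^sup>+l. ennreal (w (k * sqrt t * norm y * l)) * indicator {1..2} l \<partial>lborel) * indicator S y \<partial>lborel)"
    using avg freq by (intro nn_integral_mono) (auto simp: indicator_def)
  also have "\<dots> = (\<integral>\<^sup>+y. (\<integral>\<^sup>+l. ennreal (w (k * sqrt t * norm y * l)) * indicator {1..2} l * indicator S y \<partial>lborel) \<partial>lborel)"
    by (intro nn_integral_cong nn_integral_multc[symmetric]) measurable
  also have "\<dots> = (\<integral>\<^sup>+l. (\<integral>\<^sup>+y. ennreal (w (k * sqrt t * norm y * l)) * indicator {1..2} l * indicator S y \<partial>lborel) \<partial>lborel)"
    by (rule lborel_pair.Fubini') measurable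
  also have "\<dots> = (\<integral>\<^sup>+l. (\<integral>\<^sup>+y. ennreal (w (k * sqrt t * norm y * l)) * indicator S y \<partial>lborel) * indicator {1..2} l \<partial>lborel)"
    by (intro nn_integral_cong, subst nn_integral_multc[symmetric]) (auto simp: mult_ac)
  finally have A: "ennreal (1/4) * 1 \<le> \<dots>" .
  have "ennreal (T * g0 / 4) = ennreal (T * g0 * (1/4))" by simp
  also have "\<dots> = ennreal (T * g0) * ennreal (1/4)" using T0 g0 by (intro ennreal_mult) auto
  also have "\<dots> \<le> ennreal (T * g0) * (\<integral>\<^sup>+l. (\<integral>\<^sup>+y. ennreal (w (k * sqrt t * norm y * l)) * indicator S y \<partial>lborel) * indicator {1..2} l \<partial>lborel)"
    using mult_left_mono[OF A, of "ennreal (T * g0)"] by (simp only: mult_1_right zero_le)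
  also have "\<dots> = (\<integral>\<^sup>+l. ennreal (T * g0) * (\<integral>\<^sup>+y. ennreal (w (k * sqrt t * norm y * l)) * indicator S y \<partial>lborel) * indicator {1..2} l \<partial>lborel)"
    by (subst nn_integral_cmult[symmetric]) (auto simp: mult_ac)
  also have "\<dots> \<le> (\<integral>\<^sup>+l. I * indicator {1..2::real} l \<partial>lborel)"
    using step by (intro nn_integral_mono) (auto simp: indicator_def)
  also have "\<dots> = I" by (simp add: nn_integral_cmult_indicator)
  finally show ?thesis by (simp add: I_def T_def)
qed

lemma box_norm_bounds:
  fixes y :: "real^'n"
  assumes "\<And>i. p \<le> \<bar>y $ i\<bar> \<and> \<bar>y $ i\<bar> \<le> q" and p: "p \<ge> 0"
  shows "real CARD('n) * p\<^sup>2 \<le> (norm y)\<^sup>2" "(norm y)\<^sup>2 \<le> real CARD('n) * q\<^sup>2"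
proof -
  have ns: "(norm y)\<^sup>2 = (\<Sum>i\<in>UNIV. \<bar>y $ i\<bar>\<^sup>2)"
    by (simp add: norm_vec_def L2_set_def sum_nonneg)
  have "(\<Sum>i\<in>(UNIV::'n set). p\<^sup>2) \<le> (\<Sum>i\<in>UNIV. \<bar>y $ i\<bar>\<^sup>2)" using assms by (intro sum_mono power_mono) auto
  then show "real CARD('n) * p\<^sup>2 \<le> (norm y)\<^sup>2" unfolding ns by simp
  have "(\<Sum>i\<in>UNIV. \<bar>y $ i\<bar>\<^sup>2) \<le> (\<Sum>i\<in>(UNIV::'n set). q\<^sup>2)" using assms by (intro sum_mono power_mono) auto
  then show "(norm y)\<^sup>2 \<le> real CARD('n) * q\<^sup>2" unfolding ns by simp
qed

lemma box_volume:
  fixes l u :: "real^'n"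
  assumes "\<And>i. l $ i + 1 \<le> u $ i"
  shows "emeasure lborel (cbox l u) \<ge> 1"
proof -
  have "l $ i \<le> u $ i" for i using assms[of i] by linarith
  then have ne: "cbox l u \<noteq> {}" by (simp add: interval_ne_empty_cart)
  have "1 \<le> (\<Prod>i\<in>UNIV. u $ i - l $ i)" using assms by (intro prod_ge_1) (simp add: algebra_simps)
  also have "\<dots> = measure lborel (cbox l u)" using content_cbox_cart[OF ne] by simp
  finally have "ennreal 1 \<le> ennreal (measure lborel (cbox l u))" by (rule ennreal_leI)
  moreover have "emeasure lborel (cbox l u) = ennreal (measure lborel (cbox l u))"
    by (rule emeasure_eq_ennreal_measure) (use emeasure_bounded_finite[OF bounded_cbox, of l u] in \<open>simp add: less_top\<close>)
  ultimately show ?thesis by simp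
qed

text \<open>The sin^2 part sees M, the cos^2 part sees x and y. Each is bounded below on a box of
  side at least 1 on which its amplitude cannot degenerate; \<open>oscillation_lower_bound\<close>
  then disposes of the oscillating factor.\<close>

lemma profile_lower_bound:
  fixes \<beta> k :: real
  assumes b: "\<beta> > 0" and k: "k > 0"
  shows "\<exists>c>0. \<exists>T>0. \<forall>t\<ge>T. \<forall>(M::real^'n) x y.
     ennreal (c * t powr (- (real CARD('n) / 2)) * ((norm M)\<^sup>2 + x\<^sup>2 + y\<^sup>2)) \<le>
     (\<integral>\<^sup>+\<xi>. ennreal (exp (- 2 * \<beta> * (norm \<xi>)\<^sup>2 * t) * ((M \<bullet> \<xi>)\<^sup>2 / (k * norm \<xi>)\<^sup>2 * (sin (k * norm \<xi> * t))\<^sup>2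
         + (x + y * (norm \<xi>)\<^sup>2 * t)\<^sup>2 * (cos (k * norm \<xi> * t))\<^sup>2)) \<partial>lborel)"
proof -
  define n where "n = real CARD('n)"
  have n1: "n \<ge> 1" unfolding n_def using zero_less_card_finite[where 'a='n] by linarith
  \<comment> \<open>The numbers 16 n and 1024 n bound l^2 |v|^2 on the two boxes for l \<le> 2: the
    first box has |v|^2 \<le> 4 n, the second |v|^2 \<le> 4 n p^2 with p \<le> 8.\<close>
  define c1 where "c1 = exp (- 2 * \<beta> * (16 * n)) / (4 * n * k\<^sup>2)"
  define c2 where "c2 = exp (- 2 * \<beta> * (1024 * n)) / 8"
  define c where "c = min c1 c2 / 8"
  have c12: "c1 > 0" "c2 > 0" using n1 k by (auto simp: c1_def c2_def)
  have c: "c > 0" "8 * c \<le> c1" "8 * c \<le> c2" using c12 by (auto simp: c_def)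
  define T where "T = (2 / k)\<^sup>2"
  have T: "T > 0" using k by (simp add: T_def)
  show ?thesis
  proof (rule exI[of _ c], rule conjI[OF c(1)], rule exI[of _ T], rule conjI[OF T], intro allI impI)
    fix t :: real and M :: "real^'n" and x y :: real assume tT: "T \<le> t"
    have t: "t > 0" using T tT by simp
    define s where "s = t powr (- (real CARD('n) / 2))"
    have s0: "s \<ge> 0" by (simp add: s_def)
    have "2 / k \<le> sqrt t" using tT k by (intro real_le_rsqrt) (simp add: T_def)
    then have freq: "2 \<le> k * sqrt t * r" if "r \<ge> 1" for r
    proof -
      have "2 \<le> k * sqrt t" using \<open>2 / k \<le> sqrt t\<close> k by (simp add: field_simps)
      then show ?thesis using mult_mono[of 2 "k * sqrt t" 1 r] that by simp
    qed
    have norm1: "1 \<le> norm v" if "1 \<le> (norm v)\<^sup>2" for v :: "real^'n"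
      using that power2_le_imp_le[of 1 "norm v"] by simp
    define H where "H = (\<lambda>\<xi>::real^'n. exp (- 2 * \<beta> * (norm \<xi>)\<^sup>2 * t) * ((M \<bullet> \<xi>)\<^sup>2 / (k * norm \<xi>)\<^sup>2 * (sin (k * norm \<xi> * t))\<^sup>2
         + (x + y * (norm \<xi>)\<^sup>2 * t)\<^sup>2 * (cos (k * norm \<xi> * t))\<^sup>2))"
    have nsc: "(norm ((l / sqrt t) *\<^sub>R v))\<^sup>2 * t = l\<^sup>2 * (norm v)\<^sup>2" for l and v :: "real^'n"
      using t by (simp add: power_mult_distrib power_divide)
    have h1: "ennreal (s * (c1 * (norm M)\<^sup>2) / 4) \<le> (\<integral>\<^sup>+\<xi>. ennreal (H \<xi>) \<partial>lborel)"
    proof -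
      define G where "G = (\<lambda>\<xi>::real^'n. exp (- 2 * \<beta> * (norm \<xi>)\<^sup>2 * t) * ((M \<bullet> \<xi>)\<^sup>2 / (k * norm \<xi>)\<^sup>2))"
      \<comment> \<open>A unit cube on which each coordinate of v has the sign of that of M and
        modulus between 1 and 2. There M \<bullet> v is at least the 1-norm of M, hence at least
        |M|.\<close>
      define lo :: "real^'n" where "lo = (\<chi> i. if M $ i \<ge> 0 then 1 else - 2)"
      define up :: "real^'n" where "up = (\<chi> i. lo $ i + 1)"
      have "ennreal (s * (c1 * (norm M)\<^sup>2) / 4) \<le> (\<integral>\<^sup>+\<xi>. ennreal (G \<xi> * (\<lambda>x. (sin x)\<^sup>2) (k * norm \<xi> * t)) \<partial>lborel)"
        unfolding s_def
      proof (rule oscillation_lower_bound[where S = "cbox lo up"])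
        show "G \<in> borel_measurable borel" unfolding G_def by measurable
        show "1 \<le> emeasure lborel (cbox lo up)" by (rule box_volume) (simp add: up_def)
        fix v assume v: "v \<in> cbox lo up"
        have vi: "lo $ i \<le> v $ i" "v $ i \<le> lo $ i + 1" for i using v by (auto simp: mem_box_cart up_def)
        have av: "1 \<le> \<bar>v $ i\<bar> \<and> \<bar>v $ i\<bar> \<le> 2" for i using vi[of i] by (auto simp: lo_def split: if_splits)
        note nb = box_norm_bounds[OF av, simplified, folded n_def]
        have nv: "1 \<le> (norm v)\<^sup>2" "(norm v)\<^sup>2 \<le> 4 * n" using nb n1 by auto
        show "2 \<le> k * sqrt t * norm v" by (intro freq norm1 nv)
        have "norm M \<le> M \<bullet> v"
        proof -
          have "norm M \<le> (\<Sum>i\<in>UNIV. \<bar>M $ i\<bar>)" by (rule norm_le_l1_cart)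
          also have "\<dots> \<le> (\<Sum>i\<in>UNIV. M $ i * v $ i)"
          proof (rule sum_mono)
            fix i
            show "\<bar>M $ i\<bar> \<le> M $ i * v $ i"
            proof (cases "M $ i \<ge> 0")
              case True
              then show ?thesis using vi(1)[of i] mult_left_mono[of 1 "v $ i" "M $ i"] by (simp add: lo_def)
            next
              case False
              then show ?thesis using vi(2)[of i] mult_left_mono_neg[of "v $ i" "-1" "M $ i"] by (simp add: lo_def)
            qed
          qed
          finally show ?thesis by (simp add: inner_vec_def)
        qed
        then have Mv: "(norm M)\<^sup>2 \<le> (M \<bullet> v)\<^sup>2" by (intro power_mono) auto
        fix l :: real assume l: "1 \<le> l" "l \<le> 2"
        have l2: "l\<^sup>2 \<le> 4" using power_mono[OF l(2), of 2] l by simp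
        have v0: "norm v > 0" "k * norm v \<noteq> 0" using norm1[OF nv(1)] k by auto
        have "l\<^sup>2 * (norm v)\<^sup>2 \<le> 4 * (4 * n)" using l2 nv by (intro mult_mono) auto
        then have e: "exp (- 2 * \<beta> * (16 * n)) \<le> exp (- 2 * \<beta> * (l\<^sup>2 * (norm v)\<^sup>2))" using b by simp
        have "(M \<bullet> ((l / sqrt t) *\<^sub>R v))\<^sup>2 / (k * norm ((l / sqrt t) *\<^sub>R v))\<^sup>2 = (M \<bullet> v)\<^sup>2 / (k\<^sup>2 * (norm v)\<^sup>2)"
          using l t v0 by (simp add: power_mult_distrib power_divide)
        moreover have "(norm M)\<^sup>2 / (k\<^sup>2 * (4 * n)) \<le> (M \<bullet> v)\<^sup>2 / (k\<^sup>2 * (norm v)\<^sup>2)"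
          using Mv nv k v0 by (intro frac_le mult_left_mono) auto
        ultimately have "exp (- 2 * \<beta> * (16 * n)) * ((norm M)\<^sup>2 / (k\<^sup>2 * (4 * n))) \<le>
            exp (- 2 * \<beta> * ((norm ((l / sqrt t) *\<^sub>R v))\<^sup>2 * t)) * ((M \<bullet> ((l / sqrt t) *\<^sub>R v))\<^sup>2 / (k * norm ((l / sqrt t) *\<^sub>R v))\<^sup>2)"
          unfolding nsc using e k n1 by (intro mult_mono) auto
        then show "c1 * (norm M)\<^sup>2 \<le> G ((l / sqrt t) *\<^sub>R v)" unfolding G_def c1_def by (simp add: mult_ac)
      qed (use mean_square_oscillation(1) c12 t k in auto)
      also have "\<dots> \<le> (\<integral>\<^sup>+\<xi>. ennreal (H \<xi>) \<partial>lborel)"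
        unfolding G_def H_def by (intro nn_integral_mono ennreal_leI) (simp add: distrib_left mult.assoc)
      finally show ?thesis .
    qed
    have h2: "ennreal (s * (c2 * (x\<^sup>2 + y\<^sup>2)) / 4) \<le> (\<integral>\<^sup>+\<xi>. ennreal (H \<xi>) \<partial>lborel)"
    proof -
      define G where "G = (\<lambda>\<xi>::real^'n. exp (- 2 * \<beta> * (norm \<xi>)\<^sup>2 * t) * (x + y * (norm \<xi>)\<^sup>2 * t)\<^sup>2)"
      \<comment> \<open>The amplitude x + y \<rho> with \<rho> = l^2 |v|^2 may vanish for one value
        of \<rho>, which the box has to avoid. If |x| \<ge> 32 n |y|, then p = 1 keeps \<rho> \<le>
        16 n, so |y \<rho>| \<le> |x| / 2. Otherwise p = 8 makes \<rho> \<ge> 64 n, so |y \<rho>|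
        exceeds 2 |x|.\<close>
      define p :: real where "p = (if 32 * n * \<bar>y\<bar> \<le> \<bar>x\<bar> then 1 else 8)"
      define lo :: "real^'n" where "lo = (\<chi> i. p)"
      define up :: "real^'n" where "up = (\<chi> i. 2 * p)"
      have p: "1 \<le> p" "p \<le> 8" by (auto simp: p_def)
      have "ennreal (s * (c2 * (x\<^sup>2 + y\<^sup>2)) / 4) \<le> (\<integral>\<^sup>+\<xi>. ennreal (G \<xi> * (\<lambda>x. (cos x)\<^sup>2) (k * norm \<xi> * t)) \<partial>lborel)"
        unfolding s_def
      proof (rule oscillation_lower_bound[where S = "cbox lo up"])
        show "G \<in> borel_measurable borel" unfolding G_def by measurable
        show "1 \<le> emeasure lborel (cbox lo up)" by (rule box_volume) (use p in \<open>simp add: up_def lo_def\<close>)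
        fix v assume v: "v \<in> cbox lo up"
        have av: "p \<le> \<bar>v $ i\<bar> \<and> \<bar>v $ i\<bar> \<le> 2 * p" for i
        proof -
          have "p \<le> v $ i" "v $ i \<le> 2 * p" using v by (auto simp: mem_box_cart up_def lo_def)
          then show ?thesis using p by (simp add: abs_if)
        qed
        have nv: "n * p\<^sup>2 \<le> (norm v)\<^sup>2" "(norm v)\<^sup>2 \<le> n * (2 * p)\<^sup>2"
          using box_norm_bounds[OF av] p by (auto simp: n_def)
        have p2: "1 \<le> p\<^sup>2" "p\<^sup>2 \<le> 64" using power_mono[OF p(1), of 2] power_mono[OF p(2), of 2] p by auto
        have "1 * 1 \<le> n * p\<^sup>2" using n1 p2 by (intro mult_mono) auto
        then have nv1: "1 \<le> (norm v)\<^sup>2" using nv by linarith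
        show "2 \<le> k * sqrt t * norm v" by (intro freq norm1 nv1)
        fix l :: real assume l: "1 \<le> l" "l \<le> 2"
        have l2: "1 \<le> l\<^sup>2" "l\<^sup>2 \<le> 4" using power_mono[OF l(1), of 2] power_mono[OF l(2), of 2] l by auto
        define \<rho> where "\<rho> = l\<^sup>2 * (norm v)\<^sup>2"
        have r1: "n * p\<^sup>2 \<le> \<rho>" using mult_mono[OF l2(1) nv(1)] n1 by (simp add: \<rho>_def)
        have "\<rho> \<le> 4 * (n * (2 * p)\<^sup>2)" unfolding \<rho>_def using l2 nv by (intro mult_mono) auto
        then have r2: "\<rho> \<le> 16 * n * p\<^sup>2" by (simp add: power_mult_distrib)
        have "16 * n * p\<^sup>2 \<le> 16 * n * 64" using p2 n1 by (intro mult_left_mono) auto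
        then have r3: "\<rho> \<le> 1024 * n" using r2 by simp
        have r0: "\<rho> \<ge> 0" by (simp add: \<rho>_def)
        have e: "exp (- 2 * \<beta> * (1024 * n)) \<le> exp (- 2 * \<beta> * \<rho>)" using r3 b by simp
        have sq: "(x\<^sup>2 + y\<^sup>2) / 8 \<le> (x + y * \<rho>)\<^sup>2"
        proof (cases "32 * n * \<bar>y\<bar> \<le> \<bar>x\<bar>")
          case True
          then have "\<rho> \<le> 16 * n" using r2 by (simp add: p_def)
          then have "\<bar>y\<bar> * \<rho> \<le> \<bar>y\<bar> * (16 * n)" by (intro mult_left_mono) auto
          also have "\<dots> \<le> \<bar>x\<bar> / 2" using True by (simp add: mult_ac)
          finally have "\<bar>y * \<rho>\<bar> \<le> \<bar>x\<bar> / 2" using r0 by (simp add: abs_mult)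
          then have "\<bar>x\<bar> / 2 \<le> \<bar>x + y * \<rho>\<bar>" by linarith
          then have "(\<bar>x\<bar> / 2)\<^sup>2 \<le> \<bar>x + y * \<rho>\<bar>\<^sup>2" by (intro power_mono) auto
          then have 1: "x\<^sup>2 / 4 \<le> (x + y * \<rho>)\<^sup>2" by (simp add: power_divide)
          have "1 * \<bar>y\<bar> \<le> 32 * n * \<bar>y\<bar>" using n1 by (intro mult_right_mono) auto
          then have "\<bar>y\<bar>\<^sup>2 \<le> \<bar>x\<bar>\<^sup>2" using True by (intro power_mono) auto
          then show ?thesis using 1 by simp
        next
          case False
          then have "64 * n \<le> \<rho>" using r1 by (simp add: p_def)
          then have "\<bar>y\<bar> * (64 * n) \<le> \<bar>y\<bar> * \<rho>" by (intro mult_left_mono) auto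
          moreover have "\<bar>y * \<rho>\<bar> = \<bar>y\<bar> * \<rho>" using r0 by (simp add: abs_mult)
          moreover have "\<bar>y\<bar> * (64 * n) = \<bar>y\<bar> * (32 * n) + \<bar>y\<bar> * (32 * n)" by simp
          moreover have "\<bar>x\<bar> < \<bar>y\<bar> * (32 * n)" using False by (simp add: mult_ac)
          ultimately have 0: "\<bar>y\<bar> * (32 * n) \<le> \<bar>x + y * \<rho>\<bar>" by linarith
          have "\<bar>x\<bar>\<^sup>2 \<le> \<bar>x + y * \<rho>\<bar>\<^sup>2" using 0 False by (intro power_mono) (auto simp: mult_ac)
          moreover have "\<bar>y\<bar> * 1 \<le> \<bar>y\<bar> * (32 * n)" using n1 by (intro mult_left_mono) auto
          then have "\<bar>y\<bar>\<^sup>2 \<le> \<bar>x + y * \<rho>\<bar>\<^sup>2" using 0 by (intro power_mono) auto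
          ultimately have "x\<^sup>2 + y\<^sup>2 \<le> 8 * (x + y * \<rho>)\<^sup>2"
            unfolding power2_abs using zero_le_power2[of "x + y * \<rho>"] by (smt (verit))
          then show ?thesis by simp
        qed
        have "exp (- 2 * \<beta> * (1024 * n)) * ((x\<^sup>2 + y\<^sup>2) / 8) \<le> exp (- 2 * \<beta> * ((norm ((l / sqrt t) *\<^sub>R v))\<^sup>2 * t)) * (x + y * ((norm ((l / sqrt t) *\<^sub>R v))\<^sup>2 * t))\<^sup>2"
          unfolding nsc \<rho>_def[symmetric] using e sq by (intro mult_mono) auto
        then show "c2 * (x\<^sup>2 + y\<^sup>2) \<le> G ((l / sqrt t) *\<^sub>R v)" unfolding G_def c2_def by (simp add: mult_ac)
      qed (use mean_square_oscillation(2) c12 t k in auto)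
      also have "\<dots> \<le> (\<integral>\<^sup>+\<xi>. ennreal (H \<xi>) \<partial>lborel)"
        unfolding G_def H_def by (intro nn_integral_mono ennreal_leI) (simp add: distrib_left mult.assoc)
      finally show ?thesis .
    qed
    \<comment> \<open>Both bounds concern the same integral, so only their maximum is available. The
      8 in the choice of c covers the 4 in each bound and the 2 lost from the sum to the
      maximum.\<close>
    have "c * s * ((norm M)\<^sup>2 + x\<^sup>2 + y\<^sup>2) \<le> max (s * (c1 * (norm M)\<^sup>2) / 4) (s * (c2 * (x\<^sup>2 + y\<^sup>2)) / 4)"
    proof -
      have "s * (8 * c * (norm M)\<^sup>2) \<le> s * (c1 * (norm M)\<^sup>2)" "s * (8 * c * (x\<^sup>2 + y\<^sup>2)) \<le> s * (c2 * (x\<^sup>2 + y\<^sup>2))"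
        using c s0 by (auto intro!: mult_left_mono mult_right_mono)
      then show ?thesis by (simp add: algebra_simps max_def)
    qed
    then have "ennreal (c * s * ((norm M)\<^sup>2 + x\<^sup>2 + y\<^sup>2)) \<le> (\<integral>\<^sup>+\<xi>. ennreal (H \<xi>) \<partial>lborel)"
      unfolding le_max_iff_disj using order_trans[OF ennreal_leI h1] order_trans[OF ennreal_leI h2] by blast
    then show "ennreal (c * t powr (- (real CARD('n) / 2)) * ((norm M)\<^sup>2 + x\<^sup>2 + y\<^sup>2)) \<le>
     (\<integral>\<^sup>+\<xi>. ennreal (exp (- 2 * \<beta> * (norm \<xi>)\<^sup>2 * t) * ((M \<bullet> \<xi>)\<^sup>2 / (k * norm \<xi>)\<^sup>2 * (sin (k * norm \<xi> * t))\<^sup>2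
         + (x + y * (norm \<xi>)\<^sup>2 * t)\<^sup>2 * (cos (k * norm \<xi> * t))\<^sup>2)) \<partial>lborel)"
      unfolding H_def s_def .
  qed
qed

section \<open>Comparison with the profiles\<close>

text \<open>Real and imaginary parts of exp (i (x + h)) = exp (i x) exp (i h), with exp (i h)
  expanded to order 0 or 1.\<close>

lemma trig_perturbation:
  fixes x h :: real
  shows "\<bar>sin (x + h) - sin x\<bar> \<le> \<bar>h\<bar>" "\<bar>cos (x + h) - cos x\<bar> \<le> \<bar>h\<bar>"
    "\<bar>sin (x + h) - sin x - h * cos x\<bar> \<le> h\<^sup>2"
proof -
  define E where "E = (\<lambda>x. exp (\<i> * complex_of_real x))"
  have E: "E (x + h) = E x * E h" "cmod (E x) = 1" "\<And>y. Re (E y) = cos y" "\<And>y. Im (E y) = sin y"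
    by (auto simp: E_def distrib_left exp_add Re_exp Im_exp)
  have "cmod (E (x + h) - E x) = cmod (E x) * cmod (E h - 1)" unfolding E(1) by (simp add: right_diff_distrib flip: norm_mult)
  also have "\<dots> \<le> \<bar>h\<bar>" unfolding E(2) using iexp_approx1[of h 0] by (simp add: E_def)
  finally have 1: "cmod (E (x + h) - E x) \<le> \<bar>h\<bar>" .
  show "\<bar>sin (x + h) - sin x\<bar> \<le> \<bar>h\<bar>" using order_trans[OF abs_Im_le_cmod 1] by (simp only: minus_complex.sel E(4))
  show "\<bar>cos (x + h) - cos x\<bar> \<le> \<bar>h\<bar>" using order_trans[OF abs_Re_le_cmod 1] by (simp only: minus_complex.sel E(3))
  have "cmod (E x * E h - E x * (1 + \<i> * complex_of_real h)) = cmod (E x) * cmod (E h - (1 + \<i> * complex_of_real h))"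
    by (simp add: right_diff_distrib[symmetric] norm_mult)
  also have "\<dots> \<le> \<bar>h\<bar>\<^sup>2 / 2" unfolding E(2) using iexp_approx1[of h 1] by (simp add: E_def power2_eq_square)
  also have "\<dots> \<le> h\<^sup>2" by simp
  finally have "cmod (E (x + h) - E x * (1 + \<i> * complex_of_real h)) \<le> h\<^sup>2" unfolding E(1) .
  from order_trans[OF abs_Im_le_cmod this]
  show "\<bar>sin (x + h) - sin x - h * cos x\<bar> \<le> h\<^sup>2" by (simp add: E(3,4) algebra_simps)
qed

text \<open>Used to trade polynomial factors in r^2 t for a part of the Gaussian exponent.\<close>

lemma one_plus_le_exp:
  fixes a x :: real
  assumes a: "a > 0" and x: "x \<ge> 0"
  shows "1 + x \<le> max 1 (1 / a) * exp (a * x)" "(1 + x)\<^sup>2 \<le> (max 1 (2 / a))\<^sup>2 * exp (a * x)"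
proof -
  have *: "1 + x \<le> max 1 (1 / a) * exp (a * x)" if a: "a > 0" for a
  proof -
    have "1 + x \<le> max 1 (1 / a) * 1 + max 1 (1 / a) * (a * x)"
    proof (rule add_mono)
      have "1 / a * (a * x) \<le> max 1 (1 / a) * (a * x)" using a x by (intro mult_right_mono) auto
      then show "x \<le> max 1 (1 / a) * (a * x)" using a by simp
    qed simp
    also have "\<dots> = max 1 (1 / a) * (1 + a * x)" by (simp add: distrib_left)
    also have "\<dots> \<le> max 1 (1 / a) * exp (a * x)" by (intro mult_left_mono exp_ge_add_one_self) auto
    finally show ?thesis .
  qed
  from *[OF a] show "1 + x \<le> max 1 (1 / a) * exp (a * x)" .
  have "(1 + x)\<^sup>2 \<le> (max 1 (1 / (a / 2)) * exp (a / 2 * x))\<^sup>2" using *[of "a / 2"] a x by (intro power_mono) auto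
  also have "\<dots> = (max 1 (2 / a))\<^sup>2 * exp (a * x)" by (simp add: power_mult_distrib flip: exp_double)
  finally show "(1 + x)\<^sup>2 \<le> (max 1 (2 / a))\<^sup>2 * exp (a * x)" .
qed

context mgt begin

definition osc :: "real \<Rightarrow> real \<Rightarrow> real" where "osc r t = sin (k * r * t) / (k * r)"

definition main1 :: "real \<Rightarrow> real \<Rightarrow> real \<Rightarrow> complex" where
  "main1 r t PB = complex_of_real (exp (- \<beta> * r\<^sup>2 * t) * (osc r t * PB))"

text \<open>Symbol of the second profile at |\<xi>| = r, with \<mu> in place of M \<bullet> \<xi>:
  the gradient term contributes - i \<mu> times the symbol of \<open>J0\<close>. It is written as
  real and imaginary part because its squared modulus then has no mixed sin cos term, and the lower
  bound can treat M separately.\<close>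

definition main2 :: "real \<Rightarrow> real \<Rightarrow> real \<Rightarrow> real \<Rightarrow> real \<Rightarrow> complex" where
  "main2 r t \<mu> PA PB = complex_of_real (exp (- \<beta> * r\<^sup>2 * t)) *
     Complex (cos (k * r * t) * (PA + \<gamma> / k * PB * r\<^sup>2 * t)) (- (\<mu> * osc r t))"

text \<open>The two phases differ by h = \<gamma> r^3 t. The first-order term of sin (k r t + h) /
  (k r) is (\<gamma> / k) r^2 t cos (k r t), which is the symbol of \<open>J2\<close>: this summand
  of the second profile is the trace of the cubic correction of the root. The error left after it
  gains a factor r at the price of powers of 1 + r^2 t.\<close>

lemma osc_perturbation:
  assumes r: "0 < r" "r \<le> 1" and w: "k * r / 2 \<le> \<omega> r" and t: "t \<ge> 0"
  defines "C \<equiv> \<bar>\<gamma>\<bar> / k + 2 * \<bar>\<gamma>\<bar> / k\<^sup>2 + \<bar>\<gamma>\<bar>\<^sup>2 / k + \<bar>\<gamma>\<bar>"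
  shows "1 / \<omega> r \<le> 2 / k / r" "\<bar>cos (\<omega> r * t) - cos (k * r * t)\<bar> \<le> C * r * (1 + r\<^sup>2 * t)\<^sup>2"
    "\<bar>sin (\<omega> r * t) / \<omega> r - osc r t\<bar> \<le> C * (1 + r\<^sup>2 * t)"
    "\<bar>sin (\<omega> r * t) / \<omega> r - osc r t - \<gamma> / k * r\<^sup>2 * t * cos (k * r * t)\<bar> \<le> C * r * (1 + r\<^sup>2 * t)\<^sup>2"
proof -
  have kr: "k * r > 0" using k r by simp
  have wp: "\<omega> r > 0" using w kr by linarith
  define h where "h = \<gamma> * r ^ 3 * t"
  define x where "x = k * r * t"
  define G where "G = \<bar>\<gamma>\<bar>"
  have G: "G \<ge> 0" by (simp add: G_def)
  have wt: "\<omega> r * t = x + h" by (simp add: \<omega>_def x_def h_def algebra_simps)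
  define q where "q = 1 + r\<^sup>2 * t"
  have q: "1 \<le> q" "r\<^sup>2 * t \<le> q" "q \<le> q\<^sup>2" "r\<^sup>2 * t \<le> q\<^sup>2" "(r\<^sup>2 * t)\<^sup>2 \<le> q\<^sup>2" "1 \<le> q\<^sup>2"
  proof -
    have rt: "0 \<le> r\<^sup>2 * t" using t by simp
    show 1: "1 \<le> q" using rt by (simp add: q_def)
    show 2: "r\<^sup>2 * t \<le> q" by (simp add: q_def)
    show 3: "q \<le> q\<^sup>2" using mult_left_mono[OF 1, of q] 1 by (simp add: power2_eq_square)
    show "r\<^sup>2 * t \<le> q\<^sup>2" using 2 3 by linarith
    show "(r\<^sup>2 * t)\<^sup>2 \<le> q\<^sup>2" using 2 rt by (intro power_mono)
    show "1 \<le> q\<^sup>2" using 1 3 by linarith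
  qed
  have habs: "\<bar>h\<bar> = G * r * (r\<^sup>2 * t)" using r t by (simp add: h_def G_def abs_mult power2_eq_square power3_eq_cube)
  have Ck: "C = G / k + 2 * G / k\<^sup>2 + G\<^sup>2 / k + G" by (simp add: C_def G_def)
  have Cc: "G / k \<ge> 0" "2 * G / k\<^sup>2 \<ge> 0" "G\<^sup>2 / k \<ge> 0" using G k by auto
  have "1 / \<omega> r \<le> 1 / (k * r / 2)" using w kr wp by (intro divide_left_mono) auto
  then show i: "1 / \<omega> r \<le> 2 / k / r" by simp
  have "\<bar>h\<bar> \<le> G * r * q\<^sup>2" unfolding habs using q G r by (intro mult_left_mono) auto
  also have "\<dots> \<le> C * r * q\<^sup>2" using Cc G r unfolding Ck by (intro mult_right_mono) auto
  finally show "\<bar>cos (\<omega> r * t) - cos (k * r * t)\<bar> \<le> C * r * (1 + r\<^sup>2 * t)\<^sup>2"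
    using trig_perturbation(2)[of x h] unfolding wt x_def[symmetric] q_def by linarith
  have d1: "\<bar>1 / \<omega> r - 1 / (k * r)\<bar> \<le> 2 * G / k\<^sup>2 * r"
  proof -
    have "1 / \<omega> r - 1 / (k * r) = - (\<gamma> * r ^ 3) * (1 / \<omega> r) / (k * r)"
    proof -
      have "1 / w - 1 / v = (v - w) * (1 / w) / v" if "w > 0" "v > 0" for v w :: real
        using that by (simp add: field_simps)
      from this[OF wp kr] show ?thesis by (simp add: \<omega>_def)
    qed
    then have "\<bar>1 / \<omega> r - 1 / (k * r)\<bar> = (G * r ^ 3) * (1 / \<omega> r) / (k * r)"
      using wp kr r k by (simp add: abs_mult G_def)
    also have "\<dots> \<le> (G * r ^ 3) * (2 / k / r) / (k * r)" using i G r kr by (intro divide_right_mono mult_left_mono) auto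
    also have "\<dots> = 2 * G / k\<^sup>2 * r" using r k by (simp add: power2_eq_square power3_eq_cube field_simps)
    finally show ?thesis .
  qed
  have d2: "\<bar>sin (x + h) * (1 / \<omega> r - 1 / (k * r))\<bar> \<le> 2 * G / k\<^sup>2 * r"
  proof -
    have "\<bar>sin (x + h)\<bar> * \<bar>1 / \<omega> r - 1 / (k * r)\<bar> \<le> 1 * (2 * G / k\<^sup>2 * r)"
      using d1 by (intro mult_mono) auto
    then show ?thesis by (simp only: abs_mult mult_1)
  qed
  have split1: "sin (\<omega> r * t) / \<omega> r - osc r t = (sin (x + h) - sin x) / (k * r) + sin (x + h) * (1 / \<omega> r - 1 / (k * r))"
    unfolding wt osc_def x_def by (simp add: diff_divide_distrib right_diff_distrib)
  have "\<bar>(sin (x + h) - sin x) / (k * r)\<bar> \<le> \<bar>h\<bar> / (k * r)"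
    using trig_perturbation(1)[of x h] kr by (simp add: abs_divide divide_right_mono)
  also have "\<dots> = G / k * (r\<^sup>2 * t)" unfolding habs using r by simp
  also have "\<dots> \<le> G / k * q" using q Cc by (intro mult_left_mono) auto
  finally have e1: "\<bar>(sin (x + h) - sin x) / (k * r)\<bar> \<le> G / k * q" .
  have e2: "2 * G / k\<^sup>2 * r \<le> 2 * G / k\<^sup>2 * q" using r q Cc by (intro mult_left_mono) auto
  have "\<bar>sin (\<omega> r * t) / \<omega> r - osc r t\<bar> \<le> G / k * q + 2 * G / k\<^sup>2 * q"
    unfolding split1 using e1 d2 e2 by linarith
  also have "\<dots> = (G / k + 2 * G / k\<^sup>2) * q" by (simp add: distrib_right)
  also have "\<dots> \<le> C * q" using Cc G q unfolding Ck by (intro mult_right_mono) auto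
  finally show "\<bar>sin (\<omega> r * t) / \<omega> r - osc r t\<bar> \<le> C * (1 + r\<^sup>2 * t)" by (simp add: q_def)
  have "\<gamma> / k * r\<^sup>2 * t * cos (k * r * t) = h * cos x / (k * r)"
    using r k unfolding h_def x_def by (simp add: power2_eq_square power3_eq_cube)
  then have split2: "sin (\<omega> r * t) / \<omega> r - osc r t - \<gamma> / k * r\<^sup>2 * t * cos (k * r * t)
     = (sin (x + h) - sin x - h * cos x) / (k * r) + sin (x + h) * (1 / \<omega> r - 1 / (k * r))"
    unfolding split1 by (simp add: diff_divide_distrib)
  have "\<bar>(sin (x + h) - sin x - h * cos x) / (k * r)\<bar> \<le> h\<^sup>2 / (k * r)"
    using trig_perturbation(3)[of x h] kr by (simp add: abs_divide divide_right_mono)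
  also have "h\<^sup>2 / (k * r) = \<bar>h\<bar>\<^sup>2 / (k * r)" by simp
  also have "\<dots> = G\<^sup>2 / k * r * (r\<^sup>2 * t)\<^sup>2"
    unfolding habs using r k by (simp add: power_mult_distrib power2_eq_square)
  also have "\<dots> \<le> G\<^sup>2 / k * r * q\<^sup>2" using q(5) mult_nonneg_nonneg[OF Cc(3) less_imp_le[OF r(1)]] by (rule mult_left_mono)
  finally have f1: "\<bar>(sin (x + h) - sin x - h * cos x) / (k * r)\<bar> \<le> G\<^sup>2 / k * r * q\<^sup>2" .
  have f2: "2 * G / k\<^sup>2 * r * 1 \<le> 2 * G / k\<^sup>2 * r * q\<^sup>2" using q(6) mult_nonneg_nonneg[OF Cc(2) less_imp_le[OF r(1)]] by (rule mult_left_mono)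
  have "\<bar>sin (\<omega> r * t) / \<omega> r - osc r t - \<gamma> / k * r\<^sup>2 * t * cos (k * r * t)\<bar> \<le> G\<^sup>2 / k * r * q\<^sup>2 + 2 * G / k\<^sup>2 * r * q\<^sup>2"
    unfolding split2 using f1 d2 f2 by linarith
  also have "\<dots> = (G\<^sup>2 / k + 2 * G / k\<^sup>2) * (r * q\<^sup>2)" by (simp add: distrib_right mult.assoc)
  also have "\<dots> \<le> C * (r * q\<^sup>2)" using Cc G q r unfolding Ck by (intro mult_right_mono) auto
  finally show "\<bar>sin (\<omega> r * t) / \<omega> r - osc r t - \<gamma> / k * r\<^sup>2 * t * cos (k * r * t)\<bar> \<le> C * r * (1 + r\<^sup>2 * t)\<^sup>2"
    by (simp add: q_def mult.assoc)
qed

text \<open>A enters with a factor of order 1, but B with sin (\<omega> t) / \<omega>, which can be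
  of order 1 / r. Hence B has to be expanded one order further than A, and this is where the first
  moment enters, as \<mu>.\<close>

lemma slow_compare:
  "\<exists>C>0. \<forall>r t A B PA PB \<mu>. 0 < r \<and> r \<le> 1 \<and> k * r / 2 \<le> \<omega> r \<and> t \<ge> 0 \<longrightarrow>
     cmod (slow r t A B - main1 r t PB) \<le> C * exp (- \<beta> * r\<^sup>2 * t) * (1 + r\<^sup>2 * t) * (cmod A + cmod (B - PB) / r + \<bar>PB\<bar>) \<and>
     cmod (slow r t A B - main1 r t PB - main2 r t \<mu> PA PB) \<le> C * exp (- \<beta> * r\<^sup>2 * t) * (1 + r\<^sup>2 * t)\<^sup>2 *
       (cmod (A - PA) + cmod (B - PB + \<i> * \<mu>) / r + r * (\<bar>PA\<bar> + \<bar>PB\<bar>) + \<bar>\<mu>\<bar>)"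
proof -
  define C0 where "C0 = \<bar>\<gamma>\<bar> / k + 2 * \<bar>\<gamma>\<bar> / k\<^sup>2 + \<bar>\<gamma>\<bar>\<^sup>2 / k + \<bar>\<gamma>\<bar>"
  define C where "C = 1 + 2 / k + C0"
  have C0: "C0 \<ge> 0" using k by (simp add: C0_def)
  have C: "C > 0" "1 \<le> C" "2 / k \<le> C" "C0 \<le> C" using C0 k by (auto simp: C_def add_pos_nonneg)
  show ?thesis
  proof (rule exI[of _ C], rule conjI[OF C(1)], intro allI impI)
    fix r t :: real and A B :: complex and PA PB \<mu> :: real
    assume asm: "0 < r \<and> r \<le> 1 \<and> k * r / 2 \<le> \<omega> r \<and> t \<ge> 0"
    then have r: "0 < r" "r \<le> 1" and w: "k * r / 2 \<le> \<omega> r" and t: "t \<ge> 0" by auto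
    note op = osc_perturbation[OF r w t, folded C0_def]
    define q where "q = 1 + r\<^sup>2 * t"
    define e where "e = exp (- \<beta> * r\<^sup>2 * t)"
    define S where "S = sin (\<omega> r * t) / \<omega> r"
    define X where "X = cos (\<omega> r * t)"
    define Y where "Y = cos (k * r * t)"
    have e0: "e \<ge> 0" by (simp add: e_def)
    have q: "1 \<le> q" "1 \<le> q\<^sup>2" "q \<le> q\<^sup>2"
    proof -
      show 1: "1 \<le> q" using t by (simp add: q_def)
      show "1 \<le> q\<^sup>2" using power_mono[OF 1, of 2] by simp
      show "q \<le> q\<^sup>2" using mult_left_mono[OF 1, of q] 1 by (simp add: power2_eq_square)
    qed
    have kr: "k * r > 0" using k r by simp
    have Sb: "\<bar>S\<bar> \<le> 2 / k / r"
    proof -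
      have wp: "\<omega> r > 0" using w kr by linarith
      have "\<bar>S\<bar> \<le> 1 / \<omega> r" unfolding S_def using wp by (simp add: abs_divide divide_right_mono)
      then show ?thesis using op(1) by linarith
    qed
    have o2: "\<bar>X - Y\<bar> \<le> C0 * r * q\<^sup>2" using op(2) by (simp add: X_def Y_def q_def)
    have o3: "\<bar>S - osc r t\<bar> \<le> C0 * q" using op(3) by (simp add: S_def q_def)
    have o4: "\<bar>S - osc r t - \<gamma> / k * r\<^sup>2 * t * Y\<bar> \<le> C0 * r * q\<^sup>2" using op(4) by (simp add: S_def Y_def q_def)
    have Xb: "\<bar>X\<bar> \<le> 1" by (simp add: X_def)
    have sl: "slow r t A B = complex_of_real e * (X * A + S * B)"
      by (simp add: slow_def e_def X_def S_def scaleR_conv_of_real)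
    have SB: "cmod (S * Z) \<le> C * (cmod Z / r)" for Z :: complex
    proof -
      have "cmod (S * Z) = \<bar>S\<bar> * cmod Z" by (simp add: norm_mult)
      also have "\<dots> \<le> 2 / k / r * cmod Z" using Sb by (intro mult_right_mono) auto
      also have "\<dots> = 2 / k * (cmod Z / r)" by simp
      also have "\<dots> \<le> C * (cmod Z / r)" using C r by (intro mult_right_mono) auto
      finally show ?thesis .
    qed
    have le1: "x \<le> x * q" "x \<le> x * q\<^sup>2" if "x \<ge> 0" for x using that q mult_left_mono[of 1 q x] mult_left_mono[of 1 "q\<^sup>2" x] by auto
    have n3: "cmod (x + y + z) \<le> U + V + W" if "cmod x \<le> U" "cmod y \<le> V" "cmod z \<le> W" for x y z U V W
      using norm_triangle_ineq[of "x + y" z] norm_triangle_ineq[of x y] that by linarith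
    have "slow r t A B - main1 r t PB = complex_of_real e * (X * A + S * (B - PB) + (S - osc r t) * PB)"
      unfolding sl main1_def e_def[symmetric] by (simp add: algebra_simps)
    then have "cmod (slow r t A B - main1 r t PB) = e * cmod (X * A + S * (B - PB) + (S - osc r t) * PB)"
      using e0 by (simp add: norm_mult)
    also have "\<dots> \<le> e * (C * q * cmod A + C * q * (cmod (B - PB) / r) + C * q * \<bar>PB\<bar>)"
    proof (intro mult_left_mono e0 n3)
      have "cmod (X * A) \<le> 1 * cmod A" using Xb unfolding norm_mult by (intro mult_right_mono) auto
      also have "1 * cmod A \<le> C * q * cmod A" using mult_mono[of 1 C 1 q] C q by (intro mult_right_mono) auto
      finally show "cmod (X * A) \<le> C * q * cmod A" .
      have "C * (cmod (B - PB) / r) \<le> C * (cmod (B - PB) / r) * q" using C r by (intro le1) auto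
      then show "cmod (S * (B - PB)) \<le> C * q * (cmod (B - PB) / r)" using SB[of "B - PB"] by (simp add: mult_ac)
      have "\<bar>S - osc r t\<bar> * \<bar>PB\<bar> \<le> (C * q) * \<bar>PB\<bar>"
        using q by (intro mult_right_mono order_trans[OF o3 mult_right_mono[OF C(4)]]) auto
      then show "cmod ((S - osc r t) * PB) \<le> C * q * \<bar>PB\<bar>" by (simp add: norm_mult flip: of_real_diff)
    qed
    also have "\<dots> = C * e * q * (cmod A + cmod (B - PB) / r + \<bar>PB\<bar>)" by (simp add: algebra_simps)
    finally have 1: "cmod (slow r t A B - main1 r t PB) \<le> C * exp (- \<beta> * r\<^sup>2 * t) * (1 + r\<^sup>2 * t) * (cmod A + cmod (B - PB) / r + \<bar>PB\<bar>)"
      by (simp add: e_def q_def)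
    have m2: "main2 r t \<mu> PA PB = complex_of_real e * (complex_of_real (Y * PA) + complex_of_real (\<gamma> / k * r\<^sup>2 * t * Y * PB) - \<i> * \<mu> * osc r t)"
      unfolding main2_def e_def[symmetric] Y_def[symmetric] by (simp add: complex_eq_iff algebra_simps)
    have "slow r t A B - main1 r t PB - main2 r t \<mu> PA PB = complex_of_real e *
       ((X * (A - PA) + S * (B - PB + \<i> * \<mu>) + complex_of_real ((X - Y) * PA)) + complex_of_real ((S - osc r t - \<gamma> / k * r\<^sup>2 * t * Y) * PB)
         + - (\<i> * (complex_of_real ((S - osc r t) * \<mu>))))"
      unfolding sl main1_def e_def[symmetric] m2 by (simp add: algebra_simps)
    then have "cmod (slow r t A B - main1 r t PB - main2 r t \<mu> PA PB) = e * cmod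
       ((X * (A - PA) + S * (B - PB + \<i> * \<mu>) + complex_of_real ((X - Y) * PA)) + complex_of_real ((S - osc r t - \<gamma> / k * r\<^sup>2 * t * Y) * PB)
         + - (\<i> * (complex_of_real ((S - osc r t) * \<mu>))))"
      using e0 by (simp add: norm_mult)
    also have "\<dots> \<le> e * ((C * q\<^sup>2 * cmod (A - PA) + C * q\<^sup>2 * (cmod (B - PB + \<i> * \<mu>) / r) + C * q\<^sup>2 * (r * \<bar>PA\<bar>))
         + C * q\<^sup>2 * (r * \<bar>PB\<bar>) + C * q\<^sup>2 * \<bar>\<mu>\<bar>)"
    proof (intro mult_left_mono e0 n3)
      have "cmod (X * (A - PA)) \<le> 1 * cmod (A - PA)" using Xb unfolding norm_mult by (intro mult_right_mono) auto
      also have "1 * cmod (A - PA) \<le> C * q\<^sup>2 * cmod (A - PA)" using mult_mono[of 1 C 1 "q\<^sup>2"] C q by (intro mult_right_mono) auto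
      finally show "cmod (X * (A - PA)) \<le> C * q\<^sup>2 * cmod (A - PA)" .
      have "C * (cmod (B - PB + \<i> * \<mu>) / r) \<le> C * (cmod (B - PB + \<i> * \<mu>) / r) * q\<^sup>2" using C r by (intro le1) auto
      then show "cmod (S * (B - PB + \<i> * \<mu>)) \<le> C * q\<^sup>2 * (cmod (B - PB + \<i> * \<mu>) / r)" using SB[of "B - PB + \<i> * \<mu>"] by (simp add: mult_ac)
      have c1: "C0 * r * q\<^sup>2 \<le> C * r * q\<^sup>2" using C r by (intro mult_right_mono) auto
      have "\<bar>X - Y\<bar> * \<bar>PA\<bar> \<le> (C * r * q\<^sup>2) * \<bar>PA\<bar>" using o2 c1 by (intro mult_right_mono) auto
      then show "cmod (complex_of_real ((X - Y) * PA)) \<le> C * q\<^sup>2 * (r * \<bar>PA\<bar>)" unfolding norm_of_real abs_mult by (simp add: mult_ac)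
      have "\<bar>S - osc r t - \<gamma> / k * r\<^sup>2 * t * Y\<bar> * \<bar>PB\<bar> \<le> (C * r * q\<^sup>2) * \<bar>PB\<bar>" using o4 c1 by (intro mult_right_mono) auto
      then show "cmod (complex_of_real ((S - osc r t - \<gamma> / k * r\<^sup>2 * t * Y) * PB)) \<le> C * q\<^sup>2 * (r * \<bar>PB\<bar>)" unfolding norm_of_real abs_mult by (simp add: mult_ac)
      have "C0 * q \<le> C * q\<^sup>2" using C C0 q by (intro mult_mono) auto
      then have "\<bar>S - osc r t\<bar> * \<bar>\<mu>\<bar> \<le> (C * q\<^sup>2) * \<bar>\<mu>\<bar>" using o3 by (intro mult_right_mono) auto
      then show "cmod (- (\<i> * (complex_of_real ((S - osc r t) * \<mu>)))) \<le> C * q\<^sup>2 * \<bar>\<mu>\<bar>"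
        unfolding norm_minus_cancel norm_mult norm_of_real abs_mult by simp
    qed
    also have "\<dots> = C * e * q\<^sup>2 * (cmod (A - PA) + cmod (B - PB + \<i> * \<mu>) / r + r * (\<bar>PA\<bar> + \<bar>PB\<bar>) + \<bar>\<mu>\<bar>)" by (simp add: algebra_simps)
    finally have 2: "cmod (slow r t A B - main1 r t PB - main2 r t \<mu> PA PB) \<le> C * exp (- \<beta> * r\<^sup>2 * t) * (1 + r\<^sup>2 * t)\<^sup>2 *
       (cmod (A - PA) + cmod (B - PB + \<i> * \<mu>) / r + r * (\<bar>PA\<bar> + \<bar>PB\<bar>) + \<bar>\<mu>\<bar>)"
      by (simp add: e_def q_def)
    show "cmod (slow r t A B - main1 r t PB) \<le> C * exp (- \<beta> * r\<^sup>2 * t) * (1 + r\<^sup>2 * t) * (cmod A + cmod (B - PB) / r + \<bar>PB\<bar>) \<and>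
     cmod (slow r t A B - main1 r t PB - main2 r t \<mu> PA PB) \<le> C * exp (- \<beta> * r\<^sup>2 * t) * (1 + r\<^sup>2 * t)\<^sup>2 *
       (cmod (A - PA) + cmod (B - PB + \<i> * \<mu>) / r + r * (\<bar>PA\<bar> + \<bar>PB\<bar>) + \<bar>\<mu>\<bar>)"
      using 1 2 by blast
  qed
qed

lemma norm_main1: "cmod (main1 r t PB) = exp (- \<beta> * r\<^sup>2 * t) * (\<bar>osc r t\<bar> * \<bar>PB\<bar>)"
  unfolding main1_def norm_of_real abs_mult abs_exp_cancel ..

lemma norm_main2:
  "(cmod (main2 r t \<mu> PA PB))\<^sup>2 = exp (- 2 * \<beta> * r\<^sup>2 * t) * (\<mu>\<^sup>2 / (k * r)\<^sup>2 * (sin (k * r * t))\<^sup>2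
         + (PA + \<gamma> / k * PB * r\<^sup>2 * t)\<^sup>2 * (cos (k * r * t))\<^sup>2)"
proof -
  have "exp (- 2 * \<beta> * r\<^sup>2 * t) = (exp (- \<beta> * r\<^sup>2 * t))\<^sup>2" by (simp add: mult.assoc flip: exp_double)
  moreover have "(cmod (complex_of_real a * Complex b (- d)))\<^sup>2 = a\<^sup>2 * (d\<^sup>2 + b\<^sup>2)" for a b d
    unfolding norm_mult power_mult_distrib by (simp add: cmod_power2)
  moreover have "(\<mu> * osc r t)\<^sup>2 = \<mu>\<^sup>2 / (k * r)\<^sup>2 * (sin (k * r * t))\<^sup>2"
    by (simp add: osc_def power_mult_distrib power_divide)
  moreover have "(cos (k * r * t) * (PA + \<gamma> / k * PB * r\<^sup>2 * t))\<^sup>2 = (PA + \<gamma> / k * PB * r\<^sup>2 * t)\<^sup>2 * (cos (k * r * t))\<^sup>2"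
    by (simp only: power_mult_distrib mult.commute)
  ultimately show ?thesis unfolding main2_def by simp
qed

text \<open>N collects the sizes of the data. The two hypotheses with a factor r express that the
  transform of \<psi>1 + \<tau> \<psi>2 minus its mean, and likewise \<mu> = M \<bullet> \<xi>, are
  of order |\<xi>|, which compensates the 1 / r carried by B.\<close>

lemma pointwise_low:
  "\<exists>r0>0. r0 \<le> 1 \<and> (\<exists>C>0. \<exists>c>0. \<forall>r a0 a1 a2 u PA PB \<mu> N t.
     0 < r \<and> r \<le> r0 \<and> mgt_mode \<tau> \<delta> m (r\<^sup>2) a0 a1 a2 u \<and> t \<ge> 0 \<and> cmod a0 + cmod a1 + cmod a2 \<le> N \<and>
     \<bar>PA\<bar> + \<bar>PB\<bar> \<le> N \<and> cmod (a1 + \<tau> *\<^sub>R a2 - PB) \<le> r * N \<and> \<bar>\<mu>\<bar> \<le> r * N \<longrightarrow>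
     cmod (u t - main1 r t PB) \<le> C * N * exp (- c * r\<^sup>2 * t) \<and>
     cmod (u t - main1 r t PB - main2 r t \<mu> PA PB) \<le> C * exp (- c * r\<^sup>2 * t) *
       (cmod (a0 - \<tau>\<^sup>2 *\<^sub>R a2 - PA) + cmod (a1 + \<tau> *\<^sub>R a2 - PB + \<i> * \<mu>) / r + r * N + N * exp (- c * t)))"
proof -
  obtain r0 C1 c1 where r0: "r0 > 0" "r0 \<le> 1" and C1: "C1 > 0" and c1: "c1 > 0"
    and w: "\<And>r. 0 < r \<and> r \<le> r0 \<Longrightarrow> k * r / 2 \<le> \<omega> r"
    and low: "\<And>r a0 a1 a2 u t. 0 < r \<and> r \<le> r0 \<and> mgt_mode \<tau> \<delta> m (r\<^sup>2) a0 a1 a2 u \<and> t \<ge> 0 \<Longrightarrow>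
       cmod (u t - slow r t (a0 - \<tau>\<^sup>2 *\<^sub>R a2) (a1 + \<tau> *\<^sub>R a2) - (\<tau>\<^sup>2 * exp (- t / \<tau>)) *\<^sub>R a2)
         \<le> C1 * r * (1 + r\<^sup>2 * t) * exp (- c1 * r\<^sup>2 * t) * (cmod a0 + cmod a1 + cmod a2)"
    using mode_low by metis
  obtain C2 where C2: "C2 > 0" and cmp: "\<And>r t A B PA PB \<mu>. 0 < r \<and> r \<le> 1 \<and> k * r / 2 \<le> \<omega> r \<and> t \<ge> 0 \<Longrightarrow>
     cmod (slow r t A B - main1 r t PB) \<le> C2 * exp (- \<beta> * r\<^sup>2 * t) * (1 + r\<^sup>2 * t) * (cmod A + cmod (B - PB) / r + \<bar>PB\<bar>) \<and>
     cmod (slow r t A B - main1 r t PB - main2 r t \<mu> PA PB) \<le> C2 * exp (- \<beta> * r\<^sup>2 * t) * (1 + r\<^sup>2 * t)\<^sup>2 *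
       (cmod (A - PA) + cmod (B - PB + \<i> * \<mu>) / r + r * (\<bar>PA\<bar> + \<bar>PB\<bar>) + \<bar>\<mu>\<bar>)"
    using slow_compare by metis
  \<comment> \<open>Half of c1 and of \<beta> is given up to absorb (1 + r^2 t)^2. The last entry
    lets exp (- t / \<tau>) pay for exp (- c r^2 t) and exp (- c t) at once, as r \<le> 1.\<close>
  define c where "c = min (c1 / 2) (min (\<beta> / 2) (1 / (2 * \<tau>)))"
  have c: "c > 0" "c \<le> c1 / 2" "c \<le> \<beta> / 2" "c \<le> 1 / (2 * \<tau>)" using c1 beta tau by (auto simp: c_def)
  define K where "K = (max 1 (2 / c))\<^sup>2"
  have K1: "K \<ge> 1" using power_mono[of 1 "max 1 (2 / c)" 2] by (simp add: K_def)
  have Kb: "(1 + x)\<^sup>2 * exp (- d * x) \<le> K * exp (- c * x)" "(1 + x) * exp (- d * x) \<le> K * exp (- c * x)"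
    if x: "x \<ge> 0" and d: "2 * c \<le> d" for x d
  proof -
    have "exp (- d * x) \<le> exp (- (2 * c) * x)" using d x by (simp add: mult_right_mono)
    then have "(1 + x)\<^sup>2 * exp (- d * x) \<le> (K * exp (c * x)) * exp (- (2 * c) * x)"
      using one_plus_le_exp(2)[OF c(1) x] by (intro mult_mono) (auto simp: K_def)
    also have "\<dots> = K * exp (c * x + - (2 * c) * x)" by (simp only: exp_add mult.assoc)
    also have "c * x + - (2 * c) * x = - c * x" by simp
    finally show 1: "(1 + x)\<^sup>2 * exp (- d * x) \<le> K * exp (- c * x)" .
    have "(1 + x) * 1 \<le> (1 + x) * (1 + x)" using x by (intro mult_left_mono) auto
    then have "(1 + x) * exp (- d * x) \<le> (1 + x)\<^sup>2 * exp (- d * x)" by (intro mult_right_mono) (auto simp: power2_eq_square)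
    with 1 show "(1 + x) * exp (- d * x) \<le> K * exp (- c * x)" by linarith
  qed
  define C where "C = C1 * K + \<tau>\<^sup>2 + C2 * K * (2 + 1 + \<tau>\<^sup>2)"
  have C: "C > 0" using C1 C2 K1 by (auto simp: C_def intro!: add_pos_nonneg)
  show ?thesis
  proof (rule exI[of _ r0], rule conjI[OF r0(1)], rule conjI[OF r0(2)], rule exI[of _ C], rule conjI[OF C],
      rule exI[of _ c], rule conjI[OF c(1)], intro allI impI)
    fix r a0 a1 a2 u and PA PB \<mu> N t :: real
    assume asm: "0 < r \<and> r \<le> r0 \<and> mgt_mode \<tau> \<delta> m (r\<^sup>2) a0 a1 a2 u \<and> t \<ge> 0 \<and> cmod a0 + cmod a1 + cmod a2 \<le> N \<and>
     \<bar>PA\<bar> + \<bar>PB\<bar> \<le> N \<and> cmod (a1 + \<tau> *\<^sub>R a2 - PB) \<le> r * N \<and> \<bar>\<mu>\<bar> \<le> r * N"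
    then have r: "0 < r" "r \<le> r0" and mode: "mgt_mode \<tau> \<delta> m (r\<^sup>2) a0 a1 a2 u" and t: "t \<ge> 0"
      and N: "cmod a0 + cmod a1 + cmod a2 \<le> N" "\<bar>PA\<bar> + \<bar>PB\<bar> \<le> N" and BP: "cmod (a1 + \<tau> *\<^sub>R a2 - PB) \<le> r * N" and mu: "\<bar>\<mu>\<bar> \<le> r * N" by auto
    have r1: "r \<le> 1" using r r0 by linarith
    define x where "x = r\<^sup>2 * t"
    have x: "x \<ge> 0" using t by (simp add: x_def)
    define E where "E = exp (- c * x)"
    have E: "E > 0" by (simp add: E_def)
    have N0: "N \<ge> 0" using N(2) by linarith
    define A where "A = a0 - \<tau>\<^sup>2 *\<^sub>R a2"
    define B where "B = a1 + \<tau> *\<^sub>R a2"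
    define F where "F = (\<tau>\<^sup>2 * exp (- t / \<tau>)) *\<^sub>R a2"
    define S where "S = slow r t A B"
    have e1: "cmod (u t - S - F) \<le> C1 * K * (r * N) * E"
    proof -
      have "cmod (u t - S - F) \<le> C1 * r * (1 + x) * exp (- c1 * x) * (cmod a0 + cmod a1 + cmod a2)"
        using low[of r a0 a1 a2 u t] r mode t by (simp add: S_def A_def B_def F_def x_def mult.assoc)
      also have "\<dots> \<le> C1 * r * (1 + x) * exp (- c1 * x) * N" using N C1 r x by (intro mult_left_mono) auto
      also have "\<dots> = (C1 * (r * N)) * ((1 + x) * exp (- c1 * x))" by simp
      also have "\<dots> \<le> (C1 * (r * N)) * (K * E)" unfolding E_def using Kb(2)[OF x, of c1] c C1 r N0 by (intro mult_left_mono) auto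
      finally show ?thesis by (simp add: mult_ac)
    qed
    have e2: "cmod F \<le> \<tau>\<^sup>2 * N * (E * exp (- c * t))"
    proof -
      have "x \<le> 1 * t" unfolding x_def using r r1 t by (intro mult_right_mono) (auto simp: power_le_one)
      then have "c * x \<le> 1 / (2 * \<tau>) * t" using c x by (intro mult_mono) (auto intro: less_imp_le[OF tau])
      moreover have "c * t \<le> 1 / (2 * \<tau>) * t" using c t by (intro mult_right_mono) auto
      ultimately have "- t / \<tau> \<le> - c * x + - c * t" using tau by (simp add: field_simps)
      then have ee: "exp (- t / \<tau>) \<le> E * exp (- c * t)" unfolding E_def exp_add[symmetric] by simp
      have "cmod F = (\<tau>\<^sup>2 * cmod a2) * exp (- t / \<tau>)" by (simp add: F_def)
      also have "\<dots> \<le> (\<tau>\<^sup>2 * N) * (E * exp (- c * t))" using ee N N0 E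
        by (intro mult_mono mult_left_mono) (auto intro: order_trans[OF _ N(1)])
      finally show ?thesis .
    qed
    have nA: "cmod A \<le> (1 + \<tau>\<^sup>2) * N"
    proof -
      have "cmod A \<le> cmod a0 + \<tau>\<^sup>2 * cmod a2" using norm_triangle_ineq4[of a0 "\<tau>\<^sup>2 *\<^sub>R a2"] by (simp add: A_def)
      also have "\<dots> \<le> 1 * N + \<tau>\<^sup>2 * N"
      proof -
        have "cmod a0 \<le> N" "cmod a2 \<le> N" using N(1) norm_ge_zero[of a0] norm_ge_zero[of a1] norm_ge_zero[of a2] by linarith+
        moreover from this have "\<tau>\<^sup>2 * cmod a2 \<le> \<tau>\<^sup>2 * N" by (intro mult_left_mono) auto
        ultimately show ?thesis by linarith
      qed
      finally show ?thesis by (simp add: distrib_right)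
    qed
    have cmp1: "cmod (S - main1 r t PB) \<le> C2 * exp (- \<beta> * x) * (1 + x) * (cmod A + cmod (B - PB) / r + \<bar>PB\<bar>)"
      and cmp2: "cmod (S - main1 r t PB - main2 r t \<mu> PA PB) \<le> C2 * exp (- \<beta> * x) * (1 + x)\<^sup>2 *
       (cmod (A - PA) + cmod (B - PB + \<i> * \<mu>) / r + r * (\<bar>PA\<bar> + \<bar>PB\<bar>) + \<bar>\<mu>\<bar>)"
      using cmp[of r t A B PB \<mu> PA] r r1 w t by (auto simp: S_def x_def mult.assoc)
    have f1: "cmod (S - main1 r t PB) \<le> C2 * K * ((2 + 1 + \<tau>\<^sup>2) * N) * E"
    proof -
      have "cmod A + cmod (B - PB) / r + \<bar>PB\<bar> \<le> (1 + \<tau>\<^sup>2) * N + N + N"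
        using nA BP r N(2) by (intro add_mono) (auto simp: B_def pos_divide_le_eq mult.commute)
      then have "C2 * exp (- \<beta> * x) * (1 + x) * (cmod A + cmod (B - PB) / r + \<bar>PB\<bar>) \<le> C2 * exp (- \<beta> * x) * (1 + x) * ((1 + \<tau>\<^sup>2) * N + N + N)"
        using C2 x by (intro mult_left_mono) auto
      also have "\<dots> = (C2 * ((2 + 1 + \<tau>\<^sup>2) * N)) * ((1 + x) * exp (- \<beta> * x))" by (simp add: algebra_simps)
      also have "\<dots> \<le> (C2 * ((2 + 1 + \<tau>\<^sup>2) * N)) * (K * E)" unfolding E_def using Kb(2)[OF x, of \<beta>] c C2 N0 by (intro mult_left_mono) auto
      finally show ?thesis using cmp1 by (simp add: mult_ac)
    qed
    define V where "V = cmod (A - PA) + cmod (B - PB + \<i> * \<mu>) / r"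
    have V0: "V \<ge> 0" using r by (simp add: V_def)
    have f2: "cmod (S - main1 r t PB - main2 r t \<mu> PA PB) \<le> C2 * K * (V + 2 * (r * N)) * E"
    proof -
      have "r * (\<bar>PA\<bar> + \<bar>PB\<bar>) \<le> r * N" using N r by (intro mult_left_mono) auto
      then have "cmod (A - PA) + cmod (B - PB + \<i> * \<mu>) / r + r * (\<bar>PA\<bar> + \<bar>PB\<bar>) + \<bar>\<mu>\<bar> \<le> V + 2 * (r * N)"
        using mu by (simp add: V_def)
      then have "C2 * exp (- \<beta> * x) * (1 + x)\<^sup>2 * (cmod (A - PA) + cmod (B - PB + \<i> * \<mu>) / r + r * (\<bar>PA\<bar> + \<bar>PB\<bar>) + \<bar>\<mu>\<bar>)
        \<le> C2 * exp (- \<beta> * x) * (1 + x)\<^sup>2 * (V + 2 * (r * N))"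
        using C2 x by (intro mult_left_mono) auto
      also have "\<dots> = (C2 * (V + 2 * (r * N))) * ((1 + x)\<^sup>2 * exp (- \<beta> * x))" by simp
      also have "\<dots> \<le> (C2 * (V + 2 * (r * N))) * (K * E)" unfolding E_def using Kb(1)[OF x, of \<beta>] c C2 N0 V0 r by (intro mult_left_mono) auto
      finally show ?thesis using cmp2 by (simp add: mult_ac)
    qed
    have rN: "r * N \<le> N" using mult_right_mono[OF r1 N0] by simp
    have et: "exp (- c * t) \<le> 1" using c t by simp
    have 1: "cmod (u t - main1 r t PB) \<le> C * N * E"
    proof -
      have "cmod (u t - main1 r t PB) = cmod ((u t - S - F) + F + (S - main1 r t PB))" by simp
      also have "\<dots> \<le> cmod (u t - S - F) + cmod F + cmod (S - main1 r t PB)"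
        by (rule order_trans[OF norm_triangle_ineq add_right_mono[OF norm_triangle_ineq]])
      also have "\<dots> \<le> C1 * K * N * E + \<tau>\<^sup>2 * N * E + C2 * K * ((2 + 1 + \<tau>\<^sup>2) * N) * E"
      proof (intro add_mono f1)
        have "C1 * K * (r * N) * E \<le> C1 * K * N * E" using rN C1 K1 E by (intro mult_right_mono mult_left_mono) auto
        then show "cmod (u t - S - F) \<le> C1 * K * N * E" using e1 by linarith
        have "\<tau>\<^sup>2 * N * (E * exp (- c * t)) \<le> \<tau>\<^sup>2 * N * (E * 1)" using et E N0 by (intro mult_left_mono) auto
        then show "cmod F \<le> \<tau>\<^sup>2 * N * E" using e2 by simp
      qed
      also have "\<dots> = C * N * E" by (simp add: C_def algebra_simps)
      finally show ?thesis .
    qed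
    have 2: "cmod (u t - main1 r t PB - main2 r t \<mu> PA PB) \<le> C * E * (V + r * N + N * exp (- c * t))"
    proof -
      have "cmod (u t - main1 r t PB - main2 r t \<mu> PA PB) = cmod ((u t - S - F) + F + (S - main1 r t PB - main2 r t \<mu> PA PB))" by (rule arg_cong[where f = cmod]) (simp only: diff_add_cancel add_diff_eq)
      also have "\<dots> \<le> cmod (u t - S - F) + cmod F + cmod (S - main1 r t PB - main2 r t \<mu> PA PB)"
        by (rule order_trans[OF norm_triangle_ineq add_right_mono[OF norm_triangle_ineq]])
      also have "\<dots> \<le> C1 * K * (r * N) * E + \<tau>\<^sup>2 * N * (E * exp (- c * t)) + C2 * K * (V + 2 * (r * N)) * E"
        by (intro add_mono e1 e2 f2)
      also have "\<dots> = E * (C1 * K * (r * N) + \<tau>\<^sup>2 * (N * exp (- c * t)) + C2 * K * (V + 2 * (r * N)))" by (simp add: algebra_simps)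
      also have "\<dots> \<le> E * (C * (V + r * N + N * exp (- c * t)))"
      proof (intro mult_left_mono)
        have p: "C1 * K \<ge> 0" "C2 * K \<ge> 0" "C2 * K * \<tau>\<^sup>2 \<ge> 0" using C1 C2 K1 by auto
        have "C1 * K + 2 * (C2 * K) \<le> C" "\<tau>\<^sup>2 \<le> C" "C2 * K \<le> C" using p by (auto simp: C_def distrib_left)
        then have "(C1 * K + 2 * (C2 * K)) * (r * N) \<le> C * (r * N)" "\<tau>\<^sup>2 * (N * exp (- c * t)) \<le> C * (N * exp (- c * t))" "C2 * K * V \<le> C * V"
          using r N0 V0 by (intro mult_right_mono; simp)+
        then show "C1 * K * (r * N) + \<tau>\<^sup>2 * (N * exp (- c * t)) + C2 * K * (V + 2 * (r * N)) \<le> C * (V + r * N + N * exp (- c * t))"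
          by (simp add: algebra_simps)
      qed (use E in simp)
      finally show ?thesis by (simp add: mult_ac)
    qed
    show "cmod (u t - main1 r t PB) \<le> C * N * exp (- c * r\<^sup>2 * t) \<and>
     cmod (u t - main1 r t PB - main2 r t \<mu> PA PB) \<le> C * exp (- c * r\<^sup>2 * t) *
       (cmod (a0 - \<tau>\<^sup>2 *\<^sub>R a2 - PA) + cmod (a1 + \<tau> *\<^sub>R a2 - PB + \<i> * \<mu>) / r + r * N + N * exp (- c * t))"
      using 1 2 by (simp add: E_def x_def V_def A_def B_def mult.assoc)
  qed
qed

lemma main_high:
  assumes r0: "r0 > 0"
  shows "\<exists>C>0. \<exists>c>0. \<forall>r PA PB \<mu> N t. r0 \<le> r \<and> t \<ge> 0 \<and> \<bar>PA\<bar> + \<bar>PB\<bar> \<le> N \<and> \<bar>\<mu>\<bar> \<le> r * N \<longrightarrow>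
     cmod (main1 r t PB) \<le> C * N * exp (- c * r\<^sup>2 * t) * exp (- c * t) \<and> cmod (main2 r t \<mu> PA PB) \<le> C * N * exp (- c * r\<^sup>2 * t) * exp (- c * t)"
proof -
  \<comment> \<open>Half of the exponent \<beta> r^2 t absorbs the factor 1 + r^2 t. The other half
    is split evenly between exp (- c r^2 t) and, by r \<ge> r0, exp (- c t).\<close>
  define c where "c = min (\<beta> / 4) (\<beta> * r0\<^sup>2 / 4)"
  have c: "c > 0" "c \<le> \<beta> / 4" "c \<le> \<beta> * r0\<^sup>2 / 4" using beta r0 by (auto simp: c_def)
  define K where "K = max 1 (1 / (\<beta> / 2))"
  define g where "g = \<bar>\<gamma>\<bar> / k"
  have g: "g \<ge> 0" using k by (simp add: g_def)
  define C where "C = 1 / (k * r0) + K * (1 / k + 1 + g)"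
  have K: "K \<ge> 1" by (simp add: K_def)
  have C: "C > 0" "1 / (k * r0) \<le> C" "K * (1 / k + 1 + g) \<le> C" using k r0 K g by (auto simp: C_def add_pos_nonneg)
  show ?thesis
  proof (rule exI[of _ C], rule conjI[OF C(1)], rule exI[of _ c], rule conjI[OF c(1)], intro allI impI)
    fix r PA PB \<mu> N t :: real
    assume "r0 \<le> r \<and> t \<ge> 0 \<and> \<bar>PA\<bar> + \<bar>PB\<bar> \<le> N \<and> \<bar>\<mu>\<bar> \<le> r * N"
    then have r: "r0 \<le> r" and t: "t \<ge> 0" and N: "\<bar>PA\<bar> + \<bar>PB\<bar> \<le> N" "\<bar>\<mu>\<bar> \<le> r * N" by auto
    have rp: "r > 0" using r r0 by linarith
    have N0: "N \<ge> 0" "\<bar>PA\<bar> \<le> N" "\<bar>PB\<bar> \<le> N" using N by linarith+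
    define x where "x = r\<^sup>2 * t"
    have x: "x \<ge> 0" using t by (simp add: x_def)
    define E where "E = exp (- c * x) * exp (- c * t)"
    have half: "exp (- (\<beta> / 2) * x) \<le> E"
    proof -
      have "c * x \<le> \<beta> / 4 * x" using c x by (intro mult_right_mono) auto
      moreover have "c * t \<le> \<beta> * r0\<^sup>2 / 4 * t" using c t by (intro mult_right_mono) auto
      moreover have "\<beta> / 4 * (r0\<^sup>2 * t) \<le> \<beta> / 4 * x" unfolding x_def using beta r r0 t by (intro mult_left_mono mult_right_mono power_mono) auto
      ultimately have "- (\<beta> / 2) * x \<le> - c * x + - c * t" by simp
      then show ?thesis unfolding E_def exp_add[symmetric] by simp
    qed
    have bx: "exp (- \<beta> * x) \<le> exp (- (\<beta> / 2) * x)" using beta x by (simp add: mult_right_mono)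
    have kr: "k * r0 > 0" "k * r > 0" "k * r0 \<le> k * r" using k r r0 rp by auto
    have ob: "\<bar>osc r t\<bar> \<le> 1 / (k * r)" unfolding osc_def abs_divide using kr by (simp add: divide_right_mono)
    then have ob': "\<bar>osc r t\<bar> \<le> 1 / (k * r0)" using divide_left_mono[of "k * r0" "k * r" 1] kr by simp
    have 1: "cmod (main1 r t PB) \<le> C * N * E"
    proof -
      have "cmod (main1 r t PB) = exp (- \<beta> * x) * (\<bar>osc r t\<bar> * \<bar>PB\<bar>)" by (simp add: norm_main1 x_def mult.assoc)
      also have "\<dots> \<le> E * (C * N)"
      proof (intro mult_mono)
        show "exp (- \<beta> * x) \<le> E" using bx half by linarith
        show "0 \<le> E" by (simp add: E_def)
      qed (use ob' C N0 in auto)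
      finally show ?thesis by (simp add: mult_ac)
    qed
    have "cmod (main2 r t \<mu> PA PB) \<le> exp (- \<beta> * x) * (\<bar>cos (k * r * t) * (PA + \<gamma> / k * PB * r\<^sup>2 * t)\<bar> + \<bar>\<mu> * osc r t\<bar>)"
      unfolding main2_def norm_mult using cmod_le[of "Complex (cos (k * r * t) * (PA + \<gamma> / k * PB * r\<^sup>2 * t)) (- (\<mu> * osc r t))"]
      by (simp add: x_def mult.assoc)
    also have "\<dots> \<le> exp (- \<beta> * x) * ((1 / k + 1 + g) * (1 + x) * N)"
    proof (intro mult_left_mono)
      have "\<bar>\<mu> * osc r t\<bar> \<le> (r * N) * (1 / (k * r))" unfolding abs_mult using ob N N0 rp by (intro mult_mono) auto
      also have "\<dots> = 1 / k * N" using rp by simp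
      finally have a: "\<bar>\<mu> * osc r t\<bar> \<le> 1 / k * N" .
      have "\<bar>PA + \<gamma> / k * PB * r\<^sup>2 * t\<bar> \<le> \<bar>PA\<bar> + \<bar>\<gamma> / k * PB * r\<^sup>2 * t\<bar>" by (rule abs_triangle_ineq)
      also have "\<bar>\<gamma> / k * PB * r\<^sup>2 * t\<bar> = g * \<bar>PB\<bar> * x" using k t by (simp add: g_def x_def abs_mult)
      also have "\<bar>PA\<bar> + g * \<bar>PB\<bar> * x \<le> N + g * N * x" using N0 g x by (intro add_mono mult_right_mono mult_left_mono) auto
      finally have "\<bar>PA + \<gamma> / k * PB * r\<^sup>2 * t\<bar> \<le> N + g * N * x" .
      then have "\<bar>cos (k * r * t)\<bar> * \<bar>PA + \<gamma> / k * PB * r\<^sup>2 * t\<bar> \<le> 1 * (N + g * N * x)" by (intro mult_mono) auto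
      then have b: "\<bar>cos (k * r * t) * (PA + \<gamma> / k * PB * r\<^sup>2 * t)\<bar> \<le> N + g * N * x" by (simp add: abs_mult)
      have "0 \<le> 1 / k * N * x + N * x + g * N" using k N0 x g by auto
      moreover have "(1 / k + 1 + g) * (1 + x) * N = N + g * N * x + 1 / k * N + (1 / k * N * x + N * x + g * N)" by (simp add: algebra_simps add_divide_distrib)
      ultimately show "\<bar>cos (k * r * t) * (PA + \<gamma> / k * PB * r\<^sup>2 * t)\<bar> + \<bar>\<mu> * osc r t\<bar> \<le> (1 / k + 1 + g) * (1 + x) * N"
        using a b by linarith
    qed simp
    also have "\<dots> \<le> exp (- \<beta> * x) * ((1 / k + 1 + g) * (K * exp (\<beta> / 2 * x)) * N)"
      using one_plus_le_exp(1)[of "\<beta> / 2" x] beta x k g N0 by (intro mult_left_mono mult_right_mono) (auto simp: K_def)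
    also have "\<dots> = (K * (1 / k + 1 + g)) * N * exp (- \<beta> * x + \<beta> / 2 * x)" by (simp only: exp_add mult_ac)
    also have "- \<beta> * x + \<beta> / 2 * x = - (\<beta> / 2) * x" by simp
    also have "(K * (1 / k + 1 + g)) * N * exp (- (\<beta> / 2) * x) \<le> C * N * E"
      using half C N0 by (intro mult_mono) auto
    finally have 2: "cmod (main2 r t \<mu> PA PB) \<le> C * N * E" .
    show "cmod (main1 r t PB) \<le> C * N * exp (- c * r\<^sup>2 * t) * exp (- c * t) \<and> cmod (main2 r t \<mu> PA PB) \<le> C * N * exp (- c * r\<^sup>2 * t) * exp (- c * t)"
      using 1 2 by (simp add: E_def x_def mult.assoc)
  qed
qed

end

section \<open>The profiles as inverse transforms of their symbols\<close>

lemma gaussian_dominated: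
  fixes g :: "real^'n \<Rightarrow> complex"
  assumes m: "g \<in> borel_measurable borel" and le: "\<And>\<xi>. cmod (g \<xi>) \<le> C * exp (- c * (norm \<xi>)\<^sup>2)" and c: "c > 0"
  shows "integrable lborel g" "g \<in> L2_space"
proof -
  show "integrable lborel g"
  proof (rule Bochner_Integration.integrable_bound)
    show "integrable lborel (\<lambda>\<xi>::real^'n. C * exp (- c * (norm \<xi>)\<^sup>2))" by (intro integrable_mult_right gaussian_integrable c)
    show "AE x in lborel. norm (g x) \<le> norm (C * exp (- c * (norm x)\<^sup>2))" using le by (auto intro!: order_trans[OF _ abs_ge_self])
  qed (use m in simp)
  show "g \<in> L2_space"
  proof (rule L2_bound(1)[OF m])
    show "integrable lborel (\<lambda>\<xi>::real^'n. C\<^sup>2 * exp (- (2 * c) * (norm \<xi>)\<^sup>2))" using c by (intro integrable_mult_right gaussian_integrable) simp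
    show "AE x in lborel. (norm (g x))\<^sup>2 \<le> C\<^sup>2 * exp (- (2 * c) * (norm x)\<^sup>2)"
    proof (rule AE_I2)
      fix x
      have "(norm (g x))\<^sup>2 \<le> (C * exp (- c * (norm x)\<^sup>2))\<^sup>2" using le by (intro power_mono) auto
      then show "(norm (g x))\<^sup>2 \<le> C\<^sup>2 * exp (- (2 * c) * (norm x)\<^sup>2)" by (simp add: power_mult_distrib mult.assoc flip: exp_double)
    qed
  qed
qed

context mgt begin

definition sym0 :: "real \<Rightarrow> real^'n \<Rightarrow> complex" where
  "sym0 t \<xi> = complex_of_real (osc (norm \<xi>) t * exp (- \<beta> * (norm \<xi>)\<^sup>2 * t))"
definition sym1 :: "real \<Rightarrow> real^'n \<Rightarrow> complex" where
  "sym1 t \<xi> = complex_of_real (cos (k * norm \<xi> * t) * exp (- \<beta> * (norm \<xi>)\<^sup>2 * t))"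
definition sym2 :: "real \<Rightarrow> real^'n \<Rightarrow> complex" where
  "sym2 t \<xi> = complex_of_real ((norm \<xi>)\<^sup>2 * cos (k * norm \<xi> * t) * exp (- \<beta> * (norm \<xi>)\<^sup>2 * t))"

lemma J_eq:
  "J0 \<tau> \<delta> m t = (\<lambda>x::real^'n. Re (inv_fourier (sym0 t) x))"
  "J1 \<tau> \<delta> m t = (\<lambda>x::real^'n. Re (inv_fourier (sym1 t) x))"
  "J2 \<tau> \<delta> m t = (\<lambda>x::real^'n. \<gamma> * t / k * Re (inv_fourier (sym2 t) x))"
proof -
  have b: "- (1 / 2) * (\<delta> + 2 * m * \<tau>\<^sup>2) = - \<beta>" by (simp add: \<beta>_def)
  show "J0 \<tau> \<delta> m t = (\<lambda>x::real^'n. Re (inv_fourier (sym0 t) x))"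
    unfolding J0_def[abs_def] sym0_def[abs_def] osc_def b k(3)[symmetric] ..
  show "J1 \<tau> \<delta> m t = (\<lambda>x::real^'n. Re (inv_fourier (sym1 t) x))"
    unfolding J1_def[abs_def] sym1_def[abs_def] b k(3)[symmetric] ..
  show "J2 \<tau> \<delta> m t = (\<lambda>x::real^'n. \<gamma> * t / k * Re (inv_fourier (sym2 t) x))"
    unfolding J2_def[abs_def] sym2_def[abs_def] b k(3)[symmetric] ..
qed

text \<open>At r = 0 the quotient is 0 by convention, although its limit is t; the bound covers both
  values.\<close>

lemma osc_bound: "0 \<le> r \<Longrightarrow> 0 \<le> t \<Longrightarrow> \<bar>osc r t\<bar> \<le> t"
proof -
  assume r: "0 \<le> r" and t: "0 \<le> t"
  show "\<bar>osc r t\<bar> \<le> t"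
  proof (cases "r = 0")
    case False
    then have kr: "k * r > 0" using r k by simp
    have "\<bar>sin (k * r * t)\<bar> \<le> \<bar>k * r * t\<bar>" by (rule abs_sin_x_le_abs_x)
    also have "\<dots> = t * (k * r)"
      using mult_nonneg_nonneg[OF less_imp_le[OF kr] t] unfolding mult.commute[of t] by (rule abs_of_nonneg)
    finally show ?thesis using kr unfolding osc_def abs_divide by (simp add: pos_divide_le_eq)
  qed (use t in \<open>simp add: osc_def\<close>)
qed

lemma sym_measurable [measurable]:
  "sym0 t \<in> borel_measurable borel" "sym1 t \<in> borel_measurable borel" "sym2 t \<in> borel_measurable borel"
  unfolding sym0_def[abs_def] sym1_def[abs_def] sym2_def[abs_def] osc_def by measurable

lemma sq_exp_le:
  fixes a x :: real
  assumes a: "a > 0"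
  shows "x\<^sup>2 * exp (- a * x\<^sup>2) \<le> 2 / a * exp (- (a / 2) * x\<^sup>2)"
proof -
  have "a / 2 * x\<^sup>2 \<le> exp (a / 2 * x\<^sup>2)" using exp_ge_add_one_self[of "a / 2 * x\<^sup>2"] by linarith
  then have "x\<^sup>2 \<le> 2 / a * exp (a / 2 * x\<^sup>2)" using a by (simp add: field_simps)
  then have "x\<^sup>2 * exp (- a * x\<^sup>2) \<le> 2 / a * exp (a / 2 * x\<^sup>2) * exp (- a * x\<^sup>2)" by (intro mult_right_mono) auto
  also have "\<dots> = 2 / a * exp (a / 2 * x\<^sup>2 + - a * x\<^sup>2)" by (simp only: exp_add mult.assoc)
  also have "a / 2 * x\<^sup>2 + - a * x\<^sup>2 = - (a / 2) * x\<^sup>2" by (simp add: field_simps)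
  finally show ?thesis .
qed

text \<open>The third estimate supplies the second moment asked for by
  \<open>inv_fourier_has_derivative\<close>. There and in the last one the Gaussian pays for
  |\<xi>|^2 with half of its exponent.\<close>

lemma sym_bounds:
  fixes \<xi> :: "real^'n"
  assumes t: "t > 0"
  shows "cmod (sym0 t \<xi>) \<le> t * exp (- (\<beta> * t) * (norm \<xi>)\<^sup>2)"
    "cmod (sym1 t \<xi>) \<le> 1 * exp (- (\<beta> * t) * (norm \<xi>)\<^sup>2)"
    "(norm \<xi>)\<^sup>2 * cmod (sym0 t \<xi>) \<le> (t * (2 / (\<beta> * t))) * exp (- (\<beta> * t / 2) * (norm \<xi>)\<^sup>2)"
    "cmod (sym2 t \<xi>) \<le> (2 / (\<beta> * t)) * exp (- (\<beta> * t / 2) * (norm \<xi>)\<^sup>2)"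
proof -
  have e: "exp (- \<beta> * (norm \<xi>)\<^sup>2 * t) = exp (- (\<beta> * t) * (norm \<xi>)\<^sup>2)" by (simp add: mult_ac)
  show 0: "cmod (sym0 t \<xi>) \<le> t * exp (- (\<beta> * t) * (norm \<xi>)\<^sup>2)"
    unfolding sym0_def norm_of_real abs_mult e abs_exp_cancel using osc_bound[of "norm \<xi>" t] t by (intro mult_right_mono) auto
  show "cmod (sym1 t \<xi>) \<le> 1 * exp (- (\<beta> * t) * (norm \<xi>)\<^sup>2)"
    unfolding sym1_def norm_of_real abs_mult e abs_exp_cancel by (intro mult_right_mono) auto
  have bt: "\<beta> * t > 0" using beta t by simp
  note sq = sq_exp_le[OF bt, of "norm \<xi>"]
  have "(norm \<xi>)\<^sup>2 * cmod (sym0 t \<xi>) \<le> (norm \<xi>)\<^sup>2 * (t * exp (- (\<beta> * t) * (norm \<xi>)\<^sup>2))" by (intro mult_left_mono 0) auto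
  also have "\<dots> = t * ((norm \<xi>)\<^sup>2 * exp (- (\<beta> * t) * (norm \<xi>)\<^sup>2))" by simp
  also have "\<dots> \<le> t * (2 / (\<beta> * t) * exp (- (\<beta> * t / 2) * (norm \<xi>)\<^sup>2))" using sq t by (intro mult_left_mono) auto
  finally show "(norm \<xi>)\<^sup>2 * cmod (sym0 t \<xi>) \<le> (t * (2 / (\<beta> * t))) * exp (- (\<beta> * t / 2) * (norm \<xi>)\<^sup>2)" by (simp only: mult.assoc)
  have "cmod (sym2 t \<xi>) = \<bar>cos (k * norm \<xi> * t)\<bar> * ((norm \<xi>)\<^sup>2 * exp (- (\<beta> * t) * (norm \<xi>)\<^sup>2))"
    unfolding sym2_def norm_of_real abs_mult e abs_exp_cancel by simp
  also have "\<dots> \<le> 1 * ((norm \<xi>)\<^sup>2 * exp (- (\<beta> * t) * (norm \<xi>)\<^sup>2))" by (intro mult_right_mono) auto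
  finally show "cmod (sym2 t \<xi>) \<le> (2 / (\<beta> * t)) * exp (- (\<beta> * t / 2) * (norm \<xi>)\<^sup>2)" using sq by simp
qed

lemma sym_integrable:
  assumes t: "t > 0"
  shows "integrable lborel (sym0 t :: real^'n \<Rightarrow> complex)" "integrable lborel (sym1 t :: real^'n \<Rightarrow> complex)" "integrable lborel (sym2 t :: real^'n \<Rightarrow> complex)"
    "sym0 t \<in> (L2_space :: (real^'n \<Rightarrow> complex) set)" "integrable lborel (\<lambda>\<xi>::real^'n. (norm \<xi>)\<^sup>2 * cmod (sym0 t \<xi>))"
proof -
  have bt: "\<beta> * t > 0" "\<beta> * t / 2 > 0" using beta t by auto
  show "integrable lborel (sym0 t :: real^'n \<Rightarrow> complex)" "sym0 t \<in> (L2_space :: (real^'n \<Rightarrow> complex) set)"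
    using gaussian_dominated[OF _ sym_bounds(1)[OF t] bt(1)] by auto
  show "integrable lborel (sym1 t :: real^'n \<Rightarrow> complex)" using gaussian_dominated(1)[OF _ sym_bounds(2)[OF t] bt(1)] by auto
  show "integrable lborel (sym2 t :: real^'n \<Rightarrow> complex)" using gaussian_dominated(1)[OF _ sym_bounds(4)[OF t] bt(2)] by auto
  show "integrable lborel (\<lambda>\<xi>::real^'n. (norm \<xi>)\<^sup>2 * cmod (sym0 t \<xi>))"
  proof (rule Bochner_Integration.integrable_bound)
    show "integrable lborel (\<lambda>\<xi>::real^'n. (t * (2 / (\<beta> * t))) * exp (- (\<beta> * t / 2) * (norm \<xi>)\<^sup>2))"
      by (intro integrable_mult_right gaussian_integrable bt)
    show "AE \<xi> in lborel. norm ((norm (\<xi>::real^'n))\<^sup>2 * cmod (sym0 t \<xi>)) \<le> norm ((t * (2 / (\<beta> * t))) * exp (- (\<beta> * t / 2) * (norm \<xi>)\<^sup>2))"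
    proof (rule AE_I2)
      fix \<xi> :: "real^'n"
      have "norm ((norm \<xi>)\<^sup>2 * cmod (sym0 t \<xi>)) = (norm \<xi>)\<^sup>2 * cmod (sym0 t \<xi>)" by (simp add: abs_mult)
      also have "\<dots> \<le> (t * (2 / (\<beta> * t))) * exp (- (\<beta> * t / 2) * (norm \<xi>)\<^sup>2)" by (rule sym_bounds(3)[OF t])
      also have "\<dots> \<le> norm \<dots>" by simp
      finally show "norm ((norm \<xi>)\<^sup>2 * cmod (sym0 t \<xi>)) \<le> norm ((t * (2 / (\<beta> * t))) * exp (- (\<beta> * t / 2) * (norm \<xi>)\<^sup>2))" .
    qed
  qed measurable
qed

definition p1hat :: "real \<Rightarrow> real \<Rightarrow> real^'n \<Rightarrow> complex" where "p1hat PB t \<xi> = main1 (norm \<xi>) t PB"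
definition p2hat :: "real^'n \<Rightarrow> real \<Rightarrow> real \<Rightarrow> real \<Rightarrow> real^'n \<Rightarrow> complex" where
  "p2hat v PA PB t \<xi> = main2 (norm \<xi>) t (v \<bullet> \<xi>) PA PB"

lemma p1hat_eq: "p1hat PB t \<xi> = complex_of_real PB * sym0 t \<xi>"
  by (simp add: p1hat_def main1_def sym0_def mult_ac)

lemma p2hat_eq:
  fixes M :: "real^'n"
  shows "p2hat M PA PB t \<xi> = - (\<i> * complex_of_real (M \<bullet> \<xi>) * sym0 t \<xi>) + complex_of_real PA * sym1 t \<xi> + complex_of_real (\<gamma> * t / k * PB) * sym2 t \<xi>"
  by (simp add: p2hat_def main2_def sym0_def sym1_def sym2_def complex_eq_iff algebra_simps)

lemma p1hat_props:
  fixes PB t :: real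
  assumes t: "t > 0"
  shows "integrable lborel (p1hat PB t :: real^'n \<Rightarrow> complex)" "p1hat PB t \<in> (L2_space :: (real^'n \<Rightarrow> complex) set)"
    "(\<lambda>x::real^'n. complex_of_real (J0 \<tau> \<delta> m t x * PB)) = inv_fourier (p1hat PB t)"
proof -
  have eq: "(p1hat PB t :: real^'n \<Rightarrow> complex) = (\<lambda>\<xi>. complex_of_real PB * sym0 t \<xi>)" by (rule ext) (rule p1hat_eq)
  show "integrable lborel (p1hat PB t :: real^'n \<Rightarrow> complex)" unfolding eq by (intro integrable_mult_right sym_integrable t)
  have "cmod (complex_of_real PB * sym0 t \<xi>) \<le> (\<bar>PB\<bar> * t) * exp (- (\<beta> * t) * (norm \<xi>)\<^sup>2)" for \<xi> :: "real^'n"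
    using mult_left_mono[OF sym_bounds(1)[OF t, of \<xi>], of "\<bar>PB\<bar>"] by (simp add: norm_mult mult.assoc)
  from gaussian_dominated(2)[OF _ this] show "p1hat PB t \<in> (L2_space :: (real^'n \<Rightarrow> complex) set)" unfolding eq using beta t by simp
  have h: "complex_of_real (Re (inv_fourier (sym0 t) x)) = inv_fourier (sym0 t) x" for x :: "real^'n"
    by (rule inv_fourier_hermitian) (simp_all add: sym0_def)
  show "(\<lambda>x::real^'n. complex_of_real (J0 \<tau> \<delta> m t x * PB)) = inv_fourier (p1hat PB t)"
    by (rule ext) (simp add: J_eq h, simp add: inv_fourier_eq eq fourier_mult)
qed

text \<open>The conventional value of \<open>osc\<close> at r = 0 makes it discontinuous for t
  \<noteq> 0, but here it is multiplied by M \<bullet> \<xi>, which vanishes there, so it can be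
  replaced by a multiple of sinc. Continuity is what \<open>plancherel_continuous\<close> asks
  for.\<close>

lemma p2hat_continuous:
  fixes M :: "real^'n"
  shows "continuous_on UNIV (p2hat M PA PB t)"
proof -
  define S where "S = (\<lambda>\<xi>::real^'n. sinc (k * t * norm \<xi>))"
  have osc: "osc (norm \<xi>) t = t * S \<xi>" if "\<xi> \<noteq> 0" for \<xi>
    using k(1) that unfolding S_def osc_def by (cases "t = 0") (simp_all add: mult_ac)
  have MS: "(M \<bullet> \<xi>) * osc (norm \<xi>) t = (M \<bullet> \<xi>) * (t * S \<xi>)" for \<xi>
    by (cases "\<xi> = 0") (simp_all add: osc)
  have "continuous_on UNIV (sinc :: real \<Rightarrow> real)" by (intro continuous_at_imp_continuous_on ballI isCont_sinc)
  moreover have "continuous_on UNIV (\<lambda>\<xi>::real^'n. k * t * norm \<xi>)" by (intro continuous_intros)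
  ultimately have c: "continuous_on UNIV S" unfolding S_def by (rule continuous_on_compose2) simp
  have split: "x * Complex y (- z) = x * (complex_of_real y - \<i> * complex_of_real z)" for x y z by (simp add: complex_eq_iff)
  define R where "R = (\<lambda>\<xi>. complex_of_real (exp (- \<beta> * (norm \<xi>)\<^sup>2 * t)) *
     (complex_of_real (cos (k * norm \<xi> * t) * (PA + \<gamma> / k * PB * (norm \<xi>)\<^sup>2 * t)) - \<i> * complex_of_real ((M \<bullet> \<xi>) * (t * S \<xi>))))"
  have "p2hat M PA PB t \<xi> = R \<xi>" for \<xi>
    unfolding R_def p2hat_def main2_def MS by (rule split)
  then have "p2hat M PA PB t = R" by (rule ext)
  moreover have "continuous_on UNIV R" unfolding R_def by (intro continuous_intros c)
  ultimately show ?thesis by (simp only:)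
qed

lemma p2hat_props:
  fixes M :: "real^'n"
  assumes t: "t > 0"
  shows "integrable lborel (p2hat M PA PB t)" "p2hat M PA PB t \<in> L2_space"
    "\<exists>B. \<forall>\<xi>::real^'n. cmod (p2hat M PA PB t \<xi>) \<le> B"
    "(\<lambda>x. complex_of_real (- (grad (J0 \<tau> \<delta> m t) x \<bullet> M) + J1 \<tau> \<delta> m t x * PA + J2 \<tau> \<delta> m t x * PB)) = inv_fourier (p2hat M PA PB t)"
proof -
  define c where "c = \<gamma> * t / k * PB"
  define a where "a = \<beta> * t / 2"
  have a: "a > 0" using beta t by (simp add: a_def)
  have ms: "p2hat M PA PB t \<in> borel_measurable borel" by (intro borel_measurable_continuous_onI p2hat_continuous)
  define C where "C = norm M * (t + t * (2 / (\<beta> * t))) + \<bar>PA\<bar> + \<bar>c\<bar> * (2 / (\<beta> * t))"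
  have bd: "cmod (p2hat M PA PB t \<xi>) \<le> C * exp (- a * (norm \<xi>)\<^sup>2)" for \<xi> :: "real^'n"
  proof -
    define e where "e = exp (- a * (norm \<xi>)\<^sup>2)"
    have e1: "exp (- (\<beta> * t) * (norm \<xi>)\<^sup>2) \<le> e"
    proof -
      have "a * (norm \<xi>)\<^sup>2 \<le> (\<beta> * t) * (norm \<xi>)\<^sup>2" using beta t unfolding a_def by (intro mult_right_mono) auto
      then show ?thesis unfolding e_def by simp
    qed
    have s0: "cmod (sym0 t \<xi>) \<le> t * e" using sym_bounds(1)[OF t, of \<xi>] mult_left_mono[OF e1, of t] t by linarith
    have s1: "cmod (sym1 t \<xi>) \<le> e" using sym_bounds(2)[OF t, of \<xi>] e1 by linarith
    have s2: "cmod (sym2 t \<xi>) \<le> (2 / (\<beta> * t)) * e" using sym_bounds(4)[OF t, of \<xi>] by (simp add: e_def a_def)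
    have s3: "(norm \<xi>)\<^sup>2 * cmod (sym0 t \<xi>) \<le> t * (2 / (\<beta> * t)) * e" using sym_bounds(3)[OF t, of \<xi>] by (simp add: e_def a_def)
    have "norm \<xi> \<le> 1 + (norm \<xi>)\<^sup>2" using zero_le_power2[of "norm \<xi> - 1"] norm_ge_zero[of \<xi>] unfolding power2_diff power_one mult_1_right by linarith
    then have "norm M * norm \<xi> \<le> norm M * (1 + (norm \<xi>)\<^sup>2)" by (intro mult_left_mono) auto
    then have "\<bar>M \<bullet> \<xi>\<bar> \<le> norm M * (1 + (norm \<xi>)\<^sup>2)" using Cauchy_Schwarz_ineq2[of M \<xi>] by linarith
    then have "\<bar>M \<bullet> \<xi>\<bar> * cmod (sym0 t \<xi>) \<le> norm M * (1 + (norm \<xi>)\<^sup>2) * cmod (sym0 t \<xi>)" by (intro mult_right_mono) auto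
    also have "\<dots> = norm M * (cmod (sym0 t \<xi>) + (norm \<xi>)\<^sup>2 * cmod (sym0 t \<xi>))" by (simp add: algebra_simps)
    also have "\<dots> \<le> norm M * (t * e + t * (2 / (\<beta> * t)) * e)" using s0 s3 by (intro mult_left_mono add_mono) auto
    finally have 1: "cmod (- (\<i> * complex_of_real (M \<bullet> \<xi>) * sym0 t \<xi>)) \<le> norm M * (t * e + t * (2 / (\<beta> * t)) * e)" by (simp add: norm_mult)
    have 2: "cmod (complex_of_real PA * sym1 t \<xi>) \<le> \<bar>PA\<bar> * e" unfolding norm_mult norm_of_real using s1 by (intro mult_left_mono) auto
    have 3: "cmod (complex_of_real c * sym2 t \<xi>) \<le> \<bar>c\<bar> * ((2 / (\<beta> * t)) * e)" unfolding norm_mult norm_of_real using s2 by (intro mult_left_mono) auto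
    have "cmod (p2hat M PA PB t \<xi>) \<le> norm M * (t * e + t * (2 / (\<beta> * t)) * e) + \<bar>PA\<bar> * e + \<bar>c\<bar> * ((2 / (\<beta> * t)) * e)"
      unfolding p2hat_eq c_def[symmetric] using norm_triangle_le[OF add_mono[OF norm_triangle_le[OF add_mono[OF 1 2]] 3]] .
    also have "\<dots> = C * e" by (simp add: C_def algebra_simps)
    finally show ?thesis by (simp add: e_def)
  qed
  show "integrable lborel (p2hat M PA PB t)" "p2hat M PA PB t \<in> L2_space" by (rule gaussian_dominated[OF ms bd a])+
  have C0: "C \<ge> 0" using t beta by (simp add: C_def)
  show "\<exists>B. \<forall>\<xi>::real^'n. cmod (p2hat M PA PB t \<xi>) \<le> B"
  proof (intro exI[of _ C] allI)
    fix \<xi> :: "real^'n"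
    have "exp (- a * (norm \<xi>)\<^sup>2) \<le> 1" using a by simp
    then have "C * exp (- a * (norm \<xi>)\<^sup>2) \<le> C * 1" using C0 by (intro mult_left_mono)
    then show "cmod (p2hat M PA PB t \<xi>) \<le> C" using bd[of \<xi>] by linarith
  qed
  have i0: "integrable lborel (\<lambda>\<xi>::real^'n. \<i> * complex_of_real (M \<bullet> \<xi>) * sym0 t \<xi>)"
  proof -
    have "(\<lambda>\<xi>::real^'n. \<i> * complex_of_real (M \<bullet> \<xi>) * sym0 t \<xi>) = (\<lambda>\<xi>. complex_of_real PA * sym1 t \<xi> + complex_of_real c * sym2 t \<xi> - p2hat M PA PB t \<xi>)"
      unfolding p2hat_eq c_def by (rule ext) simp
    moreover have "integrable lborel \<dots>"
      by (intro Bochner_Integration.integrable_diff Bochner_Integration.integrable_add integrable_mult_right sym_integrable[OF t]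
          gaussian_dominated(1)[OF ms bd a])
    ultimately show ?thesis by (simp only:)
  qed
  show "(\<lambda>x. complex_of_real (- (grad (J0 \<tau> \<delta> m t) x \<bullet> M) + J1 \<tau> \<delta> m t x * PA + J2 \<tau> \<delta> m t x * PB)) = inv_fourier (p2hat M PA PB t)"
  proof
    fix x :: "real^'n"
    define D where "D = (\<lambda>h::real^'n. inv_fourier (\<lambda>\<xi>. \<i> * complex_of_real (h \<bullet> \<xi>) * sym0 t \<xi>) x)"
    have d: "(inv_fourier (sym0 t) has_derivative D) (at x)"
      unfolding D_def by (rule inv_fourier_has_derivative[OF sym_integrable(1,5)[OF t]])
    have dJ: "(J0 \<tau> \<delta> m t has_derivative (\<lambda>h. Re (D h))) (at x)"
      unfolding J_eq using bounded_linear.has_derivative[OF bounded_linear_Re d] .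
    have lin: "linear (\<lambda>h. Re (D h))" using has_derivative_linear[OF dJ] .
    \<comment> \<open>\<open>grad\<close> lists the partial derivatives of a function that is
      differentiable at x, so by linearity its inner product with M is the derivative in direction
      M.\<close>
    have "grad (J0 \<tau> \<delta> m t) x \<bullet> M = (\<Sum>i\<in>UNIV. Re (D (axis i 1)) * M $ i)"
      unfolding grad_def frechet_derivative_at[OF dJ, symmetric] by (simp add: inner_vec_def)
    also have "\<dots> = (\<Sum>i\<in>UNIV. Re (D (M $ i *\<^sub>R axis i 1)))"
      by (rule sum.cong) (simp_all add: linear_cmul[OF lin, simplified] mult.commute)
    also have "\<dots> = Re (D (\<Sum>i\<in>UNIV. M $ i *\<^sub>R axis i 1))" by (rule linear_sum[OF lin, symmetric])
    also have "(\<Sum>i\<in>UNIV. M $ i *\<^sub>R axis i 1) = M" using basis_expansion[of M] by (simp add: scalar_mult_eq_scaleR)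
    finally have g: "grad (J0 \<tau> \<delta> m t) x \<bullet> M = Re (D M)" .
    have "inv_fourier (p2hat M PA PB t) x = - D M + complex_of_real PA * inv_fourier (sym1 t) x + complex_of_real c * inv_fourier (sym2 t) x"
    proof -
      have "p2hat M PA PB t = (\<lambda>\<xi>::real^'n. (complex_of_real PA * sym1 t \<xi> + complex_of_real c * sym2 t \<xi>) - \<i> * complex_of_real (M \<bullet> \<xi>) * sym0 t \<xi>)"
        unfolding p2hat_eq[abs_def] c_def by (rule ext) simp
      then have f: "fourier (p2hat M PA PB t) (- x) = complex_of_real PA * fourier (sym1 t) (- x) + complex_of_real c * fourier (sym2 t) (- x) - fourier (\<lambda>\<xi>. \<i> * complex_of_real (M \<bullet> \<xi>) * sym0 t \<xi>) (- x)"
        using fourier_diff[OF Bochner_Integration.integrable_add[OF integrable_mult_right[OF sym_integrable(2)[OF t], of "complex_of_real PA"] integrable_mult_right[OF sym_integrable(3)[OF t], of "complex_of_real c"]] i0, of "- x"]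
          fourier_add[OF integrable_mult_right[OF sym_integrable(2)[OF t], of "complex_of_real PA"] integrable_mult_right[OF sym_integrable(3)[OF t], of "complex_of_real c"], of "- x"]
        by (simp add: fourier_mult)
      have "q * (A * X + B * Y - Z) = - (q * Z) + A * (q * X) + B * (q * Y)" for q A B X Y Z :: complex
        by (simp add: algebra_simps)
      then show ?thesis unfolding D_def inv_fourier_eq f .
    qed
    note e1 = this
    have e2: "complex_of_real (Re (inv_fourier (p2hat M PA PB t) x)) = inv_fourier (p2hat M PA PB t) x"
      by (rule inv_fourier_hermitian[OF ms]) (simp add: p2hat_def main2_def complex_eq_iff)
    have e3: "Re (- D M + complex_of_real PA * inv_fourier (sym1 t) x + complex_of_real c * inv_fourier (sym2 t) x) =
       - (grad (J0 \<tau> \<delta> m t) x \<bullet> M) + J1 \<tau> \<delta> m t x * PA + J2 \<tau> \<delta> m t x * PB"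
      unfolding g J_eq(2,3) c_def by simp
    show "complex_of_real (- (grad (J0 \<tau> \<delta> m t) x \<bullet> M) + J1 \<tau> \<delta> m t x * PA + J2 \<tau> \<delta> m t x * PB) = inv_fourier (p2hat M PA PB t) x"
      unfolding e3[symmetric] e1[symmetric] by (rule e2)
  qed
qed

text \<open>Below r0 this is \<open>pointwise_low\<close>. Above r0 the profiles do not approximate
  u, and the three terms are bounded separately: u by \<open>mode_high\<close>, the symbols by
  \<open>main_high\<close>. Their factor exp (- c t) makes the high-frequency part of the profiles
  negligible against every power of t.\<close>

lemma mode_error:
  "\<exists>r0>0. r0 \<le> 1 \<and> (\<exists>C>0. \<exists>c>0. \<forall>r a0 a1 a2 u PA PB \<mu> N t.
     0 < r \<and> mgt_mode \<tau> \<delta> m (r\<^sup>2) a0 a1 a2 u \<and> t \<ge> 0 \<and> cmod a0 + cmod a1 + cmod a2 \<le> N \<and>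
     \<bar>PA\<bar> + \<bar>PB\<bar> \<le> N \<and> cmod (a1 + \<tau> *\<^sub>R a2 - PB) \<le> r * N \<and> \<bar>\<mu>\<bar> \<le> r * N \<longrightarrow>
     cmod (u t - main1 r t PB) \<le> C * (N * exp (- c * r\<^sup>2 * t)
       + (if r \<le> r0 then 0 else exp (- c * rate (r\<^sup>2) * t) * (cmod a0 + cmod a1 / r + cmod a2 / r\<^sup>2))) \<and>
     cmod (u t - main1 r t PB - main2 r t \<mu> PA PB) \<le> C * (exp (- c * r\<^sup>2 * t) *
       ((if r \<le> r0 then cmod (a0 - \<tau>\<^sup>2 *\<^sub>R a2 - PA) + cmod (a1 + \<tau> *\<^sub>R a2 - PB + \<i> * \<mu>) / r + r * N else 0) + N * exp (- c * t))
       + (if r \<le> r0 then 0 else exp (- c * rate (r\<^sup>2) * t) * (cmod a0 + cmod a1 / r + cmod a2 / r\<^sup>2))))"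
proof -
  obtain r0 C1 c1 where r0: "r0 > 0" "r0 \<le> 1" and C1: "C1 > 0" and c1: "c1 > 0"
    and low: "\<And>r a0 a1 a2 u PA PB \<mu> N t. 0 < r \<and> r \<le> r0 \<and> mgt_mode \<tau> \<delta> m (r\<^sup>2) a0 a1 a2 u \<and> t \<ge> 0 \<and> cmod a0 + cmod a1 + cmod a2 \<le> N \<and>
     \<bar>PA\<bar> + \<bar>PB\<bar> \<le> N \<and> cmod (a1 + \<tau> *\<^sub>R a2 - PB) \<le> r * N \<and> \<bar>\<mu>\<bar> \<le> r * N \<Longrightarrow>
     cmod (u t - main1 r t PB) \<le> C1 * N * exp (- c1 * r\<^sup>2 * t) \<and>
     cmod (u t - main1 r t PB - main2 r t \<mu> PA PB) \<le> C1 * exp (- c1 * r\<^sup>2 * t) *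
       (cmod (a0 - \<tau>\<^sup>2 *\<^sub>R a2 - PA) + cmod (a1 + \<tau> *\<^sub>R a2 - PB + \<i> * \<mu>) / r + r * N + N * exp (- c1 * t))"
    using pointwise_low by metis
  have s0: "r0\<^sup>2 > 0" using r0 by simp
  obtain C2 c2 where C2: "C2 > 0" and c2: "c2 > 0" and high: "\<And>s a0 a1 a2 u t. r0\<^sup>2 \<le> s \<Longrightarrow> mgt_mode \<tau> \<delta> m s a0 a1 a2 u \<Longrightarrow> t \<ge> 0 \<Longrightarrow>
      cmod (u t) \<le> C2 * exp (- c2 * rate s * t) * (cmod a0 + cmod a1 / sqrt s + cmod a2 / s)"
    using mode_high[OF s0] by metis
  obtain C3 c3 where C3: "C3 > 0" and c3: "c3 > 0" and mh: "\<And>r PA PB \<mu> N t. r0 \<le> r \<and> t \<ge> 0 \<and> \<bar>PA\<bar> + \<bar>PB\<bar> \<le> N \<and> \<bar>\<mu>\<bar> \<le> r * N \<Longrightarrow>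
     cmod (main1 r t PB) \<le> C3 * N * exp (- c3 * r\<^sup>2 * t) * exp (- c3 * t) \<and> cmod (main2 r t \<mu> PA PB) \<le> C3 * N * exp (- c3 * r\<^sup>2 * t) * exp (- c3 * t)"
    using main_high[OF r0(1)] by metis
  define C where "C = max C1 (max C2 (2 * C3))"
  define c where "c = min c1 (min c2 c3)"
  have C: "C > 0" "C1 \<le> C" "C2 \<le> C" "2 * C3 \<le> C" using C1 by (auto simp: C_def)
  have c: "c > 0" "c \<le> c1" "c \<le> c2" "c \<le> c3" using c1 c2 c3 by (auto simp: c_def)
  show ?thesis
  proof (rule exI[of _ r0], rule conjI[OF r0(1)], rule conjI[OF r0(2)], rule exI[of _ C], rule conjI[OF C(1)],
      rule exI[of _ c], rule conjI[OF c(1)], intro allI impI)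
    fix r a0 a1 a2 u and PA PB \<mu> N t :: real
    assume a: "0 < r \<and> mgt_mode \<tau> \<delta> m (r\<^sup>2) a0 a1 a2 u \<and> t \<ge> 0 \<and> cmod a0 + cmod a1 + cmod a2 \<le> N \<and>
     \<bar>PA\<bar> + \<bar>PB\<bar> \<le> N \<and> cmod (a1 + \<tau> *\<^sub>R a2 - PB) \<le> r * N \<and> \<bar>\<mu>\<bar> \<le> r * N"
    then have r: "0 < r" and t: "t \<ge> 0" and N0: "N \<ge> 0" by linarith+
    have mono: "exp (- d * y * t) \<le> exp (- c * y * t)" if "c \<le> d" "y \<ge> 0" for d y
      using that t by (simp add: mult_right_mono)
    have mono1: "exp (- d * t) \<le> exp (- c * t)" if "c \<le> d" for d
      using mono[of d 1] that by simp
    show "cmod (u t - main1 r t PB) \<le> C * (N * exp (- c * r\<^sup>2 * t)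
       + (if r \<le> r0 then 0 else exp (- c * rate (r\<^sup>2) * t) * (cmod a0 + cmod a1 / r + cmod a2 / r\<^sup>2))) \<and>
     cmod (u t - main1 r t PB - main2 r t \<mu> PA PB) \<le> C * (exp (- c * r\<^sup>2 * t) *
       ((if r \<le> r0 then cmod (a0 - \<tau>\<^sup>2 *\<^sub>R a2 - PA) + cmod (a1 + \<tau> *\<^sub>R a2 - PB + \<i> * \<mu>) / r + r * N else 0) + N * exp (- c * t))
       + (if r \<le> r0 then 0 else exp (- c * rate (r\<^sup>2) * t) * (cmod a0 + cmod a1 / r + cmod a2 / r\<^sup>2)))"
    proof (cases "r \<le> r0")
      case True
      define V where "V = cmod (a0 - \<tau>\<^sup>2 *\<^sub>R a2 - PA) + cmod (a1 + \<tau> *\<^sub>R a2 - PB + \<i> * \<mu>) / r + r * N"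
      have V: "V \<ge> 0" using r N0 by (simp add: V_def)
      have l: "cmod (u t - main1 r t PB) \<le> C1 * N * exp (- c1 * r\<^sup>2 * t)"
         "cmod (u t - main1 r t PB - main2 r t \<mu> PA PB) \<le> C1 * exp (- c1 * r\<^sup>2 * t) * (V + N * exp (- c1 * t))"
        using low[of r a0 a1 a2 u t N PA PB \<mu>] a True unfolding V_def by blast+
      note l(1)
      also have "C1 * N * exp (- c1 * r\<^sup>2 * t) \<le> C * N * exp (- c * r\<^sup>2 * t)"
        using C C1 N0 c mono[of c1 "r\<^sup>2"] by (intro mult_mono) auto
      finally have 1: "cmod (u t - main1 r t PB) \<le> C * N * exp (- c * r\<^sup>2 * t)" .
      note l(2)
      also have "C1 * exp (- c1 * r\<^sup>2 * t) * (V + N * exp (- c1 * t)) \<le> C * exp (- c * r\<^sup>2 * t) * (V + N * exp (- c * t))"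
        using C C1 N0 V c mono[of c1 "r\<^sup>2"] mono1[of c1] by (intro mult_mono add_mono) auto
      finally show ?thesis using 1 True by (simp add: V_def mult.assoc)
    next
      case False
      then have rr: "r0 \<le> r" by simp
      define H where "H = cmod a0 + cmod a1 / r + cmod a2 / r\<^sup>2"
      have H: "H \<ge> 0" using r by (simp add: H_def)
      have rate0: "rate (r\<^sup>2) \<ge> 0" using rate_pos[of "r\<^sup>2"] r by simp
      have "cmod (u t) \<le> C2 * exp (- c2 * rate (r\<^sup>2) * t) * H"
        using high[of "r\<^sup>2" a0 a1 a2 u t] a rr r0 r by (simp add: H_def power_mono)
      also have "\<dots> \<le> C * exp (- c * rate (r\<^sup>2) * t) * H"
        using C C2 c mono[of c2 "rate (r\<^sup>2)"] rate0 H by (intro mult_mono) auto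
      finally have h: "cmod (u t) \<le> C * (exp (- c * rate (r\<^sup>2) * t) * H)" by (simp add: mult.assoc)
      define e where "e = exp (- c * r\<^sup>2 * t)"
      define d where "d = exp (- c * t)"
      have e: "e > 0" "d > 0" "d \<le> 1" using c t by (auto simp: e_def d_def)
      have "C3 * N * exp (- c3 * r\<^sup>2 * t) * exp (- c3 * t) \<le> C3 * N * e * d"
        unfolding e_def d_def using C3 N0 c mono[of c3 "r\<^sup>2"] mono1[of c3] by (intro mult_mono) auto
      then have m: "cmod (main1 r t PB) \<le> C3 * N * e * d" "cmod (main2 r t \<mu> PA PB) \<le> C3 * N * e * d"
        using mh[of r t PA PB N \<mu>] a rr by (meson order_trans)+
      have z: "0 \<le> N * e * d" using N0 e by simp
      have CC: "2 * (C3 * N * e * d) \<le> C * (N * e * d)" using mult_right_mono[OF C(4) z] by (simp add: mult.assoc)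
      have zz: "0 \<le> C3 * N * e * d" using z C3 by (simp add: mult.assoc)
      have "C * (N * e * d) \<le> C * (N * e * 1)" using C N0 e by (intro mult_left_mono) auto
      then have "cmod (u t - main1 r t PB) \<le> C * (exp (- c * rate (r\<^sup>2) * t) * H) + C * (N * e)"
        using norm_triangle_ineq4[of "u t" "main1 r t PB"] m h CC zz by simp
      moreover have "cmod (u t - main1 r t PB - main2 r t \<mu> PA PB) \<le> C * (exp (- c * rate (r\<^sup>2) * t) * H) + C * (N * e * d)"
        using norm_triangle_ineq4[of "u t" "main1 r t PB"] norm_triangle_ineq4[of "u t - main1 r t PB" "main2 r t \<mu> PA PB"] m h CC by linarith
      ultimately show ?thesis using False by (simp add: H_def e_def d_def distrib_left mult_ac)
    qed
  qed
qed

end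

section \<open>High frequencies\<close>

text \<open>The function x powr l times exp (- x) is largest at x = l, with value exp (l ln l -
  l).\<close>

lemma exp_minus_le_powr:
  fixes l x :: real
  assumes "l > 0" "x > 0"
  shows "exp (- x) \<le> exp (l * ln l - l) * x powr (- l)"
proof -
  have "ln (x / l) \<le> x / l - 1" using assms by (intro ln_le_minus_one) auto
  then have "l * ln (x / l) \<le> l * (x / l - 1)" using assms by (intro mult_left_mono) auto
  then have "- x \<le> (l * ln l - l) + - l * ln x" using assms by (simp add: ln_div algebra_simps)
  then show ?thesis using assms by (simp add: powr_def flip: exp_add)
qed

context mgt begin

text \<open>Weight on the squared transform of the j-th datum, at s = |\<xi>|^2: its integral
  expresses the L2 condition if \<delta> > 0 and the Sobolev condition of order max (l - j) 0 if
  \<delta> = 0.\<close>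

definition weight :: "real \<Rightarrow> nat \<Rightarrow> real \<Rightarrow> real" where
  "weight l j s = (if \<delta> > 0 then 1 else (1 + s) powr max (l - real j) 0)"

text \<open>If \<delta> = 0, the exponent is at least a multiple of t / (1 + s) and is traded for
  the power - l of that quotient: decay of order l in time costs l powers of 1 + s, of which the
  division by s^j refunds j. The resulting t powr (- l) will beat t powr (- n / 2) because l > n /
  2.\<close>

lemma weight_bound:
  assumes l: "l > 0" and c: "c > 0" and s0: "s0 > 0"
  shows "\<exists>K>0. \<forall>s\<ge>s0. \<forall>t>0. \<forall>j\<le>2. exp (- c * rate s * t) / s ^ j \<le> K * t powr (- l) * weight l j s"
proof -
  define \<rho> where "\<rho> = s0 / (1 + s0)"
  have rho: "\<rho> > 0" using s0 by (simp add: \<rho>_def)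
  \<comment> \<open>Bounds (1 + s) / s for s \<ge> s0, so that negative powers of s can be replaced
    by those of 1 + s.\<close>
  define q where "q = 1 + 1 / s0"
  have q: "q \<ge> 1" using s0 by (simp add: q_def)
  define L where "L = exp (l * ln l - l) * (c * \<rho>) powr (- l)"
  have L: "L > 0" using c rho by (simp add: L_def)
  show ?thesis
  proof (rule exI[of _ "L * q\<^sup>2"], rule conjI, use L q in simp, intro allI impI)
    fix s t :: real and j :: nat assume s: "s0 \<le> s" and t: "0 < t" and j: "j \<le> 2"
    have sp: "s > 0" using s s0 by linarith
    have rs: "\<rho> \<le> s / (1 + s)" using s s0 by (simp add: \<rho>_def field_simps)
    have qj: "q ^ j \<le> q\<^sup>2" using q j by (intro power_increasing) auto
    show "exp (- c * rate s * t) / s ^ j \<le> L * q\<^sup>2 * t powr (- l) * weight l j s"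
    proof (cases "\<delta> > 0")
      case True
      have "c * \<rho> * t \<le> c * rate s * t" using True rs c t by (intro mult_right_mono mult_left_mono) (auto simp: rate_def)
      then have "exp (- c * rate s * t) \<le> exp (- (c * \<rho> * t))" by simp
      also have "\<dots> \<le> exp (l * ln l - l) * (c * \<rho> * t) powr (- l)" using c rho t by (intro exp_minus_le_powr l) simp
      also have "\<dots> = L * t powr (- l)" using c rho t by (simp add: L_def powr_mult)
      finally have e: "exp (- c * rate s * t) \<le> L * t powr (- l)" .
      have "1 / s \<le> 1 / s0" using s s0 by (simp add: frac_le)
      then have "(1 / s) ^ j \<le> q ^ j" using sp by (intro power_mono) (auto simp: q_def)
      then have "(1 / s) ^ j \<le> q\<^sup>2" using qj by linarith
      then have "exp (- c * rate s * t) * (1 / s) ^ j \<le> (L * t powr (- l)) * q\<^sup>2" using e L sp by (intro mult_mono) auto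
      then show ?thesis using True by (simp add: weight_def power_divide mult_ac)
    next
      case False
      define y where "y = 1 + s"
      have y: "y \<ge> 1" using sp by (simp add: y_def)
      have "\<rho> / y \<le> s / y / y" using rs y by (intro divide_right_mono) (auto simp: y_def)
      then have "\<rho> / y \<le> rate s" using False by (simp add: rate_def y_def power2_eq_square)
      then have "c * (\<rho> / y) * t \<le> c * rate s * t" using c t by (intro mult_right_mono mult_left_mono) auto
      then have "exp (- c * rate s * t) \<le> exp (- (c * \<rho> * t / y))" by simp
      also have "\<dots> \<le> exp (l * ln l - l) * (c * \<rho> * t / y) powr (- l)" using c rho t y by (intro exp_minus_le_powr l) simp
      also have "(c * \<rho> * t / y) powr (- l) = (c * \<rho>) powr (- l) * t powr (- l) * y powr l"
        using c rho t y by (simp add: powr_mult powr_divide powr_minus field_simps)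
      finally have e: "exp (- c * rate s * t) \<le> L * t powr (- l) * y powr l" by (simp add: L_def mult_ac)
      have "y / s = 1 + 1 / s" using sp by (simp add: y_def add_divide_distrib)
      then have "1 / s = (1 + 1 / s) / y" using y by (simp flip: \<open>y / s = 1 + 1 / s\<close>)
      also have "\<dots> \<le> q / y" using s s0 sp y by (intro divide_right_mono) (auto simp: q_def frac_le)
      finally have "(1 / s) ^ j \<le> (q / y) ^ j" using sp by (intro power_mono) auto
      also have "\<dots> = q ^ j * y powr (- real j)" using y by (simp add: power_divide powr_minus_divide powr_realpow)
      also have "\<dots> \<le> q\<^sup>2 * y powr (- real j)" using qj by (intro mult_right_mono) auto
      finally have "exp (- c * rate s * t) * (1 / s) ^ j \<le> (L * t powr (- l) * y powr l) * (q\<^sup>2 * y powr (- real j))"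
        using e L sp y by (intro mult_mono) auto
      also have "\<dots> = L * q\<^sup>2 * t powr (- l) * (y powr (l - real j))" by (simp add: powr_diff powr_minus divide_inverse)
      also have "\<dots> \<le> L * q\<^sup>2 * t powr (- l) * (y powr max (l - real j) 0)"
        using L y by (intro mult_left_mono powr_mono) auto
      finally show ?thesis using False by (simp add: weight_def y_def power_divide)
    qed
  qed
qed

text \<open>Plancherel's inequality if \<delta> > 0. If \<delta> = 0, the integral is the squared
  Sobolev norm itself, and (2 pi)^n \<ge> 1 lets both cases share one constant.\<close>

lemma weighted_plancherel:
  fixes f :: "real^'n \<Rightarrow> real"
  assumes f: "f \<in> (if \<delta> > 0 then L2_space \<inter> L1_space else H_L1_space (max (l - real j) 0))"
    and N: "(if \<delta> > 0 then L2_norm f else H_norm (max (l - real j) 0) f) \<le> N"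
  shows "integrable lborel (\<lambda>\<xi>. weight l j ((norm \<xi>)\<^sup>2) * (cmod (fourier_real f \<xi>))\<^sup>2)"
    "(LINT \<xi>|lborel. weight l j ((norm \<xi>)\<^sup>2) * (cmod (fourier_real f \<xi>))\<^sup>2) \<le> (2 * pi) ^ CARD('n) * N\<^sup>2"
proof -
  have "integrable lborel (\<lambda>\<xi>. weight l j ((norm \<xi>)\<^sup>2) * (cmod (fourier_real f \<xi>))\<^sup>2) \<and>
    (LINT \<xi>|lborel. weight l j ((norm \<xi>)\<^sup>2) * (cmod (fourier_real f \<xi>))\<^sup>2) \<le> (2 * pi) ^ CARD('n) * N\<^sup>2"
  proof (cases "\<delta> > 0")
    case True
    have i: "integrable lborel (\<lambda>x. complex_of_real (f x))" using f True by (simp add: L1_space_iff)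
    have i2: "integrable lborel (\<lambda>x. (cmod (complex_of_real (f x)))\<^sup>2)" using f True L2_spaceD(2)[of f] by simp
    have a: "(2 * pi) ^ CARD('n) * (L2_norm f)\<^sup>2 \<le> (2 * pi) ^ CARD('n) * N\<^sup>2"
      using N True by (intro mult_left_mono power_mono L2_norm_nonneg) auto
    have e: "(LINT x|lborel. (cmod (complex_of_real (f x)))\<^sup>2) = (L2_norm f)\<^sup>2" by (simp add: L2_norm_square)
    have "(LINT \<xi>|lborel. (cmod (fourier_real f \<xi>))\<^sup>2) \<le> (2 * pi) ^ CARD('n) * N\<^sup>2"
      by (rule order_trans[OF plancherel_le(2)[OF i i2, unfolded e] a])
    with plancherel_le(1)[OF i i2] show ?thesis unfolding weight_def if_P[OF True] mult_1 by (rule conjI)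
  next
    case False
    have "1 \<le> (2 * pi) ^ CARD('n)" using pi_gt3 by (intro one_le_power) linarith
    then have "1 * N\<^sup>2 \<le> (2 * pi) ^ CARD('n) * N\<^sup>2" by (intro mult_right_mono) auto
    moreover have "(H_norm (max (l - real j) 0) f)\<^sup>2 \<le> N\<^sup>2" using N False by (intro power_mono) (auto simp: H_norm_def)
    moreover have "(H_norm (max (l - real j) 0) f)\<^sup>2 = (LINT \<xi>|lborel. (1 + (norm \<xi>)\<^sup>2) powr max (l - real j) 0 * (cmod (fourier_real f \<xi>))\<^sup>2)"
      unfolding H_norm_def by (intro real_sqrt_pow2 Bochner_Integration.integral_nonneg) simp
    ultimately show ?thesis using f False by (simp add: weight_def H_L1_space_def)
  qed
  then show "integrable lborel (\<lambda>\<xi>. weight l j ((norm \<xi>)\<^sup>2) * (cmod (fourier_real f \<xi>))\<^sup>2)"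
    "(LINT \<xi>|lborel. weight l j ((norm \<xi>)\<^sup>2) * (cmod (fourier_real f \<xi>))\<^sup>2) \<le> (2 * pi) ^ CARD('n) * N\<^sup>2" by auto
qed

text \<open>The orders are written as max (l - real j) 0 for j = 0, 1, 2, even where this is l, to
  match \<open>weight\<close>.\<close>

lemma B_spaceD:
  assumes B: "(\<psi>0, \<psi>1, \<psi>2) \<in> B_space \<delta> l" and l: "l \<ge> 0"
  shows "\<psi>0 \<in> L1_space" "\<psi>1 \<in> L11_space" "\<psi>2 \<in> L11_space"
    "L1_norm \<psi>0 + L11_norm \<psi>1 + L11_norm \<psi>2 \<le> B_norm \<delta> l \<psi>0 \<psi>1 \<psi>2"
    "\<psi>0 \<in> (if \<delta> > 0 then L2_space \<inter> L1_space else H_L1_space (max (l - real 0) 0))"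
    "\<psi>1 \<in> (if \<delta> > 0 then L2_space \<inter> L1_space else H_L1_space (max (l - real 1) 0))"
    "\<psi>2 \<in> (if \<delta> > 0 then L2_space \<inter> L1_space else H_L1_space (max (l - real 2) 0))"
    "(if \<delta> > 0 then L2_norm \<psi>0 else H_norm (max (l - real 0) 0) \<psi>0) \<le> B_norm \<delta> l \<psi>0 \<psi>1 \<psi>2"
    "(if \<delta> > 0 then L2_norm \<psi>1 else H_norm (max (l - real 1) 0) \<psi>1) \<le> B_norm \<delta> l \<psi>0 \<psi>1 \<psi>2"
    "(if \<delta> > 0 then L2_norm \<psi>2 else H_norm (max (l - real 2) 0) \<psi>2) \<le> B_norm \<delta> l \<psi>0 \<psi>1 \<psi>2"
proof -
  have nn: "0 \<le> L1_norm \<psi>0" "0 \<le> L1_norm \<psi>1" "0 \<le> L1_norm \<psi>2" "0 \<le> L11_norm \<psi>1" "0 \<le> L11_norm \<psi>2"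
    unfolding L1_norm_def L11_norm_def by (intro Bochner_Integration.integral_nonneg; simp)+
  have hn: "0 \<le> H_norm s f" for s and f :: "real^'n \<Rightarrow> real"
    unfolding H_norm_def by (intro real_sqrt_ge_zero Bochner_Integration.integral_nonneg) simp
  note n = nn hn[of _ \<psi>0] hn[of _ \<psi>1] hn[of _ \<psi>2] L2_norm_nonneg[of \<psi>0] L2_norm_nonneg[of \<psi>1] L2_norm_nonneg[of \<psi>2]
  have m: "max l 0 = l" using l by simp
  show "\<psi>0 \<in> L1_space" "\<psi>1 \<in> L11_space" "\<psi>2 \<in> L11_space" using B by (auto simp: B_space_def)
  show "\<psi>0 \<in> (if \<delta> > 0 then L2_space \<inter> L1_space else H_L1_space (max (l - real 0) 0))"
    "\<psi>1 \<in> (if \<delta> > 0 then L2_space \<inter> L1_space else H_L1_space (max (l - real 1) 0))"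
    "\<psi>2 \<in> (if \<delta> > 0 then L2_space \<inter> L1_space else H_L1_space (max (l - real 2) 0))"
    using B m by (auto simp: B_space_def A_space_def split: if_splits)
  show "L1_norm \<psi>0 + L11_norm \<psi>1 + L11_norm \<psi>2 \<le> B_norm \<delta> l \<psi>0 \<psi>1 \<psi>2"
    "(if \<delta> > 0 then L2_norm \<psi>0 else H_norm (max (l - real 0) 0) \<psi>0) \<le> B_norm \<delta> l \<psi>0 \<psi>1 \<psi>2"
    "(if \<delta> > 0 then L2_norm \<psi>1 else H_norm (max (l - real 1) 0) \<psi>1) \<le> B_norm \<delta> l \<psi>0 \<psi>1 \<psi>2"
    "(if \<delta> > 0 then L2_norm \<psi>2 else H_norm (max (l - real 2) 0) \<psi>2) \<le> B_norm \<delta> l \<psi>0 \<psi>1 \<psi>2"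
    using n(1-5,9-11) n(6)[of l] n(7)[of "max (l - 1) 0"] n(8)[of "max (l - 2) 0"] m
    by (auto simp: B_norm_def A_norm_def)
qed

text \<open>The point is that W does not depend on t: the whole time dependence of the bound is the
  factor t powr (- l), and one integral of W serves all t.\<close>

lemma high_weight:
  assumes l: "l > 0" and c: "c > 0" and r0: "r0 > 0"
  shows "\<exists>K>0. \<forall>(\<psi>0::real^'n \<Rightarrow> real) \<psi>1 \<psi>2. (\<psi>0, \<psi>1, \<psi>2) \<in> B_space \<delta> l \<longrightarrow>
    (\<exists>W. integrable lborel W \<and> (LINT \<xi>|lborel. W \<xi>) \<le> K * (B_norm \<delta> l \<psi>0 \<psi>1 \<psi>2)\<^sup>2 \<and> (\<forall>\<xi>. 0 \<le> W \<xi>) \<and>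
      (\<forall>\<xi> t. r0 \<le> norm \<xi> \<and> 0 < t \<longrightarrow>
        (exp (- c * rate ((norm \<xi>)\<^sup>2) * t) * (cmod (fourier_real \<psi>0 \<xi>) + cmod (fourier_real \<psi>1 \<xi>) / norm \<xi>
           + cmod (fourier_real \<psi>2 \<xi>) / (norm \<xi>)\<^sup>2))\<^sup>2 \<le> t powr (- l) * W \<xi>))"
proof -
  have c2: "2 * c > 0" and s0: "r0\<^sup>2 > 0" using c r0 by auto
  obtain K where K: "K > 0" and wb: "\<And>s t j. r0\<^sup>2 \<le> s \<Longrightarrow> 0 < t \<Longrightarrow> j \<le> 2 \<Longrightarrow> exp (- (2 * c) * rate s * t) / s ^ j \<le> K * t powr (- l) * weight l j s"
    using weight_bound[OF l c2 s0] by blast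
  define P where "P = (2 * pi) ^ CARD('n)"
  have P: "P > 0" by (simp add: P_def)
  show ?thesis
  proof (rule exI[of _ "9 * K * P"], rule conjI, use K P in simp, intro allI impI)
    fix \<psi>0 \<psi>1 \<psi>2 :: "real^'n \<Rightarrow> real" assume B: "(\<psi>0, \<psi>1, \<psi>2) \<in> B_space \<delta> l"
    define N where "N = B_norm \<delta> l \<psi>0 \<psi>1 \<psi>2"
    note D = B_spaceD[OF B less_imp_le[OF l], folded N_def]
    define g where "g = (\<lambda>j (f::real^'n \<Rightarrow> real) \<xi>. weight l j ((norm \<xi>)\<^sup>2) * (cmod (fourier_real f \<xi>))\<^sup>2)"
    have i: "integrable lborel (g 0 \<psi>0)" "integrable lborel (g 1 \<psi>1)" "integrable lborel (g 2 \<psi>2)"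
      and b: "(LINT \<xi>|lborel. g 0 \<psi>0 \<xi>) \<le> P * N\<^sup>2" "(LINT \<xi>|lborel. g 1 \<psi>1 \<xi>) \<le> P * N\<^sup>2" "(LINT \<xi>|lborel. g 2 \<psi>2 \<xi>) \<le> P * N\<^sup>2"
      unfolding g_def P_def
      using weighted_plancherel[OF D(5,8)] weighted_plancherel[OF D(6,9)] weighted_plancherel[OF D(7,10)] by blast+
    have g0: "0 \<le> g j f \<xi>" for j f \<xi> by (simp add: g_def weight_def)
    define W where "W = (\<lambda>\<xi>. 3 * K * (g 0 \<psi>0 \<xi> + g 1 \<psi>1 \<xi> + g 2 \<psi>2 \<xi>))"
    show "\<exists>W. integrable lborel W \<and> (LINT \<xi>|lborel. W \<xi>) \<le> 9 * K * P * (B_norm \<delta> l \<psi>0 \<psi>1 \<psi>2)\<^sup>2 \<and> (\<forall>\<xi>. 0 \<le> W \<xi>) \<and>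
      (\<forall>\<xi> t. r0 \<le> norm \<xi> \<and> 0 < t \<longrightarrow>
        (exp (- c * rate ((norm \<xi>)\<^sup>2) * t) * (cmod (fourier_real \<psi>0 \<xi>) + cmod (fourier_real \<psi>1 \<xi>) / norm \<xi>
           + cmod (fourier_real \<psi>2 \<xi>) / (norm \<xi>)\<^sup>2))\<^sup>2 \<le> t powr (- l) * W \<xi>)"
    proof (rule exI[of _ W], intro conjI allI impI)
      show "integrable lborel W" unfolding W_def using i by auto
      have "(LINT \<xi>|lborel. W \<xi>) = 3 * K * ((LINT \<xi>|lborel. g 0 \<psi>0 \<xi>) + (LINT \<xi>|lborel. g 1 \<psi>1 \<xi>) + (LINT \<xi>|lborel. g 2 \<psi>2 \<xi>))"
        unfolding W_def using i by simp
      also have "\<dots> \<le> 3 * K * (3 * (P * N\<^sup>2))" using b K by (intro mult_left_mono) auto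
      finally show "(LINT \<xi>|lborel. W \<xi>) \<le> 9 * K * P * (B_norm \<delta> l \<psi>0 \<psi>1 \<psi>2)\<^sup>2" by (simp add: N_def)
      show "0 \<le> W \<xi>" for \<xi> unfolding W_def using g0 K by (intro mult_nonneg_nonneg add_nonneg_nonneg) auto
      fix \<xi> :: "real^'n" and t :: real assume a: "r0 \<le> norm \<xi> \<and> 0 < t"
      define r where "r = norm \<xi>"
      have r: "r0 \<le> r" "r > 0" and t: "0 < t" using a r0 by (auto simp: r_def)
      have r2: "r0\<^sup>2 \<le> r\<^sup>2" using r r0 by (intro power_mono) auto
      define e where "e = exp (- (2 * c) * rate (r\<^sup>2) * t)"
      define x0 x1 x2 where "x0 = cmod (fourier_real \<psi>0 \<xi>)" and "x1 = cmod (fourier_real \<psi>1 \<xi>)" and "x2 = cmod (fourier_real \<psi>2 \<xi>)"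
      have ee: "(exp (- c * rate (r\<^sup>2) * t))\<^sup>2 = e" by (simp add: e_def mult.assoc flip: exp_double)
      have three: "(x + y + z)\<^sup>2 \<le> 3 * (x\<^sup>2 + y\<^sup>2 + z\<^sup>2)" for x y z :: real
        using sum_squares_bound[of x y] sum_squares_bound[of y z] sum_squares_bound[of x z] by (simp add: power2_eq_square algebra_simps)
      have tb: "e * (x / r ^ j)\<^sup>2 \<le> K * t powr (- l) * (weight l j (r\<^sup>2) * x\<^sup>2)" if "j \<le> 2" for x j
      proof -
        have "e / (r\<^sup>2) ^ j * x\<^sup>2 \<le> K * t powr (- l) * weight l j (r\<^sup>2) * x\<^sup>2"
          unfolding e_def using wb[OF r2 t that] by (intro mult_right_mono) auto
        moreover have "(r\<^sup>2) ^ j = (r ^ j)\<^sup>2" by (simp add: mult.commute flip: power_mult)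
        ultimately show ?thesis by (simp add: power_divide mult.assoc)
      qed
      have "(exp (- c * rate (r\<^sup>2) * t) * (x0 + x1 / r + x2 / r\<^sup>2))\<^sup>2 = e * (x0 + x1 / r + x2 / r\<^sup>2)\<^sup>2"
        by (simp only: power_mult_distrib ee)
      also have "\<dots> \<le> e * (3 * (x0\<^sup>2 + (x1 / r)\<^sup>2 + (x2 / r\<^sup>2)\<^sup>2))" using three by (intro mult_left_mono) (auto simp: e_def)
      also have "\<dots> = 3 * (e * x0\<^sup>2 + e * (x1 / r)\<^sup>2 + e * (x2 / r\<^sup>2)\<^sup>2)" by (simp add: algebra_simps)
      also have "\<dots> \<le> 3 * (K * t powr (- l) * (weight l 0 (r\<^sup>2) * x0\<^sup>2) + K * t powr (- l) * (weight l 1 (r\<^sup>2) * x1\<^sup>2) + K * t powr (- l) * (weight l 2 (r\<^sup>2) * x2\<^sup>2))"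
        using tb[of 0 x0] tb[of 1 x1] tb[of 2 x2] by simp
      also have "\<dots> = t powr (- l) * W \<xi>" by (simp add: W_def g_def x0_def x1_def x2_def r_def algebra_simps)
      finally show "(exp (- c * rate ((norm \<xi>)\<^sup>2) * t) * (cmod (fourier_real \<psi>0 \<xi>) + cmod (fourier_real \<psi>1 \<xi>) / norm \<xi>
           + cmod (fourier_real \<psi>2 \<xi>) / (norm \<xi>)\<^sup>2))\<^sup>2 \<le> t powr (- l) * W \<xi>"
        by (simp add: x0_def x1_def x2_def r_def)
    qed
  qed
qed

section \<open>Pointwise errors in terms of the data\<close>

lemma combination_bounds:
  fixes \<psi>0 \<psi>1 \<psi>2 \<phi> \<zeta> :: "real^'n \<Rightarrow> real"
  assumes \<psi>: "\<psi>0 \<in> L1_space" "\<psi>1 \<in> L11_space" "\<psi>2 \<in> L11_space"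
    and S: "L1_norm \<psi>0 + L11_norm \<psi>1 + L11_norm \<psi>2 \<le> S"
    and \<phi>_def: "\<phi> = (\<lambda>y. \<psi>0 y - \<tau>\<^sup>2 * \<psi>2 y)" and \<zeta>_def: "\<zeta> = (\<lambda>y. \<psi>1 y + \<tau> * \<psi>2 y)"
  shows "integrable lborel \<phi>" "\<zeta> \<in> L11_space" "0 \<le> S"
    "fourier_real \<phi> \<xi> = fourier_real \<psi>0 \<xi> - \<tau>\<^sup>2 *\<^sub>R fourier_real \<psi>2 \<xi>"
    "fourier_real \<zeta> \<xi> = fourier_real \<psi>1 \<xi> + \<tau> *\<^sub>R fourier_real \<psi>2 \<xi>"
    "cmod (fourier_real \<psi>0 \<xi>) + cmod (fourier_real \<psi>1 \<xi>) + cmod (fourier_real \<psi>2 \<xi>) \<le> (2 + \<tau> + \<tau>\<^sup>2) * S"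
    "cmod (fourier_real \<phi> \<xi>) \<le> (2 + \<tau> + \<tau>\<^sup>2) * S"
    "\<bar>P_mean \<phi>\<bar> + \<bar>P_mean \<zeta>\<bar> \<le> (2 + \<tau> + \<tau>\<^sup>2) * S"
    "cmod (fourier_real \<zeta> \<xi> - complex_of_real (P_mean \<zeta>)) \<le> norm \<xi> * ((2 + \<tau> + \<tau>\<^sup>2) * S)"
    "\<bar>M_mean \<zeta> \<bullet> \<xi>\<bar> \<le> norm \<xi> * ((2 + \<tau> + \<tau>\<^sup>2) * S)"
proof -
  have i0: "integrable lborel \<psi>0" and i1: "integrable lborel \<psi>1" and i2: "integrable lborel \<psi>2"
    using \<psi> L11_spaceD(1) by (auto simp: L1_space_iff)
  have w: "integrable lborel (\<lambda>x. (1 + norm x) * \<bar>\<psi>1 x\<bar>)" "integrable lborel (\<lambda>x. (1 + norm x) * \<bar>\<psi>2 x\<bar>)"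
    using \<psi> by (auto simp: L11_space_def)
  have nn: "0 \<le> L1_norm \<psi>0" "0 \<le> L1_norm \<psi>1" "0 \<le> L1_norm \<psi>2" "0 \<le> L11_norm \<psi>1" "0 \<le> L11_norm \<psi>2"
    unfolding L1_norm_def L11_norm_def by (intro Bochner_Integration.integral_nonneg; simp)+
  note d = L11_spaceD(3)[OF \<psi>(2)] L11_spaceD(3)[OF \<psi>(3)]
  show S0: "0 \<le> S" using nn S by linarith
  have b: "L1_norm \<psi>0 \<le> S" "L1_norm \<psi>2 \<le> S" "L11_norm \<psi>2 \<le> S" "L11_norm \<psi>1 + L11_norm \<psi>2 \<le> S"
    "L1_norm \<psi>0 + L1_norm \<psi>1 + L1_norm \<psi>2 \<le> S" "L11_norm \<psi>1 \<le> S" using nn S d by linarith+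
  show i: "integrable lborel \<phi>" unfolding \<phi>_def using i0 i2 by auto
  have ic: "integrable lborel \<zeta>" unfolding \<zeta>_def using i1 i2 by auto
  have wle: "(1 + norm x) * \<bar>\<zeta> x\<bar> \<le> (1 + norm x) * \<bar>\<psi>1 x\<bar> + \<tau> * ((1 + norm x) * \<bar>\<psi>2 x\<bar>)" for x
  proof -
    have "\<bar>\<zeta> x\<bar> \<le> \<bar>\<psi>1 x\<bar> + \<tau> * \<bar>\<psi>2 x\<bar>" unfolding \<zeta>_def using abs_triangle_ineq[of "\<psi>1 x" "\<tau> * \<psi>2 x"] tau by (simp add: abs_mult)
    then have "(1 + norm x) * \<bar>\<zeta> x\<bar> \<le> (1 + norm x) * (\<bar>\<psi>1 x\<bar> + \<tau> * \<bar>\<psi>2 x\<bar>)" by (intro mult_left_mono) auto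
    also have "\<dots> = (1 + norm x) * \<bar>\<psi>1 x\<bar> + \<tau> * ((1 + norm x) * \<bar>\<psi>2 x\<bar>)" by (simp add: algebra_simps)
    finally show ?thesis .
  qed
  have wi: "integrable lborel (\<lambda>x. (1 + norm x) * \<bar>\<psi>1 x\<bar> + \<tau> * ((1 + norm x) * \<bar>\<psi>2 x\<bar>))" using w by auto
  have cw: "integrable lborel (\<lambda>x. (1 + norm x) * \<bar>\<zeta> x\<bar>)"
  proof (rule Bochner_Integration.integrable_bound[OF wi])
    show "AE x in lborel. norm ((1 + norm x) * \<bar>\<zeta> x\<bar>) \<le> norm ((1 + norm x) * \<bar>\<psi>1 x\<bar> + \<tau> * ((1 + norm x) * \<bar>\<psi>2 x\<bar>))"
      using wle by (intro AE_I2) (auto simp: abs_mult intro: order_trans[OF _ abs_ge_self])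
  qed (use borel_measurable_integrable[OF ic] in simp)
  show c11: "\<zeta> \<in> L11_space" using ic cw by (simp add: L11_space_def L1_space_iff)
  have "L11_norm \<zeta> \<le> (LINT x|lborel. (1 + norm x) * \<bar>\<psi>1 x\<bar> + \<tau> * ((1 + norm x) * \<bar>\<psi>2 x\<bar>))"
    unfolding L11_norm_def by (rule Bochner_Integration.integral_mono[OF cw wi wle])
  also have "\<dots> = L11_norm \<psi>1 + \<tau> * L11_norm \<psi>2" unfolding L11_norm_def using w by simp
  also have "\<dots> \<le> S + \<tau> * S" using b tau by (intro add_mono mult_left_mono) auto
  finally have c1: "L11_norm \<zeta> \<le> S + \<tau> * S" .
  have "L1_norm \<phi> \<le> (LINT x|lborel. \<bar>\<psi>0 x\<bar> + \<tau>\<^sup>2 * \<bar>\<psi>2 x\<bar>)"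
    unfolding L1_norm_def
  proof (rule Bochner_Integration.integral_mono)
    show "norm (\<phi> x) \<le> \<bar>\<psi>0 x\<bar> + \<tau>\<^sup>2 * \<bar>\<psi>2 x\<bar>" for x
      unfolding \<phi>_def using abs_triangle_ineq4[of "\<psi>0 x" "\<tau>\<^sup>2 * \<psi>2 x"] by (simp add: abs_mult)
  qed (use i i0 i2 in auto)
  also have "\<dots> = L1_norm \<psi>0 + \<tau>\<^sup>2 * L1_norm \<psi>2" unfolding L1_norm_def using i0 i2 by simp
  also have "\<dots> \<le> S + \<tau>\<^sup>2 * S" using b by (intro add_mono mult_left_mono) auto
  finally have f1: "L1_norm \<phi> \<le> S + \<tau>\<^sup>2 * S" .
  have pos: "0 \<le> \<tau> * S" "0 \<le> \<tau>\<^sup>2 * S" using tau S0 by auto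
  have N: "(2 + \<tau> + \<tau>\<^sup>2) * S = 2 * S + \<tau> * S + \<tau>\<^sup>2 * S" by (simp add: algebra_simps)
  note I = i0[THEN integrable_of_real[where 'a=complex]] i1[THEN integrable_of_real[where 'a=complex]] i2[THEN integrable_of_real[where 'a=complex]]
  have m2: "fourier (\<lambda>x. complex_of_real c * complex_of_real (\<psi>2 x)) \<xi> = c *\<^sub>R fourier_real \<psi>2 \<xi>" for c
    using fourier_mult[of "complex_of_real c" "\<lambda>x. complex_of_real (\<psi>2 x)" \<xi>] by (simp add: scaleR_conv_of_real[where 'a=complex])
  show "fourier_real \<phi> \<xi> = fourier_real \<psi>0 \<xi> - \<tau>\<^sup>2 *\<^sub>R fourier_real \<psi>2 \<xi>"
    unfolding \<phi>_def of_real_diff of_real_mult fourier_diff[OF I(1) integrable_mult_right[OF I(3)]] m2 ..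
  show "fourier_real \<zeta> \<xi> = fourier_real \<psi>1 \<xi> + \<tau> *\<^sub>R fourier_real \<psi>2 \<xi>"
    unfolding \<zeta>_def of_real_add of_real_mult fourier_add[OF I(2) integrable_mult_right[OF I(3)]] m2 ..
  show "cmod (fourier_real \<psi>0 \<xi>) + cmod (fourier_real \<psi>1 \<xi>) + cmod (fourier_real \<psi>2 \<xi>) \<le> (2 + \<tau> + \<tau>\<^sup>2) * S"
    using fourier_real_bound[OF i0, of \<xi>] fourier_real_bound[OF i1, of \<xi>] fourier_real_bound[OF i2, of \<xi>] b pos S0 unfolding N by linarith
  show "cmod (fourier_real \<phi> \<xi>) \<le> (2 + \<tau> + \<tau>\<^sup>2) * S" using fourier_real_bound[OF i, of \<xi>] f1 pos S0 unfolding N by linarith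
  show "\<bar>P_mean \<phi>\<bar> + \<bar>P_mean \<zeta>\<bar> \<le> (2 + \<tau> + \<tau>\<^sup>2) * S"
    using P_mean_bound[of \<phi>] P_mean_bound[of \<zeta>] L11_spaceD(3)[OF c11] f1 c1 unfolding N by linarith
  have c1': "L11_norm \<zeta> \<le> (2 + \<tau> + \<tau>\<^sup>2) * S" using c1 pos S0 unfolding N by linarith
  show "cmod (fourier_real \<zeta> \<xi> - complex_of_real (P_mean \<zeta>)) \<le> norm \<xi> * ((2 + \<tau> + \<tau>\<^sup>2) * S)"
    using fourier_minus_mean_bound[OF c11, of \<xi>] mult_left_mono[OF c1', of "norm \<xi>"] by simp
  have "norm (M_mean \<zeta>) * norm \<xi> \<le> (2 + \<tau> + \<tau>\<^sup>2) * S * norm \<xi>"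
    using M_mean_bound[OF c11] c1' by (intro mult_right_mono) auto
  then show "\<bar>M_mean \<zeta> \<bullet> \<xi>\<bar> \<le> norm \<xi> * ((2 + \<tau> + \<tau>\<^sup>2) * S)"
    using Cauchy_Schwarz_ineq2[of "M_mean \<zeta>" \<xi>] by (simp add: mult.commute)
qed

text \<open>The estimates are squared, ready for integration in \<xi>. The constants are uniform in
  the data, but \<eta> is not: it is the squared error of expanding the transformed data at \<xi> =
  0, which vanishes there without a rate. After rescaling, only this limit matters.\<close>

lemma error_bounds:
  assumes l: "l > 0"
  shows "\<exists>C>0. \<exists>c>0. \<forall>(\<psi>0::real^'n \<Rightarrow> real) \<psi>1 \<psi>2. (\<psi>0, \<psi>1, \<psi>2) \<in> B_space \<delta> l \<longrightarrow>
    (\<exists>\<eta> W. \<eta> \<in> borel_measurable borel \<and> (\<exists>B. \<forall>\<xi>. \<bar>\<eta> \<xi>\<bar> \<le> B) \<and> (\<eta> \<longlongrightarrow> 0) (at 0) \<and>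
      integrable lborel W \<and> (LINT \<xi>|lborel. W \<xi>) \<le> C * (B_norm \<delta> l \<psi>0 \<psi>1 \<psi>2)\<^sup>2 \<and>
      (\<forall>\<xi> t u. \<xi> \<noteq> 0 \<and> 0 < t \<and> mgt_mode \<tau> \<delta> m ((norm \<xi>)\<^sup>2) (fourier_real \<psi>0 \<xi>) (fourier_real \<psi>1 \<xi>) (fourier_real \<psi>2 \<xi>) u \<longrightarrow>
        (cmod (u t - p1hat (P_mean (\<lambda>y. \<psi>1 y + \<tau> * \<psi>2 y)) t \<xi>))\<^sup>2
          \<le> C * (B_norm \<delta> l \<psi>0 \<psi>1 \<psi>2)\<^sup>2 * exp (- c * (norm \<xi>)\<^sup>2 * t) + t powr (- l) * W \<xi> \<and>
        (cmod (u t - p1hat (P_mean (\<lambda>y. \<psi>1 y + \<tau> * \<psi>2 y)) t \<xi>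
           - p2hat (M_mean (\<lambda>y. \<psi>1 y + \<tau> * \<psi>2 y)) (P_mean (\<lambda>y. \<psi>0 y - \<tau>\<^sup>2 * \<psi>2 y)) (P_mean (\<lambda>y. \<psi>1 y + \<tau> * \<psi>2 y)) t \<xi>))\<^sup>2
          \<le> C * (exp (- c * (norm \<xi>)\<^sup>2 * t) * \<eta> \<xi>) + C * (B_norm \<delta> l \<psi>0 \<psi>1 \<psi>2)\<^sup>2 * exp (- c * t) * exp (- c * (norm \<xi>)\<^sup>2 * t)
             + t powr (- l) * W \<xi>))"
proof -
  obtain r0 C0 c0 where r0: "r0 > 0" and C0: "C0 > 0" and c0: "c0 > 0" and me: "\<And>r a0 a1 a2 u PA PB \<mu> N t.
     0 < r \<and> mgt_mode \<tau> \<delta> m (r\<^sup>2) a0 a1 a2 u \<and> t \<ge> 0 \<and> cmod a0 + cmod a1 + cmod a2 \<le> N \<and>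
     \<bar>PA\<bar> + \<bar>PB\<bar> \<le> N \<and> cmod (a1 + \<tau> *\<^sub>R a2 - PB) \<le> r * N \<and> \<bar>\<mu>\<bar> \<le> r * N \<Longrightarrow>
     cmod (u t - main1 r t PB) \<le> C0 * (N * exp (- c0 * r\<^sup>2 * t)
       + (if r \<le> r0 then 0 else exp (- c0 * rate (r\<^sup>2) * t) * (cmod a0 + cmod a1 / r + cmod a2 / r\<^sup>2))) \<and>
     cmod (u t - main1 r t PB - main2 r t \<mu> PA PB) \<le> C0 * (exp (- c0 * r\<^sup>2 * t) *
       ((if r \<le> r0 then cmod (a0 - \<tau>\<^sup>2 *\<^sub>R a2 - PA) + cmod (a1 + \<tau> *\<^sub>R a2 - PB + \<i> * \<mu>) / r + r * N else 0) + N * exp (- c0 * t))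
       + (if r \<le> r0 then 0 else exp (- c0 * rate (r\<^sup>2) * t) * (cmod a0 + cmod a1 / r + cmod a2 / r\<^sup>2)))"
    using mode_error by metis
  obtain K where K: "K > 0" and hw: "\<forall>(\<psi>0::real^'n \<Rightarrow> real) \<psi>1 \<psi>2. (\<psi>0, \<psi>1, \<psi>2) \<in> B_space \<delta> l \<longrightarrow>
    (\<exists>W. integrable lborel W \<and> (LINT \<xi>|lborel. W \<xi>) \<le> K * (B_norm \<delta> l \<psi>0 \<psi>1 \<psi>2)\<^sup>2 \<and> (\<forall>\<xi>. 0 \<le> W \<xi>) \<and>
      (\<forall>\<xi> t. r0 \<le> norm \<xi> \<and> 0 < t \<longrightarrow>
        (exp (- c0 * rate ((norm \<xi>)\<^sup>2) * t) * (cmod (fourier_real \<psi>0 \<xi>) + cmod (fourier_real \<psi>1 \<xi>) / norm \<xi>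
           + cmod (fourier_real \<psi>2 \<xi>) / (norm \<xi>)\<^sup>2))\<^sup>2 \<le> t powr (- l) * W \<xi>))"
    using high_weight[OF l c0 r0] by blast
  define K0 where "K0 = 2 + \<tau> + \<tau>\<^sup>2"
  have K0: "K0 \<ge> 0" using tau by (simp add: K0_def)
  define C where "C = 4 * C0\<^sup>2 * (1 + K0\<^sup>2 + K)"
  have C: "C > 0" using C0 K by (auto simp: C_def intro!: mult_pos_pos add_pos_nonneg add_nonneg_pos)
  have Cs: "4 * C0\<^sup>2 \<le> C" "4 * C0\<^sup>2 * K0\<^sup>2 \<le> C" "4 * C0\<^sup>2 * K \<le> C" using K by (auto simp: C_def distrib_left)
  show ?thesis
  proof (rule exI[of _ C], rule conjI[OF C], rule exI[of _ "2 * c0"], rule conjI, use c0 in simp, intro allI impI)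
    fix \<psi>0 \<psi>1 \<psi>2 :: "real^'n \<Rightarrow> real" assume B: "(\<psi>0, \<psi>1, \<psi>2) \<in> B_space \<delta> l"
    define S where "S = B_norm \<delta> l \<psi>0 \<psi>1 \<psi>2"
    define N where "N = K0 * S"
    define \<phi> where "\<phi> = (\<lambda>y. \<psi>0 y - \<tau>\<^sup>2 * \<psi>2 y)"
    define \<zeta> where "\<zeta> = (\<lambda>y. \<psi>1 y + \<tau> * \<psi>2 y)"
    define PA PB and Mz :: "real^'n" where "PA = P_mean \<phi>" and "PB = P_mean \<zeta>" and "Mz = M_mean \<zeta>"
    note D = B_spaceD(1-4)[OF B less_imp_le[OF l], folded S_def]
    note cb = combination_bounds[OF D \<phi>_def \<zeta>_def, folded K0_def N_def PA_def PB_def Mz_def]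
    have N0: "N \<ge> 0" using cb(3) K0 by (simp add: N_def)
    obtain W0 where W0: "integrable lborel W0" "(LINT \<xi>|lborel. W0 \<xi>) \<le> K * S\<^sup>2" "\<And>\<xi>. 0 \<le> W0 \<xi>"
      and W0b: "\<And>\<xi> t. r0 \<le> norm \<xi> \<and> 0 < t \<Longrightarrow>
        (exp (- c0 * rate ((norm \<xi>)\<^sup>2) * t) * (cmod (fourier_real \<psi>0 \<xi>) + cmod (fourier_real \<psi>1 \<xi>) / norm \<xi>
           + cmod (fourier_real \<psi>2 \<xi>) / (norm \<xi>)\<^sup>2))\<^sup>2 \<le> t powr (- l) * W0 \<xi>"
      using hw[rule_format, OF B] unfolding S_def by blast
    define V where "V = (\<lambda>\<xi>. cmod (fourier_real \<phi> \<xi> - PA) + cmod (fourier_real \<zeta> \<xi> - PB + \<i> * (Mz \<bullet> \<xi>)) / norm \<xi> + norm \<xi> * N)"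
    \<comment> \<open>Cutting \<open>V\<close> off at r0 makes it bounded without changing its limit
      at 0; above r0 it does not occur in the estimate of \<open>mode_error\<close>.\<close>
    define X where "X = (\<lambda>\<xi>. if norm \<xi> \<le> r0 then V \<xi> else 0)"
    have V0: "V \<xi> \<ge> 0" for \<xi> using N0 by (simp add: V_def)
    have X0: "X \<xi> \<ge> 0" "X \<xi> \<le> V \<xi>" for \<xi> using V0 by (auto simp: X_def)
    have Xb: "X \<xi> \<le> 4 * N + r0 * N" for \<xi>
    proof (cases "norm \<xi> \<le> r0")
      case True
      have "\<bar>PA\<bar> \<le> N" using cb(8) by linarith
      then have 1: "cmod (fourier_real \<phi> \<xi> - PA) \<le> 2 * N" using cb(7)[of \<xi>] norm_triangle_ineq4[of "fourier_real \<phi> \<xi>" PA] by simp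
      have "cmod (fourier_real \<zeta> \<xi> - PB + \<i> * (Mz \<bullet> \<xi>)) \<le> norm \<xi> * (2 * N)"
        using cb(9)[of \<xi>] cb(10)[of \<xi>] norm_triangle_ineq[of "fourier_real \<zeta> \<xi> - PB" "\<i> * (Mz \<bullet> \<xi>)"] by (simp add: norm_mult)
      then have 2: "cmod (fourier_real \<zeta> \<xi> - PB + \<i> * (Mz \<bullet> \<xi>)) / norm \<xi> \<le> 2 * N"
        using N0 by (cases "\<xi> = 0") (simp_all add: pos_divide_le_eq mult.commute)
      have "norm \<xi> * N \<le> r0 * N" using True N0 by (intro mult_right_mono)
      then show ?thesis using 1 2 True by (simp add: X_def V_def)
    qed (use N0 r0 in \<open>simp add: X_def\<close>)
    have mF: "fourier_real \<phi> \<in> borel_measurable borel" "fourier_real \<zeta> \<in> borel_measurable borel"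
      using fourier_measurable cb(1) L11_spaceD(1)[OF cb(2)] by auto
    have mX: "X \<in> borel_measurable borel" using mF unfolding X_def V_def by measurable
    have "(V \<longlongrightarrow> 0 + 0 + 0 * N) (at 0)"
      unfolding V_def PA_def PB_def Mz_def
      by (rule tendsto_add[OF tendsto_add[OF fourier_tendsto_mean[OF cb(1)] fourier_first_order[OF cb(2)]]
            tendsto_mult[OF tendsto_norm_zero[OF tendsto_ident_at] tendsto_const]])
    then have limV: "(V \<longlongrightarrow> 0) (at 0)" by simp
    have limX: "(X \<longlongrightarrow> 0) (at 0)"
      by (rule Lim_null_comparison[OF _ limV]) (use X0 in \<open>auto intro: always_eventually\<close>)
    define W where "W = (\<lambda>\<xi>. 2 * C0\<^sup>2 * W0 \<xi>)"
    have sq2: "(x + y)\<^sup>2 \<le> 2 * x\<^sup>2 + 2 * y\<^sup>2" for x y :: real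
      using sum_squares_bound[of x y] by (simp add: power2_eq_square algebra_simps)
    have main: "(cmod (u t - p1hat PB t \<xi>))\<^sup>2 \<le> C * S\<^sup>2 * exp (- (2 * c0) * (norm \<xi>)\<^sup>2 * t) + t powr (- l) * W \<xi> \<and>
        (cmod (u t - p1hat PB t \<xi> - p2hat Mz PA PB t \<xi>))\<^sup>2
          \<le> C * (exp (- (2 * c0) * (norm \<xi>)\<^sup>2 * t) * (X \<xi>)\<^sup>2) + C * S\<^sup>2 * exp (- (2 * c0) * t) * exp (- (2 * c0) * (norm \<xi>)\<^sup>2 * t)
             + t powr (- l) * W \<xi>"
      if xi: "\<xi> \<noteq> 0" and t: "0 < t" and u: "mgt_mode \<tau> \<delta> m ((norm \<xi>)\<^sup>2) (fourier_real \<psi>0 \<xi>) (fourier_real \<psi>1 \<xi>) (fourier_real \<psi>2 \<xi>) u" for \<xi> t u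
    proof -
      define r where "r = norm \<xi>"
      have r: "r > 0" using xi by (simp add: r_def)
      define e where "e = exp (- c0 * r\<^sup>2 * t)"
      define d where "d = exp (- c0 * t)"
      define H where "H = (if r \<le> r0 then 0 else exp (- c0 * rate (r\<^sup>2) * t) * (cmod (fourier_real \<psi>0 \<xi>) + cmod (fourier_real \<psi>1 \<xi>) / r + cmod (fourier_real \<psi>2 \<xi>) / r\<^sup>2))"
      have ee: "exp (- (2 * c0) * (norm \<xi>)\<^sup>2 * t) = e\<^sup>2" "exp (- (2 * c0) * t) = d\<^sup>2"
        by (simp_all add: e_def d_def r_def mult.assoc flip: exp_double)
      have H2: "H\<^sup>2 \<le> t powr (- l) * W0 \<xi>"
        using W0b[of \<xi> t] W0(3)[of \<xi>] t by (auto simp: H_def r_def)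
      have est: "cmod (u t - p1hat PB t \<xi>) \<le> C0 * (N * e + H)"
        "cmod (u t - p1hat PB t \<xi> - p2hat Mz PA PB t \<xi>) \<le> C0 * (e * (X \<xi> + N * d) + H)"
        using me[of r "fourier_real \<psi>0 \<xi>" "fourier_real \<psi>1 \<xi>" "fourier_real \<psi>2 \<xi>" u t N PA PB "Mz \<bullet> \<xi>"] r t u cb(6)[of \<xi>] cb(8) cb(9)[of \<xi>] cb(10)[of \<xi>]
        unfolding p1hat_def p2hat_def e_def d_def H_def X_def V_def cb(4)[of \<xi>] cb(5)[of \<xi>] r_def by auto
      have "(cmod (u t - p1hat PB t \<xi>))\<^sup>2 \<le> (C0 * (N * e + H))\<^sup>2" by (intro power_mono est) simp
      also have "\<dots> \<le> C0\<^sup>2 * (2 * (N * e)\<^sup>2 + 2 * H\<^sup>2)" unfolding power_mult_distrib[of C0] by (intro mult_left_mono sq2) simp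
      also have "\<dots> \<le> C0\<^sup>2 * (2 * (N * e)\<^sup>2 + 2 * (t powr (- l) * W0 \<xi>))" using H2 by (intro mult_left_mono) auto
      also have "\<dots> = 2 * C0\<^sup>2 * K0\<^sup>2 * (S\<^sup>2 * e\<^sup>2) + t powr (- l) * W \<xi>" by (simp add: W_def N_def power_mult_distrib algebra_simps)
      also have "2 * C0\<^sup>2 * K0\<^sup>2 * (S\<^sup>2 * e\<^sup>2) \<le> C * (S\<^sup>2 * e\<^sup>2)"
      proof (intro mult_right_mono)
        have "0 \<le> C0\<^sup>2 * K0\<^sup>2" by simp
        then show "2 * C0\<^sup>2 * K0\<^sup>2 \<le> C" using Cs(2) by linarith
      qed simp
      finally have 1: "(cmod (u t - p1hat PB t \<xi>))\<^sup>2 \<le> C * S\<^sup>2 * e\<^sup>2 + t powr (- l) * W \<xi>" by (simp add: mult.assoc)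
      have "(cmod (u t - p1hat PB t \<xi> - p2hat Mz PA PB t \<xi>))\<^sup>2 \<le> (C0 * (e * (X \<xi> + N * d) + H))\<^sup>2" by (intro power_mono est) simp
      also have "\<dots> \<le> C0\<^sup>2 * (2 * (e * (X \<xi> + N * d))\<^sup>2 + 2 * H\<^sup>2)" unfolding power_mult_distrib[of C0] by (intro mult_left_mono sq2) simp
      also have "\<dots> \<le> C0\<^sup>2 * (2 * (e\<^sup>2 * (2 * (X \<xi>)\<^sup>2 + 2 * (N * d)\<^sup>2)) + 2 * (t powr (- l) * W0 \<xi>))"
        unfolding power_mult_distrib[of e] using H2 sq2[of "X \<xi>" "N * d"] by (intro mult_left_mono add_mono) auto
      also have "\<dots> = 4 * C0\<^sup>2 * (e\<^sup>2 * (X \<xi>)\<^sup>2) + 4 * C0\<^sup>2 * K0\<^sup>2 * (S\<^sup>2 * d\<^sup>2 * e\<^sup>2) + t powr (- l) * W \<xi>"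
        by (simp add: W_def N_def power_mult_distrib algebra_simps)
      also have "\<dots> \<le> C * (e\<^sup>2 * (X \<xi>)\<^sup>2) + C * (S\<^sup>2 * d\<^sup>2 * e\<^sup>2) + t powr (- l) * W \<xi>"
        by (intro add_mono mult_right_mono Cs order_refl) simp_all
      finally show ?thesis using 1 unfolding ee by (simp add: mult.assoc)
    qed
    show "\<exists>\<eta> W. \<eta> \<in> borel_measurable borel \<and> (\<exists>B. \<forall>\<xi>. \<bar>\<eta> \<xi>\<bar> \<le> B) \<and> (\<eta> \<longlongrightarrow> 0) (at 0) \<and>
      integrable lborel W \<and> (LINT \<xi>|lborel. W \<xi>) \<le> C * (B_norm \<delta> l \<psi>0 \<psi>1 \<psi>2)\<^sup>2 \<and>
      (\<forall>\<xi> t u. \<xi> \<noteq> 0 \<and> 0 < t \<and> mgt_mode \<tau> \<delta> m ((norm \<xi>)\<^sup>2) (fourier_real \<psi>0 \<xi>) (fourier_real \<psi>1 \<xi>) (fourier_real \<psi>2 \<xi>) u \<longrightarrow>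
        (cmod (u t - p1hat (P_mean (\<lambda>y. \<psi>1 y + \<tau> * \<psi>2 y)) t \<xi>))\<^sup>2
          \<le> C * (B_norm \<delta> l \<psi>0 \<psi>1 \<psi>2)\<^sup>2 * exp (- (2 * c0) * (norm \<xi>)\<^sup>2 * t) + t powr (- l) * W \<xi> \<and>
        (cmod (u t - p1hat (P_mean (\<lambda>y. \<psi>1 y + \<tau> * \<psi>2 y)) t \<xi>
           - p2hat (M_mean (\<lambda>y. \<psi>1 y + \<tau> * \<psi>2 y)) (P_mean (\<lambda>y. \<psi>0 y - \<tau>\<^sup>2 * \<psi>2 y)) (P_mean (\<lambda>y. \<psi>1 y + \<tau> * \<psi>2 y)) t \<xi>))\<^sup>2
          \<le> C * (exp (- (2 * c0) * (norm \<xi>)\<^sup>2 * t) * \<eta> \<xi>) + C * (B_norm \<delta> l \<psi>0 \<psi>1 \<psi>2)\<^sup>2 * exp (- (2 * c0) * t) * exp (- (2 * c0) * (norm \<xi>)\<^sup>2 * t)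
             + t powr (- l) * W \<xi>)"
      unfolding S_def[symmetric] \<phi>_def[symmetric] \<zeta>_def[symmetric] PA_def[symmetric] PB_def[symmetric] Mz_def[symmetric]
    proof (rule exI[of _ "\<lambda>\<xi>. (X \<xi>)\<^sup>2"], rule exI[of _ W], intro conjI)
      show "(\<lambda>\<xi>. (X \<xi>)\<^sup>2) \<in> borel_measurable borel" using mX by measurable
      show "\<exists>B. \<forall>\<xi>. \<bar>(X \<xi>)\<^sup>2\<bar> \<le> B"
        by (rule exI[of _ "(4 * N + r0 * N)\<^sup>2"]) (use X0 Xb in \<open>auto intro: power_mono\<close>)
      show "((\<lambda>\<xi>. (X \<xi>)\<^sup>2) \<longlongrightarrow> 0) (at 0)" using tendsto_power[OF limX, of 2] by simp
      show "integrable lborel W" unfolding W_def using W0 by auto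
      have "(LINT \<xi>|lborel. W \<xi>) = 2 * C0\<^sup>2 * (LINT \<xi>|lborel. W0 \<xi>)" unfolding W_def by simp
      also have "\<dots> \<le> 2 * C0\<^sup>2 * (K * S\<^sup>2)" using W0 by (intro mult_left_mono) auto
      also have "\<dots> = (2 * C0\<^sup>2 * K) * S\<^sup>2" by simp
      also have "\<dots> \<le> C * S\<^sup>2"
      proof (intro mult_right_mono)
        have "0 \<le> C0\<^sup>2 * K" using K by simp
        then show "2 * C0\<^sup>2 * K \<le> C" using Cs(3) by linarith
      qed simp
      finally show "(LINT \<xi>|lborel. W \<xi>) \<le> C * S\<^sup>2" .
    qed (use main in blast)
  qed
qed

section \<open>Error estimates\<close>

text \<open>Solution and profiles are inverse transforms in the same L2 sense, hence so are their
  differences, and the norm bound for such transforms applies; its factor 1 / sqrt ((2 pi)^n) \<le>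
  1 is dropped.\<close>

lemma remainder_L2:
  fixes f \<psi>0 \<psi>1 \<psi>2 :: "real^'n \<Rightarrow> real"
  assumes w: "is_L2_inv_fourier w (\<lambda>x. complex_of_real (f x))" and t: "t > 0"
  defines "p1 \<equiv> p1hat (P_mean (\<lambda>y. \<psi>1 y + \<tau> * \<psi>2 y)) t"
    and "p2 \<equiv> p2hat (M_mean (\<lambda>y. \<psi>1 y + \<tau> * \<psi>2 y)) (P_mean (\<lambda>y. \<psi>0 y - \<tau>\<^sup>2 * \<psi>2 y)) (P_mean (\<lambda>y. \<psi>1 y + \<tau> * \<psi>2 y)) t"
  shows "(\<lambda>x. f x - profile1 \<tau> \<delta> m \<psi>0 \<psi>1 \<psi>2 t x) \<in> L2_space"
    "L2_norm (\<lambda>x. f x - profile1 \<tau> \<delta> m \<psi>0 \<psi>1 \<psi>2 t x) \<le> L2_norm (\<lambda>\<xi>. w \<xi> - p1 \<xi>)"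
    "(\<lambda>x. f x - profile1 \<tau> \<delta> m \<psi>0 \<psi>1 \<psi>2 t x - profile2 \<tau> \<delta> m \<psi>0 \<psi>1 \<psi>2 t x) \<in> L2_space"
    "L2_norm (\<lambda>x. f x - profile1 \<tau> \<delta> m \<psi>0 \<psi>1 \<psi>2 t x - profile2 \<tau> \<delta> m \<psi>0 \<psi>1 \<psi>2 t x) \<le> L2_norm (\<lambda>\<xi>. w \<xi> - p1 \<xi> - p2 \<xi>)"
proof -
  have c: "1 \<le> sqrt ((2 * pi) ^ CARD('n))" using pi_gt3 by (intro real_sqrt_ge_one one_le_power) linarith
  have le: "L2_norm g \<le> L2_norm h" if "is_L2_inv_fourier h (\<lambda>x. complex_of_real (g x))" for h and g :: "real^'n \<Rightarrow> real"
  proof -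
    have "L2_norm g \<le> L2_norm h / sqrt ((2 * pi) ^ CARD('n))" using is_L2_inv_fourier_norm[OF that] by (simp only: L2_of_real)
    also have "\<dots> \<le> L2_norm h / 1" using c L2_norm_nonneg by (intro divide_left_mono) auto
    finally show ?thesis by simp
  qed
  have mem: "g \<in> L2_space" if "is_L2_inv_fourier h (\<lambda>x. complex_of_real (g x))" for h and g :: "real^'n \<Rightarrow> real"
    using that unfolding is_L2_inv_fourier_def L2_of_real by blast
  have i1: "is_L2_inv_fourier p1 (\<lambda>x. complex_of_real (profile1 \<tau> \<delta> m \<psi>0 \<psi>1 \<psi>2 t x))"
    unfolding p1_def profile1_def p1hat_props(3)[OF t] by (intro is_L2_inv_fourier_integrable p1hat_props t)
  have i2: "is_L2_inv_fourier p2 (\<lambda>x. complex_of_real (profile2 \<tau> \<delta> m \<psi>0 \<psi>1 \<psi>2 t x))"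
    unfolding p2_def profile2_def p2hat_props(4)[OF t] by (intro is_L2_inv_fourier_integrable p2hat_props t)
  note d1 = is_L2_inv_fourier_diff[OF w i1]
  note d2 = is_L2_inv_fourier_diff[OF d1 i2]
  note d = d1[folded of_real_diff] d2[folded of_real_diff]
  show "(\<lambda>x. f x - profile1 \<tau> \<delta> m \<psi>0 \<psi>1 \<psi>2 t x) \<in> L2_space" by (rule mem[OF d(1)])
  show "L2_norm (\<lambda>x. f x - profile1 \<tau> \<delta> m \<psi>0 \<psi>1 \<psi>2 t x) \<le> L2_norm (\<lambda>\<xi>. w \<xi> - p1 \<xi>)" by (rule le[OF d(1)])
  show "(\<lambda>x. f x - profile1 \<tau> \<delta> m \<psi>0 \<psi>1 \<psi>2 t x - profile2 \<tau> \<delta> m \<psi>0 \<psi>1 \<psi>2 t x) \<in> L2_space" by (rule mem[OF d(2)])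
  show "L2_norm (\<lambda>x. f x - profile1 \<tau> \<delta> m \<psi>0 \<psi>1 \<psi>2 t x - profile2 \<tau> \<delta> m \<psi>0 \<psi>1 \<psi>2 t x) \<le> L2_norm (\<lambda>\<xi>. w \<xi> - p1 \<xi> - p2 \<xi>)" by (rule le[OF d(2)])
qed

text \<open>The inequality of Plancherel points in the wrong direction here. The equality for
  continuous bounded symbols, through \<open>inv_fourier_L2\<close>, carries the lower bound from
  the symbol to the profile.\<close>

lemma profile2_lower:
  "\<exists>c>0. \<exists>T>0. \<forall>t\<ge>T. \<forall>(Mz::real^'n) PA PB.
     c * t powr (- (real CARD('n) / 2)) * ((norm Mz)\<^sup>2 + PA\<^sup>2 + (\<gamma> / k * PB)\<^sup>2) \<le> (L2_norm (inv_fourier (p2hat Mz PA PB t)))\<^sup>2"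
proof -
  obtain c T where c: "c > 0" and T: "T > 0" and lb: "\<forall>t\<ge>T. \<forall>(M::real^'n) x y.
     ennreal (c * t powr (- (real CARD('n) / 2)) * ((norm M)\<^sup>2 + x\<^sup>2 + y\<^sup>2)) \<le>
     (\<integral>\<^sup>+\<xi>. ennreal (exp (- 2 * \<beta> * (norm \<xi>)\<^sup>2 * t) * ((M \<bullet> \<xi>)\<^sup>2 / (k * norm \<xi>)\<^sup>2 * (sin (k * norm \<xi> * t))\<^sup>2
         + (x + y * (norm \<xi>)\<^sup>2 * t)\<^sup>2 * (cos (k * norm \<xi> * t))\<^sup>2)) \<partial>lborel)"
    using profile_lower_bound[OF beta k(1)] by blast
  define d where "d = (2 * pi) ^ CARD('n)"
  have d: "d > 0" by (simp add: d_def)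
  show ?thesis
  proof (rule exI[of _ "c / d"], rule conjI, use c d in simp, rule exI[of _ T], rule conjI[OF T], intro allI impI)
    fix t PA PB :: real and Mz :: "real^'n" assume tT: "T \<le> t"
    have t: "t > 0" using tT T by linarith
    define p where "p = p2hat Mz PA PB t"
    note pp = p2hat_props[OF t, of Mz PA PB, folded p_def]
    obtain Bd where "\<And>\<xi>. cmod (p \<xi>) \<le> Bd" using pp(3) by blast
    then have "L2_norm (inv_fourier p) = L2_norm p / sqrt d"
      unfolding d_def by (intro inv_fourier_L2(3) pp) (auto simp: p_def p2hat_continuous)
    then have n: "(L2_norm (inv_fourier p))\<^sup>2 = (LINT \<xi>|lborel. (cmod (p \<xi>))\<^sup>2) / d"
      using d by (simp only: power_divide L2_norm_square real_sqrt_pow2 less_imp_le)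
    have p2: "(cmod (p \<xi>))\<^sup>2 = exp (- 2 * \<beta> * (norm \<xi>)\<^sup>2 * t) * ((Mz \<bullet> \<xi>)\<^sup>2 / (k * norm \<xi>)\<^sup>2 * (sin (k * norm \<xi> * t))\<^sup>2
         + (PA + \<gamma> / k * PB * (norm \<xi>)\<^sup>2 * t)\<^sup>2 * (cos (k * norm \<xi> * t))\<^sup>2)" for \<xi>
      unfolding p_def p2hat_def by (rule norm_main2)
    have "ennreal (c * t powr (- (real CARD('n) / 2)) * ((norm Mz)\<^sup>2 + PA\<^sup>2 + (\<gamma> / k * PB)\<^sup>2)) \<le> (\<integral>\<^sup>+\<xi>. ennreal ((cmod (p \<xi>))\<^sup>2) \<partial>lborel)"
      unfolding p2 using lb tT by blast
    also have "\<dots> = ennreal (LINT \<xi>|lborel. (cmod (p \<xi>))\<^sup>2)" by (intro nn_integral_eq_integral L2_spaceD pp) simp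
    finally have "c * t powr (- (real CARD('n) / 2)) * ((norm Mz)\<^sup>2 + PA\<^sup>2 + (\<gamma> / k * PB)\<^sup>2) \<le> (LINT \<xi>|lborel. (cmod (p \<xi>))\<^sup>2)"
      by (subst (asm) ennreal_le_iff) (auto intro: Bochner_Integration.integral_nonneg)
    then have "c * t powr (- (real CARD('n) / 2)) * ((norm Mz)\<^sup>2 + PA\<^sup>2 + (\<gamma> / k * PB)\<^sup>2) / d \<le> (L2_norm (inv_fourier p))\<^sup>2"
      unfolding n using d by (intro divide_right_mono) auto
    then show "c / d * t powr (- (real CARD('n) / 2)) * ((norm Mz)\<^sup>2 + PA\<^sup>2 + (\<gamma> / k * PB)\<^sup>2) \<le> (L2_norm (inv_fourier (p2hat Mz PA PB t)))\<^sup>2"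
      by (simp add: p_def)
  qed
qed

text \<open>The second profile controls PB only in the form (\<gamma> / k) PB. Recovering PB, which
  occurs alone in |Q|, requires \<gamma> \<noteq> 0 or PB = 0.\<close>

lemma Q_abs_bound:
  "\<exists>C>0. \<forall>(\<psi>0::real^'n \<Rightarrow> real) \<psi>1 \<psi>2. \<gamma> \<noteq> 0 \<or> P_mean (\<lambda>y. \<psi>1 y + \<tau> * \<psi>2 y) = 0 \<longrightarrow>
     (Q_abs \<tau> \<delta> m \<psi>0 \<psi>1 \<psi>2)\<^sup>2 \<le> C * ((norm (M_mean (\<lambda>y. \<psi>1 y + \<tau> * \<psi>2 y)))\<^sup>2
        + (P_mean (\<lambda>y. \<psi>0 y - \<tau>\<^sup>2 * \<psi>2 y))\<^sup>2 + (\<gamma> / k * P_mean (\<lambda>y. \<psi>1 y + \<tau> * \<psi>2 y))\<^sup>2)"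
proof -
  define b n where "b = \<delta> + 2 * m * \<tau>\<^sup>2" and "n = real CARD('n)"
  \<comment> \<open>For \<gamma> = 0 the quotient is 0 by convention, and PB^2 = g y^2 still holds
    because then PB = 0.\<close>
  define g where "g = (k / \<gamma>)\<^sup>2"
  define C where "C = 1 + 2 * b\<^sup>2 + n\<^sup>2 / 2 + g"
  have g: "g \<ge> 0" by (simp add: g_def)
  have C: "1 \<le> C" "2 * b\<^sup>2 \<le> C" "n\<^sup>2 / 2 + g \<le> C" using g by (auto simp: C_def)
  show ?thesis
  proof (rule exI[of _ C], rule conjI, use C in simp, intro allI impI)
    fix \<psi>0 \<psi>1 \<psi>2 :: "real^'n \<Rightarrow> real" assume a: "\<gamma> \<noteq> 0 \<or> P_mean (\<lambda>y. \<psi>1 y + \<tau> * \<psi>2 y) = 0"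
    define PA PB where "PA = P_mean (\<lambda>y. \<psi>0 y - \<tau>\<^sup>2 * \<psi>2 y)" and "PB = P_mean (\<lambda>y. \<psi>1 y + \<tau> * \<psi>2 y)"
    define M2 where "M2 = (norm (M_mean (\<lambda>y. \<psi>1 y + \<tau> * \<psi>2 y)))\<^sup>2"
    define y where "y = \<gamma> / k * PB"
    have M2: "M2 \<ge> 0" by (simp add: M2_def)
    have "(Q_abs \<tau> \<delta> m \<psi>0 \<psi>1 \<psi>2)\<^sup>2 = M2 + (b * PA + n * \<gamma> / (2 * k) * PB)\<^sup>2 + PB\<^sup>2"
      unfolding Q_abs_def k(3)[symmetric] PA_def[symmetric] PB_def[symmetric] M2_def[symmetric] b_def[symmetric] n_def[symmetric] power2_abs
      using M2 by (intro real_sqrt_pow2) simp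
    also have "n * \<gamma> / (2 * k) * PB = n / 2 * y" by (simp add: y_def)
    also have "PB\<^sup>2 = g * y\<^sup>2" using a k(1) by (auto simp: g_def y_def PB_def power_mult_distrib power_divide)
    also have "(b * PA + n / 2 * y)\<^sup>2 \<le> 2 * b\<^sup>2 * PA\<^sup>2 + n\<^sup>2 / 2 * y\<^sup>2"
      using zero_le_power2[of "b * PA - n / 2 * y"] by (simp add: power2_eq_square algebra_simps)
    finally have "(Q_abs \<tau> \<delta> m \<psi>0 \<psi>1 \<psi>2)\<^sup>2 \<le> 1 * M2 + 2 * b\<^sup>2 * PA\<^sup>2 + (n\<^sup>2 / 2 + g) * y\<^sup>2" by (simp add: algebra_simps)
    also have "\<dots> \<le> C * M2 + C * PA\<^sup>2 + C * y\<^sup>2" using C M2 by (intro add_mono mult_right_mono; simp)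
    finally show "(Q_abs \<tau> \<delta> m \<psi>0 \<psi>1 \<psi>2)\<^sup>2 \<le> C * ((norm (M_mean (\<lambda>y. \<psi>1 y + \<tau> * \<psi>2 y)))\<^sup>2
        + (P_mean (\<lambda>y. \<psi>0 y - \<tau>\<^sup>2 * \<psi>2 y))\<^sup>2 + (\<gamma> / k * P_mean (\<lambda>y. \<psi>1 y + \<tau> * \<psi>2 y))\<^sup>2)"
      by (simp add: M2_def PA_def PB_def y_def distrib_left)
  qed
qed

lemma solution_asymptotics:
  assumes l: "l > real CARD('n) / 2"
  shows "\<exists>C>0. \<forall>(\<psi>0::real^'n \<Rightarrow> real) \<psi>1 \<psi>2 \<psi>. (\<psi>0, \<psi>1, \<psi>2) \<in> B_space \<delta> l \<and> mgt_solution \<tau> \<delta> m \<psi>0 \<psi>1 \<psi>2 \<psi> \<longrightarrow>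
    (\<forall>t\<ge>1. (\<lambda>x. \<psi> t x - profile1 \<tau> \<delta> m \<psi>0 \<psi>1 \<psi>2 t x) \<in> L2_space \<and>
      (\<lambda>x. \<psi> t x - profile1 \<tau> \<delta> m \<psi>0 \<psi>1 \<psi>2 t x - profile2 \<tau> \<delta> m \<psi>0 \<psi>1 \<psi>2 t x) \<in> L2_space \<and>
      L2_norm (\<lambda>x. \<psi> t x - profile1 \<tau> \<delta> m \<psi>0 \<psi>1 \<psi>2 t x) \<le> C * (t powr (- (real CARD('n) / 4)) * B_norm \<delta> l \<psi>0 \<psi>1 \<psi>2)) \<and>
    ((\<lambda>t. t powr (real CARD('n) / 4) * L2_norm (\<lambda>x. \<psi> t x - profile1 \<tau> \<delta> m \<psi>0 \<psi>1 \<psi>2 t x - profile2 \<tau> \<delta> m \<psi>0 \<psi>1 \<psi>2 t x)) \<longlongrightarrow> 0) at_top"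
proof -
  define n where "n = real CARD('n)"
  have "n > 0" by (simp add: n_def)
  moreover have "l > n / 2" using l by (simp add: n_def)
  ultimately have n: "n > 0" "l > n / 2" "l > 0" by linarith+
  obtain C c where C: "C > 0" and c: "c > 0" and eb: "\<forall>(\<psi>0::real^'n \<Rightarrow> real) \<psi>1 \<psi>2. (\<psi>0, \<psi>1, \<psi>2) \<in> B_space \<delta> l \<longrightarrow>
    (\<exists>\<eta> W. \<eta> \<in> borel_measurable borel \<and> (\<exists>B. \<forall>\<xi>. \<bar>\<eta> \<xi>\<bar> \<le> B) \<and> (\<eta> \<longlongrightarrow> 0) (at 0) \<and>
      integrable lborel W \<and> (LINT \<xi>|lborel. W \<xi>) \<le> C * (B_norm \<delta> l \<psi>0 \<psi>1 \<psi>2)\<^sup>2 \<and>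
      (\<forall>\<xi> t u. \<xi> \<noteq> 0 \<and> 0 < t \<and> mgt_mode \<tau> \<delta> m ((norm \<xi>)\<^sup>2) (fourier_real \<psi>0 \<xi>) (fourier_real \<psi>1 \<xi>) (fourier_real \<psi>2 \<xi>) u \<longrightarrow>
        (cmod (u t - p1hat (P_mean (\<lambda>y. \<psi>1 y + \<tau> * \<psi>2 y)) t \<xi>))\<^sup>2
          \<le> C * (B_norm \<delta> l \<psi>0 \<psi>1 \<psi>2)\<^sup>2 * exp (- c * (norm \<xi>)\<^sup>2 * t) + t powr (- l) * W \<xi> \<and>
        (cmod (u t - p1hat (P_mean (\<lambda>y. \<psi>1 y + \<tau> * \<psi>2 y)) t \<xi>
           - p2hat (M_mean (\<lambda>y. \<psi>1 y + \<tau> * \<psi>2 y)) (P_mean (\<lambda>y. \<psi>0 y - \<tau>\<^sup>2 * \<psi>2 y)) (P_mean (\<lambda>y. \<psi>1 y + \<tau> * \<psi>2 y)) t \<xi>))\<^sup>2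
          \<le> C * (exp (- c * (norm \<xi>)\<^sup>2 * t) * \<eta> \<xi>) + C * (B_norm \<delta> l \<psi>0 \<psi>1 \<psi>2)\<^sup>2 * exp (- c * t) * exp (- c * (norm \<xi>)\<^sup>2 * t)
             + t powr (- l) * W \<xi>))"
    using error_bounds[OF n(3), where 'n='n] by blast
  define I where "I = (LINT \<xi>|lborel. exp (- c * (norm (\<xi>::real^'n))\<^sup>2))"
  have I: "I \<ge> 0" unfolding I_def by (intro Bochner_Integration.integral_nonneg) simp
  define C' where "C' = sqrt (C * (I + 1))"
  have C': "C' > 0" "C'\<^sup>2 = C * (I + 1)" using C I by (auto simp: C'_def)
  show ?thesis
  proof (rule exI[of _ C'], rule conjI[OF C'(1)], intro allI impI, elim conjE)
    fix \<psi>0 \<psi>1 \<psi>2 :: "real^'n \<Rightarrow> real" and \<psi>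
    assume B: "(\<psi>0, \<psi>1, \<psi>2) \<in> B_space \<delta> l" and sol: "mgt_solution \<tau> \<delta> m \<psi>0 \<psi>1 \<psi>2 \<psi>"
    define S where "S = B_norm \<delta> l \<psi>0 \<psi>1 \<psi>2"
    have S: "S \<ge> 0" using combination_bounds(3)[OF B_spaceD(1-4)[OF B less_imp_le[OF n(3)]] refl refl] by (simp add: S_def)
    obtain u where u: "\<And>\<xi>. mgt_mode \<tau> \<delta> m ((norm \<xi>)\<^sup>2) (fourier_real \<psi>0 \<xi>) (fourier_real \<psi>1 \<xi>) (fourier_real \<psi>2 \<xi>) (\<lambda>t. u t \<xi>)"
      and iu: "\<And>t. t \<ge> 0 \<Longrightarrow> is_L2_inv_fourier (u t) (\<lambda>x. complex_of_real (\<psi> t x))"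
      using sol unfolding mgt_solution_def by blast
    define p1 :: "real \<Rightarrow> real^'n \<Rightarrow> complex" where "p1 = p1hat (P_mean (\<lambda>y. \<psi>1 y + \<tau> * \<psi>2 y))"
    define p2 where "p2 = p2hat (M_mean (\<lambda>y. \<psi>1 y + \<tau> * \<psi>2 y)) (P_mean (\<lambda>y. \<psi>0 y - \<tau>\<^sup>2 * \<psi>2 y)) (P_mean (\<lambda>y. \<psi>1 y + \<tau> * \<psi>2 y))"
    define D1 where "D1 = (\<lambda>t. L2_norm (\<lambda>x. \<psi> t x - profile1 \<tau> \<delta> m \<psi>0 \<psi>1 \<psi>2 t x))"
    define D2 where "D2 = (\<lambda>t. L2_norm (\<lambda>x. \<psi> t x - profile1 \<tau> \<delta> m \<psi>0 \<psi>1 \<psi>2 t x - profile2 \<tau> \<delta> m \<psi>0 \<psi>1 \<psi>2 t x))"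
    obtain \<eta> W Bd where [measurable]: "\<eta> \<in> borel_measurable borel" and Bd: "\<And>\<xi>. \<bar>\<eta> \<xi>\<bar> \<le> Bd" and lim: "(\<eta> \<longlongrightarrow> 0) (at 0)"
      and W: "integrable lborel W" "(LINT \<xi>|lborel. W \<xi>) \<le> C * S\<^sup>2"
      and e1: "\<And>\<xi> t. \<xi> \<noteq> 0 \<Longrightarrow> 0 < t \<Longrightarrow> (cmod (u t \<xi> - p1 t \<xi>))\<^sup>2 \<le> C * S\<^sup>2 * exp (- c * (norm \<xi>)\<^sup>2 * t) + t powr (- l) * W \<xi>"
      and e2: "\<And>\<xi> t. \<xi> \<noteq> 0 \<Longrightarrow> 0 < t \<Longrightarrow> (cmod (u t \<xi> - p1 t \<xi> - p2 t \<xi>))\<^sup>2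
          \<le> C * (exp (- c * (norm \<xi>)\<^sup>2 * t) * \<eta> \<xi>) + C * S\<^sup>2 * exp (- c * t) * exp (- c * (norm \<xi>)\<^sup>2 * t) + t powr (- l) * W \<xi>"
      using eb[rule_format, OF B] u unfolding S_def p1_def p2_def by blast
    \<comment> \<open>The frequency 0, excluded from the pointwise estimates, is a null set.\<close>
    have ae: "AE \<xi> in lborel. P \<xi>" if "\<And>\<xi>. \<xi> \<noteq> 0 \<Longrightarrow> P \<xi>" for P :: "real^'n \<Rightarrow> bool"
      using AE_lborel_singleton[of "0::real^'n"] by eventually_elim (rule that)
    have tl: "t powr (- l) * (LINT \<xi>|lborel. W \<xi>) \<le> t powr (- l) * (C * S\<^sup>2)" for t using W(2) by (intro mult_left_mono) auto
    have gi: "integrable lborel (\<lambda>\<xi>::real^'n. exp (- c * (norm \<xi>)\<^sup>2 * t))"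
      "(LINT \<xi>|lborel. exp (- c * (norm (\<xi>::real^'n))\<^sup>2 * t)) = t powr (- (n / 2)) * I" if "t > 0" for t
      using gaussian_integral_scaled[OF c that, where 'n='n] by (simp_all add: n_def I_def)
    have mem: "u t \<in> borel_measurable borel" "p1 t \<in> borel_measurable borel" "p2 t \<in> borel_measurable borel" if "t > 0" for t
      using iu[of t] that L2_spaceD(1)[OF p1hat_props(2)[OF that]] L2_spaceD(1)[OF p2hat_props(2)[OF that]] L2_spaceD(1)[of "u t"]
      unfolding is_L2_inv_fourier_def p1_def p2_def by simp_all
    have rem: "(\<lambda>x. \<psi> t x - profile1 \<tau> \<delta> m \<psi>0 \<psi>1 \<psi>2 t x) \<in> L2_space"
      "(\<lambda>x. \<psi> t x - profile1 \<tau> \<delta> m \<psi>0 \<psi>1 \<psi>2 t x - profile2 \<tau> \<delta> m \<psi>0 \<psi>1 \<psi>2 t x) \<in> L2_space"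
      "D1 t \<le> L2_norm (\<lambda>\<xi>. u t \<xi> - p1 t \<xi>)" "D2 t \<le> L2_norm (\<lambda>\<xi>. u t \<xi> - p1 t \<xi> - p2 t \<xi>)" if "t > 0" for t
      unfolding D1_def D2_def p1_def p2_def using remainder_L2[OF iu[OF less_imp_le[OF that]] that] by blast+
    have D0: "D1 t \<ge> 0" "D2 t \<ge> 0" for t by (simp_all add: D1_def D2_def L2_norm_nonneg)
    have b1: "D1 t \<le> C' * (t powr (- (n / 4)) * S)" if t1: "t \<ge> 1" for t
    proof -
      have t: "t > 0" using t1 by simp
      have "(D1 t)\<^sup>2 \<le> (L2_norm (\<lambda>\<xi>. u t \<xi> - p1 t \<xi>))\<^sup>2" using rem(3)[OF t] D0 by (intro power_mono)
      also have "\<dots> \<le> (LINT \<xi>|lborel. C * S\<^sup>2 * exp (- c * (norm \<xi>)\<^sup>2 * t) + t powr (- l) * W \<xi>)"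
        using mem[OF t] gi(1)[OF t] W e1 t by (intro L2_bound(2) ae) auto
      also have "\<dots> = C * S\<^sup>2 * (t powr (- (n / 2)) * I) + t powr (- l) * (LINT \<xi>|lborel. W \<xi>)"
        using gi[OF t] W by simp
      also have "\<dots> \<le> C * S\<^sup>2 * (t powr (- (n / 2)) * I) + t powr (- (n / 2)) * (C * S\<^sup>2)"
      proof -
        have "t powr (- l) \<le> t powr (- (n / 2))" using t1 n by (intro powr_mono) auto
        from mult_right_mono[OF this, of "C * S\<^sup>2"] have "t powr (- l) * (C * S\<^sup>2) \<le> t powr (- (n / 2)) * (C * S\<^sup>2)" using C by simp
        with tl[of t] show ?thesis by linarith
      qed
      also have "\<dots> = (C' * (t powr (- (n / 4)) * S))\<^sup>2"
      proof -
        have "(t powr (- (n / 4)))\<^sup>2 = t powr (- (n / 2))" by (simp add: power2_eq_square flip: powr_add)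
        then show ?thesis by (simp add: power_mult_distrib C'(2) algebra_simps)
      qed
      finally show ?thesis by (rule power2_le_imp_le) (use C' S in simp)
    qed
    \<comment> \<open>Bound for t powr (n / 2) times the squared error. The first summand tends to 0
      by \<open>gaussian_concentration\<close>, the second exponentially, the third because l > n /
      2.\<close>
    define G where "G = (\<lambda>t. C * (t powr (n / 2) * (LINT \<xi>|lborel. exp (- c * (norm \<xi>)\<^sup>2 * t) * \<eta> \<xi>)) + C * S\<^sup>2 * I * exp (- c * t) + C * S\<^sup>2 * t powr (n / 2 - l))"
    have b2: "(t powr (n / 4) * D2 t)\<^sup>2 \<le> G t" if t: "t > 0" for t
    proof -
      have ie: "integrable lborel (\<lambda>\<xi>. exp (- c * (norm \<xi>)\<^sup>2 * t) * \<eta> \<xi>)"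
      proof (rule Bochner_Integration.integrable_bound)
        show "integrable lborel (\<lambda>\<xi>::real^'n. exp (- c * (norm \<xi>)\<^sup>2 * t) * Bd)" using gi(1)[OF t] by simp
        show "AE \<xi> in lborel. norm (exp (- c * (norm \<xi>)\<^sup>2 * t) * \<eta> \<xi>) \<le> norm (exp (- c * (norm \<xi>)\<^sup>2 * t) * Bd)"
        proof (rule AE_I2)
          show "norm (exp (- c * (norm \<xi>)\<^sup>2 * t) * \<eta> \<xi>) \<le> norm (exp (- c * (norm \<xi>)\<^sup>2 * t) * Bd)" for \<xi>
            unfolding real_norm_def abs_mult using Bd[of \<xi>] by (intro mult_left_mono) auto
        qed
      qed measurable
      have "(D2 t)\<^sup>2 \<le> (L2_norm (\<lambda>\<xi>. u t \<xi> - p1 t \<xi> - p2 t \<xi>))\<^sup>2" using rem(4)[OF t] D0 by (intro power_mono)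
      also have "\<dots> \<le> (LINT \<xi>|lborel. C * (exp (- c * (norm \<xi>)\<^sup>2 * t) * \<eta> \<xi>) + C * S\<^sup>2 * exp (- c * t) * exp (- c * (norm \<xi>)\<^sup>2 * t) + t powr (- l) * W \<xi>)"
        using mem[OF t] gi(1)[OF t] ie W e2 t by (intro L2_bound(2) ae) auto
      also have "\<dots> = C * (LINT \<xi>|lborel. exp (- c * (norm \<xi>)\<^sup>2 * t) * \<eta> \<xi>) + C * S\<^sup>2 * exp (- c * t) * (t powr (- (n / 2)) * I) + t powr (- l) * (LINT \<xi>|lborel. W \<xi>)"
        using gi[OF t] ie W by simp
      also have "\<dots> \<le> C * (LINT \<xi>|lborel. exp (- c * (norm \<xi>)\<^sup>2 * t) * \<eta> \<xi>) + C * S\<^sup>2 * exp (- c * t) * (t powr (- (n / 2)) * I) + t powr (- l) * (C * S\<^sup>2)"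
        using tl[of t] by simp
      finally have "t powr (n / 2) * (D2 t)\<^sup>2 \<le> t powr (n / 2) * (C * (LINT \<xi>|lborel. exp (- c * (norm \<xi>)\<^sup>2 * t) * \<eta> \<xi>) + C * S\<^sup>2 * exp (- c * t) * (t powr (- (n / 2)) * I) + t powr (- l) * (C * S\<^sup>2))"
        by (intro mult_left_mono) auto
      also have "\<dots> = C * (t powr (n / 2) * (LINT \<xi>|lborel. exp (- c * (norm \<xi>)\<^sup>2 * t) * \<eta> \<xi>)) + C * S\<^sup>2 * I * exp (- c * t) * (t powr (n / 2) * t powr (- (n / 2))) + C * S\<^sup>2 * (t powr (n / 2) * t powr (- l))"
        by (simp add: algebra_simps)
      also have "\<dots> = G t"
      proof -
        have "t powr (n / 2) * t powr (- (n / 2)) = 1" "t powr (n / 2) * t powr (- l) = t powr (n / 2 - l)"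
          using t by (simp_all flip: powr_add)
        then show ?thesis unfolding G_def by (simp only: mult_1_right)
      qed
      finally have "t powr (n / 2) * (D2 t)\<^sup>2 \<le> G t" .
      moreover have "(t powr (n / 4))\<^sup>2 = t powr (n / 2)" by (simp add: power2_eq_square flip: powr_add)
      ultimately show ?thesis by (simp only: power_mult_distrib)
    qed
    have limG: "(G \<longlongrightarrow> 0) at_top"
    proof -
      have 1: "((\<lambda>t. exp (- c * t)) \<longlongrightarrow> 0) at_top" using c by real_asymp
      have 2: "((\<lambda>t::real. t powr (n / 2 - l)) \<longlongrightarrow> 0) at_top" using n by (intro tendsto_neg_powr filterlim_ident) simp
      have "(G \<longlongrightarrow> C * 0 + C * S\<^sup>2 * I * 0 + C * S\<^sup>2 * 0) at_top"
        unfolding G_def n_def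
        by (intro tendsto_add tendsto_mult_left 1 2[unfolded n_def] gaussian_concentration[OF _ Bd lim c]) measurable
      then show ?thesis by simp
    qed
    have "((\<lambda>t. (t powr (n / 4) * D2 t)\<^sup>2) \<longlongrightarrow> 0) at_top"
    proof (rule tendsto_sandwich[OF _ _ tendsto_const limG])
      show "\<forall>\<^sub>F t in at_top. (t powr (n / 4) * D2 t)\<^sup>2 \<le> G t" using eventually_gt_at_top[of 0] by eventually_elim (rule b2)
    qed simp
    from tendsto_real_sqrt[OF this] have "((\<lambda>t. t powr (n / 4) * D2 t) \<longlongrightarrow> 0) at_top"
      using D0 by (simp add: abs_mult)
    note lim2 = this[unfolded D2_def n_def]
    show "(\<forall>t\<ge>1. (\<lambda>x. \<psi> t x - profile1 \<tau> \<delta> m \<psi>0 \<psi>1 \<psi>2 t x) \<in> L2_space \<and>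
      (\<lambda>x. \<psi> t x - profile1 \<tau> \<delta> m \<psi>0 \<psi>1 \<psi>2 t x - profile2 \<tau> \<delta> m \<psi>0 \<psi>1 \<psi>2 t x) \<in> L2_space \<and>
      L2_norm (\<lambda>x. \<psi> t x - profile1 \<tau> \<delta> m \<psi>0 \<psi>1 \<psi>2 t x) \<le> C' * (t powr (- (real CARD('n) / 4)) * B_norm \<delta> l \<psi>0 \<psi>1 \<psi>2)) \<and>
    ((\<lambda>t. t powr (real CARD('n) / 4) * L2_norm (\<lambda>x. \<psi> t x - profile1 \<tau> \<delta> m \<psi>0 \<psi>1 \<psi>2 t x - profile2 \<tau> \<delta> m \<psi>0 \<psi>1 \<psi>2 t x)) \<longlongrightarrow> 0) at_top"
    proof (rule conjI[OF _ lim2], intro allI impI)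
      fix t :: real assume t: "t \<ge> 1"
      then have "t > 0" by simp
      note r = rem(1,2)[OF this]
      show "(\<lambda>x. \<psi> t x - profile1 \<tau> \<delta> m \<psi>0 \<psi>1 \<psi>2 t x) \<in> L2_space \<and>
      (\<lambda>x. \<psi> t x - profile1 \<tau> \<delta> m \<psi>0 \<psi>1 \<psi>2 t x - profile2 \<tau> \<delta> m \<psi>0 \<psi>1 \<psi>2 t x) \<in> L2_space \<and>
      L2_norm (\<lambda>x. \<psi> t x - profile1 \<tau> \<delta> m \<psi>0 \<psi>1 \<psi>2 t x) \<le> C' * (t powr (- (real CARD('n) / 4)) * B_norm \<delta> l \<psi>0 \<psi>1 \<psi>2)"
        using r b1[OF t, unfolded D1_def n_def S_def] by (intro conjI)
    qed
  qed
qed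

text \<open>The second profile is the difference of the two remainders. Its lower bound therefore
  passes to the first remainder up to the second one, which is o(t powr (- n / 4)) and eventually
  takes at most half of it. Only the time from which this holds depends on the data.\<close>

lemma solution_lower_bound:
  assumes l: "l > real CARD('n) / 2"
  shows "\<exists>C>0. \<forall>(\<psi>0::real^'n \<Rightarrow> real) \<psi>1 \<psi>2 \<psi>. (\<psi>0, \<psi>1, \<psi>2) \<in> B_space \<delta> l \<and> mgt_solution \<tau> \<delta> m \<psi>0 \<psi>1 \<psi>2 \<psi> \<and>
    Q_abs \<tau> \<delta> m \<psi>0 \<psi>1 \<psi>2 \<noteq> 0 \<and> (\<gamma> \<noteq> 0 \<or> P_mean (\<lambda>x. \<psi>1 x + \<tau> * \<psi>2 x) = 0) \<longrightarrow>
    (\<exists>T0. \<forall>t\<ge>T0. t powr (- (real CARD('n) / 4)) * Q_abs \<tau> \<delta> m \<psi>0 \<psi>1 \<psi>2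
       \<le> C * L2_norm (\<lambda>x. \<psi> t x - profile1 \<tau> \<delta> m \<psi>0 \<psi>1 \<psi>2 t x))"
proof -
  define n where "n = real CARD('n)"
  obtain c T where c: "c > 0" and T: "T > 0" and low: "\<forall>t\<ge>T. \<forall>(Mz::real^'n) PA PB.
     c * t powr (- (n / 2)) * ((norm Mz)\<^sup>2 + PA\<^sup>2 + (\<gamma> / k * PB)\<^sup>2) \<le> (L2_norm (inv_fourier (p2hat Mz PA PB t)))\<^sup>2"
    using profile2_lower[where 'n='n] unfolding n_def by blast
  obtain Cq where Cq: "Cq > 0" and Q: "\<forall>(\<psi>0::real^'n \<Rightarrow> real) \<psi>1 \<psi>2. \<gamma> \<noteq> 0 \<or> P_mean (\<lambda>y. \<psi>1 y + \<tau> * \<psi>2 y) = 0 \<longrightarrow>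
     (Q_abs \<tau> \<delta> m \<psi>0 \<psi>1 \<psi>2)\<^sup>2 \<le> Cq * ((norm (M_mean (\<lambda>y. \<psi>1 y + \<tau> * \<psi>2 y)))\<^sup>2
        + (P_mean (\<lambda>y. \<psi>0 y - \<tau>\<^sup>2 * \<psi>2 y))\<^sup>2 + (\<gamma> / k * P_mean (\<lambda>y. \<psi>1 y + \<tau> * \<psi>2 y))\<^sup>2)"
    using Q_abs_bound[where 'n='n] by blast
  obtain C2 where up: "\<forall>(\<psi>0::real^'n \<Rightarrow> real) \<psi>1 \<psi>2 \<psi>. (\<psi>0, \<psi>1, \<psi>2) \<in> B_space \<delta> l \<and> mgt_solution \<tau> \<delta> m \<psi>0 \<psi>1 \<psi>2 \<psi> \<longrightarrow>
    (\<forall>t\<ge>1. (\<lambda>x. \<psi> t x - profile1 \<tau> \<delta> m \<psi>0 \<psi>1 \<psi>2 t x) \<in> L2_space \<and>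
      (\<lambda>x. \<psi> t x - profile1 \<tau> \<delta> m \<psi>0 \<psi>1 \<psi>2 t x - profile2 \<tau> \<delta> m \<psi>0 \<psi>1 \<psi>2 t x) \<in> L2_space \<and>
      L2_norm (\<lambda>x. \<psi> t x - profile1 \<tau> \<delta> m \<psi>0 \<psi>1 \<psi>2 t x) \<le> C2 * (t powr (- (real CARD('n) / 4)) * B_norm \<delta> l \<psi>0 \<psi>1 \<psi>2)) \<and>
    ((\<lambda>t. t powr (real CARD('n) / 4) * L2_norm (\<lambda>x. \<psi> t x - profile1 \<tau> \<delta> m \<psi>0 \<psi>1 \<psi>2 t x - profile2 \<tau> \<delta> m \<psi>0 \<psi>1 \<psi>2 t x)) \<longlongrightarrow> 0) at_top"
    using solution_asymptotics[OF l] by blast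
  \<comment> \<open>Its square is the constant of \<open>profile2_lower\<close> divided by that of
    \<open>Q_abs_bound\<close>; the 2 in 2 / a accounts for the half given to the second
    remainder.\<close>
  define a where "a = sqrt (c / Cq)"
  have a: "a > 0" "a\<^sup>2 = c / Cq" using c Cq by (auto simp: a_def)
  show ?thesis
  proof (rule exI[of _ "2 / a"], rule conjI, use a in simp, intro allI impI, elim conjE)
    fix \<psi>0 \<psi>1 \<psi>2 :: "real^'n \<Rightarrow> real" and \<psi>
    assume B: "(\<psi>0, \<psi>1, \<psi>2) \<in> B_space \<delta> l" and sol: "mgt_solution \<tau> \<delta> m \<psi>0 \<psi>1 \<psi>2 \<psi>"
      and Q0: "Q_abs \<tau> \<delta> m \<psi>0 \<psi>1 \<psi>2 \<noteq> 0" and g: "\<gamma> \<noteq> 0 \<or> P_mean (\<lambda>x. \<psi>1 x + \<tau> * \<psi>2 x) = 0"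
    define q where "q = Q_abs \<tau> \<delta> m \<psi>0 \<psi>1 \<psi>2"
    have "q \<ge> 0" unfolding q_def Q_abs_def by (intro real_sqrt_ge_zero) simp
    then have q: "q > 0" using Q0 by (simp add: q_def)
    define f1 where "f1 = (\<lambda>t x. \<psi> t x - profile1 \<tau> \<delta> m \<psi>0 \<psi>1 \<psi>2 t x)"
    define f2 where "f2 = (\<lambda>t x. \<psi> t x - profile1 \<tau> \<delta> m \<psi>0 \<psi>1 \<psi>2 t x - profile2 \<tau> \<delta> m \<psi>0 \<psi>1 \<psi>2 t x)"
    note U = up[rule_format, OF conjI[OF B sol], folded f1_def f2_def n_def]
    have mem: "f1 t \<in> L2_space" "f2 t \<in> L2_space" if "t \<ge> 1" for t using conjunct1[OF U, rule_format, OF that] by (simp_all add: f1_def f2_def)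
    have lim: "((\<lambda>t. t powr (n / 4) * L2_norm (f2 t)) \<longlongrightarrow> 0) at_top" using conjunct2[OF U] unfolding f2_def .
    have "a * q / 2 > 0" using a q by simp
    from order_tendstoD(2)[OF lim this] obtain T1 where T1: "\<And>t. t \<ge> T1 \<Longrightarrow> t powr (n / 4) * L2_norm (f2 t) < a * q / 2"
      unfolding eventually_at_top_linorder by blast
    have "t powr (- (n / 4)) * q \<le> 2 / a * L2_norm (f1 t)" if tt: "t \<ge> max 1 (max T T1)" for t
    proof -
      have t: "t \<ge> 1" "t \<ge> T" "t \<ge> T1" "t > 0" using tt by auto
      define p where "p = t powr (- (n / 4))"
      have p: "p > 0" "p * t powr (n / 4) = 1" "p\<^sup>2 = t powr (- (n / 2))"
        using t by (simp_all add: p_def power2_eq_square flip: powr_add)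
      define F where "F = L2_norm (\<lambda>x. f1 t x - f2 t x)"
      have F: "F \<le> L2_norm (f1 t) + L2_norm (f2 t)" unfolding F_def using mem t by (intro L2_diff(2))
      have d: "f1 t x - f2 t x = profile2 \<tau> \<delta> m \<psi>0 \<psi>1 \<psi>2 t x" for x by (simp add: f1_def f2_def)
      have "L2_norm (\<lambda>x. complex_of_real (f1 t x - f2 t x)) = L2_norm (inv_fourier (p2hat (M_mean (\<lambda>y. \<psi>1 y + \<tau> * \<psi>2 y)) (P_mean (\<lambda>y. \<psi>0 y - \<tau>\<^sup>2 * \<psi>2 y)) (P_mean (\<lambda>y. \<psi>1 y + \<tau> * \<psi>2 y)) t))"
        unfolding d profile2_def p2hat_props(4)[OF t(4)] ..
      then have Feq: "F = L2_norm (inv_fourier (p2hat (M_mean (\<lambda>y. \<psi>1 y + \<tau> * \<psi>2 y)) (P_mean (\<lambda>y. \<psi>0 y - \<tau>\<^sup>2 * \<psi>2 y)) (P_mean (\<lambda>y. \<psi>1 y + \<tau> * \<psi>2 y)) t))"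
        unfolding F_def L2_of_real .
      define R where "R = (norm (M_mean (\<lambda>y. \<psi>1 y + \<tau> * \<psi>2 y)))\<^sup>2 + (P_mean (\<lambda>y. \<psi>0 y - \<tau>\<^sup>2 * \<psi>2 y))\<^sup>2 + (\<gamma> / k * P_mean (\<lambda>y. \<psi>1 y + \<tau> * \<psi>2 y))\<^sup>2"
      have "q\<^sup>2 \<le> Cq * R" unfolding q_def R_def by (rule Q[rule_format, OF g])
      then have "q\<^sup>2 / Cq \<le> R" using Cq by (simp add: pos_divide_le_eq mult.commute)
      then have "c * p\<^sup>2 * (q\<^sup>2 / Cq) \<le> c * p\<^sup>2 * R" using c by (intro mult_left_mono) auto
      also have "\<dots> \<le> F\<^sup>2" unfolding p(3) Feq R_def by (rule low[rule_format, OF t(2)])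
      finally have "(a * p * q)\<^sup>2 \<le> F\<^sup>2" by (simp add: power_mult_distrib a(2) mult_ac)
      then have "a * p * q \<le> F" by (rule power2_le_imp_le) (simp add: F_def L2_norm_nonneg)
      moreover have "L2_norm (f2 t) \<le> p * (a * q / 2)"
      proof -
        have "p * (t powr (n / 4) * L2_norm (f2 t)) \<le> p * (a * q / 2)" using T1[OF t(3)] p by (intro mult_left_mono) auto
        moreover have "p * (t powr (n / 4) * L2_norm (f2 t)) = L2_norm (f2 t)" unfolding mult.assoc[symmetric] p(2) by simp
        ultimately show ?thesis by simp
      qed
      ultimately have "a * (p * q) \<le> 2 * L2_norm (f1 t)" using F by (simp add: mult_ac)
      then show ?thesis using a by (simp add: p_def pos_le_divide_eq mult_ac)
    qed
    then show "\<exists>T0. \<forall>t\<ge>T0. t powr (- (real CARD('n) / 4)) * Q_abs \<tau> \<delta> m \<psi>0 \<psi>1 \<psi>2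
       \<le> 2 / a * L2_norm (\<lambda>x. \<psi> t x - profile1 \<tau> \<delta> m \<psi>0 \<psi>1 \<psi>2 t x)"
      unfolding n_def q_def f1_def by blast
  qed
qed

end

theorem theorem2p2:
  fixes \<tau> \<delta> m l :: real
  assumes "\<tau> > 0" and "\<delta> \<ge> 0" and "m > 0" and "m * \<tau> < 1"
    and "l > real CARD('n::finite) / 2"
  shows "\<exists>C1>0. \<exists>C2>0. \<exists>T1. \<forall>(\<psi>0 :: real^'n \<Rightarrow> real) \<psi>1 \<psi>2 \<psi>.
    (\<psi>0, \<psi>1, \<psi>2) \<in> B_space \<delta> l \<and> mgt_solution \<tau> \<delta> m \<psi>0 \<psi>1 \<psi>2 \<psi> \<longrightarrow>
      (Q_abs \<tau> \<delta> m \<psi>0 \<psi>1 \<psi>2 \<noteq> 0 \<longrightarrow>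
         (gamma0 \<tau> \<delta> m \<noteq> 0 \<or> P_mean (\<lambda>x. \<psi>1 x + \<tau> * \<psi>2 x) = 0 \<longrightarrow>
           (\<exists>T0. \<forall>t\<ge>T0. t powr (- (real CARD('n) / 4)) * Q_abs \<tau> \<delta> m \<psi>0 \<psi>1 \<psi>2
              \<le> C1 * L2_norm (\<lambda>x. \<psi> t x - profile1 \<tau> \<delta> m \<psi>0 \<psi>1 \<psi>2 t x))) \<and>
         (\<forall>t\<ge>T1. (\<lambda>x. \<psi> t x - profile1 \<tau> \<delta> m \<psi>0 \<psi>1 \<psi>2 t x) \<in> L2_space \<and>
            L2_norm (\<lambda>x. \<psi> t x - profile1 \<tau> \<delta> m \<psi>0 \<psi>1 \<psi>2 t x)
              \<le> C2 * (t powr (- (real CARD('n) / 4)) * B_norm \<delta> l \<psi>0 \<psi>1 \<psi>2))) \<and>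
      (\<forall>\<^sub>F t in at_top. (\<lambda>x. \<psi> t x - profile1 \<tau> \<delta> m \<psi>0 \<psi>1 \<psi>2 t x
                                - profile2 \<tau> \<delta> m \<psi>0 \<psi>1 \<psi>2 t x) \<in> L2_space) \<and>
      (\<lambda>t. L2_norm (\<lambda>x. \<psi> t x - profile1 \<tau> \<delta> m \<psi>0 \<psi>1 \<psi>2 t x
                          - profile2 \<tau> \<delta> m \<psi>0 \<psi>1 \<psi>2 t x))
        \<in> o[at_top](\<lambda>t. t powr (- (real CARD('n) / 4)))"
proof -
  interpret mgt \<tau> \<delta> m using assms by unfold_locales
  obtain C2 where C2: "C2 > 0" and up: "\<forall>(\<psi>0::real^'n \<Rightarrow> real) \<psi>1 \<psi>2 \<psi>. (\<psi>0, \<psi>1, \<psi>2) \<in> B_space \<delta> l \<and> mgt_solution \<tau> \<delta> m \<psi>0 \<psi>1 \<psi>2 \<psi> \<longrightarrow>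
    (\<forall>t\<ge>1. (\<lambda>x. \<psi> t x - profile1 \<tau> \<delta> m \<psi>0 \<psi>1 \<psi>2 t x) \<in> L2_space \<and>
      (\<lambda>x. \<psi> t x - profile1 \<tau> \<delta> m \<psi>0 \<psi>1 \<psi>2 t x - profile2 \<tau> \<delta> m \<psi>0 \<psi>1 \<psi>2 t x) \<in> L2_space \<and>
      L2_norm (\<lambda>x. \<psi> t x - profile1 \<tau> \<delta> m \<psi>0 \<psi>1 \<psi>2 t x) \<le> C2 * (t powr (- (real CARD('n) / 4)) * B_norm \<delta> l \<psi>0 \<psi>1 \<psi>2)) \<and>
    ((\<lambda>t. t powr (real CARD('n) / 4) * L2_norm (\<lambda>x. \<psi> t x - profile1 \<tau> \<delta> m \<psi>0 \<psi>1 \<psi>2 t x - profile2 \<tau> \<delta> m \<psi>0 \<psi>1 \<psi>2 t x)) \<longlongrightarrow> 0) at_top"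
    using solution_asymptotics[OF assms(5)] by blast
  obtain C1 where C1: "C1 > 0" and low: "\<forall>(\<psi>0::real^'n \<Rightarrow> real) \<psi>1 \<psi>2 \<psi>. (\<psi>0, \<psi>1, \<psi>2) \<in> B_space \<delta> l \<and> mgt_solution \<tau> \<delta> m \<psi>0 \<psi>1 \<psi>2 \<psi> \<and>
    Q_abs \<tau> \<delta> m \<psi>0 \<psi>1 \<psi>2 \<noteq> 0 \<and> (gamma0 \<tau> \<delta> m \<noteq> 0 \<or> P_mean (\<lambda>x. \<psi>1 x + \<tau> * \<psi>2 x) = 0) \<longrightarrow>
    (\<exists>T0. \<forall>t\<ge>T0. t powr (- (real CARD('n) / 4)) * Q_abs \<tau> \<delta> m \<psi>0 \<psi>1 \<psi>2
       \<le> C1 * L2_norm (\<lambda>x. \<psi> t x - profile1 \<tau> \<delta> m \<psi>0 \<psi>1 \<psi>2 t x))"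
    using solution_lower_bound[OF assms(5)] by blast
  show ?thesis
  proof (rule exI[of _ C1], rule conjI[OF C1], rule exI[of _ C2], rule conjI[OF C2], rule exI[of _ 1], intro allI impI, elim conjE, intro conjI impI)
    fix \<psi>0 \<psi>1 \<psi>2 :: "real^'n \<Rightarrow> real" and \<psi>
    assume B: "(\<psi>0, \<psi>1, \<psi>2) \<in> B_space \<delta> l" and sol: "mgt_solution \<tau> \<delta> m \<psi>0 \<psi>1 \<psi>2 \<psi>"
    note U = up[rule_format, OF conjI[OF B sol]]
    show "\<forall>t\<ge>1. (\<lambda>x. \<psi> t x - profile1 \<tau> \<delta> m \<psi>0 \<psi>1 \<psi>2 t x) \<in> L2_space \<and>
            L2_norm (\<lambda>x. \<psi> t x - profile1 \<tau> \<delta> m \<psi>0 \<psi>1 \<psi>2 t x) \<le> C2 * (t powr (- (real CARD('n) / 4)) * B_norm \<delta> l \<psi>0 \<psi>1 \<psi>2)"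
      using conjunct1[OF U] by simp
    show "\<forall>\<^sub>F t in at_top. (\<lambda>x. \<psi> t x - profile1 \<tau> \<delta> m \<psi>0 \<psi>1 \<psi>2 t x - profile2 \<tau> \<delta> m \<psi>0 \<psi>1 \<psi>2 t x) \<in> L2_space"
      by (rule eventually_mono[OF eventually_ge_at_top[of 1]]) (use conjunct1[OF U] in simp)
    define D2 where "D2 = (\<lambda>t. L2_norm (\<lambda>x. \<psi> t x - profile1 \<tau> \<delta> m \<psi>0 \<psi>1 \<psi>2 t x - profile2 \<tau> \<delta> m \<psi>0 \<psi>1 \<psi>2 t x))"
    have "((\<lambda>t. t powr (real CARD('n) / 4) * D2 t) \<longlongrightarrow> 0) at_top" unfolding D2_def by (rule conjunct2[OF U])
    moreover have "t powr (real CARD('n) / 4) * D2 t = D2 t / t powr (- (real CARD('n) / 4))" for t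
      by (simp add: powr_minus_divide)
    ultimately have lim: "((\<lambda>t. D2 t / t powr (- (real CARD('n) / 4))) \<longlongrightarrow> 0) at_top" by (simp only:)
    show "(\<lambda>t. L2_norm (\<lambda>x. \<psi> t x - profile1 \<tau> \<delta> m \<psi>0 \<psi>1 \<psi>2 t x - profile2 \<tau> \<delta> m \<psi>0 \<psi>1 \<psi>2 t x)) \<in> o[at_top](\<lambda>t. t powr (- (real CARD('n) / 4)))"
      unfolding D2_def[symmetric]
      by (rule smalloI_tendsto[OF lim eventually_mono[OF eventually_gt_at_top[of 0]]]) simp
    assume Q: "Q_abs \<tau> \<delta> m \<psi>0 \<psi>1 \<psi>2 \<noteq> 0" "gamma0 \<tau> \<delta> m \<noteq> 0 \<or> P_mean (\<lambda>x. \<psi>1 x + \<tau> * \<psi>2 x) = 0"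
    show "\<exists>T0. \<forall>t\<ge>T0. t powr (- (real CARD('n) / 4)) * Q_abs \<tau> \<delta> m \<psi>0 \<psi>1 \<psi>2 \<le> C1 * L2_norm (\<lambda>x. \<psi> t x - profile1 \<tau> \<delta> m \<psi>0 \<psi>1 \<psi>2 t x)"
      by (rule low[rule_format, OF conjI[OF B conjI[OF sol conjI[OF Q]]]])
  qed
qed

end
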